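(* Let $m \geq 1$ be an integer and, for each $n$, let $Y_i = f_o(t_i) + \epsilon_i$, $i=1,\ldots,n$, where $f_o \in \mathcal{W}^{m,2}([0,1])$, the $t_i = t_{n,i} \in [0,1]$ are non-random design points, and $\epsilon_1, \epsilon_2, \ldots$ are independent and identically distributed random variables. Let $\rho:\mathbb{R}\to[0,\infty)$ with $\rho(0)=0$, and assume: (A1) $\rho$ is absolutely continuous and convex, and $\psi$ is any choice of its subgradient. (A2) There exist finite constants $\kappa>0$ and $M_1$ such that $|\psi(x+y)-\psi(x)| \leq M_1$ for all $x\in\mathbb{R}$ and all $|y|<\kappa$. (A3) There exists a finite constant $M_2$ such that $\sup_{|t|\leq h} \mathbb{E}\{|\psi(\epsilon_1+t)-\psi(\epsilon_1)|^2\} \leq M_2 |h|$ as $h\to 0$ (i.e. for all sufficiently small $h>0$). (A4) $\mathbb{E}\{|\psi(\epsilon_1)|^2\} \leq \tau^2 < \infty$, $\mathbb{E}\{\psi(\epsilon_1)\}=0$, and there exists a constant $\xi>0$ such that $\mathbb{E}\{\psi(\epsilon_1+t)\} = \xi t + o(t)$ as $t\to 0$. (A5) There exists a constant $M_3$ such that for all $n\geq 2$ and all $f\in\mathcal{W}^{1,1}([0,1])$, $$\left|\frac1n\sum_{i=1}^n f(t_i) - \int_0^1 f(t)\,dt\right| \leq \frac{M_3}{n}\int_0^1 |f'(t)|\,dt.$$ Let $\lambda=\lambda_n>0$ be a deterministic sequence with $\lambda\to 0$ and $n\lambda^{\frac{3}{2m}-\frac{1}{4m^2}}\to\infty$ as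 $n\to\infty$. Then there exists a sequence of M-type smoothing splines $\widehat f_n$ satisfying $$\|\widehat f_n - f_o\|_{m,\lambda}^2 = O_P\left(\lambda + (n\lambda^{1/(2m)})^{-1}\right).$$
   Context: $\mathcal{W}^{m,2}([0,1])$ is the Sobolev space of functions $f:[0,1]\to\mathbb{R}$ such that $f, f^{(1)}, \ldots, f^{(m-1)}$ are absolutely continuous and $\int_0^1 |f^{(m)}(x)|^2\,dx < \infty$; $\mathcal{W}^{1,1}([0,1])$ is the space of absolutely continuous functions on $[0,1]$ (with integrable derivative). With $\langle\cdot,\cdot\rangle_2$ the $\mathcal{L}^2([0,1])$ inner product, set $\langle f,g\rangle_{m,\lambda} = \langle f,g\rangle_2 + \lambda\langle f^{(m)},g^{(m)}\rangle_2$ and $\|f\|_{m,\lambda} = \langle f,f\rangle_{m,\lambda}^{1/2}$. An M-type smoothing spline $\widehat f_n$ (for given $n$, $\lambda$, $\rho$) is any minimizer over $f\in\mathcal{W}^{m,2}([0,1])$ of $$\frac1n\sum_{i=1}^n \rho(Y_i - f(t_i)) + \lambda\int_0^1 |f^{(m)}(x)|^2\,dx.$$ *)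

theory Defs
  imports "HOL-Probability.Probability" "HOL-Library.Landau_Symbols"
begin

definition abs_continuous_on_interval :: "real \<Rightarrow> real \<Rightarrow> (real \<Rightarrow> real) \<Rightarrow> bool" where
  "abs_continuous_on_interval a b f \<longleftrightarrow>
    (\<forall>e>0. \<exists>d>0. \<forall>(I :: nat set) l r.
       finite I \<and> (\<forall>i\<in>I. a \<le> l i \<and> l i \<le> r i \<and> r i \<le> b) \<and>
       disjoint_family_on (\<lambda>i. {l i<..<r i}) I \<and> (\<Sum>i\<in>I. r i - l i) < d
       \<longrightarrow> (\<Sum>i\<in>I. \<bar>f (r i) - f (l i)\<bar>) < e)"

text \<open>
  Iterated derivatives relative to the unit interval, so one-sided at its endpoints. On the interval they
  depend only on the values of the function there. The value is unspecified where the derivative does not exist.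
\<close>

fun deriv01 :: "nat \<Rightarrow> (real \<Rightarrow> real) \<Rightarrow> real \<Rightarrow> real" where
  "deriv01 0 f = f"
| "deriv01 (Suc k) f = (\<lambda>x. vector_derivative (deriv01 k f) (at x within {0..1}))"

text \<open>
  The derivatives of order below \<open>m\<close> have to exist at every point of the interval. The one of
  order \<open>m\<close> then exists almost everywhere, by absolute continuity of the preceding one.
\<close>

definition sobolev01 :: "nat \<Rightarrow> nat \<Rightarrow> (real \<Rightarrow> real) set" where
  "sobolev01 m p = {f.
     (\<forall>k. k + 1 < m \<longrightarrow> deriv01 k f differentiable_on {0..1}) \<and>
     (\<forall>k<m. abs_continuous_on_interval 0 1 (deriv01 k f)) \<and>
     set_integrable lebesgue {0..1} (\<lambda>x. \<bar>deriv01 m f x\<bar> ^ p)}"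

definition L2_inner01 :: "(real \<Rightarrow> real) \<Rightarrow> (real \<Rightarrow> real) \<Rightarrow> real" where
  "L2_inner01 f g = (LINT x:{0..1}|lebesgue. f x * g x)"

definition sob_inner :: "nat \<Rightarrow> real \<Rightarrow> (real \<Rightarrow> real) \<Rightarrow> (real \<Rightarrow> real) \<Rightarrow> real" where
  "sob_inner m lam f g = L2_inner01 f g + lam * L2_inner01 (deriv01 m f) (deriv01 m g)"

definition sob_norm :: "nat \<Rightarrow> real \<Rightarrow> (real \<Rightarrow> real) \<Rightarrow> real" where
  "sob_norm m lam f = sqrt (sob_inner m lam f f)"

definition M_spline_objective ::
  "(real \<Rightarrow> real) \<Rightarrow> nat \<Rightarrow> real \<Rightarrow> nat \<Rightarrow> (nat \<Rightarrow> real) \<Rightarrow> (nat \<Rightarrow> real) \<Rightarrow> (real \<Rightarrow> real) \<Rightarrow> real" where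
  "M_spline_objective \<rho> m lam n t y f =
     1 / real n * (\<Sum>i=1..n. \<rho> (y i - f (t i)))
     + lam * (LINT x:{0..1}|lebesgue. \<bar>deriv01 m f x\<bar> ^ 2)"

definition M_smoothing_spline ::
  "(real \<Rightarrow> real) \<Rightarrow> nat \<Rightarrow> real \<Rightarrow> nat \<Rightarrow> (nat \<Rightarrow> real) \<Rightarrow> (nat \<Rightarrow> real) \<Rightarrow> (real \<Rightarrow> real) \<Rightarrow> bool" where
  "M_smoothing_spline \<rho> m lam n t y =
     is_arg_min (M_spline_objective \<rho> m lam n t y) (\<lambda>f. f \<in> sobolev01 m 2)"

text \<open>
  Boundedness in probability at rate \<open>a\<close>. Measurability is part of the notion because
  \<open>measure M\<close> is 0 on sets that are not measurable.
\<close>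

definition bigO_P :: "'a measure \<Rightarrow> (nat \<Rightarrow> 'a \<Rightarrow> real) \<Rightarrow> (nat \<Rightarrow> real) \<Rightarrow> bool" where
  "bigO_P M X a \<longleftrightarrow>
     (\<forall>n. X n \<in> borel_measurable M) \<and>
     (\<forall>\<delta>>0. \<exists>C>0. \<forall>\<^sub>F n in sequentially.
        measure M {\<omega> \<in> space M. \<bar>X n \<omega>\<bar> > C * a n} \<le> \<delta>)"

definition is_subgradient :: "(real \<Rightarrow> real) \<Rightarrow> (real \<Rightarrow> real) \<Rightarrow> bool" where
  "is_subgradient \<rho> \<psi> \<longleftrightarrow> (\<forall>x y. \<rho> y \<ge> \<rho> x + \<psi> x * (y - x))"

end

theory Submission
  imports Defs "HOL-Computational_Algebra.Polynomial"
begin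

text \<open>
  Minimizers need not be unique, so \<open>fhat\<close> is chosen as the minimizer closest to \<open>f0\<close> in the norm
  \<open>sob_norm m lam\<close>. Its error can then be recovered from the infima of the objective over countable
  families, which makes it measurable. By convexity it suffices that the objective exceeds its value
  at \<open>f0\<close> on the sphere of squared radius \<open>D\<^sup>2 Cn\<close> around \<open>f0\<close>, where \<open>Cn = lam + 1 / (n h)\<close> and
  \<open>h = lam powr (1 / (2 m))\<close>.

  A kernel of size \<open>1 / h\<close> on the diagonal represents the values at the design points, so that the score
  \<open>\<Sum>i. \<psi> (\<epsilon> i) g (t i)\<close> is at most \<open>sob_norm m lam g\<close> times the square root of a quadratic form in
  the \<open>\<psi> (\<epsilon> i)\<close>, whose mean is at most of order \<open>n / h\<close>. By (A2) the remainder
  \<open>\<rho> (\<epsilon> - z) - \<rho> \<epsilon> + z \<psi> \<epsilon>\<close> is Lipschitz in \<open>z\<close>, and symmetrization and contraction bound its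
  deviation from the mean in the same way, uniformly in \<open>g\<close>. By (A4) its mean is at least of order
  \<open>z\<^sup>2\<close> near 0, and by (A5) the sum of these means is at least of order \<open>n\<close> times the squared \<open>L\<^sup>2\<close>
  norm of \<open>g\<close>. So the curvature on the sphere is of order \<open>D\<^sup>2 Cn\<close>, while score, deviation and the
  linear part of the penalty are of order \<open>D Cn\<close>; a large \<open>D\<close> decides.
\<close>

section \<open>Lebesgue differentiation\<close>

text \<open>Two obstacles shape the proof. The space is described by pointwise derivatives and by
  the epsilon-delta form of absolute continuity, so integration by parts, Taylor expansion and
  completeness become available only once an absolutely continuous function is known to be the
  integral of its almost everywhere derivative; from then on \<open>primitive_chain\<close> stands
  in for the space. The other obstacle is that (A2) and (A4) speak of small shifts of the error
  only, so every \<open>g\<close> in the ball must be small at the design points. The kernel bounds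
  these values by a multiple of \<open>sqrt (Cn / h)\<close>, and the rate condition enters as
  \<open>n h^2 \<rightarrow> \<infinity>\<close>, which sends this to 0. The relation
  \<open>h ^ (2 * m) = lam\<close> balances the two parts of the kernel, one paired with the
  function and one with its \<open>m\<close>-th derivative. No entropy of the ball is needed for the
  deviation: after contraction the values at the design points enter linearly, so the supremum is
  the square root of a quadratic form, and only its trace remains in the mean.\<close>

lemma integral_small_on_small_sets:
  fixes h :: "'a \<Rightarrow> real"
  assumes h: "integrable M h" "\<And>x. h x \<ge> 0" and e: "e > 0"
  shows "\<exists>d>0. \<forall>A\<in>sets M. emeasure M A < ennreal d \<longrightarrow> (LINT x:A|M. h x) < e"
proof -
  have hm[measurable]: "h \<in> borel_measurable M" using h by auto
  \<comment> \<open>The part of \<open>h\<close> above a high level \<open>n\<close> has small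
    integral by dominated convergence; the part below is at most \<open>n\<close>, so its integral
    over \<open>A\<close> is controlled by the measure of \<open>A\<close>.\<close>
  have "(\<lambda>n::nat. \<integral>x. max (h x - real n) 0 \<partial>M) \<longlonglongrightarrow> (\<integral>x. 0 \<partial>M)"
  proof (rule integral_dominated_convergence[where w=h])
    show "AE x in M. (\<lambda>n. max (h x - real n) 0) \<longlonglongrightarrow> 0"
    proof (rule AE_I2)
      fix x
      have "\<forall>\<^sub>F n in sequentially. max (h x - real n) 0 = 0"
        using eventually_ge_at_top[of "nat \<lceil>h x\<rceil>"] by eventually_elim linarith
      then show "(\<lambda>n. max (h x - real n) 0) \<longlonglongrightarrow> 0"
        by (simp add: tendsto_eventually)
    qed
    show "AE x in M. norm (max (h x - real n) 0) \<le> h x" for n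
      using h(2) by (auto simp: max_def)
  qed (use h in auto)
  then have "\<forall>\<^sub>F n in sequentially. (\<integral>x. max (h x - real n) 0 \<partial>M) < e/2"
    using e by (intro order_tendstoD(2)) auto
  then obtain n where n: "(\<integral>x. max (h x - real n) 0 \<partial>M) < e/2"
    by (auto simp: eventually_sequentially)
  have im: "integrable M (\<lambda>x. max (h x - real n) 0)"
    by (rule Bochner_Integration.integrable_bound[OF h(1)]) (use h(2) in \<open>auto simp: max_def\<close>)
  define d where "d = e / (2 * (real n + 1))"
  have d: "d > 0" using e by (simp add: d_def)
  show ?thesis
  proof (intro exI[of _ d] conjI ballI impI d)
    fix A assume A[measurable]: "A \<in> sets M" and Ad: "emeasure M A < ennreal d"
    have fin: "emeasure M A < \<infinity>" using Ad by (rule order_less_trans) simp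
    have mA: "measure M A < d"
      using Ad fin by (simp add: emeasure_eq_ennreal_measure less_top)
        (metis d ennreal_less_iff measure_nonneg)
    have iA: "integrable M (\<lambda>x. real n * indicator A x)"
      using fin by (intro integrable_mult_right integrable_real_indicator) auto
    have "(LINT x:A|M. h x) \<le> (\<integral>x. max (h x - real n) 0 + real n * indicator A x \<partial>M)"
      unfolding set_lebesgue_integral_def
    proof (rule integral_mono)
      show "integrable M (\<lambda>x. indicat_real A x *\<^sub>R h x)"
        by (rule Bochner_Integration.integrable_bound[OF h(1)]) (auto simp: indicator_def)
      show "integrable M (\<lambda>x. max (h x - real n) 0 + real n * indicator A x)"
        using im iA by (rule Bochner_Integration.integrable_add)
    qed (use h(2) in \<open>auto simp: indicator_def\<close>)
    also have "\<dots> = (\<integral>x. max (h x - real n) 0 \<partial>M) + real n * measure M A"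
      using im iA by (simp add: Bochner_Integration.integral_add)
    also have "\<dots> < e/2 + real n * d + 0"
      using n mA by (auto intro!: add_less_le_mono mult_left_mono)
    also have "\<dots> \<le> e/2 + e/2"
      using e by (auto simp: d_def field_simps)
    finally show "(LINT x:A|M. h x) < e" by simp
  qed
qed

text \<open>Vitali's covering theorem selects disjoint intervals of mean above \<open>c\<close> that
  cover almost all exceptional points and lie in an open set barely larger than the zero set of
  \<open>h\<close>. Their total length is at most \<open>1 / c\<close> times the integral of
  \<open>h\<close> over them, to which only the small part outside the zero set contributes. The
  intervals need not be centred at \<open>x\<close>, which is what difference quotients call
  for.\<close>

lemma negligible_zero_density_exceptions:
  fixes h :: "real \<Rightarrow> real"
  assumes h: "integrable lebesgue h" "\<And>x. h x \<ge> 0" and c: "c > 0"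
  shows "negligible {x. h x = 0 \<and> (\<forall>d>0. \<exists>u v. u < v \<and> x \<in> {u..v} \<and> v - u < d \<and>
           c * (v - u) < (LINT y:{u..v}|lebesgue. h y))}" (is "negligible ?B")
  unfolding negligible_outer_le
proof (intro allI impI)
  fix e :: real assume e: "e > 0"
  have hm[measurable]: "h \<in> borel_measurable lebesgue" using h by auto
  \<comment> \<open>The tolerance \<open>c * e\<close> becomes \<open>e\<close> after the final
    division by \<open>c\<close>.\<close>
  have "c * e > 0" using c e by simp
  from integral_small_on_small_sets[OF h this] obtain d where d: "d > 0"
    "\<And>A. A \<in> sets lebesgue \<Longrightarrow> emeasure lebesgue A < ennreal d \<Longrightarrow> (LINT x:A|lebesgue. h x) < c * e"
    by blast
  define Z where "Z = {x. h x = 0}"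
  have Z[measurable]: "Z \<in> sets lebesgue"
    using measurable_sets[OF hm, of "{0}"] by (simp add: Z_def vimage_def)
  obtain T where T: "open T" "Z \<subseteq> T" "emeasure lebesgue (T - Z) < ennreal d"
    using sets_lebesgue_outer_open[OF Z d(1)] by metis
  define K where "K = {(u,v). u < v \<and> {u..v} \<subseteq> T \<and> c * (v - u) < (LINT y:{u..v}|lebesgue. h y)}"
  \<comment> \<open>Midpoint and half-length present the intervals as the closed balls of the
    covering theorem.\<close>
  define a r where "a = (\<lambda>(u,v). (u+v)/2 :: real)" and "r = (\<lambda>(u,v). (v-u)/2 :: real)"
  have cb: "cball (a i) (r i) = {fst i..snd i}" for i
    by (cases i) (auto simp: a_def r_def cball_eq_atLeastAtMost field_simps)
  obtain C where C: "countable C" "C \<subseteq> K"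
     "pairwise (\<lambda>i j. disjnt (cball (a i) (r i)) (cball (a j) (r j))) C"
     "negligible(?B - (\<Union>i \<in> C. cball (a i) (r i)))"
  proof (rule Vitali_covering_theorem_cballs[of K r ?B a])
    show "0 < r i" if "i \<in> K" for i using that by (auto simp: K_def r_def)
    fix x \<delta> :: real assume x: "x \<in> ?B" and \<delta>: "0 < \<delta>"
    have "x \<in> T" using x T(2) by (auto simp: Z_def)
    then obtain s where s: "s > 0" "ball x s \<subseteq> T" using T(1) by (meson openE)
    obtain u v where uv: "u < v" "x \<in> {u..v}" "v - u < min \<delta> s"
       "c * (v - u) < (LINT y:{u..v}|lebesgue. h y)"
      using x \<delta> s(1) by (auto dest!: spec[of _ "min \<delta> s"])
    have "{u..v} \<subseteq> ball x s" using uv by (auto simp: dist_real_def)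
    then have "(u,v) \<in> K" using uv s by (auto simp: K_def)
    then show "\<exists>i. i \<in> K \<and> x \<in> cball (a i) (r i) \<and> r i < \<delta>"
    proof (intro exI[of _ "(u,v)"] conjI)
      show "x \<in> cball (a (u,v)) (r (u,v))" unfolding cb using uv by simp
    qed (use uv in \<open>auto simp: r_def\<close>)
  qed blast
  define W where "W = (\<Union>i \<in> C. cball (a i) (r i))"
  have W[measurable]: "W \<in> sets lebesgue"
    unfolding W_def using C(1) by (intro sets.countable_UN') auto
  have WT: "W \<subseteq> T" using C(2) by (fastforce simp: W_def cb K_def)
  have disj: "disjoint_family_on (\<lambda>i. cball (a i) (r i)) C"
    using C(3) by (auto simp: disjoint_family_on_def pairwise_def disjnt_def)
  \<comment> \<open>As a measure with density \<open>h\<close> the integral is countably additive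
    over the selected family, without any summability question.\<close>
  define N where "N = density lebesgue (\<lambda>x. ennreal (h x))"
  have N: "emeasure N A = ennreal (LINT x:A|lebesgue. h x)" if [measurable]: "A \<in> sets lebesgue" for A
  proof -
    have "emeasure N A = (\<integral>\<^sup>+x. ennreal (h x) * indicator A x \<partial>lebesgue)"
      by (simp add: N_def emeasure_density)
    also have "\<dots> = (\<integral>\<^sup>+x. ennreal (indicator A x *\<^sub>R h x) \<partial>lebesgue)"
      by (intro nn_integral_cong) (auto simp: indicator_def)
    also have "\<dots> = ennreal (LINT x:A|lebesgue. h x)"
      unfolding set_lebesgue_integral_def
    proof (rule nn_integral_eq_integral)
      show "integrable lebesgue (\<lambda>x. indicat_real A x *\<^sub>R h x)"
        by (rule Bochner_Integration.integrable_bound[OF h(1)]) (auto simp: indicator_def)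
    qed (use h(2) in auto)
    finally show ?thesis .
  qed
  have "ennreal c * emeasure lebesgue W = (\<integral>\<^sup>+i. ennreal c * emeasure lebesgue (cball (a i) (r i)) \<partial>count_space C)"
    unfolding W_def using C(1) disj
    by (subst emeasure_UN_countable) (auto simp: nn_integral_cmult)
  also have "\<dots> \<le> (\<integral>\<^sup>+i. emeasure N (cball (a i) (r i)) \<partial>count_space C)"
  proof (intro nn_integral_mono)
    fix i assume "i \<in> space (count_space C)"
    then have "i \<in> K" using C(2) by auto
    then show "ennreal c * emeasure lebesgue (cball (a i) (r i)) \<le> emeasure N (cball (a i) (r i))"
      using c by (cases i) (auto simp: cb N K_def emeasure_lborel_Icc ennreal_mult[symmetric] intro!: ennreal_leI)
  qed
  also have "\<dots> = emeasure N W"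
    unfolding W_def using C(1) disj
    by (subst emeasure_UN_countable) (auto simp: N_def)
  \<comment> \<open>\<open>h\<close> vanishes on \<open>Z\<close>, so only \<open>W - Z\<close>
    counts, a set of measure below \<open>d\<close>.\<close>
  also have "\<dots> = ennreal (LINT x:W - Z|lebesgue. h x)"
    unfolding N[OF W] set_lebesgue_integral_def
    by (intro arg_cong[where f=ennreal] Bochner_Integration.integral_cong) (auto simp: indicator_def Z_def)
  also have "\<dots> \<le> ennreal (c * e)"
  proof (intro ennreal_leI less_imp_le d(2))
    show "emeasure lebesgue (W - Z) < ennreal d"
      using T(3) WT by (intro le_less_trans[OF emeasure_mono T(3)]) (use T(1) in auto)
  qed auto
  finally have "ennreal c * emeasure lebesgue W \<le> ennreal c * ennreal e" using c e by (simp add: ennreal_mult)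
  then have We: "emeasure lebesgue W \<le> ennreal e"
    using c by (subst (asm) ennreal_mult_le_mult_iff) auto
  then have Wl: "W \<in> lmeasurable" by (intro fmeasurableI) (auto simp: le_less_trans)
  have Wm: "measure lebesgue W \<le> e"
    using We e by (simp add: measure_def enn2real_leI)
  show "\<exists>T. ?B \<subseteq> T \<and> T \<in> lmeasurable \<and> measure lebesgue T \<le> e"
  proof (intro exI[of _ "W \<union> (?B - W)"] conjI)
    have neg: "negligible (?B - W)" using C(4) by (simp add: W_def)
    show "W \<union> (?B - W) \<in> lmeasurable"
      by (rule fmeasurable.Un[OF Wl negligible_imp_measurable[OF neg]])
    have "measure lebesgue (W \<union> (?B - W)) \<le> measure lebesgue W + measure lebesgue (?B - W)"
      by (rule measure_Un_le[OF W negligible_imp_sets[OF neg]])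
    then show "measure lebesgue (W \<union> (?B - W)) \<le> e"
      using Wm negligible_imp_measure0[OF neg] by simp
  qed blast
qed

text \<open>The previous estimate is applied to the positive parts of \<open>g - p\<close> and
  \<open>p - g\<close> for rational \<open>p\<close>. If \<open>p\<close> lies just above
  \<open>g x\<close>, the positive part of \<open>g - p\<close> vanishes at \<open>x\<close>, so its
  means over small intervals tend to 0 and the means of \<open>g\<close> are eventually at most
  \<open>g x + e\<close>; the mirrored choice bounds them from below. Rational levels keep the
  exceptional set negligible.\<close>

lemma Lebesgue_differentiation:
  fixes g :: "real \<Rightarrow> real"
  assumes g: "g absolutely_integrable_on {0..1}"
  shows "\<exists>N. negligible N \<and> (\<forall>x\<in>{0..1} - N.
    ((\<lambda>x. integral {0..x} g) has_real_derivative g x) (at x within {0..1}))"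
proof -
  define hp where "hp = (\<lambda>s p x. indicator {0..1} x *\<^sub>R max (s * (g x - p)) (0::real))"
  define E where "E = (\<lambda>s p c. {x. hp s p x = 0 \<and> (\<forall>d>0. \<exists>u v. u < v \<and> x \<in> {u..v} \<and> v - u < d \<and>
           c * (v - u) < (LINT y:{u..v}|lebesgue. hp s p y))})"
  have hp_ai: "(\<lambda>x. max (s * (g x - p)) 0) absolutely_integrable_on {0..1}" for s p
    by (intro absolutely_integrable_max_1 set_integrable_mult_right set_integral_diff g absolutely_integrable_on_const)
       auto
  then have hp_int: "integrable lebesgue (hp s p)" for s p
    by (simp add: hp_def set_integrable_def)
  have hp_nn: "hp s p x \<ge> 0" for s p x by (simp add: hp_def)
  have negE: "negligible (E s p c)" if "c > 0" for s p c
    unfolding E_def by (rule negligible_zero_density_exceptions[OF hp_int hp_nn that])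
  define N where "N = (\<Union>p\<in>\<rat>. \<Union>n::nat. E 1 p (1 / (real n + 1)) \<union> E (-1) p (1 / (real n + 1)))"
  have "negligible N"
    unfolding N_def
    by (intro negligible_countable_Union countable_image countable_rat countable_UN)
       (auto intro!: negligible_countable_Union negE negligible_Un)
  moreover have "((\<lambda>x. integral {0..x} g) has_real_derivative g x) (at x within {0..1})"
    if x: "x \<in> {0..1} - N" for x
  proof -
    have key: "\<exists>d>0. \<forall>u v. 0 \<le> u \<and> u < v \<and> v \<le> 1 \<and> u \<le> x \<and> x \<le> v \<and> v - u < d \<longrightarrow>
        s * integral {u..v} g \<le> (s * g x + e) * (v - u)" if e: "e > 0" and s: "s = 1 \<or> s = -1" for e s
    proof -
      \<comment> \<open>\<open>p\<close> lies on the side of \<open>g x\<close> on which the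
        positive part vanishes at \<open>x\<close>, at distance at most \<open>e / 2\<close>; the
        other half of \<open>e\<close> is spent on the mean of that positive part.\<close>
      obtain p where p: "p \<in> \<rat>" "s * (g x - p) \<le> 0" "s * (p - g x) \<le> e/2"
      proof (cases "s = 1")
        case True
        obtain p where "p \<in> \<rat>" "g x < p" "p < g x + e/2"
          using Rats_dense_in_real[of "g x" "g x + e/2"] e by auto
        then show ?thesis using True by (intro that[of p]) auto
      next
        case False
        obtain p where "p \<in> \<rat>" "g x - e/2 < p" "p < g x"
          using Rats_dense_in_real[of "g x - e/2" "g x"] e by auto
        then show ?thesis using False s by (intro that[of p]) auto
      qed
      obtain n :: nat where n: "1 / (real n + 1) < e/2"
        using nat_approx_posE[of "e/2"] e by (auto simp: add.commute)
      have "x \<notin> E s p (1 / (real n + 1))" using x p(1) s by (auto simp: N_def)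
      moreover have "hp s p x = 0" using p(2) by (auto simp: hp_def max_def)
      ultimately have "\<exists>d>0. \<forall>u v. u < v \<and> x \<in> {u..v} \<and> v - u < d \<longrightarrow>
          \<not> 1 / (real n + 1) * (v - u) < (LINT y:{u..v}|lebesgue. hp s p y)"
        by (simp add: E_def) blast
      then obtain d where d: "d > 0" and
        dd: "\<And>u v. u < v \<Longrightarrow> x \<in> {u..v} \<Longrightarrow> v - u < d \<Longrightarrow>
          (LINT y:{u..v}|lebesgue. hp s p y) \<le> 1 / (real n + 1) * (v - u)"
        unfolding not_less by blast
      show ?thesis
      proof (intro exI[of _ d] conjI allI impI d)
        fix u v assume uv: "0 \<le> u \<and> u < v \<and> v \<le> 1 \<and> u \<le> x \<and> x \<le> v \<and> v - u < d"
        have sub: "{u..v} \<subseteq> {0..1}" using uv by auto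
        have gi: "g absolutely_integrable_on {u..v}"
          by (rule set_integrable_subset[OF g]) (use sub in auto)
        have hi: "(\<lambda>x. max (s * (g x - p)) 0) absolutely_integrable_on {u..v}"
          by (rule set_integrable_subset[OF hp_ai]) (use sub in auto)
        have "s * integral {u..v} g = integral {u..v} (\<lambda>y. s * g y)" by simp
        also have "\<dots> \<le> integral {u..v} (\<lambda>y. s * p + max (s * (g y - p)) 0)"
          by (intro integral_le integrable_add integrable_on_cmult_left[of g, simplified]
              set_lebesgue_integral_eq_integral(1) gi hi) (auto simp: max_def algebra_simps)
        also have "\<dots> = s * p * (v - u) + integral {u..v} (\<lambda>y. max (s * (g y - p)) 0)"
          using uv by (subst Henstock_Kurzweil_Integration.integral_add)
            (auto intro!: set_lebesgue_integral_eq_integral(1) hi)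
        also have "integral {u..v} (\<lambda>y. max (s * (g y - p)) 0) = (LINT y:{u..v}|lebesgue. hp s p y)"
          unfolding set_lebesgue_integral_eq_integral(2)[OF hi, symmetric] set_lebesgue_integral_def
          using sub by (intro Bochner_Integration.integral_cong) (auto simp: hp_def indicator_def)
        also have "\<dots> \<le> 1 / (real n + 1) * (v - u)" using uv by (intro dd) auto
        also have "s * p * (v - u) + 1 / (real n + 1) * (v - u) = (s * p + 1 / (real n + 1)) * (v - u)"
          by (simp add: algebra_simps)
        also have "\<dots> \<le> (s * g x + e) * (v - u)"
          using uv p(3) n by (intro mult_right_mono) (auto simp: algebra_simps)
        finally show "s * integral {u..v} g \<le> (s * g x + e) * (v - u)" by simp
      qed
    qed
    have gi: "g integrable_on {0..1}" using g by (rule set_lebesgue_integral_eq_integral(1))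
    show ?thesis
      unfolding has_field_derivative_iff Lim_within
    proof (intro allI impI)
      fix e :: real assume "e > 0"
      then have e: "e/2 > 0" by simp
      obtain d1 where d1: "d1 > 0" "\<And>u v. 0 \<le> u \<and> u < v \<and> v \<le> 1 \<and> u \<le> x \<and> x \<le> v \<and> v - u < d1 \<Longrightarrow>
        integral {u..v} g \<le> (g x + e/2) * (v - u)" using key[OF e, of 1] by auto
      obtain d2 where d2: "d2 > 0" "\<And>u v. 0 \<le> u \<and> u < v \<and> v \<le> 1 \<and> u \<le> x \<and> x \<le> v \<and> v - u < d2 \<Longrightarrow>
        - integral {u..v} g \<le> (- g x + e/2) * (v - u)" using key[OF e, of "-1"] by auto
      show "\<exists>d>0. \<forall>y\<in>{0..1}. 0 < dist y x \<and> dist y x < d \<longrightarrow>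
          dist ((integral {0..y} g - integral {0..x} g) / (y - x)) (g x) < e"
      proof (intro exI[of _ "min d1 d2"] conjI ballI impI)
        fix y assume y: "y \<in> {0..1}" and dyx: "0 < dist y x \<and> dist y x < min d1 d2"
        define u v where "u = min x y" and "v = max x y"
        have uv: "0 \<le> u" "u < v" "v \<le> 1" "u \<le> x" "x \<le> v" "v - u < d1" "v - u < d2"
          using x y dyx by (auto simp: u_def v_def dist_real_def)
        have comb: "integral {u..v} g = integral {0..v} g - integral {0..u} g"
          using uv Henstock_Kurzweil_Integration.integral_combine[of 0 u v g]
            integrable_on_subinterval[OF gi, of 0 v] by auto
        \<comment> \<open>Both orders of \<open>x\<close> and \<open>y\<close> give the same
          quotient, so intervals with one end at \<open>x\<close> treat the left and the right
          derivative together.\<close>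
        have q: "(integral {0..y} g - integral {0..x} g) / (y - x) = integral {u..v} g / (v - u)"
        proof (cases "x \<le> y")
          case False
          then have "integral {u..v} g / (v - u) = - (integral {0..y} g - integral {0..x} g) / - (y - x)"
            unfolding comb by (simp add: u_def v_def)
          then show ?thesis by (simp only: minus_divide_divide)
        next
          case True
          then have "u = x" "v = y" by (auto simp: u_def v_def)
          then show ?thesis using comb by simp
        qed
        have "integral {u..v} g / (v - u) \<le> g x + e/2"
          using d1(2)[of u v] uv by (simp add: divide_le_eq)
        moreover have "g x - e/2 \<le> integral {u..v} g / (v - u)"
          using d2(2)[of u v] uv by (simp add: le_divide_eq algebra_simps)
        ultimately show "dist ((integral {0..y} g - integral {0..x} g) / (y - x)) (g x) < e"
          unfolding q dist_real_def using \<open>e > 0\<close> by linarith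
      qed (use d1 d2 in auto)
    qed
  qed
  ultimately show ?thesis by blast
qed

section \<open>Absolutely continuous functions\<close>

text \<open>Families are sets of endpoint pairs instead of indexed sequences, so that they can be
  split, united and refined without reindexing. The strict \<open>fst p < snd p\<close> excludes
  empty intervals, which would be disjoint even from themselves; thus pairs with disjoint intervals
  are distinct and no summand is lost in a union.\<close>

definition interval_family :: "real \<Rightarrow> real \<Rightarrow> (real \<times> real) set \<Rightarrow> bool" where
  "interval_family a b D \<longleftrightarrow> finite D \<and> (\<forall>p\<in>D. a \<le> fst p \<and> fst p < snd p \<and> snd p \<le> b) \<and>
     disjoint_family_on (\<lambda>p. {fst p<..<snd p}) D"

text \<open>The increments keep their signs, so that suprema give the positive variation; for the
  identity function the value is the total length.\<close>

definition increment_sum :: "(real \<Rightarrow> real) \<Rightarrow> (real \<times> real) set \<Rightarrow> real" where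
  "increment_sum f D = (\<Sum>p\<in>D. f (snd p) - f (fst p))"

lemma interval_family_empty [simp]: "interval_family a b {}"
  by (simp add: interval_family_def disjoint_family_on_def)

lemma interval_family_mono:
  "interval_family a b D \<Longrightarrow> a' \<le> a \<Longrightarrow> b \<le> b' \<Longrightarrow> interval_family a' b' D"
  by (force simp: interval_family_def)

lemma interval_family_length_eq:
  assumes "interval_family a b D"
  shows "increment_sum (\<lambda>x. x) D = measure lborel (\<Union>p\<in>D. {fst p<..<snd p})"
proof -
  have "measure lborel (\<Union>((\<lambda>p. {fst p<..<snd p}) ` D)) = (\<Sum>p\<in>D. measure lborel {fst p<..<snd p})"
  proof (rule measure_finite_Union)
    show "emeasure lborel {fst p<..<snd p} \<noteq> \<infinity>" if "p \<in> D" for p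
      using that assms by (subst emeasure_lborel_Ioo) (auto simp: interval_family_def less_imp_le)
  qed (use assms in \<open>auto simp: interval_family_def\<close>)
  also have "\<dots> = increment_sum (\<lambda>x. x) D"
    unfolding increment_sum_def using assms
    by (intro sum.cong refl) (simp add: interval_family_def less_imp_le)
  finally show ?thesis by simp
qed

lemma interval_family_length_le:
  assumes "interval_family a b D" "a \<le> b"
  shows "increment_sum (\<lambda>x. x) D \<le> b - a"
proof -
  have "measure lborel (\<Union>p\<in>D. {fst p<..<snd p}) \<le> measure lborel {a..b}"
  proof (rule measure_mono_fmeasurable)
    show "{a..b} \<in> fmeasurable lborel" using assms by (intro fmeasurableI) auto
  qed (use assms in \<open>force simp: interval_family_def\<close>)+
  then show ?thesis using assms by (simp add: interval_family_length_eq)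
qed

text \<open>An interval straddling \<open>b\<close> is cut at \<open>b\<close>, and its two
  increments telescope. The clippings \<open>h1\<close> and \<open>h2\<close> are injective on the
  intervals reaching their side, because two nonempty intervals with a common endpoint on that side
  overlap.\<close>

lemma interval_family_split:
  assumes D: "interval_family a c D" and abc: "a \<le> b" "b \<le> c"
  obtains D1 D2 where "interval_family a b D1" "interval_family b c D2"
    "\<And>f. increment_sum f D = increment_sum f D1 + increment_sum f D2"
proof -
  have fin: "finite D" and D': "\<And>p. p \<in> D \<Longrightarrow> a \<le> fst p \<and> fst p < snd p \<and> snd p \<le> c"
    and dis: "\<And>p q. p \<in> D \<Longrightarrow> q \<in> D \<Longrightarrow> p \<noteq> q \<Longrightarrow> {fst p<..<snd p} \<inter> {fst q<..<snd q} = {}"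
    using D by (auto simp: interval_family_def disjoint_family_on_def)
  define h1 where "h1 = (\<lambda>p::real\<times>real. (fst p, min (snd p) b))"
  define h2 where "h2 = (\<lambda>p::real\<times>real. (max (fst p) b, snd p))"
  define A1 where "A1 = {p\<in>D. fst p < b}"
  define A2 where "A2 = {p\<in>D. b < snd p}"
  have inj1: "inj_on h1 A1"
  proof (rule inj_onI, rule ccontr)
    fix p q assume pq: "p \<in> A1" "q \<in> A1" "h1 p = h1 q" "p \<noteq> q"
    then have "fst p = fst q" by (simp add: h1_def)
    obtain z where "fst p < z" "z < min (snd p) (snd q)"
      using dense[of "fst p" "min (snd p) (snd q)"] pq D'[of p] D'[of q] \<open>fst p = fst q\<close> by (auto simp: A1_def)
    then have "z \<in> {fst p<..<snd p} \<inter> {fst q<..<snd q}" using \<open>fst p = fst q\<close> by auto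
    then show False using dis[of p q] pq by (auto simp: A1_def)
  qed
  have inj2: "inj_on h2 A2"
  proof (rule inj_onI, rule ccontr)
    fix p q assume pq: "p \<in> A2" "q \<in> A2" "h2 p = h2 q" "p \<noteq> q"
    then have "snd p = snd q" by (simp add: h2_def)
    obtain z where "max (fst p) (fst q) < z" "z < snd p"
      using dense[of "max (fst p) (fst q)" "snd p"] pq D'[of p] D'[of q] \<open>snd p = snd q\<close> by (auto simp: A2_def)
    then have "z \<in> {fst p<..<snd p} \<inter> {fst q<..<snd q}" using \<open>snd p = snd q\<close> by auto
    then show False using dis[of p q] pq by (auto simp: A2_def)
  qed
  show ?thesis
  proof (rule that[of "h1 ` A1" "h2 ` A2"])
    show "interval_family a b (h1 ` A1)"
      unfolding interval_family_def disjoint_family_on_def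
    proof (intro conjI ballI impI)
      fix p q assume pq: "p \<in> h1 ` A1" "q \<in> h1 ` A1" "p \<noteq> q"
      then obtain p' q' where "p' \<in> D" "q' \<in> D" "p = h1 p'" "q = h1 q'" "p' \<noteq> q'" by (auto simp: A1_def)
      then show "{fst p<..<snd p} \<inter> {fst q<..<snd q} = {}"
        using dis[of p' q'] by (auto simp: h1_def)
    qed (use fin D' abc in \<open>auto simp: A1_def h1_def\<close>)
    show "interval_family b c (h2 ` A2)"
      unfolding interval_family_def disjoint_family_on_def
    proof (intro conjI ballI impI)
      fix p q assume pq: "p \<in> h2 ` A2" "q \<in> h2 ` A2" "p \<noteq> q"
      then obtain p' q' where "p' \<in> D" "q' \<in> D" "p = h2 p'" "q = h2 q'" "p' \<noteq> q'" by (auto simp: A2_def)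
      then show "{fst p<..<snd p} \<inter> {fst q<..<snd q} = {}"
        using dis[of p' q'] by (auto simp: h2_def)
    qed (use fin D' abc in \<open>auto simp: A2_def h2_def\<close>)
    fix f
    have "increment_sum f D = (\<Sum>p\<in>D. (if fst p < b then f (min (snd p) b) - f (fst p) else 0)
        + (if b < snd p then f (snd p) - f (max (fst p) b) else 0))"
      unfolding increment_sum_def using D' by (intro sum.cong) (force simp: min_def max_def)+
    also have "\<dots> = (\<Sum>p\<in>A1. f (min (snd p) b) - f (fst p)) + (\<Sum>p\<in>A2. f (snd p) - f (max (fst p) b))"
      unfolding A1_def A2_def using fin by (simp add: sum.distrib sum.inter_filter)
    also have "\<dots> = increment_sum f (h1 ` A1) + increment_sum f (h2 ` A2)"
      unfolding increment_sum_def sum.reindex[OF inj1] sum.reindex[OF inj2] by (simp add: h1_def h2_def)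
    finally show "increment_sum f D = increment_sum f (h1 ` A1) + increment_sum f (h2 ` A2)" .
  qed
qed

text \<open>Refinement: every interval is replaced by a family inside it. Parts of different
  intervals stay disjoint and, being nonempty, distinct, which is why the sums add up.\<close>

lemma interval_family_UN:
  assumes D: "interval_family a b D" and E: "\<And>p. p \<in> D \<Longrightarrow> interval_family (fst p) (snd p) (E p)"
  shows "interval_family a b (\<Union>p\<in>D. E p)"
    "increment_sum f (\<Union>p\<in>D. E p) = (\<Sum>p\<in>D. increment_sum f (E p))"
proof -
  have dis: "{fst u<..<snd u} \<inter> {fst v<..<snd v} = {}"
    if "p \<in> D" "q \<in> D" "p \<noteq> q" "u \<in> E p" "v \<in> E q" for p q u v
  proof -
    have "{fst u<..<snd u} \<subseteq> {fst p<..<snd p}" "{fst v<..<snd v} \<subseteq> {fst q<..<snd q}"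
      using E[OF that(1)] E[OF that(2)] that by (force simp: interval_family_def)+
    then show ?thesis using D that by (fastforce simp: interval_family_def disjoint_family_on_def)
  qed
  show "interval_family a b (\<Union>p\<in>D. E p)"
    unfolding interval_family_def disjoint_family_on_def
  proof (intro conjI ballI impI)
    show "finite (\<Union>p\<in>D. E p)" using D E by (auto simp: interval_family_def)
    fix u assume "u \<in> (\<Union>p\<in>D. E p)"
    then obtain p where "p \<in> D" "u \<in> E p" by auto
    then show "a \<le> fst u" "fst u < snd u" "snd u \<le> b"
      using D E[of p] unfolding interval_family_def by force+
  next
    fix u v assume "u \<in> (\<Union>p\<in>D. E p)" "v \<in> (\<Union>p\<in>D. E p)" "u \<noteq> v"
    then obtain p q where pq: "p \<in> D" "u \<in> E p" "q \<in> D" "v \<in> E q" by auto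
    show "{fst u<..<snd u} \<inter> {fst v<..<snd v} = {}"
    proof (cases "p = q")
      case True
      then show ?thesis using E[of p] pq \<open>u \<noteq> v\<close> by (auto simp: interval_family_def disjoint_family_on_def)
    qed (use dis pq in blast)
  qed
  have "E p \<inter> E q = {}" if "p \<in> D" "q \<in> D" "p \<noteq> q" for p q
  proof (rule ccontr)
    assume "E p \<inter> E q \<noteq> {}"
    then obtain u where u: "u \<in> E p" "u \<in> E q" by auto
    have "fst u < snd u" using E[OF that(1)] u by (auto simp: interval_family_def)
    then show False using dis[OF that u] dense[of "fst u" "snd u"] by auto
  qed
  then show "increment_sum f (\<Union>p\<in>D. E p) = (\<Sum>p\<in>D. increment_sum f (E p))"
    unfolding increment_sum_def using D E
    by (intro sum.UNION_disjoint) (auto simp: interval_family_def)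
qed

section \<open>Jordan decomposition of an absolutely continuous function\<close>

lemma abs_continuous_interval_family:
  assumes f: "abs_continuous_on_interval a b f" and e: "e > 0"
  shows "\<exists>d>0. \<forall>D. interval_family a b D \<and> increment_sum (\<lambda>x. x) D < d \<longrightarrow>
    (\<Sum>p\<in>D. \<bar>f (snd p) - f (fst p)\<bar>) < e"
proof -
  obtain d where d: "d > 0" "\<And>(I :: nat set) l r.
       finite I \<and> (\<forall>i\<in>I. a \<le> l i \<and> l i \<le> r i \<and> r i \<le> b) \<and>
       disjoint_family_on (\<lambda>i. {l i<..<r i}) I \<and> (\<Sum>i\<in>I. r i - l i) < d
       \<Longrightarrow> (\<Sum>i\<in>I. \<bar>f (r i) - f (l i)\<bar>) < e"
    using f e unfolding abs_continuous_on_interval_def by meson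
  show ?thesis
  proof (intro exI[of _ d] conjI allI impI d(1))
    fix D assume D: "interval_family a b D \<and> increment_sum (\<lambda>x. x) D < d"
    then obtain h where h: "bij_betw h {0..<card D} D"
      using ex_bij_betw_nat_finite by (auto simp: interval_family_def)
    have hD: "h i \<in> D" if "i \<in> {0..<card D}" for i using h that by (auto simp: bij_betw_def)
    have "(\<Sum>i\<in>{0..<card D}. \<bar>f (snd (h i)) - f (fst (h i))\<bar>) < e"
    proof (rule d(2), intro conjI ballI)
      show "disjoint_family_on (\<lambda>i. {fst (h i)<..<snd (h i)}) {0..<card D}"
        unfolding disjoint_family_on_def
      proof (intro ballI impI)
        fix i j assume ij: "i \<in> {0..<card D}" "j \<in> {0..<card D}" "i \<noteq> j"
        then have "h i \<noteq> h j" using h by (auto simp: bij_betw_def inj_on_def)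
        then show "{fst (h i)<..<snd (h i)} \<inter> {fst (h j)<..<snd (h j)} = {}"
          using D hD ij unfolding interval_family_def disjoint_family_on_def by blast
      qed
      show "(\<Sum>i\<in>{0..<card D}. snd (h i) - fst (h i)) < d"
        using D sum.reindex_bij_betw[OF h, of "\<lambda>p. snd p - fst p"] by (simp add: increment_sum_def)
    qed (use D hD in \<open>force simp: interval_family_def\<close>)+
    then show "(\<Sum>p\<in>D. \<bar>f (snd p) - f (fst p)\<bar>) < e"
      using sum.reindex_bij_betw[OF h, of "\<lambda>p. \<bar>f (snd p) - f (fst p)\<bar>"] by simp
  qed
qed

text \<open>Positive instead of total variation: with \<open>P\<close> the positive variation from
  0, both \<open>P\<close> and \<open>P - f\<close> are increasing at once. The empty family makes
  the value nonnegative.\<close>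

definition positive_variation :: "(real \<Rightarrow> real) \<Rightarrow> real \<Rightarrow> real \<Rightarrow> real" where
  "positive_variation f a b = Sup (increment_sum f ` Collect (interval_family a b))"

text \<open>The unit interval is exhausted by steps of length \<open>d / 2\<close>, each adding at
  most 1 to the bound; half of \<open>d\<close> is taken because absolute continuity asks for a
  total length strictly below \<open>d\<close>.\<close>

lemma abs_continuous_bdd_increments:
  assumes f: "abs_continuous_on_interval 0 1 f"
  shows "\<exists>B. \<forall>D. interval_family 0 1 D \<longrightarrow> increment_sum f D \<le> B"
proof -
  obtain d where d: "d > 0" "\<And>D. interval_family 0 1 D \<Longrightarrow> increment_sum (\<lambda>x. x) D < d \<Longrightarrow>
    (\<Sum>p\<in>D. \<bar>f (snd p) - f (fst p)\<bar>) < 1"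
    using abs_continuous_interval_family[OF f, of 1] by auto
  have d': "increment_sum f D \<le> 1" if "interval_family 0 1 D" "increment_sum (\<lambda>x. x) D < d" for D
  proof -
    have "increment_sum f D \<le> (\<Sum>p\<in>D. \<bar>f (snd p) - f (fst p)\<bar>)"
      unfolding increment_sum_def by (intro sum_mono) auto
    then show ?thesis using d(2)[OF that] by simp
  qed
  have *: "\<forall>D. interval_family 0 (min 1 (real k * (d/2))) D \<longrightarrow> increment_sum f D \<le> real k" for k
  proof (induction k)
    case 0
    have "D = {}" if "interval_family 0 0 D" for D using that by (fastforce simp: interval_family_def)
    then have "increment_sum f D = 0" if "interval_family 0 0 D" for D
      using that by (force simp: increment_sum_def)
    then show ?case by simp
  next
    case (Suc k)
    show ?case
    proof (intro allI impI)
      fix D assume D: "interval_family 0 (min 1 (real (Suc k) * (d/2))) D"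
      obtain D1 D2 where D12: "interval_family 0 (min 1 (real k * (d/2))) D1"
        "interval_family (min 1 (real k * (d/2))) (min 1 (real (Suc k) * (d/2))) D2"
        "increment_sum f D = increment_sum f D1 + increment_sum f D2"
        by (rule interval_family_split[OF D, of "min 1 (real k * (d/2))"])
           (use d in \<open>auto simp: algebra_simps min_def\<close>)
      have "increment_sum (\<lambda>x. x) D2 \<le> min 1 (real (Suc k) * (d/2)) - min 1 (real k * (d/2))"
        by (rule interval_family_length_le[OF D12(2)]) (use d in \<open>auto simp: algebra_simps min_def\<close>)
      also have "\<dots> < d" using d by (auto simp: algebra_simps min_def)
      finally have "increment_sum f D2 \<le> 1"
        by (intro d' interval_family_mono[OF D12(2)]) (use d in auto)
      then show "increment_sum f D \<le> real (Suc k)" using Suc.IH D12 by force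
    qed
  qed
  obtain k :: nat where k: "2 / d < real k" using reals_Archimedean2 by blast
  then have "min 1 (real k * (d/2)) = 1" using d by (auto simp: field_simps)
  then show ?thesis using *[of k] by metis
qed

text \<open>Absolute continuity passes to the positive variation because each interval of a family
  of length below \<open>d\<close> can be replaced by a nearly optimal family inside it: the
  refinement is no longer than the original family, and its increments of \<open>f\<close> almost
  attain the increments of the variation.\<close>

lemma abs_continuous_Jordan:
  assumes f: "abs_continuous_on_interval 0 1 f"
  obtains P where "\<And>x y. 0 \<le> x \<Longrightarrow> x \<le> y \<Longrightarrow> y \<le> 1 \<Longrightarrow> P x \<le> P y"
    "\<And>x y. 0 \<le> x \<Longrightarrow> x \<le> y \<Longrightarrow> y \<le> 1 \<Longrightarrow> P x - f x \<le> P y - f y"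
    "\<And>e. e > 0 \<Longrightarrow> \<exists>d>0. \<forall>D. interval_family 0 1 D \<and> increment_sum (\<lambda>x. x) D < d \<longrightarrow> increment_sum P D \<le> e"
proof -
  obtain B where B: "\<And>D. interval_family 0 1 D \<Longrightarrow> increment_sum f D \<le> B"
    using abs_continuous_bdd_increments[OF f] by auto
  let ?V = "positive_variation f"
  have bdd: "bdd_above (increment_sum f ` Collect (interval_family x y))" if "0 \<le> x" "y \<le> 1" for x y
    using that B interval_family_mono[of x y] by (intro bdd_aboveI2[of _ _ B]) (auto)
  have V_upper: "increment_sum f D \<le> ?V x y" if "interval_family x y D" "0 \<le> x" "y \<le> 1" for x y D
    unfolding positive_variation_def using that bdd by (intro cSUP_upper) auto
  have V_approx: "\<exists>D. interval_family x y D \<and> ?V x y - \<eta> < increment_sum f D" if "0 \<le> x" "y \<le> 1" "\<eta> > 0" for x y \<eta>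
  proof -
    have "?V x y - \<eta> < Sup (increment_sum f ` Collect (interval_family x y))"
      using that(3) by (simp add: positive_variation_def)
    moreover have "increment_sum f ` Collect (interval_family x y) \<noteq> {}"
      using interval_family_empty[of x y] by blast
    ultimately show ?thesis using less_cSup_iff[OF _ bdd[OF that(1,2)]] by force
  qed
  have V_least: "?V x y \<le> u" if "\<And>D. interval_family x y D \<Longrightarrow> increment_sum f D \<le> u" for x y u
    unfolding positive_variation_def using interval_family_empty[of x y]
    by (intro cSUP_least that) blast+
  have add: "?V x z = ?V x y + ?V y z" if xyz: "0 \<le> x" "x \<le> y" "y \<le> z" "z \<le> 1" for x y z
  proof (rule antisym)
    show "?V x z \<le> ?V x y + ?V y z"
    proof (rule V_least)
      fix D assume "interval_family x z D"
      then obtain D1 D2 where "interval_family x y D1" "interval_family y z D2"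
        "increment_sum f D = increment_sum f D1 + increment_sum f D2"
        using interval_family_split xyz by metis
      then show "increment_sum f D \<le> ?V x y + ?V y z"
        using V_upper[of x y D1] V_upper[of y z D2] xyz by simp
    qed
    show "?V x y + ?V y z \<le> ?V x z"
    proof (rule field_le_epsilon)
      fix e :: real assume e: "e > 0"
      obtain D1 D2 where D12: "interval_family x y D1" "?V x y - e/2 < increment_sum f D1"
        "interval_family y z D2" "?V y z - e/2 < increment_sum f D2"
        using V_approx[of x y "e/2"] V_approx[of y z "e/2"] e xyz by auto
      have dis: "{fst p<..<snd p} \<inter> {fst q<..<snd q} = {}" if "p \<in> D1" "q \<in> D2" for p q
        using D12 that by (force simp: interval_family_def)
      have "D1 \<inter> D2 = {}" using D12 by (force simp: interval_family_def)
      then have "increment_sum f (D1 \<union> D2) = increment_sum f D1 + increment_sum f D2"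
        unfolding increment_sum_def using D12 by (intro sum.union_disjoint) (auto simp: interval_family_def)
      moreover have "interval_family x z (D1 \<union> D2)"
        using interval_family_mono[OF D12(1), of x z] interval_family_mono[OF D12(3), of x z] xyz dis
        unfolding interval_family_def disjoint_family_on_def by blast
      then have "increment_sum f (D1 \<union> D2) \<le> ?V x z" using xyz by (intro V_upper) auto
      ultimately show "?V x y + ?V y z \<le> ?V x z + e" using D12 by simp
    qed
  qed
  have V_nonneg: "0 \<le> ?V x y" if "0 \<le> x" "y \<le> 1" for x y
    using V_upper[of x y "{}"] that by (simp add: increment_sum_def)
  have V_ge: "f y - f x \<le> ?V x y" if "0 \<le> x" "x \<le> y" "y \<le> 1" for x y
  proof (cases "x = y")
    case False
    then show ?thesis using V_upper[of x y "{(x,y)}"] that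
      by (simp add: increment_sum_def interval_family_def disjoint_family_on_def)
  qed (use V_nonneg that in simp)
  show ?thesis
  proof (rule that[of "?V 0"])
    show "?V 0 x \<le> ?V 0 y" if "0 \<le> x" "x \<le> y" "y \<le> 1" for x y
      using add[of 0 x y] V_nonneg[of x y] that by simp
    show "?V 0 x - f x \<le> ?V 0 y - f y" if "0 \<le> x" "x \<le> y" "y \<le> 1" for x y
      using add[of 0 x y] V_ge[of x y] that by simp
    fix e :: real assume e: "e > 0"
    obtain d where d: "d > 0" "\<And>D. interval_family 0 1 D \<Longrightarrow> increment_sum (\<lambda>x. x) D < d \<Longrightarrow>
      (\<Sum>p\<in>D. \<bar>f (snd p) - f (fst p)\<bar>) < e/2"
      using abs_continuous_interval_family[OF f, of "e/2"] e by auto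
    show "\<exists>d>0. \<forall>D. interval_family 0 1 D \<and> increment_sum (\<lambda>x. x) D < d \<longrightarrow> increment_sum (?V 0) D \<le> e"
    proof (intro exI[of _ d] conjI allI impI d(1))
      fix D assume "interval_family 0 1 D \<and> increment_sum (\<lambda>x. x) D < d"
      then have D: "interval_family 0 1 D" "increment_sum (\<lambda>x. x) D < d" by auto
      then have D': "\<And>p. p \<in> D \<Longrightarrow> 0 \<le> fst p \<and> fst p < snd p \<and> snd p \<le> 1" by (auto simp: interval_family_def)
      \<comment> \<open>The loss per interval, chosen so that the \<open>card D\<close> losses
        together stay within \<open>e / 2\<close>.\<close>
      define \<eta> where "\<eta> = e / (2 * (real (card D) + 1))"
      have \<eta>: "\<eta> > 0" using e by (simp add: \<eta>_def)
      have "\<forall>p\<in>D. \<exists>E. interval_family (fst p) (snd p) E \<and> ?V (fst p) (snd p) - \<eta> < increment_sum f E"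
        using V_approx[OF _ _ \<eta>] D' by blast
      then obtain E where E: "\<And>p. p \<in> D \<Longrightarrow> interval_family (fst p) (snd p) (E p)"
        "\<And>p. p \<in> D \<Longrightarrow> ?V (fst p) (snd p) - \<eta> < increment_sum f (E p)" by metis
      have UN: "increment_sum h (\<Union>p\<in>D. E p) = (\<Sum>p\<in>D. increment_sum h (E p))" for h
        by (rule interval_family_UN(2)[OF D(1)]) (rule E(1))
      have "increment_sum (\<lambda>x. x) (\<Union>p\<in>D. E p) \<le> increment_sum (\<lambda>x. x) D"
        unfolding UN
        unfolding increment_sum_def[of _ D]
        by (intro sum_mono interval_family_length_le E(1)) (use D' in \<open>auto simp: less_imp_le\<close>)
      then have small: "(\<Sum>q\<in>(\<Union>p\<in>D. E p). \<bar>f (snd q) - f (fst q)\<bar>) < e/2"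
        using D by (intro d(2) interval_family_UN(1)[OF D(1) E(1)]) auto
      have "increment_sum (?V 0) D = (\<Sum>p\<in>D. ?V (fst p) (snd p))"
        unfolding increment_sum_def
      proof (rule sum.cong[OF refl])
        fix p assume "p \<in> D"
        then show "?V 0 (snd p) - ?V 0 (fst p) = ?V (fst p) (snd p)"
          using add[of 0 "fst p" "snd p"] D'[of p] by simp
      qed
      also have "\<dots> \<le> (\<Sum>p\<in>D. increment_sum f (E p) + \<eta>)"
        using E(2) by (intro sum_mono) (force simp: algebra_simps)
      also have "\<dots> = increment_sum f (\<Union>p\<in>D. E p) + real (card D) * \<eta>"
        unfolding UN by (simp add: sum.distrib)
      also have "increment_sum f (\<Union>p\<in>D. E p) \<le> (\<Sum>q\<in>(\<Union>p\<in>D. E p). \<bar>f (snd q) - f (fst q)\<bar>)"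
        unfolding increment_sum_def by (intro sum_mono) auto
      also have "\<dots> \<le> e/2" using small by simp
      also have "real (card D) * \<eta> \<le> e/2" using e by (simp add: \<eta>_def field_simps)
      finally show "increment_sum (?V 0) D \<le> e" by simp
    qed
  qed
qed

text \<open>Monotonicity supplies the Stieltjes measure of \<open>P\<close>, the increment condition
  makes it absolutely continuous with respect to Lebesgue measure, and the Radon-Nikodym density is
  the desired integrand.\<close>

lemma increasing_abs_continuous_primitive:
  assumes mono: "\<And>x y. 0 \<le> x \<Longrightarrow> x \<le> y \<Longrightarrow> y \<le> 1 \<Longrightarrow> P x \<le> (P y :: real)"
    and ac: "\<And>e. e > 0 \<Longrightarrow> \<exists>d>0. \<forall>D. interval_family 0 1 D \<and> increment_sum (\<lambda>x. x) D < d \<longrightarrow> increment_sum P D \<le> e"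
  shows "\<exists>g. g absolutely_integrable_on {0..1} \<and> (\<forall>x\<in>{0..1}. P x - P 0 = integral {0..x} g)"
proof -
  \<comment> \<open>Constant continuation beyond the unit interval, so that the measure of
    \<open>F\<close> lives on that interval.\<close>
  define F where "F = (\<lambda>x. P (max 0 (min 1 x)))"
  have F: "F x \<le> F y" if "x \<le> y" for x y
    unfolding F_def using that by (intro mono) auto
  have F_eq: "F x = P x" if "x \<in> {0..1}" for x using that by (simp add: F_def)
  have contF: "continuous_on UNIV F"
    unfolding continuous_on_iff
  proof (intro ballI allI impI)
    fix x e :: real assume e: "e > 0"
    obtain d where d: "d > 0" "\<And>D. interval_family 0 1 D \<Longrightarrow> increment_sum (\<lambda>x. x) D < d \<Longrightarrow> increment_sum P D \<le> e/2"
      using ac[of "e/2"] e by auto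
    have *: "P v - P u \<le> e/2" if "0 \<le> u" "u \<le> v" "v \<le> 1" "v - u < d" for u v
    proof (cases "u = v")
      case False
      then show ?thesis using d(2)[of "{(u,v)}"] that
        by (simp add: interval_family_def increment_sum_def disjoint_family_on_def)
    qed (use e in auto)
    have "dist (F y) (F x) < e" if "dist y x < d" for y
    proof (cases "x \<le> y")
      case True
      have "F y - F x \<le> e/2" unfolding F_def using that True by (intro *) (auto simp: dist_real_def)
      then show ?thesis using F[OF True] e by (simp add: dist_real_def)
    next
      case False
      have "F x - F y \<le> e/2" unfolding F_def using that False by (intro *) (auto simp: dist_real_def)
      then show ?thesis using F[of y x] False e by (simp add: dist_real_def)
    qed
    then show "\<exists>d>0. \<forall>x'\<in>UNIV. dist x' x < d \<longrightarrow> dist (F x') (F x) < e" using d(1) by blast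
  qed
  define N where "N = interval_measure F"
  have Icc: "emeasure N {a..b} = ennreal (F b - F a)" if "a \<le> b" for a b
    unfolding N_def using F contF that by (intro emeasure_interval_measure_Icc) (auto intro: continuous_on_subset)
  have sN[simp]: "sets N = sets borel" "space N = UNIV" by (auto simp: N_def)
  \<comment> \<open>The total mass is found by exhausting the line; each of these intervals already
    contains the unit interval.\<close>
  have "(\<Union>n. {- real n - 1..real n + 1}) = (UNIV :: real set)"
  proof -
    have "\<exists>n::nat. - real n - 1 \<le> x \<and> x \<le> real n + 1" for x :: real
    proof -
      obtain n :: nat where "\<bar>x\<bar> \<le> real n" using real_arch_simple by blast
      then show ?thesis by (intro exI[of _ n]) linarith
    qed
    then show ?thesis by auto
  qed
  moreover have "(SUP n. emeasure N {- real n - 1..real n + 1}) = emeasure N (\<Union>n. {- real n - 1..real n + 1})"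
    by (intro SUP_emeasure_incseq) (auto simp: incseq_def)
  moreover have "emeasure N {- real n - 1..real n + 1} = ennreal (P 1 - P 0)" for n
    by (subst Icc) (auto simp: F_def)
  ultimately have total: "emeasure N UNIV = ennreal (P 1 - P 0)" by simp
  have "emeasure N (UNIV - {0..1}) = emeasure N UNIV - emeasure N {0..1}"
    using emeasure_compl[of "{0..1}" N] by (simp add: Icc)
  then have out: "emeasure N (UNIV - {0..1}) = 0"
    by (simp add: total Icc F_eq)
  \<comment> \<open>A null set is covered by nonoverlapping intervals of total length below
    \<open>d\<close>; the increments of \<open>P\<close> over them, which are their masses, sum to
    at most \<open>e\<close>.\<close>
  have null: "emeasure N A = 0" if A: "A \<in> null_sets lborel" for A
  proof -
    have A': "A \<inter> {0..1} \<in> null_sets lborel" using A by (intro null_set_Int2) auto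
    have Ab: "A \<in> sets borel" using A by auto
    have lA: "A \<inter> {0..1} \<in> lmeasurable" "measure lebesgue (A \<inter> {0..1}) = 0"
    proof -
      have "A \<inter> {0..1} \<in> null_sets lebesgue" using A' by (rule null_sets_completionI)
      then show "A \<inter> {0..1} \<in> lmeasurable" "measure lebesgue (A \<inter> {0..1}) = 0"
        by (auto intro: fmeasurableI_null_sets measure_eq_0_null_sets)
    qed
    have "emeasure N (A \<inter> {0..1}) \<le> ennreal e" if e: "e > 0" for e :: real
    proof -
      obtain d where d: "d > 0" "\<And>D. interval_family 0 1 D \<Longrightarrow> increment_sum (\<lambda>x. x) D < d \<Longrightarrow> increment_sum P D \<le> e"
        using ac[OF e] by auto
      have "A \<inter> {0..1} \<subseteq> cbox 0 1" "d/2 > 0" using d by auto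
      from measurable_outer_intervals_bounded[OF lA(1) this] obtain \<D> where
        D: "countable \<D>" "\<And>K. K \<in> \<D> \<Longrightarrow> K \<subseteq> cbox 0 1 \<and> K \<noteq> {} \<and> (\<exists>c d. K = cbox c d)"
        "pairwise (\<lambda>A B. interior A \<inter> interior B = {}) \<D>"
        "\<And>K. \<lbrakk>K \<in> \<D>; box 0 (1::real) \<noteq> {}\<rbrakk> \<Longrightarrow> interior K \<noteq> {}"
        "A \<inter> {0..1} \<subseteq> \<Union>\<D>" "\<Union>\<D> \<in> lmeasurable" "measure lebesgue (\<Union>\<D>) \<le> measure lebesgue (A \<inter> {0..1}) + d/2"
        by metis
      \<comment> \<open>Absolute continuity handles finite families only; the countable cover is
        reached afterwards by continuity from below.\<close>
      have fin: "emeasure N (\<Union>\<E>) \<le> ennreal e" if E: "finite \<E>" "\<E> \<subseteq> \<D>" for \<E>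
      proof -
        define q where "q = (\<lambda>K::real set. (Inf K, Sup K))"
        have K: "K = {fst (q K)..snd (q K)} \<and> 0 \<le> fst (q K) \<and> fst (q K) < snd (q K) \<and> snd (q K) \<le> 1" if "K \<in> \<E>" for K
        proof -
          have KD: "K \<in> \<D>" using that E by auto
          obtain a b where ab: "K = {a..b}" using D(2)[OF KD] by auto
          have "interior K \<noteq> {}" using D(4)[OF KD] by simp
          then have "a < b" using ab by simp
          moreover have "0 \<le> a" "b \<le> 1" using D(2)[OF KD] ab \<open>a < b\<close> by auto
          ultimately show ?thesis by (simp add: q_def ab)
        qed
        have inj: "inj_on q \<E>" by (rule inj_onI) (metis K)
        have fam: "interval_family 0 1 (q ` \<E>)"
          unfolding interval_family_def disjoint_family_on_def
        proof (intro conjI ballI impI)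
          fix u v assume uv: "u \<in> q ` \<E>" "v \<in> q ` \<E>" "u \<noteq> v"
          then obtain K L where KL: "K \<in> \<E>" "L \<in> \<E>" "u = q K" "v = q L" "K \<noteq> L" by auto
          then have "interior K \<inter> interior L = {}" using D(3) E(2) by (auto simp: pairwise_def)
          moreover have "interior K = {fst u<..<snd u}" "interior L = {fst v<..<snd v}"
            using K[OF KL(1)] K[OF KL(2)] KL by (metis interior_atLeastAtMost_real)+
          ultimately show "{fst u<..<snd u} \<inter> {fst v<..<snd v} = {}" by simp
        qed (use E K in auto)
        have "increment_sum (\<lambda>x. x) (q ` \<E>) = measure lborel (\<Union>p\<in>q ` \<E>. {fst p<..<snd p})"
          by (rule interval_family_length_eq[OF fam])
        also have "\<dots> = measure lebesgue (\<Union>p\<in>q ` \<E>. {fst p<..<snd p})"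
          using E by (intro measure_completion[symmetric]) (auto intro!: sets.finite_UN)
        also have "\<dots> \<le> measure lebesgue (\<Union>\<D>)"
        proof (rule measure_mono_fmeasurable[OF _ _ D(6)])
          show "(\<Union>p\<in>q ` \<E>. {fst p<..<snd p}) \<subseteq> \<Union>\<D>"
          proof
            fix x assume "x \<in> (\<Union>p\<in>q ` \<E>. {fst p<..<snd p})"
            then obtain L where L: "L \<in> \<E>" "fst (q L) < x" "x < snd (q L)" by auto
            then have "x \<in> L" using K[OF L(1)] by (metis atLeastAtMost_iff less_imp_le)
            then show "x \<in> \<Union>\<D>" using L E by auto
          qed
        qed (use E in \<open>auto intro!: sets.finite_UN\<close>)
        also have "\<dots> < d" using D(7) lA d by simp
        finally have small: "increment_sum P (q ` \<E>) \<le> e" using d(2)[OF fam] by simp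
        have "emeasure N (\<Union>\<E>) \<le> (\<Sum>K\<in>\<E>. emeasure N K)"
        proof -
          have "K \<in> sets borel" if "K \<in> \<E>" for K
            using K[OF that] by (metis borel_closed closed_atLeastAtMost)
          then have "emeasure N (\<Union>((\<lambda>x. x) ` \<E>)) \<le> (\<Sum>K\<in>\<E>. emeasure N K)"
            by (intro emeasure_subadditive_finite[OF E(1)]) auto
          then show ?thesis by simp
        qed
        also have "\<dots> = (\<Sum>K\<in>\<E>. ennreal (P (snd (q K)) - P (fst (q K))))"
        proof (rule sum.cong[OF refl])
          fix L assume L: "L \<in> \<E>"
          have "emeasure N {fst (q L)..snd (q L)} = ennreal (F (snd (q L)) - F (fst (q L)))"
            using K[OF L] by (intro Icc) auto
          also have "\<dots> = ennreal (P (snd (q L)) - P (fst (q L)))"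
            using K[OF L] by (intro arg_cong[where f=ennreal] arg_cong2[where f="(-)"] F_eq) auto
          finally show "emeasure N L = ennreal (P (snd (q L)) - P (fst (q L)))" using K[OF L] by metis
        qed
        also have "\<dots> = ennreal (\<Sum>K\<in>\<E>. P (snd (q K)) - P (fst (q K)))"
          using K mono by (intro sum_ennreal) (simp add: less_imp_le)
        also have "(\<Sum>K\<in>\<E>. P (snd (q K)) - P (fst (q K))) = increment_sum P (q ` \<E>)"
          unfolding increment_sum_def sum.reindex[OF inj] by simp
        finally show ?thesis using small by (meson ennreal_leI order_trans)
      qed
      show ?thesis
      proof (cases "\<D> = {}")
        case True
        then show ?thesis using D(5) by simp
      next
        case False
        define E where "E = (\<lambda>n. from_nat_into \<D> ` {..<n::nat})"
        have ED: "E n \<subseteq> \<D>" "finite (E n)" for n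
          unfolding E_def using from_nat_into[OF False] by auto
        have DE: "\<Union>\<D> = (\<Union>n. \<Union>(E n))"
        proof -
          have ex: "\<exists>n. K \<in> E n" if KD: "K \<in> \<D>" for K
          proof -
            obtain n where "from_nat_into \<D> n = K" using from_nat_into_surj[OF D(1) KD] by blast
            then have "K \<in> E (Suc n)" unfolding E_def by (intro image_eqI[of _ _ n]) auto
            then show ?thesis by blast
          qed
          have "\<Union>\<D> \<subseteq> (\<Union>n. \<Union>(E n))"
          proof
            fix x assume "x \<in> \<Union>\<D>"
            then obtain K where K: "K \<in> \<D>" "x \<in> K" by (rule UnionE)
            obtain n where "K \<in> E n" using ex[OF K(1)] by (rule exE)
            then show "x \<in> (\<Union>n. \<Union>(E n))" using K(2) by (intro UN_I[of n] UnionI[of K]) simp_all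
          qed
          moreover have "\<Union>(E n) \<subseteq> \<Union>\<D>" for n by (rule Union_mono[OF ED(1)])
          ultimately show ?thesis by blast
        qed
        have Em: "\<Union>(E n) \<in> sets borel" for n
        proof (rule sets.finite_Union)
          show "E n \<subseteq> sets borel"
          proof
            fix K assume "K \<in> E n"
            then have "K \<in> \<D>" using ED by blast
            then obtain a b where "K = cbox a b" using D(2) by blast
            then show "K \<in> sets borel" by simp
          qed
        qed (rule ED)
        have "emeasure N (A \<inter> {0..1}) \<le> emeasure N (\<Union>n. \<Union>(E n))"
          unfolding DE[symmetric] using D(5) Em by (intro emeasure_mono) (simp_all add: DE)
        also have "\<dots> = (SUP n. emeasure N (\<Union>(E n)))"
        proof (rule SUP_emeasure_incseq[symmetric])
          show "incseq (\<lambda>n. \<Union>(E n))"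
            unfolding incseq_def E_def by (intro allI impI Union_mono image_mono) auto
        qed (use Em in auto)
        also have "\<dots> \<le> ennreal e" using fin ED by (intro SUP_least) auto
        finally show ?thesis .
      qed
    qed
    then have "emeasure N (A \<inter> {0..1}) \<le> 0"
      by (metis add_0 ennreal_le_epsilon)
    moreover have "emeasure N A \<le> emeasure N (A \<inter> {0..1}) + emeasure N (UNIV - {0..1})"
    proof -
      have "emeasure N A \<le> emeasure N ((A \<inter> {0..1}) \<union> (UNIV - {0..1}))"
        by (rule emeasure_mono) (use Ab in auto)
      also have "\<dots> \<le> emeasure N (A \<inter> {0..1}) + emeasure N (UNIV - {0..1})"
        by (rule emeasure_subadditive) (use Ab in auto)
      finally show ?thesis .
    qed
    ultimately show ?thesis by (simp add: out)
  qed
  have "absolutely_continuous lborel N"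
    unfolding absolutely_continuous_def using null by (auto simp: null_sets_def)
  then obtain f where f[measurable]: "f \<in> borel_measurable lborel" and Nf: "density lborel f = N"
    using sigma_finite_measure.Radon_Nikodym[OF sigma_finite_lborel] by (metis sN(1) sets_lborel)
  have Nint: "emeasure N A = (\<integral>\<^sup>+x. f x * indicator A x \<partial>lborel)" if "A \<in> sets borel" for A
    unfolding Nf[symmetric] using that by (subst emeasure_density) auto
  \<comment> \<open>The density may be infinite on a null set, where \<open>enn2real\<close> returns
    0; finiteness of the total mass makes this harmless.\<close>
  define g where "g = (\<lambda>x. enn2real (f x))"
  have g[measurable]: "g \<in> borel_measurable lborel" by (simp add: g_def)
  have "(\<integral>\<^sup>+x. f x \<partial>lborel) \<noteq> \<infinity>" using total by (simp add: Nint)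
  then have AEfin: "AE x in lborel. f x \<noteq> \<infinity>" by (intro nn_integral_PInf_AE) auto
  have hi: "(g has_integral (P b - P 0)) {0..b}" if b: "b \<in> {0..1}" for b
  proof -
    have "(\<integral>\<^sup>+x. ennreal (indicator {0..b} x * g x) \<partial>lborel) = (\<integral>\<^sup>+x. f x * indicator {0..b} x \<partial>lborel)"
      by (rule nn_integral_cong_AE) (use AEfin in \<open>auto simp: g_def indicator_def less_top\<close>)
    also have "\<dots> = ennreal (P b - P 0)"
      using b Nint[of "{0..b}"] Icc[of 0 b] by (simp add: F_eq)
    finally have "((\<lambda>x. indicator {0..b} x * g x) has_integral (P b - P 0)) UNIV"
      using b mono[of 0 b] by (intro nn_integral_has_integral) (auto simp: g_def)
    moreover have "(\<lambda>x. indicator {0..b} x * g x) = (\<lambda>x. if x \<in> {0..b} then g x else 0)"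
      by (auto simp: indicator_def)
    ultimately show ?thesis by (simp only: has_integral_restrict_UNIV)
  qed
  show ?thesis
  proof (intro exI[of _ g] conjI ballI)
    show "g absolutely_integrable_on {0..1}"
      using hi[of 1] by (intro nonnegative_absolutely_integrable_1) (auto simp: g_def has_integral_integrable)
    fix x :: real assume "x \<in> {0..1}"
    then show "P x - P 0 = integral {0..x} g" using integral_unique[OF hi, of x] by simp
  qed
qed

section \<open>The fundamental theorem of calculus for absolutely continuous functions\<close>

lemma integral_eq_on_subinterval:
  assumes "g absolutely_integrable_on {0..1::real}" "0 \<le> x" "x \<le> y" "y \<le> 1"
  shows "integral {0..y} g - integral {0..x} g = integral {x..y} (g :: real \<Rightarrow> real)"
    "g absolutely_integrable_on {x..y}"
proof -
  have "g integrable_on {0..y}" using assms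
    by (intro integrable_on_subinterval[OF set_lebesgue_integral_eq_integral(1)[OF assms(1)]]) auto
  then show "integral {0..y} g - integral {0..x} g = integral {x..y} g"
    using assms Henstock_Kurzweil_Integration.integral_combine[of 0 x y g] by simp
  show "g absolutely_integrable_on {x..y}"
    by (rule set_integrable_subset[OF assms(1)]) (use assms in auto)
qed

lemma integrable_on_initial:
  assumes "g absolutely_integrable_on {0..1::real}" "x \<in> {0..1}"
  shows "(g :: real \<Rightarrow> real) integrable_on {0..x}"
  using integral_eq_on_subinterval(2)[OF assms(1), of 0 x] assms(2)
  by (auto intro: set_lebesgue_integral_eq_integral(1))

text \<open>\<open>f\<close> is the difference of the increasing functions \<open>P\<close> and
  \<open>P - f\<close>; the second inherits the increment condition from \<open>P\<close> and
  \<open>f\<close>, so both are primitives.\<close>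

theorem abs_continuous_primitive:
  assumes f: "abs_continuous_on_interval 0 1 f"
  shows "\<exists>g. g absolutely_integrable_on {0..1} \<and> (\<forall>x\<in>{0..1}. f x = f 0 + integral {0..x} g)"
proof -
  obtain P where P: "\<And>x y. 0 \<le> x \<Longrightarrow> x \<le> y \<Longrightarrow> y \<le> 1 \<Longrightarrow> P x \<le> P y"
    "\<And>x y. 0 \<le> x \<Longrightarrow> x \<le> y \<Longrightarrow> y \<le> 1 \<Longrightarrow> P x - f x \<le> P y - f y"
    "\<And>e. e > 0 \<Longrightarrow> \<exists>d>0. \<forall>D. interval_family 0 1 D \<and> increment_sum (\<lambda>x. x) D < d \<longrightarrow> increment_sum P D \<le> e"
    using abs_continuous_Jordan[OF f] by blast
  obtain g1 where g1: "g1 absolutely_integrable_on {0..1}" "\<And>x. x\<in>{0..1} \<Longrightarrow> P x - P 0 = integral {0..x} g1"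
    using increasing_abs_continuous_primitive[OF P(1,3)] by blast
  have "\<exists>d>0. \<forall>D. interval_family 0 1 D \<and> increment_sum (\<lambda>x. x) D < d \<longrightarrow> increment_sum (\<lambda>x. P x - f x) D \<le> e"
    if e: "e > 0" for e
  proof -
    obtain d1 where d1: "d1 > 0" "\<And>D. interval_family 0 1 D \<Longrightarrow> increment_sum (\<lambda>x. x) D < d1 \<Longrightarrow> increment_sum P D \<le> e/2"
      using P(3)[of "e/2"] e by auto
    obtain d2 where d2: "d2 > 0" "\<And>D. interval_family 0 1 D \<Longrightarrow> increment_sum (\<lambda>x. x) D < d2 \<Longrightarrow>
      (\<Sum>p\<in>D. \<bar>f (snd p) - f (fst p)\<bar>) < e/2"
      using abs_continuous_interval_family[OF f, of "e/2"] e by auto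
    show ?thesis
    proof (intro exI[of _ "min d1 d2"] conjI allI impI)
      fix D assume D: "interval_family 0 1 D \<and> increment_sum (\<lambda>x. x) D < min d1 d2"
      have "increment_sum (\<lambda>x. P x - f x) D = increment_sum P D - (\<Sum>p\<in>D. f (snd p) - f (fst p))"
        unfolding increment_sum_def by (simp add: sum_subtractf[symmetric] algebra_simps)
      also have "\<dots> \<le> increment_sum P D + (\<Sum>p\<in>D. \<bar>f (snd p) - f (fst p)\<bar>)"
        using sum_abs[of "\<lambda>p. f (snd p) - f (fst p)" D] by linarith
      also have "\<dots> \<le> e/2 + e/2" using d1(2)[of D] d2(2)[of D] D by (intro add_mono) auto
      finally show "increment_sum (\<lambda>x. P x - f x) D \<le> e" by simp
    qed (use d1 d2 in auto)
  qed
  then obtain g2 where g2: "g2 absolutely_integrable_on {0..1}"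
    "\<And>x. x\<in>{0..1} \<Longrightarrow> (P x - f x) - (P 0 - f 0) = integral {0..x} g2"
    using increasing_abs_continuous_primitive[of "\<lambda>x. P x - f x", OF P(2)] by blast
  show ?thesis
  proof (intro exI[of _ "\<lambda>x. g1 x - g2 x"] conjI ballI)
    show "(\<lambda>x. g1 x - g2 x) absolutely_integrable_on {0..1}" using g1(1) g2(1) by (rule set_integral_diff(1))
    fix x :: real assume x: "x \<in> {0..1}"
    have "integral {0..x} (\<lambda>x. g1 x - g2 x) = integral {0..x} g1 - integral {0..x} g2"
      by (intro Henstock_Kurzweil_Integration.integral_diff integrable_on_initial[OF _ x] g1(1) g2(1))
    then show "f x = f 0 + integral {0..x} (\<lambda>x. g1 x - g2 x)"
      using g1(2)[OF x] g2(2)[OF x] by simp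
  qed
qed

text \<open>The increments are integrals over disjoint intervals, so the sum of their absolute
  values is at most the integral of \<open>\<bar>g\<bar>\<close> over a set of small
  measure.\<close>

lemma primitive_abs_continuous:
  assumes g: "g absolutely_integrable_on {0..1}" and f: "\<And>x. x \<in> {0..1} \<Longrightarrow> f x = c + integral {0..x} g"
  shows "abs_continuous_on_interval 0 1 f"
  unfolding abs_continuous_on_interval_def
proof (intro allI impI)
  fix e :: real assume e: "e > 0"
  define h where "h = (\<lambda>x. indicator {0..1} x * \<bar>g x\<bar>)"
  have h: "integrable lebesgue h" "\<And>x. h x \<ge> 0"
    using set_integrable_abs[OF g] by (auto simp: h_def set_integrable_def)
  obtain d where d: "d > 0" "\<And>A. A \<in> sets lebesgue \<Longrightarrow> emeasure lebesgue A < ennreal d \<Longrightarrow> (LINT x:A|lebesgue. h x) < e"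
    using integral_small_on_small_sets[OF h e] by blast
  show "\<exists>d>0. \<forall>(I :: nat set) l r.
       finite I \<and> (\<forall>i\<in>I. 0 \<le> l i \<and> l i \<le> r i \<and> r i \<le> 1) \<and>
       disjoint_family_on (\<lambda>i. {l i<..<r i}) I \<and> (\<Sum>i\<in>I. r i - l i) < d
       \<longrightarrow> (\<Sum>i\<in>I. \<bar>f (r i) - f (l i)\<bar>) < e"
  proof (intro exI[of _ d] conjI allI impI d(1))
    fix I :: "nat set" and l r :: "nat \<Rightarrow> real"
    assume "finite I \<and> (\<forall>i\<in>I. 0 \<le> l i \<and> l i \<le> r i \<and> r i \<le> 1) \<and>
       disjoint_family_on (\<lambda>i. {l i<..<r i}) I \<and> (\<Sum>i\<in>I. r i - l i) < d"
    then have I: "finite I" "\<And>i. i \<in> I \<Longrightarrow> 0 \<le> l i \<and> l i \<le> r i \<and> r i \<le> 1"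
       "disjoint_family_on (\<lambda>i. {l i<..<r i}) I" "(\<Sum>i\<in>I. r i - l i) < d" by auto
    define A where "A = (\<Union>i\<in>I. {l i<..<r i})"
    have "emeasure lebesgue A = (\<Sum>i\<in>I. emeasure lebesgue {l i<..<r i})"
      unfolding A_def using I by (intro sum_emeasure[symmetric]) auto
    also have "\<dots> = ennreal (\<Sum>i\<in>I. r i - l i)"
      using I(2) by (subst sum_ennreal[symmetric]) (auto intro!: sum.cong)
    also have "\<dots> < ennreal d" using I(4) d(1) by (simp add: ennreal_lessI)
    finally have small: "(LINT x:A|lebesgue. h x) < e" by (intro d(2)) (auto simp: A_def I(1) intro!: sets.finite_UN)
    have "(\<Sum>i\<in>I. \<bar>f (r i) - f (l i)\<bar>) \<le> (\<Sum>i\<in>I. LINT x:{l i<..<r i}|lebesgue. h x)"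
    proof (rule sum_mono)
      fix i assume i: "i \<in> I"
      note I2 = I(2)[OF i]
      have gi: "g absolutely_integrable_on {l i..r i}"
        by (rule integral_eq_on_subinterval(2)[OF g]) (use I2 in auto)
      have "f (r i) - f (l i) = integral {l i..r i} g"
        using integral_eq_on_subinterval(1)[OF g, of "l i" "r i"] f[of "l i"] f[of "r i"] I2 by auto
      also have "\<bar>\<dots>\<bar> \<le> integral {l i..r i} (\<lambda>x. \<bar>g x\<bar>)"
        using integral_norm_bound_integral[of g "{l i..r i}" "\<lambda>x. \<bar>g x\<bar>"] gi set_integrable_abs[OF gi]
        by (simp add: set_lebesgue_integral_eq_integral(1))
      also have "\<dots> = (LINT x:{l i..r i}|lebesgue. \<bar>g x\<bar>)"
        by (rule set_lebesgue_integral_eq_integral(2)[symmetric, OF set_integrable_abs[OF gi]])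
      also have "\<dots> = (LINT x:{l i<..<r i}|lebesgue. h x)"
        unfolding set_lebesgue_integral_def
      proof (rule integral_cong_AE)
        show "AE x in lebesgue. indicat_real {l i..r i} x *\<^sub>R \<bar>g x\<bar> = indicat_real {l i<..<r i} x *\<^sub>R h x"
        proof -
          have "{l i, r i} \<in> null_sets lebesgue" by (intro null_sets_completionI finite_imp_null_set_lborel) auto
          then have "AE x in lebesgue. x \<notin> {l i, r i}" by (rule AE_not_in)
          then show ?thesis by (rule eventually_mono) (use I2 in \<open>auto simp: h_def indicator_def\<close>)
        qed
        show "(\<lambda>x. indicat_real {l i..r i} x *\<^sub>R \<bar>g x\<bar>) \<in> borel_measurable lebesgue"
          using set_integrable_abs[OF gi] by (auto simp: set_integrable_def)
        show "(\<lambda>x. indicat_real {l i<..<r i} x *\<^sub>R h x) \<in> borel_measurable lebesgue"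
          by (intro borel_measurable_scaleR borel_measurable_indicator borel_measurable_integrable[OF h(1)]) auto
      qed
      finally show "\<bar>f (r i) - f (l i)\<bar> \<le> (LINT x:{l i<..<r i}|lebesgue. h x)" .
    qed
    also have "\<dots> = (LINT x:A|lebesgue. h x)"
      unfolding A_def
    proof (rule set_integral_finite_Union[symmetric])
      show "set_integrable lebesgue {l i<..<r i} h" for i
        unfolding set_integrable_def
        by (rule integrable_mult_indicator[OF _ h(1)]) auto
    qed (use I in auto)
    finally show "(\<Sum>i\<in>I. \<bar>f (r i) - f (l i)\<bar>) < e" using small by simp
  qed
qed

lemma primitive_deriv_AE:
  assumes g: "g absolutely_integrable_on {0..1}" and f: "\<And>x. x \<in> {0..1} \<Longrightarrow> f x = c + integral {0..x} g"
  shows "\<exists>N. negligible N \<and> (\<forall>x\<in>{0..1} - N. (f has_real_derivative g x) (at x within {0..1}))"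
proof -
  obtain N where N: "negligible N" "\<And>x. x\<in>{0..1} - N \<Longrightarrow>
    ((\<lambda>x. integral {0..x} g) has_real_derivative g x) (at x within {0..1})"
    using Lebesgue_differentiation[OF g] by blast
  have "(f has_real_derivative g x) (at x within {0..1})" if x: "x \<in> {0..1} - N" for x
  proof -
    have "((\<lambda>x. c + integral {0..x} g) has_real_derivative 0 + g x) (at x within {0..1})"
      by (intro DERIV_add DERIV_const N(2)[OF x])
    then have "((\<lambda>x. c + integral {0..x} g) has_real_derivative g x) (at x within {0..1})" by simp
    then show ?thesis
      by (rule has_field_derivative_transform_within[where d=1]) (use x f in auto)
  qed
  then show ?thesis using N(1) by blast
qed

lemma vector_derivative_01:
  assumes "(f has_real_derivative d) (at x within {0..1})" "x \<in> {0..1}"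
  shows "vector_derivative f (at x within {0..1}) = d"
  using assms
  by (intro vector_derivative_within_closed_interval) (auto simp: has_real_derivative_iff_has_vector_derivative)

text \<open>The one-sided derivative exists and equals the integrand off a null set, so the
  unspecified values of \<open>vector_derivative\<close> elsewhere do not affect the integral. This
  ties \<open>deriv01\<close> to integration.\<close>

theorem abs_continuous_FTC:
  assumes f: "abs_continuous_on_interval 0 1 f"
  defines "f' \<equiv> (\<lambda>x. vector_derivative f (at x within {0..1}))"
  shows "f' absolutely_integrable_on {0..1}" "\<And>x. x \<in> {0..1} \<Longrightarrow> f x = f 0 + integral {0..x} f'"
proof -
  obtain g where g: "g absolutely_integrable_on {0..1}" "\<And>x. x \<in> {0..1} \<Longrightarrow> f x = f 0 + integral {0..x} g"
    using abs_continuous_primitive[OF f] by blast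
  obtain N where N: "negligible N" "\<And>x. x \<in> {0..1} - N \<Longrightarrow> (f has_real_derivative g x) (at x within {0..1})"
    using primitive_deriv_AE[OF g] by blast
  have eq: "f' x = g x" if "x \<in> {0..1} - N" for x
    unfolding f'_def using vector_derivative_01[OF N(2)[OF that]] that by simp
  show "f' absolutely_integrable_on {0..1}"
    by (rule absolutely_integrable_spike[OF g(1) N(1)]) (use eq in auto)
  show "f x = f 0 + integral {0..x} f'" if "x \<in> {0..1}" for x
  proof -
    have "integral {0..x} g = integral {0..x} f'"
      by (rule integral_spike[OF N(1)]) (use eq that in auto)
    then show ?thesis using g(2)[OF that] by simp
  qed
qed

section \<open>Square integrable functions and chains of primitives\<close>

text \<open>Measurability is demanded separately, since a square can be integrable although the sign
  of the function is not measurable.\<close>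

definition square_integrable :: "'a measure \<Rightarrow> ('a \<Rightarrow> real) \<Rightarrow> bool" where
  "square_integrable M f \<longleftrightarrow> f \<in> borel_measurable M \<and> integrable M (\<lambda>x. (f x)\<^sup>2)"

definition L2_sq :: "'a measure \<Rightarrow> ('a \<Rightarrow> real) \<Rightarrow> real" where
  "L2_sq M f = (\<integral>x. (f x)\<^sup>2 \<partial>M)"

lemma L2_sq_nonneg [simp]: "0 \<le> L2_sq M f"
  by (simp add: L2_sq_def)

lemma square_integrable_mult:
  assumes "square_integrable M f" "square_integrable M g"
  shows "integrable M (\<lambda>x. f x * g x)"
proof (rule Bochner_Integration.integrable_bound)
  show "integrable M (\<lambda>x. (f x)\<^sup>2 + (g x)\<^sup>2)" using assms by (auto simp: square_integrable_def)
  have "\<bar>a * b\<bar> \<le> a\<^sup>2 + b\<^sup>2" for a b :: real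
  proof -
    have "2 * \<bar>a\<bar> * \<bar>b\<bar> \<le> a\<^sup>2 + b\<^sup>2" using sum_squares_bound[of "\<bar>a\<bar>" "\<bar>b\<bar>"] by simp
    moreover have "0 \<le> \<bar>a\<bar> * \<bar>b\<bar>" by simp
    ultimately show ?thesis unfolding abs_mult by linarith
  qed
  then show "AE x in M. norm (f x * g x) \<le> norm ((f x)\<^sup>2 + (g x)\<^sup>2)" by (auto intro!: AE_I2)
  show "(\<lambda>x. f x * g x) \<in> borel_measurable M"
    using assms by (auto simp: square_integrable_def)
qed

lemma square_integrable_lin:
  assumes "square_integrable M f" "square_integrable M g"
  shows "square_integrable M (\<lambda>x. a * f x + b * g x)"
proof -
  have "integrable M (\<lambda>x. a\<^sup>2 * (f x)\<^sup>2 + 2 * a * b * (f x * g x) + b\<^sup>2 * (g x)\<^sup>2)"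
    using assms square_integrable_mult[OF assms] by (auto simp: square_integrable_def)
  then have "integrable M (\<lambda>x. (a * f x + b * g x)\<^sup>2)"
    by (rule back_subst[of "integrable M"]) (auto simp: fun_eq_iff power2_eq_square algebra_simps)
  then show ?thesis using assms by (auto simp: square_integrable_def)
qed

lemma L2_sq_lin:
  assumes "square_integrable M f" "square_integrable M g"
  shows "L2_sq M (\<lambda>x. a * f x + b * g x) = a\<^sup>2 * L2_sq M f + 2 * a * b * (\<integral>x. f x * g x \<partial>M) + b\<^sup>2 * L2_sq M g"
proof -
  have "L2_sq M (\<lambda>x. a * f x + b * g x) = (\<integral>x. a\<^sup>2 * (f x)\<^sup>2 + 2 * a * b * (f x * g x) + b\<^sup>2 * (g x)\<^sup>2 \<partial>M)"
    unfolding L2_sq_def by (rule Bochner_Integration.integral_cong) (auto simp: power2_eq_square algebra_simps)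
  also have "\<dots> = a\<^sup>2 * L2_sq M f + 2 * a * b * (\<integral>x. f x * g x \<partial>M) + b\<^sup>2 * L2_sq M g"
    using assms square_integrable_mult[OF assms] unfolding L2_sq_def
    by (simp add: square_integrable_def)
  finally show ?thesis .
qed

lemma L2_Cauchy_Schwarz:
  assumes "square_integrable M f" "square_integrable M g"
  shows "\<bar>\<integral>x. f x * g x \<partial>M\<bar> \<le> sqrt (L2_sq M f) * sqrt (L2_sq M g)"
proof -
  let ?a = "L2_sq M f" and ?b = "\<integral>x. f x * g x \<partial>M" and ?c = "L2_sq M g"
  have pos: "0 \<le> t\<^sup>2 * ?a + 2 * t * ?b + ?c" for t
    using L2_sq_lin[OF assms, of t 1] L2_sq_nonneg[of M "\<lambda>x. t * f x + 1 * g x"] by simp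
  have "?b\<^sup>2 \<le> ?a * ?c"
  proof (cases "?a = 0")
    case True
    have "?b = 0"
    proof (rule ccontr)
      assume "?b \<noteq> 0"
      \<comment> \<open>At this \<open>t\<close> the form reduces to
        \<open>2 * t * ?b + ?c = -1\<close>.\<close>
      then show False using pos[of "- (?c + 1) / (2 * ?b)"] True L2_sq_nonneg[of M g] by (simp add: field_simps)
    qed
    then show ?thesis using True by simp
  next
    case False
    then have a: "?a > 0" using L2_sq_nonneg[of M f] by linarith
    have "0 \<le> ?a * ((- ?b / ?a)\<^sup>2 * ?a + 2 * (- ?b / ?a) * ?b + ?c)"
      using a pos[of "- ?b / ?a"] by (intro mult_nonneg_nonneg) auto
    also have "\<dots> = ?a * ?c - ?b\<^sup>2" using a by (simp add: field_simps power2_eq_square)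
    finally show ?thesis by simp
  qed
  then have "sqrt (?b\<^sup>2) \<le> sqrt (?a * ?c)" by (rule real_sqrt_le_mono)
  then show ?thesis by (simp add: real_sqrt_mult)
qed

lemma L2_Minkowski:
  assumes "square_integrable M f" "square_integrable M g"
  shows "sqrt (L2_sq M (\<lambda>x. f x + g x)) \<le> sqrt (L2_sq M f) + sqrt (L2_sq M g)"
proof (rule real_le_lsqrt)
  have "L2_sq M (\<lambda>x. f x + g x) = L2_sq M f + 2 * (\<integral>x. f x * g x \<partial>M) + L2_sq M g"
    using L2_sq_lin[OF assms, of 1 1] by simp
  also have "\<dots> \<le> L2_sq M f + 2 * (sqrt (L2_sq M f) * sqrt (L2_sq M g)) + L2_sq M g"
    using L2_Cauchy_Schwarz[OF assms] by linarith
  also have "\<dots> = (sqrt (L2_sq M f) + sqrt (L2_sq M g))\<^sup>2"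
    by (simp add: power2_sum)
  finally show "L2_sq M (\<lambda>x. f x + g x) \<le> (sqrt (L2_sq M f) + sqrt (L2_sq M g))\<^sup>2" .
qed auto

lemma L2_sq_AE_cong:
  assumes "square_integrable M f" "g \<in> borel_measurable M" "AE x in M. g x = f x"
  shows "square_integrable M g" "L2_sq M g = L2_sq M f"
proof -
  have fm[measurable]: "f \<in> borel_measurable M" and gm[measurable]: "g \<in> borel_measurable M"
    using assms by (auto simp: square_integrable_def)
  have ae: "AE x in M. (g x)\<^sup>2 = (f x)\<^sup>2" using assms(3) by eventually_elim simp
  have "integrable M (\<lambda>x. (g x)\<^sup>2) \<longleftrightarrow> integrable M (\<lambda>x. (f x)\<^sup>2)"
    by (rule integrable_cong_AE) (use ae in auto)
  then show "square_integrable M g" using assms by (simp add: square_integrable_def)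
  show "L2_sq M g = L2_sq M f" unfolding L2_sq_def
    by (rule integral_cong_AE) (use ae in auto)
qed

section \<open>Lebesgue measure on the unit interval as a probability space\<close>

abbreviation leb01 :: "real measure" where
  "leb01 \<equiv> lebesgue_on {0..1}"

lemma set_integral_leb01: "(LINT x:{0..1}|lebesgue. f x) = (\<integral>x. f x \<partial>leb01)" for f :: "real \<Rightarrow> real"
  unfolding set_lebesgue_integral_def by (subst integral_restrict_space) auto

lemma absolutely_integrable_leb01: "f absolutely_integrable_on {0..1} \<longleftrightarrow> integrable leb01 f" for f :: "real \<Rightarrow> real"
  unfolding set_integrable_def by (subst integrable_restrict_space) auto

lemma prob_space_leb01: "prob_space leb01"
  by (rule prob_spaceI) (simp add: emeasure_restrict_space space_restrict_space)

interpretation leb01: prob_space leb01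
  by (rule prob_space_leb01)

lemma space_leb01 [simp]: "space leb01 = {0..1}"
  by (simp add: space_restrict_space)

lemma AE_leb01I:
  assumes "negligible N" "\<And>x. x \<in> {0..1} - N \<Longrightarrow> P x"
  shows "AE x in leb01. P x"
proof -
  have "AE x in lebesgue. x \<notin> N"
    using assms(1) by (intro AE_not_in) (simp add: negligible_iff_null_sets)
  then have "AE x in lebesgue. x \<in> {0..1} \<longrightarrow> P x"
    by (rule eventually_mono) (use assms(2) in auto)
  then show ?thesis by (subst AE_restrict_space_iff) auto
qed

lemma integral_leb01_indicator:
  assumes f: "f absolutely_integrable_on {0..1}" and uv: "0 \<le> u" "u \<le> v" "v \<le> 1"
  shows "(\<integral>x. indicator {u..v} x * f x \<partial>leb01) = integral {u..v} (f :: real \<Rightarrow> real)"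
proof -
  have "(\<integral>x. indicator {u..v} x * f x \<partial>leb01) = (LINT x:{u..v}|lebesgue. f x)"
    unfolding set_integral_leb01[symmetric] set_lebesgue_integral_def
    by (rule Bochner_Integration.integral_cong) (use uv in \<open>auto simp: indicator_def\<close>)
  also have "\<dots> = integral {u..v} f"
    by (rule set_lebesgue_integral_eq_integral(2)[OF integral_eq_on_subinterval(2)[OF f uv]])
  finally show ?thesis .
qed

lemma square_integrable_integrable:
  assumes "square_integrable leb01 f" shows "integrable leb01 f"
  by (rule leb01.square_integrable_imp_integrable) (use assms in \<open>auto simp: square_integrable_def\<close>)

lemma integral_sq_le_L2_sq:
  assumes "square_integrable leb01 f"
  shows "(\<integral>x. \<bar>f x\<bar> \<partial>leb01) \<le> sqrt (L2_sq leb01 f)"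
proof -
  have "square_integrable leb01 (\<lambda>x. \<bar>f x\<bar>)" "square_integrable leb01 (\<lambda>x. 1)"
    using assms by (auto simp: square_integrable_def)
  from L2_Cauchy_Schwarz[OF this] show ?thesis
    using leb01.prob_space by (simp add: L2_sq_def)
qed

lemma continuous_square_integrable:
  assumes "continuous_on {0..1} f" shows "square_integrable leb01 f"
proof -
  have "(\<lambda>x. (f x)\<^sup>2) absolutely_integrable_on {0..1}" "f absolutely_integrable_on {0..1}"
    using assms by (auto intro!: absolutely_integrable_continuous_real continuous_intros)
  then show ?thesis by (auto simp: square_integrable_def absolutely_integrable_leb01)
qed

text \<open>An encoding of the Sobolev space without pointwise derivatives: \<open>D k\<close> plays
  the role of the \<open>k\<close>-th derivative, and consecutive entries are tied together by
  integration only. Linear combinations stay of this form and limits can be rebuilt in it, whereas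
  \<open>deriv01 m\<close> is well behaved only almost everywhere. Values outside the unit interval
  are left free.\<close>

definition primitive_chain :: "nat \<Rightarrow> (nat \<Rightarrow> real \<Rightarrow> real) \<Rightarrow> bool" where
  "primitive_chain m D \<longleftrightarrow>
     (\<forall>k<m. D (Suc k) absolutely_integrable_on {0..1} \<and>
        (\<forall>x\<in>{0..1}. D k x = D k 0 + integral {0..x} (D (Suc k)))) \<and>
     square_integrable leb01 (D m)"

lemma primitive_chainD:
  assumes "primitive_chain m D"
  shows "\<And>k. k < m \<Longrightarrow> D (Suc k) absolutely_integrable_on {0..1}"
    "\<And>k x. k < m \<Longrightarrow> x \<in> {0..1} \<Longrightarrow> D k x = D k 0 + integral {0..x} (D (Suc k))"
    "square_integrable leb01 (D m)"
  using assms unfolding primitive_chain_def by blast+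

lemma primitive_continuous:
  assumes g: "g absolutely_integrable_on {0..1}" and f: "\<And>x. x \<in> {0..1} \<Longrightarrow> f x = c + integral {0..x} g"
  shows "continuous_on {0..1} (f :: real \<Rightarrow> real)"
proof -
  have "continuous_on {0..1} (\<lambda>x. c + integral {0..x} g)"
    using g by (intro continuous_intros indefinite_integral_continuous_1 set_lebesgue_integral_eq_integral(1))
  then show ?thesis by (rule continuous_on_cong[THEN iffD1, rotated 2]) (use f in auto)
qed

lemma primitive_chain_continuous:
  assumes "primitive_chain m D" "k < m" shows "continuous_on {0..1} (D k)"
  using primitive_continuous primitive_chainD[OF assms(1)] assms(2) by blast

lemma primitive_chain_square_integrable:
  assumes "primitive_chain m D" "k \<le> m" shows "square_integrable leb01 (D k)"
  using assms primitive_chain_continuous[OF assms(1), of k] continuous_square_integrable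
    primitive_chainD(3)[OF assms(1)] by (cases "k = m") auto

lemma primitive_chain_lin:
  assumes D: "primitive_chain m D" and E: "primitive_chain m E"
  shows "primitive_chain m (\<lambda>k x. a * D k x + b * E k x)"
  unfolding primitive_chain_def
proof (intro conjI allI impI ballI)
  note D' = primitive_chainD[OF D] and E' = primitive_chainD[OF E]
  show "square_integrable leb01 (\<lambda>x. a * D m x + b * E m x)"
    by (rule square_integrable_lin[OF D'(3) E'(3)])
  fix k assume k: "k < m"
  show "(\<lambda>x. a * D (Suc k) x + b * E (Suc k) x) absolutely_integrable_on {0..1}"
    by (intro set_integral_add(1) set_integrable_mult_right) (use D'(1) E'(1) k in auto)
  fix x :: real assume x: "x \<in> {0..1}"
  have i: "D (Suc k) integrable_on {0..x}" "E (Suc k) integrable_on {0..x}"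
    using integrable_on_initial[OF D'(1)[OF k] x] integrable_on_initial[OF E'(1)[OF k] x] by auto
  have "integral {0..x} (\<lambda>x. a * D (Suc k) x + b * E (Suc k) x)
      = integral {0..x} (\<lambda>x. a * D (Suc k) x) + integral {0..x} (\<lambda>x. b * E (Suc k) x)"
    using i by (intro Henstock_Kurzweil_Integration.integral_add integrable_on_mult_right)
  also have "\<dots> = a * integral {0..x} (D (Suc k)) + b * integral {0..x} (E (Suc k))"
    by simp
  finally have eq: "integral {0..x} (\<lambda>x. a * D (Suc k) x + b * E (Suc k) x)
      = a * integral {0..x} (D (Suc k)) + b * integral {0..x} (E (Suc k))" .
  show "a * D k x + b * E k x = a * D k 0 + b * E k 0 + integral {0..x} (\<lambda>x. a * D (Suc k) x + b * E (Suc k) x)"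
    unfolding eq D'(2)[OF k x] E'(2)[OF k x] by (simp add: algebra_simps)
qed

theorem sobolev01_chain:
  assumes f: "f \<in> sobolev01 m 2" and m: "m \<ge> 1"
  shows "primitive_chain m (\<lambda>k. deriv01 k f)"
proof -
  have ac: "abs_continuous_on_interval 0 1 (deriv01 k f)" if "k < m" for k
    using f that by (simp add: sobolev01_def)
  have ai: "deriv01 (Suc k) f absolutely_integrable_on {0..1}" if "k < m" for k
    using abs_continuous_FTC(1)[OF ac[OF that]] by simp
  have "deriv01 m f \<in> borel_measurable leb01"
    using ai[of "m - 1"] m by (simp add: absolutely_integrable_leb01 borel_measurable_integrable)
  moreover have "(\<lambda>x. \<bar>deriv01 m f x\<bar> ^ 2) absolutely_integrable_on {0..1}"
    using f by (simp add: sobolev01_def)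
  ultimately have "square_integrable leb01 (deriv01 m f)"
    by (simp add: absolutely_integrable_leb01 square_integrable_def)
  then show ?thesis
    unfolding primitive_chain_def
  proof (intro conjI allI impI ballI)
    fix k :: nat and x :: real assume k: "k < m" and x: "x \<in> {0..1}"
    show "deriv01 k f x = deriv01 k f 0 + integral {0..x} (deriv01 (Suc k) f)"
      using abs_continuous_FTC(2)[OF ac[OF k] x] by (simp only: deriv01.simps)
  qed (use ai in auto)
qed

text \<open>Below order \<open>m\<close> the entries are continuous, so these derivatives exist at
  every point, endpoints included; the last entry is merely integrable and is recovered almost
  everywhere by Lebesgue differentiation.\<close>

theorem chain_sobolev01:
  assumes D: "primitive_chain m D" and m: "m \<ge> 1" and f: "\<And>x. x \<in> {0..1} \<Longrightarrow> f x = D 0 x"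
  shows "f \<in> sobolev01 m 2"
    "\<And>k x. k < m \<Longrightarrow> x \<in> {0..1} \<Longrightarrow> deriv01 k f x = D k x"
    "AE x in leb01. deriv01 m f x = D m x"
proof -
  note D' = primitive_chainD[OF D]
  \<comment> \<open>The derivative claim stops at \<open>Suc k < m\<close>, where
    \<open>D (Suc k)\<close> is still continuous.\<close>
  have der: "\<forall>x\<in>{0..1}. deriv01 k f x = D k x \<and>
    (Suc k < m \<longrightarrow> (deriv01 k f has_real_derivative D (Suc k) x) (at x within {0..1}))" if "k < m" for k
    using that
  proof (induction k)
    case 0
    have "(f has_real_derivative D 1 x) (at x within {0..1})" if x: "x \<in> {0..1}" and m: "1 < m" for x
    proof -
      have "((\<lambda>x. integral {0..x} (D 1)) has_real_derivative D 1 x) (at x within {0..1})"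
        using primitive_chain_continuous[OF D m] x by (rule integral_has_real_derivative)
      then have "((\<lambda>x. D 0 0 + integral {0..x} (D 1)) has_real_derivative 0 + D 1 x) (at x within {0..1})"
        by (intro DERIV_add DERIV_const)
      then have "((\<lambda>x. D 0 0 + integral {0..x} (D 1)) has_real_derivative D 1 x) (at x within {0..1})" by simp
      then show ?thesis
        by (rule has_field_derivative_transform_within[where d=1]) (use x m in \<open>auto simp: f D'(2)[of 0, symmetric]\<close>)
    qed
    then show ?case using f by auto
  next
    case (Suc k)
    have IH: "(deriv01 k f has_real_derivative D (Suc k) x) (at x within {0..1})" if "x \<in> {0..1}" for x
      using Suc that by simp
    have eq: "deriv01 (Suc k) f x = D (Suc k) x" if "x \<in> {0..1}" for x
      using vector_derivative_01[OF IH[OF that] that] by simp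
    have "(deriv01 (Suc k) f has_real_derivative D (Suc (Suc k)) x) (at x within {0..1})"
      if x: "x \<in> {0..1}" and m: "Suc (Suc k) < m" for x
    proof -
      have "((\<lambda>x. integral {0..x} (D (Suc (Suc k)))) has_real_derivative D (Suc (Suc k)) x) (at x within {0..1})"
        using primitive_chain_continuous[OF D m] x by (rule integral_has_real_derivative)
      then have "((\<lambda>x. D (Suc k) 0 + integral {0..x} (D (Suc (Suc k)))) has_real_derivative 0 + D (Suc (Suc k)) x) (at x within {0..1})"
        by (intro DERIV_add DERIV_const)
      then have "((\<lambda>x. D (Suc k) 0 + integral {0..x} (D (Suc (Suc k)))) has_real_derivative D (Suc (Suc k)) x) (at x within {0..1})" by simp
      then show ?thesis
        by (rule has_field_derivative_transform_within[where d=1]) (use x m in \<open>auto simp: eq D'(2)[of "Suc k", symmetric] simp del: deriv01.simps\<close>)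
    qed
    then show ?case using eq by auto
  qed
  show eq: "deriv01 k f x = D k x" if "k < m" "x \<in> {0..1}" for k x using der that by blast
  have pr: "deriv01 k f x = D k 0 + integral {0..x} (D (Suc k))" if "k < m" "x \<in> {0..1}" for k x
    using eq[OF that] D'(2)[OF that] by simp
  have ac: "abs_continuous_on_interval 0 1 (deriv01 k f)" if "k < m" for k
    by (rule primitive_abs_continuous[OF D'(1)[OF that] pr[OF that]])
  have m1: "m - 1 < m" "Suc (m - 1) = m" using m by auto
  obtain N where N: "negligible N"
    "\<And>x. x \<in> {0..1} - N \<Longrightarrow> (deriv01 (m - 1) f has_real_derivative D m x) (at x within {0..1})"
    using primitive_deriv_AE[OF D'(1)[OF m1(1)] pr[OF m1(1)]] unfolding m1(2) by blast
  have eqm: "deriv01 m f x = D m x" if "x \<in> {0..1} - N" for x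
  proof -
    have "deriv01 (Suc (m - 1)) f x = D m x"
      using vector_derivative_01[OF N(2)[OF that]] that by simp
    then show ?thesis using m by simp
  qed
  show ae: "AE x in leb01. deriv01 m f x = D m x"
    by (rule AE_leb01I[OF N(1) eqm])
  have "deriv01 (Suc (m - 1)) f absolutely_integrable_on {0..1}"
    using abs_continuous_FTC(1)[OF ac[OF m1(1)]] unfolding deriv01.simps .
  then have "deriv01 m f \<in> borel_measurable leb01"
    unfolding m1(2) by (simp add: absolutely_integrable_leb01 borel_measurable_integrable)
  from L2_sq_AE_cong(1)[OF D'(3) this ae]
  have "(\<lambda>x. \<bar>deriv01 m f x\<bar> ^ 2) absolutely_integrable_on {0..1}"
    by (simp add: absolutely_integrable_leb01 square_integrable_def)
  moreover have "deriv01 k f differentiable_on {0..1}" if "k + 1 < m" for k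
    unfolding differentiable_on_def
    unfolding real_differentiable_def using der[of k] that by auto
  ultimately show "f \<in> sobolev01 m 2"
    using ac by (simp add: sobolev01_def)
qed

section \<open>Products of absolutely continuous functions\<close>

lemma abs_continuous_mult:
  assumes f: "abs_continuous_on_interval 0 1 f" and g: "abs_continuous_on_interval 0 1 g"
    and Bf: "\<And>x. x \<in> {0..1} \<Longrightarrow> \<bar>f x\<bar> \<le> B" and Bg: "\<And>x. x \<in> {0..1} \<Longrightarrow> \<bar>g x\<bar> \<le> B"
  shows "abs_continuous_on_interval 0 1 (\<lambda>x. f x * g x)"
  unfolding abs_continuous_on_interval_def
proof (intro allI impI)
  fix e :: real assume e: "e > 0"
  \<comment> \<open>Each factor contributes half of \<open>e\<close> after multiplication by the
    bound; the \<open>+ 1\<close> keeps the divisor positive.\<close>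
  define e' where "e' = (e / 2) / (\<bar>B\<bar> + 1)"
  have e': "e' > 0" using e by (simp add: e'_def)
  obtain d1 where d1: "d1 > 0" "\<And>(I :: nat set) l r.
       finite I \<and> (\<forall>i\<in>I. 0 \<le> l i \<and> l i \<le> r i \<and> r i \<le> 1) \<and>
       disjoint_family_on (\<lambda>i. {l i<..<r i}) I \<and> (\<Sum>i\<in>I. r i - l i) < d1
       \<Longrightarrow> (\<Sum>i\<in>I. \<bar>f (r i) - f (l i)\<bar>) < e'"
    using f e' unfolding abs_continuous_on_interval_def by meson
  obtain d2 where d2: "d2 > 0" "\<And>(I :: nat set) l r.
       finite I \<and> (\<forall>i\<in>I. 0 \<le> l i \<and> l i \<le> r i \<and> r i \<le> 1) \<and>
       disjoint_family_on (\<lambda>i. {l i<..<r i}) I \<and> (\<Sum>i\<in>I. r i - l i) < d2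
       \<Longrightarrow> (\<Sum>i\<in>I. \<bar>g (r i) - g (l i)\<bar>) < e'"
    using g e' unfolding abs_continuous_on_interval_def by meson
  show "\<exists>d>0. \<forall>(I :: nat set) l r.
       finite I \<and> (\<forall>i\<in>I. 0 \<le> l i \<and> l i \<le> r i \<and> r i \<le> 1) \<and>
       disjoint_family_on (\<lambda>i. {l i<..<r i}) I \<and> (\<Sum>i\<in>I. r i - l i) < d
       \<longrightarrow> (\<Sum>i\<in>I. \<bar>f (r i) * g (r i) - f (l i) * g (l i)\<bar>) < e"
  proof (intro exI[of _ "min d1 d2"] conjI allI impI)
    fix I :: "nat set" and l r
    assume I: "finite I \<and> (\<forall>i\<in>I. 0 \<le> l i \<and> l i \<le> r i \<and> r i \<le> 1) \<and>
       disjoint_family_on (\<lambda>i. {l i<..<r i}) I \<and> (\<Sum>i\<in>I. r i - l i) < min d1 d2"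
    have "(\<Sum>i\<in>I. \<bar>f (r i) * g (r i) - f (l i) * g (l i)\<bar>)
        \<le> (\<Sum>i\<in>I. (\<bar>B\<bar> + 1) * (\<bar>f (r i) - f (l i)\<bar> + \<bar>g (r i) - g (l i)\<bar>))"
    proof (rule sum_mono)
      fix i assume i: "i \<in> I"
      have lr: "l i \<in> {0..1}" "r i \<in> {0..1}" using I i by force+
      have "f (r i) * g (r i) - f (l i) * g (l i) = (f (r i) - f (l i)) * g (r i) + f (l i) * (g (r i) - g (l i))"
        by (simp add: algebra_simps)
      also have "\<bar>\<dots>\<bar> \<le> \<bar>f (r i) - f (l i)\<bar> * \<bar>g (r i)\<bar> + \<bar>f (l i)\<bar> * \<bar>g (r i) - g (l i)\<bar>"
        by (metis abs_mult abs_triangle_ineq)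
      also have "\<dots> \<le> \<bar>f (r i) - f (l i)\<bar> * (\<bar>B\<bar> + 1) + (\<bar>B\<bar> + 1) * \<bar>g (r i) - g (l i)\<bar>"
        using Bf[OF lr(1)] Bg[OF lr(2)] by (intro add_mono mult_left_mono mult_right_mono) auto
      finally show "\<bar>f (r i) * g (r i) - f (l i) * g (l i)\<bar> \<le> (\<bar>B\<bar> + 1) * (\<bar>f (r i) - f (l i)\<bar> + \<bar>g (r i) - g (l i)\<bar>)"
        by (simp add: algebra_simps)
    qed
    also have "\<dots> = (\<bar>B\<bar> + 1) * ((\<Sum>i\<in>I. \<bar>f (r i) - f (l i)\<bar>) + (\<Sum>i\<in>I. \<bar>g (r i) - g (l i)\<bar>))"
      unfolding sum_distrib_left[symmetric] sum.distrib by (rule refl)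
    also have "\<dots> < (\<bar>B\<bar> + 1) * (e' + e')"
      using I by (intro mult_strict_left_mono add_strict_mono d1(2) d2(2)) auto
    also have "\<dots> = e"
    proof -
      have "\<bar>B\<bar> + 1 \<noteq> 0" by simp
      then show ?thesis unfolding e'_def by (metis field_sum_of_halves add_divide_distrib nonzero_mult_div_cancel_left times_divide_eq_right)
    qed
    finally show "(\<Sum>i\<in>I. \<bar>f (r i) * g (r i) - f (l i) * g (l i)\<bar>) < e" .
  qed (use d1 d2 in auto)
qed

text \<open>The product is absolutely continuous, hence the integral of its derivative, and off the
  two exceptional null sets the classical product rule computes that derivative. In this form it
  covers factors whose derivative is only integrable, such as the top entry of a chain.\<close>

lemma primitive_mult:
  assumes f': "f' absolutely_integrable_on {0..1}" and f: "\<And>x. x \<in> {0..1} \<Longrightarrow> f x = f 0 + integral {0..x} f'"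
    and g': "g' absolutely_integrable_on {0..1}" and g: "\<And>x. x \<in> {0..1} \<Longrightarrow> g x = g 0 + integral {0..x} g'"
  shows "(\<lambda>x. f' x * g x + f x * g' x) absolutely_integrable_on {0..1}"
    "\<And>x. x \<in> {0..1} \<Longrightarrow> f x * g x = f 0 * g 0 + integral {0..x} (\<lambda>x. f' x * g x + f x * g' x)"
    "abs_continuous_on_interval 0 1 (\<lambda>x. f x * g x)"
    "AE x in leb01. vector_derivative (\<lambda>x. f x * g x) (at x within {0..1}) = f' x * g x + f x * g' x"
proof -
  have cont: "continuous_on {0..1} f" "continuous_on {0..1} g"
    using primitive_continuous[OF f' f] primitive_continuous[OF g' g] by auto
  have "bounded (f ` {0..1} \<union> g ` {0..1})"
    using cont by (intro bounded_Un[THEN iffD2] conjI compact_imp_bounded compact_continuous_image) auto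
  then obtain B where B: "\<And>y. y \<in> f ` {0..1} \<union> g ` {0..1} \<Longrightarrow> \<bar>y\<bar> \<le> B"
    unfolding bounded_iff real_norm_def by blast
  show ac: "abs_continuous_on_interval 0 1 (\<lambda>x. f x * g x)"
    by (rule abs_continuous_mult[OF primitive_abs_continuous[OF f' f] primitive_abs_continuous[OF g' g], of B])
       (use B in auto)
  let ?h = "\<lambda>x. vector_derivative (\<lambda>x. f x * g x) (at x within {0..1})"
  obtain N1 where N1: "negligible N1" "\<And>x. x \<in> {0..1} - N1 \<Longrightarrow> (f has_real_derivative f' x) (at x within {0..1})"
    using primitive_deriv_AE[OF f' f] by blast
  obtain N2 where N2: "negligible N2" "\<And>x. x \<in> {0..1} - N2 \<Longrightarrow> (g has_real_derivative g' x) (at x within {0..1})"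
    using primitive_deriv_AE[OF g' g] by blast
  have N: "negligible (N1 \<union> N2)" using N1 N2 by simp
  have eq: "?h x = f' x * g x + f x * g' x" if "x \<in> {0..1} - (N1 \<union> N2)" for x
  proof -
    have "((\<lambda>x. f x * g x) has_real_derivative (f' x * g x + g' x * f x)) (at x within {0..1})"
      by (rule DERIV_mult[OF N1(2) N2(2)]) (use that in auto)
    from vector_derivative_01[OF this] that show ?thesis by (simp add: mult.commute)
  qed
  note FTC = abs_continuous_FTC[OF ac]
  show "AE x in leb01. ?h x = f' x * g x + f x * g' x"
    by (rule AE_leb01I[OF N eq])
  show "(\<lambda>x. f' x * g x + f x * g' x) absolutely_integrable_on {0..1}"
    by (rule absolutely_integrable_spike[OF FTC(1) N]) (use eq in auto)
  fix x :: real assume x: "x \<in> {0..1}"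
  have "integral {0..x} ?h = integral {0..x} (\<lambda>x. f' x * g x + f x * g' x)"
    by (rule integral_spike[OF N]) (use eq x in auto)
  then show "f x * g x = f 0 * g 0 + integral {0..x} (\<lambda>x. f' x * g x + f x * g' x)"
    using FTC(2)[OF x] by simp
qed

section \<open>Reproducing kernels for point evaluation\<close>

lemma pderiv_power_dvd:
  fixes p q :: "'a::idom poly"
  assumes "q ^ Suc n dvd p" shows "q ^ n dvd pderiv p"
proof -
  obtain r where "p = q ^ Suc n * r" using assms by auto
  then have "pderiv p = q ^ n * (smult (of_nat (Suc n)) (pderiv q) * r + q * pderiv r)"
    by (simp add: pderiv_mult pderiv_power_Suc algebra_simps del: power_Suc) (simp add: algebra_simps)
  then show ?thesis by simp
qed

text \<open>A root of multiplicity \<open>m\<close> loses one power per differentiation.\<close>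

lemma higher_pderiv_root:
  fixes p :: "'a::idom poly"
  assumes "q ^ m dvd p" "poly q x = 0" "j < m" shows "poly ((pderiv ^^ j) p) x = 0"
proof -
  have "q ^ (m - j) dvd (pderiv ^^ j) p" if "j \<le> m" for j
    using that
  proof (induction j)
    case (Suc j)
    then have "q ^ Suc (m - Suc j) dvd (pderiv ^^ j) p" by (simp add: Suc_diff_Suc)
    then show ?case by (simp add: pderiv_power_dvd)
  qed (use assms in simp)
  then have "q ^ (m - j) dvd (pderiv ^^ j) p" using assms by simp
  moreover have "q dvd q ^ (m - j)" using assms by (simp add: dvd_power)
  ultimately have "q dvd (pderiv ^^ j) p" by (rule dvd_trans[rotated])
  then show ?thesis using assms(2) by (auto elim!: dvdE)
qed

text \<open>Splitting the binomial expansion of \<open>1 = (X + (1 - X)) ^ (2 m)\<close> in the middle gives a polynomial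
  that is \<open>1\<close> modulo \<open>X ^ m\<close> and \<open>0\<close> modulo \<open>(1 - X) ^ m\<close>.\<close>

lemma ex_boundary_polynomial:
  fixes m i :: nat
  shows "\<exists>\<kappa> :: real poly. (\<forall>j<m. poly ((pderiv ^^ j) \<kappa>) 1 = 0) \<and>
     (\<forall>j<m. poly ((pderiv ^^ j) \<kappa>) 0 = (if j = i then 1 else 0))"
proof -
  define p q :: "real poly" where "p = [:0, 1:]" and "q = [:1, -1:]"
  have "1 = (p + q) ^ (2 * m)" proof -
    have "p + q = 1" by (simp add: p_def q_def one_pCons)
    then show ?thesis by simp
  qed
  also have "\<dots> = (\<Sum>k\<le>2*m. of_nat ((2*m) choose k) * p ^ k * q ^ (2*m - k))"
    by (rule binomial_ring)
  also have "\<dots> = (\<Sum>k\<in>{..<m}. of_nat ((2*m) choose k) * p ^ k * q ^ (2*m - k))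
      + (\<Sum>k\<in>{m..2*m}. of_nat ((2*m) choose k) * p ^ k * q ^ (2*m - k))"
    by (subst sum.union_disjoint[symmetric]) (auto intro!: sum.cong)
  finally have split: "1 = (\<Sum>k\<in>{..<m}. of_nat ((2*m) choose k) * p ^ k * q ^ (2*m - k))
      + (\<Sum>k\<in>{m..2*m}. of_nat ((2*m) choose k) * p ^ k * q ^ (2*m - k))" (is "1 = ?A + ?B") .
  have A: "q ^ m dvd ?A"
    by (intro dvd_sum dvd_mult le_imp_power_dvd) auto
  have B: "p ^ m dvd ?B"
    by (intro dvd_sum dvd_mult2 dvd_mult le_imp_power_dvd) auto
  \<comment> \<open>Multiplication by \<open>X^i / i!\<close> turns the value 1 at 0 into a
    prescribed derivative there: modulo \<open>X^m\<close> the product \<open>c * ?A\<close> is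
    \<open>X^i / i!\<close> itself, while it stays divisible by \<open>(1 - X)^m\<close>.\<close>
  define c where "c = monom (1 / fact i :: real) i"
  have "poly ((pderiv ^^ j) (c * ?A)) 1 = 0" if "j < m" for j
    using dvd_mult[OF A, of c] by (rule higher_pderiv_root) (use that in \<open>auto simp: q_def\<close>)
  moreover have "poly ((pderiv ^^ j) (c * ?A)) 0 = (if j = i then 1 else 0)" if j: "j < m" for j
  proof -
    have "c * ?A + c * ?B = c * 1" unfolding distrib_left[symmetric] by (simp only: split[symmetric])
    then have eq: "(pderiv ^^ j) (c * ?A) + (pderiv ^^ j) (c * ?B) = (pderiv ^^ j) c"
      by (simp only: mult_1_right higher_pderiv_add[symmetric])
    have "poly ((pderiv ^^ j) (c * ?B)) 0 = 0"
      using dvd_mult[OF B, of c] by (rule higher_pderiv_root) (use j in \<open>auto simp: p_def\<close>)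
    moreover have "poly ((pderiv ^^ j) c) 0 = (if j = i then 1 else 0)"
      by (simp add: poly_0_coeff_0 coeff_higher_pderiv c_def pochhammer_fact[symmetric])
    ultimately show ?thesis using arg_cong[OF eq, of "\<lambda>p. poly p 0"] by (simp only: poly_add)
  qed
  ultimately show ?thesis by blast
qed

lemma primitive_of_C1:
  assumes "\<And>x. x \<in> {0..1} \<Longrightarrow> (f has_real_derivative f' x) (at x)" "continuous_on {0..1} f'" "x \<in> {0..1}"
  shows "f x = f 0 + integral {0..x} f'" "f' absolutely_integrable_on {0..1}"
proof -
  have "(f' has_integral f x - f 0) {0..x}"
    using assms by (intro fundamental_theorem_of_calculus)
      (auto simp: has_real_derivative_iff_has_vector_derivative[symmetric] intro: has_field_derivative_at_within)
  then show "f x = f 0 + integral {0..x} f'" by (simp add: integral_unique)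
  show "f' absolutely_integrable_on {0..1}"
    using assms(2) by (rule absolutely_integrable_continuous_real)
qed

text \<open>Integration by parts moved from \<open>D m\<close> down to \<open>D 0\<close>: the sum telescopes.\<close>

lemma chain_integration_by_parts:
  assumes D: "primitive_chain m D"
    and k: "\<And>i x. x \<in> {0..1} \<Longrightarrow> (k i has_real_derivative k (Suc i) x) (at x)"
    and x: "x \<in> {0..1}"
  defines "G \<equiv> \<lambda>x. \<Sum>i<m. (-1)^i * (k i x * D (m - 1 - i) x)"
  shows "G x = G 0 + integral {0..x} (\<lambda>x. k 0 x * D m x - (-1)^m * (k m x * D 0 x))"
    "(\<lambda>x. k 0 x * D m x - (-1)^m * (k m x * D 0 x)) absolutely_integrable_on {0..1}"
proof -
  have contk: "continuous_on {0..1} (k i)" for i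
    by (rule DERIV_continuous_on[where D="k (Suc i)"]) (use k in \<open>auto intro: has_field_derivative_at_within\<close>)
  define d where "d = (\<lambda>i x. k (Suc i) x * D (m - 1 - i) x + k i x * D (m - i) x)"
  have summand: "d i absolutely_integrable_on {0..1} \<and> k i x * D (m - 1 - i) x = k i 0 * D (m - 1 - i) 0 + integral {0..x} (d i)"
    if i: "i < m" for i
  proof -
    have m: "m - 1 - i < m" "Suc (m - 1 - i) = m - i" using i by auto
    note D' = primitive_chainD(1,2)[OF D m(1)]
    have C1: "k i y = k i 0 + integral {0..y} (k (Suc i))" if "y \<in> {0..1}" for y
      by (rule primitive_of_C1(1)[OF k contk that])
    have C2: "k (Suc i) absolutely_integrable_on {0..1}"
      by (rule primitive_of_C1(2)[OF k contk x])
    show ?thesis using primitive_mult(1,2)[OF C2 C1 D'] x unfolding m(2) d_def by blast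
  qed
  have tel: "(\<Sum>i<m. (-1)^i * d i y) = k 0 y * D m y - (-1)^m * (k m y * D 0 y)" for y
  proof -
    define c where "c = (\<lambda>i. (-1)^i * (k i y * D (m - i) y))"
    have "(\<Sum>i<m. (-1)^i * d i y) = (\<Sum>i<m. c i - c (Suc i))"
      by (intro sum.cong) (auto simp: c_def d_def algebra_simps)
    also have "\<dots> = c 0 - c m" by (rule sum_lessThan_telescope')
    finally show ?thesis by (simp add: c_def)
  qed
  have int: "(\<lambda>y. (-1)^i * d i y) integrable_on {0..x}" if "i < m" for i
    using summand[OF that] by (intro integrable_on_mult_right integrable_on_initial[OF _ x]) auto
  have "G x = G 0 + (\<Sum>i<m. (-1)^i * integral {0..x} (d i))"
    unfolding G_def sum.distrib[symmetric] using summand by (intro sum.cong) (auto simp: algebra_simps)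
  also have "(\<Sum>i<m. (-1)^i * integral {0..x} (d i)) = (\<Sum>i<m. integral {0..x} (\<lambda>y. (-1)^i * d i y))"
    by simp
  also have "\<dots> = integral {0..x} (\<lambda>y. \<Sum>i<m. (-1)^i * d i y)"
    using int by (intro Henstock_Kurzweil_Integration.integral_sum[symmetric]) auto
  finally show "G x = G 0 + integral {0..x} (\<lambda>x. k 0 x * D m x - (-1)^m * (k m x * D 0 x))"
    unfolding tel .
  have "(\<lambda>y. \<Sum>i<m. (-1)^i * d i y) absolutely_integrable_on {0..1}"
    using summand by (intro absolutely_integrable_sum set_integrable_mult_right) auto
  then show "(\<lambda>x. k 0 x * D m x - (-1)^m * (k m x * D 0 x)) absolutely_integrable_on {0..1}"
    unfolding tel .
qed

text \<open>Integration by parts against a rescaled polynomial: it vanishes to order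
  \<open>m\<close> at the far end of a window of length \<open>h\<close>, and at \<open>t\<close>
  every boundary term disappears except the one carrying \<open>D j\<close>. Each derivative of the
  polynomial costs a factor \<open>1 / h\<close>, so the kernel \<open>a\<close> paired with
  \<open>D 0\<close> has size \<open>1 / h ^ (j + 1)\<close>, and \<open>b\<close> paired with
  \<open>D m\<close> is smaller by \<open>h ^ m\<close>. The support in a window around
  \<open>t\<close> is used twice, for the square norm and for the local estimate of the first
  derivative.\<close>

lemma local_reproducing_kernel:
  fixes m j :: nat
  assumes j: "j < m"
  shows "\<exists>B>0. \<forall>h t. 0 < h \<and> h \<le> 1/2 \<and> t \<in> {0..1} \<longrightarrow>
    (\<exists>a b. a \<in> borel_measurable leb01 \<and> b \<in> borel_measurable leb01 \<and>
      (\<forall>s\<in>{0..1}. \<bar>a s\<bar> * h ^ Suc j \<le> B * indicator {t-h..t+h} s \<and> \<bar>b s\<bar> * h ^ Suc j \<le> B * h ^ m * indicator {t-h..t+h} s) \<and>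
      (\<forall>D. primitive_chain m D \<longrightarrow>
         D j t = (\<integral>s. a s * D 0 s \<partial>leb01) + (\<integral>s. b s * D m s \<partial>leb01)))"
proof -
  \<comment> \<open>The \<open>i\<close>-th boundary term pairs with \<open>D (m - 1 - i)\<close>,
    so \<open>i0\<close> is the index that meets \<open>D j\<close>.\<close>
  define i0 where "i0 = m - 1 - j"
  obtain \<kappa> :: "real poly" where \<kappa>: "\<And>j. j < m \<Longrightarrow> poly ((pderiv ^^ j) \<kappa>) 1 = 0"
    "\<And>j. j < m \<Longrightarrow> poly ((pderiv ^^ j) \<kappa>) 0 = (if j = i0 then 1 else 0)"
    using ex_boundary_polynomial[of m i0] by blast
  let ?\<kappa> = "\<lambda>i. poly ((pderiv ^^ i) \<kappa>)"
  have "bounded (?\<kappa> 0 ` {0..1} \<union> ?\<kappa> m ` {0..1})"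
    by (intro bounded_Un[THEN iffD2] conjI compact_imp_bounded compact_continuous_image continuous_intros) auto
  then obtain B' where B': "\<And>y. y \<in> ?\<kappa> 0 ` {0..1} \<union> ?\<kappa> m ` {0..1} \<Longrightarrow> \<bar>y\<bar> \<le> B'"
    unfolding bounded_iff real_norm_def by blast
  define B where "B = \<bar>B'\<bar> + 1"
  have B: "B > 0" by (simp add: B_def)
  have \<kappa>B: "\<bar>?\<kappa> 0 u\<bar> \<le> B" "\<bar>?\<kappa> m u\<bar> \<le> B" if "u \<in> {0..1}" for u
    using B'[of "?\<kappa> 0 u"] B'[of "?\<kappa> m u"] that unfolding B_def by auto
  show ?thesis
  proof (intro exI[of _ B] conjI B allI impI)
    fix h t :: real assume ht: "0 < h \<and> h \<le> 1/2 \<and> t \<in> {0..1}"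
    \<comment> \<open>The window points into the interval, to the right from the left half and to
      the left from the right half; it fits because \<open>h \<le> 1/2\<close>.\<close>
    define \<eta> where "\<eta> = (if t \<le> 1/2 then h else - h)"
    define sg where "sg = (if t \<le> 1/2 then 1 else - 1 :: real)"
    define w where "w = {min t (t+\<eta>)..max t (t+\<eta>)}"
    have \<eta>: "\<eta> \<noteq> 0" "\<bar>\<eta>\<bar> = h" "t + \<eta> \<in> {0..1}" using ht by (auto simp: \<eta>_def)
    have wsub: "w \<subseteq> {t-h..t+h}" using ht by (auto simp: w_def \<eta>_def)
    have w01: "0 \<le> min t (t+\<eta>)" "min t (t+\<eta>) \<le> max t (t+\<eta>)" "max t (t+\<eta>) \<le> 1" using ht by (cases "t \<le> 1/2"; simp add: \<eta>_def min_def max_def)+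
    have wu: "(s - t) / \<eta> \<in> {0..1}" if "s \<in> w" for s
      using that ht by (auto simp: w_def \<eta>_def field_simps split: if_splits)
    define k where "k = (\<lambda>i s. ?\<kappa> i ((s - t) / \<eta>) / \<eta> ^ i)"
    have kder: "(k i has_real_derivative k (Suc i) x) (at x)" for i x
      unfolding k_def using \<eta>(1)
      by (auto intro!: derivative_eq_intros poly_DERIV[THEN DERIV_chain2] simp: field_simps)
    have kc: "continuous_on A (k i)" for A i
      unfolding k_def using \<eta>(1) by (intro continuous_intros) auto
    \<comment> \<open>Inverts the factor \<open>(-1)^i0 / \<eta>^i0\<close> of the surviving
      boundary term; \<open>sg\<close> is the orientation of the window.\<close>
    define cf where "cf = (-1)^i0 * \<eta>^i0 * sg"
    define a where "a = (\<lambda>s. indicator w s * (cf * (-1)^m * k m s))"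
    define b where "b = (\<lambda>s. indicator w s * (- cf * k 0 s))"
    have abs_cf: "\<bar>cf\<bar> = h ^ i0" using \<eta>(2) by (simp add: cf_def abs_mult power_abs sg_def)
    have i0j: "i0 + Suc j = m" using j by (simp add: i0_def)
    have kmeas: "k i \<in> borel_measurable leb01" for i
      by (rule continuous_imp_measurable_on_sets_lebesgue[OF kc]) auto
    have wm: "(indicator w :: real \<Rightarrow> real) \<in> borel_measurable leb01"
      unfolding w_def by (intro measurable_restrict_space1 borel_measurable_indicator) simp
    show "\<exists>a b. a \<in> borel_measurable leb01 \<and> b \<in> borel_measurable leb01 \<and>
      (\<forall>s\<in>{0..1}. \<bar>a s\<bar> * h ^ Suc j \<le> B * indicator {t-h..t+h} s \<and> \<bar>b s\<bar> * h ^ Suc j \<le> B * h ^ m * indicator {t-h..t+h} s) \<and>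
      (\<forall>D. primitive_chain m D \<longrightarrow>
         D j t = (\<integral>s. a s * D 0 s \<partial>leb01) + (\<integral>s. b s * D m s \<partial>leb01))"
    proof (rule exI[of _ a], rule exI[of _ b], intro conjI ballI allI impI)
      show am: "a \<in> borel_measurable leb01" unfolding a_def using kmeas wm by (intro borel_measurable_times) auto
      show bm: "b \<in> borel_measurable leb01" unfolding b_def using kmeas wm by (intro borel_measurable_times) auto
      fix s :: real assume s: "s \<in> {0..1}"
      show "\<bar>a s\<bar> * h ^ Suc j \<le> B * indicator {t-h..t+h} s"
      proof (cases "s \<in> w")
        case True
        have "\<bar>a s\<bar> * h ^ Suc j = h ^ i0 * (\<bar>?\<kappa> m ((s - t) / \<eta>)\<bar> / h ^ m) * h ^ Suc j"
          using True \<eta>(2) abs_cf by (simp add: a_def abs_mult k_def power_abs)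
        also have "\<dots> = h ^ (i0 + Suc j) / h ^ m * \<bar>?\<kappa> m ((s - t) / \<eta>)\<bar>"
          by (simp add: power_add)
        also have "\<dots> = \<bar>?\<kappa> m ((s - t) / \<eta>)\<bar>" unfolding i0j using ht by simp
        also have "\<dots> \<le> B" by (rule \<kappa>B(2)[OF wu[OF True]])
        finally show ?thesis using True wsub by (auto simp: indicator_def)
      qed (use B in \<open>simp add: a_def\<close>)
      show "\<bar>b s\<bar> * h ^ Suc j \<le> B * h ^ m * indicator {t-h..t+h} s"
      proof (cases "s \<in> w")
        case True
        have "\<bar>b s\<bar> * h ^ Suc j = h ^ i0 * \<bar>?\<kappa> 0 ((s - t) / \<eta>)\<bar> * h ^ Suc j"
          using True abs_cf by (simp add: b_def abs_mult k_def)
        also have "\<dots> = h ^ (i0 + Suc j) * \<bar>?\<kappa> 0 ((s - t) / \<eta>)\<bar>"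
          by (simp add: power_add)
        also have "\<dots> \<le> h ^ m * B" unfolding i0j using \<kappa>B(1)[OF wu[OF True]] ht by (intro mult_left_mono) auto
        finally show ?thesis using True wsub by (auto simp: indicator_def mult.commute)
      qed (use B ht in \<open>simp add: b_def\<close>)
    next
      fix D assume D: "primitive_chain m D"
      define f where "f = (\<lambda>x. k 0 x * D m x - (-1)^m * (k m x * D 0 x))"
      define G where "G = (\<lambda>x. \<Sum>i<m. (-1)^i * (k i x * D (m - 1 - i) x))"
      have fai: "f absolutely_integrable_on {0..1}"
        unfolding f_def by (rule chain_integration_by_parts(2)[OF D, where k=k and x=0]) (auto intro: kder)
      have G: "G x = G 0 + integral {0..x} f" if "x \<in> {0..1}" for x
        unfolding f_def G_def by (rule chain_integration_by_parts(1)[OF D, where k=k]) (use that kder in auto)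
      have Gend: "G (t + \<eta>) = 0"
        unfolding G_def by (rule sum.neutral) (use \<kappa>(1) \<eta>(1) in \<open>auto simp: k_def\<close>)
      have "G t = (\<Sum>i<m. if i = i0 then (-1)^i0 / \<eta>^i0 * D j t else 0)"
        unfolding G_def by (rule sum.cong) (use \<kappa>(2) j in \<open>auto simp: k_def i0_def\<close>)
      also have "\<dots> = (-1)^i0 / \<eta>^i0 * D j t" using j by (simp add: i0_def)
      finally have "G t = (-1)^i0 / \<eta>^i0 * D j t" .
      then have Gt: "(-1)^i0 * \<eta>^i0 * G t = D j t"
      proof -
        have gen: "e * p * (e / p * d) = (e * e) * d" if "p \<noteq> 0" for e p d :: real
          using that by (simp add: field_simps)
        have "(-1::real)^i0 * (-1)^i0 = 1" by (simp add: power_mult_distrib[symmetric])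
        then show ?thesis
          unfolding \<open>G t = (-1)^i0 / \<eta>^i0 * D j t\<close> using gen[of "\<eta>^i0" "(-1)^i0" "D j t"] \<eta>(1) by simp
      qed
      have I: "G (t+\<eta>) - G t = sg * integral w f"
      proof (cases "t \<le> 1/2")
        case True
        then have "w = {t..t+\<eta>}" using ht by (auto simp: w_def \<eta>_def)
        then show ?thesis
          using integral_eq_on_subinterval(1)[OF fai, of t "t+\<eta>"] G[of t] G[OF \<eta>(3)] ht True
          by (auto simp: sg_def \<eta>_def)
      next
        case False
        then have "w = {t+\<eta>..t}" using ht by (auto simp: w_def \<eta>_def)
        then show ?thesis
          using integral_eq_on_subinterval(1)[OF fai, of "t+\<eta>" t] G[of t] G[OF \<eta>(3)] ht False
          by (auto simp: sg_def \<eta>_def)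
      qed
      have si: "square_integrable leb01 (D 0)" "square_integrable leb01 (D m)"
        using primitive_chain_square_integrable[OF D] by auto
      have bd: "integrable leb01 (\<lambda>s. indicator w s * (k i s * g s))" if g: "square_integrable leb01 g" for g i
      proof -
        have "integrable leb01 (\<lambda>s. k i s * g s)"
          by (rule square_integrable_mult[OF continuous_square_integrable[OF kc] g])
        moreover have "(\<lambda>s. indicator w s * (k i s * g s)) \<in> borel_measurable leb01"
          using kmeas wm g by (intro borel_measurable_times) (auto simp: square_integrable_def)
        ultimately show ?thesis
          by (rule Bochner_Integration.integrable_bound) (auto simp: indicator_def)
      qed
      have "D j t = - (cf * integral w f)"
        using Gt Gend I by (simp add: cf_def mult.assoc) (smt (verit) mult_minus_right)
      also have "integral w f = (\<integral>s. indicator w s * f s \<partial>leb01)"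
        unfolding w_def by (rule integral_leb01_indicator[OF fai w01, symmetric])
      also have "- (cf * \<dots>) = (\<integral>s. - cf * (indicator w s * f s) \<partial>leb01)" by simp
      also have "\<dots> = (\<integral>s. (cf * (-1)^m) * (indicator w s * (k m s * D 0 s)) + (- cf) * (indicator w s * (k 0 s * D m s)) \<partial>leb01)"
        by (rule Bochner_Integration.integral_cong) (auto simp: f_def algebra_simps)
      also have "\<dots> = (\<integral>s. (cf * (-1)^m) * (indicator w s * (k m s * D 0 s)) \<partial>leb01) + (\<integral>s. (- cf) * (indicator w s * (k 0 s * D m s)) \<partial>leb01)"
        by (intro Bochner_Integration.integral_add integrable_mult_right bd si)
      also have "\<dots> = (\<integral>s. a s * D 0 s \<partial>leb01) + (\<integral>s. b s * D m s \<partial>leb01)"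
        unfolding a_def b_def by (simp add: mult.assoc mult.left_commute)
      finally show "D j t = (\<integral>s. a s * D 0 s \<partial>leb01) + (\<integral>s. b s * D m s \<partial>leb01)" .
    qed
  qed
qed

section \<open>Square norms of the kernels and pointwise bounds\<close>

lemma L2_sq_window_le:
  assumes a: "a \<in> borel_measurable leb01" and c: "0 \<le> c" and h: "0 < h"
    and bnd: "\<And>s. s \<in> {0..1} \<Longrightarrow> \<bar>a s\<bar> \<le> c * indicator {t-h..t+h} s"
  shows "square_integrable leb01 a" "L2_sq leb01 a \<le> c\<^sup>2 * (2 * h)"
proof -
  have b: "(a s)\<^sup>2 \<le> c\<^sup>2 * indicator {t-h..t+h} s" if "s \<in> {0..1}" for s
    using abs_le_square_iff[of "a s" "c * indicator {t-h..t+h} s"] bnd[OF that] c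
    by (auto simp: indicator_def power_mult_distrib split: if_splits)
  have wm: "(indicator {t-h..t+h} :: real \<Rightarrow> real) \<in> borel_measurable leb01"
    by (intro measurable_restrict_space1 borel_measurable_indicator) simp
  have ii: "integrable leb01 (\<lambda>s. c\<^sup>2 * indicator {t-h..t+h} s :: real)"
    by (rule leb01.integrable_const_bound[where B="c\<^sup>2"])
      (use wm in \<open>auto intro!: AE_I2 borel_measurable_times split: split_indicator simp del: of_bool_conj\<close>)
  have int: "integrable leb01 (\<lambda>s. (a s)\<^sup>2)"
    by (rule Bochner_Integration.integrable_bound[OF ii]) (use a b in \<open>auto intro!: AE_I2\<close>)
  then show "square_integrable leb01 a" using a by (simp add: square_integrable_def)
  have "L2_sq leb01 a \<le> (\<integral>s. c\<^sup>2 * indicator {t-h..t+h} s \<partial>leb01)"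
    unfolding L2_sq_def by (rule integral_mono[OF int ii]) (use b in auto)
  also have "\<dots> = c\<^sup>2 * (\<integral>s. indicator ({t-h..t+h} \<inter> {0..1}) s \<partial>leb01)"
    unfolding Bochner_Integration.integral_mult_right_zero
    by (intro arg_cong2[where f="(*)"] refl Bochner_Integration.integral_cong) (auto simp: indicator_def)
  also have "(\<integral>s. indicator ({t-h..t+h} \<inter> {0..1}) s \<partial>leb01) = measure lebesgue ({t-h..t+h} \<inter> {0..1})"
  proof -
    have S: "{t-h..t+h} \<inter> {0..1} \<in> sets leb01"
      by (subst sets_restrict_space_iff) auto
    have "measure leb01 ({t-h..t+h} \<inter> {0..1}) = measure lebesgue ({t-h..t+h} \<inter> {0..1})"
      by (rule measure_restrict_space) auto
    then show ?thesis using S by simp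
  qed
  also have "\<dots> \<le> measure lebesgue {t-h..t+h}"
    by (rule measure_mono_fmeasurable) auto
  also have "measure lebesgue {t-h..t+h} = 2 * h" using h by simp
  finally show "L2_sq leb01 a \<le> c\<^sup>2 * (2 * h)" by (simp add: mult_left_mono)
qed

text \<open>Squaring the size of the kernel and multiplying by the window length
  \<open>2 * h\<close> gives the order \<open>1 / h ^ (2 * j + 1)\<close>, the price of evaluating
  the \<open>j\<close>-th derivative at scale \<open>h\<close>.\<close>

lemma reproducing_kernel_L2:
  fixes m j :: nat
  assumes j: "j < m"
  shows "\<exists>B>0. \<forall>h t. 0 < h \<and> h \<le> 1/2 \<and> t \<in> {0..1} \<longrightarrow>
    (\<exists>a b. square_integrable leb01 a \<and> square_integrable leb01 b \<and>
      L2_sq leb01 a * h ^ (2 * j + 1) \<le> B \<and> L2_sq leb01 b * h ^ (2 * j + 1) \<le> B * h ^ (2 * m) \<and>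
      (\<forall>D. primitive_chain m D \<longrightarrow>
         D j t = (\<integral>s. a s * D 0 s \<partial>leb01) + (\<integral>s. b s * D m s \<partial>leb01)))"
proof -
  obtain B where B: "B > 0" and ker': "\<forall>h t. 0 < h \<and> h \<le> 1/2 \<and> t \<in> {0..1} \<longrightarrow>
    (\<exists>a b. a \<in> borel_measurable leb01 \<and> b \<in> borel_measurable leb01 \<and>
      (\<forall>s\<in>{0..1}. \<bar>a s\<bar> * h ^ Suc j \<le> B * indicator {t-h..t+h} s \<and> \<bar>b s\<bar> * h ^ Suc j \<le> B * h ^ m * indicator {t-h..t+h} s) \<and>
      (\<forall>D. primitive_chain m D \<longrightarrow>
         D j t = (\<integral>s. a s * D 0 s \<partial>leb01) + (\<integral>s. b s * D m s \<partial>leb01)))"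
    using local_reproducing_kernel[OF j] by (elim exE conjE) (rule that)
  note ker = ker'[rule_format]
  show ?thesis
  proof (intro exI[of _ "2 * B\<^sup>2"] conjI allI impI)
    fix h t :: real assume ht: "0 < h \<and> h \<le> 1/2 \<and> t \<in> {0..1}"
    obtain a b where a: "a \<in> borel_measurable leb01" and b: "b \<in> borel_measurable leb01"
      and bnd: "\<And>s. s\<in>{0..1} \<Longrightarrow> \<bar>a s\<bar> * h ^ Suc j \<le> B * indicator {t-h..t+h} s"
        "\<And>s. s\<in>{0..1} \<Longrightarrow> \<bar>b s\<bar> * h ^ Suc j \<le> B * h ^ m * indicator {t-h..t+h} s"
      and rep: "\<forall>D. primitive_chain m D \<longrightarrow>
         D j t = (\<integral>s. a s * D 0 s \<partial>leb01) + (\<integral>s. b s * D m s \<partial>leb01)"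
      using ker[OF ht] by blast
    have hp: "h ^ Suc j > 0" using ht by simp
    have "\<bar>a s\<bar> \<le> B / h ^ Suc j * indicator {t-h..t+h} s" if "s \<in> {0..1}" for s
      using bnd(1)[OF that] hp by (simp add: field_simps)
    note A = L2_sq_window_le[OF a _ _ this]
    have "\<bar>b s\<bar> \<le> B * h ^ m / h ^ Suc j * indicator {t-h..t+h} s" if "s \<in> {0..1}" for s
      using bnd(2)[OF that] hp by (simp add: field_simps)
    note Bb = L2_sq_window_le[OF b _ _ this]
    have e: "(1 / h ^ Suc j)\<^sup>2 * (2 * h) * h ^ (2 * j + 1) = 2"
    proof -
      have "(h ^ Suc j)\<^sup>2 = h * h ^ (2 * j + 1)"
        by (simp only: power_mult[symmetric] power_Suc[symmetric]) (simp add: mult.commute)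
      moreover have "h ^ (2 * j + 1) > 0" using ht by simp
      ultimately show ?thesis using ht by (simp add: power_divide)
    qed
    have "L2_sq leb01 a * h ^ (2 * j + 1) \<le> (B / h ^ Suc j)\<^sup>2 * (2 * h) * h ^ (2 * j + 1)"
      using A(2) B ht by (intro mult_right_mono) auto
    also have "\<dots> = B\<^sup>2 * ((1 / h ^ Suc j)\<^sup>2 * (2 * h) * h ^ (2 * j + 1))" by (simp add: power_divide)
    also have "\<dots> = 2 * B\<^sup>2" unfolding e by simp
    finally have 1: "L2_sq leb01 a * h ^ (2 * j + 1) \<le> 2 * B\<^sup>2" .
    have "L2_sq leb01 b * h ^ (2 * j + 1) \<le> (B * h ^ m / h ^ Suc j)\<^sup>2 * (2 * h) * h ^ (2 * j + 1)"
      using Bb(2) B ht by (intro mult_right_mono) auto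
    also have "\<dots> = B\<^sup>2 * (h ^ m)\<^sup>2 * ((1 / h ^ Suc j)\<^sup>2 * (2 * h) * h ^ (2 * j + 1))"
      by (simp add: power_divide power_mult_distrib)
    also have "\<dots> = 2 * B\<^sup>2 * h ^ (2 * m)" unfolding e by (simp add: power_mult[symmetric] mult.commute)
    finally have 2: "L2_sq leb01 b * h ^ (2 * j + 1) \<le> 2 * B\<^sup>2 * h ^ (2 * m)" .
    show "\<exists>a b. square_integrable leb01 a \<and> square_integrable leb01 b \<and>
      L2_sq leb01 a * h ^ (2 * j + 1) \<le> 2 * B\<^sup>2 \<and> L2_sq leb01 b * h ^ (2 * j + 1) \<le> 2 * B\<^sup>2 * h ^ (2 * m) \<and>
      (\<forall>D. primitive_chain m D \<longrightarrow>
         D j t = (\<integral>s. a s * D 0 s \<partial>leb01) + (\<integral>s. b s * D m s \<partial>leb01))"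
      using A(1) Bb(1) 1 2 rep B ht by (intro exI[of _ a] exI[of _ b] conjI) auto
  qed (use B in auto)
qed

text \<open>The kernel at the fixed scale \<open>1/2\<close>. Only the boundedness of evaluation
  matters here; it makes initial values converge in the completeness proof.\<close>

lemma chain_pointwise_bound:
  assumes j: "j < m"
  shows "\<exists>C>0. \<forall>D t. primitive_chain m D \<and> t \<in> {0..1} \<longrightarrow>
    \<bar>D j t\<bar> \<le> C * (sqrt (L2_sq leb01 (D 0)) + sqrt (L2_sq leb01 (D m)))"
proof -
  obtain B where B: "B > 0" and ker': "\<forall>h t. 0 < h \<and> h \<le> 1/2 \<and> t \<in> {0..1} \<longrightarrow>
    (\<exists>a b. square_integrable leb01 a \<and> square_integrable leb01 b \<and>
      L2_sq leb01 a * h ^ (2 * j + 1) \<le> B \<and> L2_sq leb01 b * h ^ (2 * j + 1) \<le> B * h ^ (2 * m) \<and>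
      (\<forall>D. primitive_chain m D \<longrightarrow>
         D j t = (\<integral>s. a s * D 0 s \<partial>leb01) + (\<integral>s. b s * D m s \<partial>leb01)))"
    using reproducing_kernel_L2[OF j] by (elim exE conjE) (rule that)
  note ker = ker'[rule_format]
  define C where "C = sqrt (B * 2 ^ (2 * j + 1))"
  show ?thesis
  proof (intro exI[of _ C] conjI allI impI)
    show "C > 0" using B by (simp add: C_def)
    fix D and t :: real assume Dt: "primitive_chain m D \<and> t \<in> {0..1}"
    obtain a b where ab: "square_integrable leb01 a" "square_integrable leb01 b"
      "L2_sq leb01 a * (1/2) ^ (2 * j + 1) \<le> B" "L2_sq leb01 b * (1/2) ^ (2 * j + 1) \<le> B * (1/2) ^ (2 * m)"
      "D j t = (\<integral>s. a s * D 0 s \<partial>leb01) + (\<integral>s. b s * D m s \<partial>leb01)"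
      using ker[of "1/2" t] Dt by auto
    have D: "square_integrable leb01 (D 0)" "square_integrable leb01 (D m)"
      using primitive_chain_square_integrable Dt by auto
    have "B * (1/2) ^ (2 * m) \<le> B * 1" using B by (intro mult_left_mono power_le_one) auto
    then have "B * (1/2) ^ (2 * m) \<le> B" by simp
    from order_trans[OF ab(4) this]
    have "L2_sq leb01 a \<le> B * 2 ^ (2 * j + 1)" "L2_sq leb01 b \<le> B * 2 ^ (2 * j + 1)"
      using ab(3) by (auto simp: power_divide field_simps)
    then have s: "sqrt (L2_sq leb01 a) \<le> C" "sqrt (L2_sq leb01 b) \<le> C" by (auto simp: C_def)
    have "\<bar>D j t\<bar> \<le> \<bar>\<integral>s. a s * D 0 s \<partial>leb01\<bar> + \<bar>\<integral>s. b s * D m s \<partial>leb01\<bar>"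
      unfolding ab(5) by simp
    also have "\<dots> \<le> sqrt (L2_sq leb01 a) * sqrt (L2_sq leb01 (D 0)) + sqrt (L2_sq leb01 b) * sqrt (L2_sq leb01 (D m))"
      using L2_Cauchy_Schwarz[OF ab(1) D(1)] L2_Cauchy_Schwarz[OF ab(2) D(2)] by linarith
    also have "\<dots> \<le> C * sqrt (L2_sq leb01 (D 0)) + C * sqrt (L2_sq leb01 (D m))"
      by (intro add_mono mult_right_mono s) auto
    finally show "\<bar>D j t\<bar> \<le> C * (sqrt (L2_sq leb01 (D 0)) + sqrt (L2_sq leb01 (D m)))"
      by (simp add: algebra_simps)
  qed
qed

section \<open>Quadratic forms and the evaluation kernel\<close>

definition quadratic_form :: "'i set \<Rightarrow> ('i \<Rightarrow> 'i \<Rightarrow> real) \<Rightarrow> ('i \<Rightarrow> real) \<Rightarrow> real" where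
  "quadratic_form J K c = (\<Sum>i\<in>J. \<Sum>j\<in>J. c i * c j * K i j)"

lemma square_integrable_sum:
  assumes "finite J" "\<And>i. i \<in> J \<Longrightarrow> square_integrable M (a i)"
  shows "square_integrable M (\<lambda>s. \<Sum>i\<in>J. c i * a i s)"
  using assms
proof (induction J rule: finite_induct)
  case empty
  then show ?case by (simp add: square_integrable_def)
next
  case (insert i J)
  then show ?case
    using square_integrable_lin[of M "a i" "\<lambda>s. \<Sum>i\<in>J. c i * a i s" "c i" 1] by simp
qed

lemma L2_sq_sum:
  assumes "finite J" "\<And>i. i \<in> J \<Longrightarrow> square_integrable M (a i)"
  shows "L2_sq M (\<lambda>s. \<Sum>i\<in>J. c i * a i s) = quadratic_form J (\<lambda>i j. \<integral>s. a i s * a j s \<partial>M) c"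
proof -
  have int: "integrable M (\<lambda>s. c i * c j * (a i s * a j s))" if "i \<in> J" "j \<in> J" for i j
    using that assms by (intro integrable_mult_right square_integrable_mult)
  have "L2_sq M (\<lambda>s. \<Sum>i\<in>J. c i * a i s) = (\<integral>s. (\<Sum>i\<in>J. \<Sum>j\<in>J. c i * c j * (a i s * a j s)) \<partial>M)"
    unfolding L2_sq_def power2_eq_square sum_product
    by (intro Bochner_Integration.integral_cong refl sum.cong) (auto simp: algebra_simps)
  also have "\<dots> = (\<Sum>i\<in>J. \<Sum>j\<in>J. c i * c j * (\<integral>s. a i s * a j s \<partial>M))"
    using int by (subst Bochner_Integration.integral_sum; (intro Bochner_Integration.integrable_sum)?; simp add: Bochner_Integration.integral_sum)
  finally show ?thesis by (simp add: quadratic_form_def)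
qed

lemma integral_sum_mult:
  assumes "finite J" "\<And>i. i \<in> J \<Longrightarrow> square_integrable M (a i)" "square_integrable M g"
  shows "(\<Sum>i\<in>J. c i * (\<integral>s. a i s * g s \<partial>M)) = (\<integral>s. (\<Sum>i\<in>J. c i * a i s) * g s \<partial>M)"
proof -
  have "(\<integral>s. (\<Sum>i\<in>J. c i * a i s) * g s \<partial>M) = (\<integral>s. (\<Sum>i\<in>J. c i * (a i s * g s)) \<partial>M)"
    by (simp add: sum_distrib_right mult.assoc)
  also have "\<dots> = (\<Sum>i\<in>J. c i * (\<integral>s. a i s * g s \<partial>M))"
    using assms by (subst Bochner_Integration.integral_sum) (auto intro!: square_integrable_mult)
  finally show ?thesis by simp
qed

text \<open>\<open>K\<close> is the Gram kernel of the pairs formed by \<open>a t\<close> and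
  \<open>b t / h ^ m\<close>. With this weighting, evaluation at \<open>t\<close> is the inner
  product of such a pair with \<open>D 0\<close> and \<open>h ^ m\<close> times \<open>D m\<close>,
  whose squared norm is the Sobolev one for \<open>lam = h ^ (2 * m)\<close>. Hence the quadratic
  form is a squared norm, Cauchy-Schwarz gives the duality bound, and the diagonal is a sum of two
  terms of size at most \<open>B / h\<close>. Only the size of the representer counts, not that it
  be the exact reproducing kernel.\<close>

lemma evaluation_kernel:
  assumes m: "m \<ge> 1"
  shows "\<exists>C>0. \<forall>h. 0 < h \<and> h \<le> 1/2 \<longrightarrow> (\<exists>K :: real \<Rightarrow> real \<Rightarrow> real.
    (\<forall>s t. K s t = K t s) \<and> (\<forall>t\<in>{0..1}. K t t \<le> C / h) \<and>
    (\<forall>(J :: nat set) x c. finite J \<and> (\<forall>i\<in>J. x i \<in> {0..1}) \<longrightarrow>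
       0 \<le> quadratic_form J (\<lambda>i j. K (x i) (x j)) c \<and>
       (\<forall>D. primitive_chain m D \<longrightarrow> \<bar>\<Sum>i\<in>J. c i * D 0 (x i)\<bar> \<le>
          sqrt (quadratic_form J (\<lambda>i j. K (x i) (x j)) c) *
          sqrt (L2_sq leb01 (D 0) + h ^ (2 * m) * L2_sq leb01 (D m)))))"
proof -
  have m0: "0 < m" using m by simp
  obtain B where B: "B > 0" and ker': "\<forall>h t. 0 < h \<and> h \<le> 1/2 \<and> t \<in> {0..1} \<longrightarrow>
    (\<exists>a b. square_integrable leb01 a \<and> square_integrable leb01 b \<and>
      L2_sq leb01 a * h ^ (2 * 0 + 1) \<le> B \<and> L2_sq leb01 b * h ^ (2 * 0 + 1) \<le> B * h ^ (2 * m) \<and>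
      (\<forall>D. primitive_chain m D \<longrightarrow>
         D 0 t = (\<integral>s. a s * D 0 s \<partial>leb01) + (\<integral>s. b s * D m s \<partial>leb01)))"
    using reproducing_kernel_L2[OF m0] by (elim exE conjE) (rule that)
  note ker = ker'[rule_format]
  show ?thesis
  proof (rule exI[of _ "2 * B"], intro conjI allI impI)
    fix h :: real assume h: "0 < h \<and> h \<le> 1/2"
    define P where "P = (\<lambda>t a b. square_integrable leb01 a \<and> square_integrable leb01 b \<and>
      L2_sq leb01 a * h \<le> B \<and> L2_sq leb01 b * h \<le> B * h ^ (2 * m) \<and>
      (\<forall>D. primitive_chain m D \<longrightarrow>
         D 0 t = (\<integral>s. a s * D 0 s \<partial>leb01) + (\<integral>s. b s * D m s \<partial>leb01)))"
    have "\<exists>a b. P t a b" if "t \<in> {0..1}" for t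
      using ker[of h t] h that by (simp add: P_def)
    then obtain a b where P: "\<And>t. t \<in> {0..1} \<Longrightarrow> P t (a t) (b t)" by metis
    have ab: "square_integrable leb01 (a t)" "square_integrable leb01 (b t)"
      "L2_sq leb01 (a t) * h \<le> B" "L2_sq leb01 (b t) * h \<le> B * h ^ (2 * m)" if "t \<in> {0..1}" for t
      using P[OF that] by (auto simp: P_def)
    have ab5: "D 0 t = (\<integral>s. a t s * D 0 s \<partial>leb01) + (\<integral>s. b t s * D m s \<partial>leb01)"
      if "t \<in> {0..1}" "primitive_chain m D" for t D
      using P[OF that(1)] that(2) by (simp add: P_def)
    define H where "H = h ^ (2 * m)"
    have H: "H > 0" using h by (simp add: H_def)
    define K where "K = (\<lambda>s t. (\<integral>x. a s x * a t x \<partial>leb01) + (\<integral>x. b s x * b t x \<partial>leb01) / H)"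
    show "\<exists>K :: real \<Rightarrow> real \<Rightarrow> real.
      (\<forall>s t. K s t = K t s) \<and> (\<forall>t\<in>{0..1}. K t t \<le> 2 * B / h) \<and>
      (\<forall>(J :: nat set) x c. finite J \<and> (\<forall>i\<in>J. x i \<in> {0..1}) \<longrightarrow>
         0 \<le> quadratic_form J (\<lambda>i j. K (x i) (x j)) c \<and>
         (\<forall>D. primitive_chain m D \<longrightarrow> \<bar>\<Sum>i\<in>J. c i * D 0 (x i)\<bar> \<le>
            sqrt (quadratic_form J (\<lambda>i j. K (x i) (x j)) c) *
            sqrt (L2_sq leb01 (D 0) + h ^ (2 * m) * L2_sq leb01 (D m))))"
    proof (rule exI[of _ K], intro conjI allI ballI impI)
      fix s t show "K s t = K t s" by (simp add: K_def mult.commute)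
    next
      fix t :: real assume t: "t \<in> {0..1}"
      have "L2_sq leb01 (a t) \<le> B / h" using ab(3)[OF t] h by (simp add: field_simps)
      moreover have "L2_sq leb01 (b t) / H \<le> B / h" using ab(4)[OF t] h H by (simp add: H_def field_simps)
      ultimately show "K t t \<le> 2 * B / h" by (simp add: K_def L2_sq_def power2_eq_square)
    next
      fix J :: "nat set" and x :: "nat \<Rightarrow> real" and c
      assume J: "finite J \<and> (\<forall>i\<in>J. x i \<in> {0..1})"
      define A where "A = (\<lambda>s. \<Sum>i\<in>J. c i * a (x i) s)"
      define Bb where "Bb = (\<lambda>s. \<Sum>i\<in>J. c i * b (x i) s)"
      have siA: "square_integrable leb01 A" and siB: "square_integrable leb01 Bb"
        unfolding A_def Bb_def using J ab by (auto intro!: square_integrable_sum)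
      have LA: "L2_sq leb01 A = quadratic_form J (\<lambda>i j. \<integral>s. a (x i) s * a (x j) s \<partial>leb01) c"
        unfolding A_def using J ab by (intro L2_sq_sum) auto
      have LB: "L2_sq leb01 Bb = quadratic_form J (\<lambda>i j. \<integral>s. b (x i) s * b (x j) s \<partial>leb01) c"
        unfolding Bb_def using J ab by (intro L2_sq_sum) auto
      have Q: "quadratic_form J (\<lambda>i j. K (x i) (x j)) c = L2_sq leb01 A + L2_sq leb01 Bb / H"
        unfolding LA LB unfolding quadratic_form_def K_def
        by (simp add: sum.distrib[symmetric] sum_divide_distrib algebra_simps)
      show "0 \<le> quadratic_form J (\<lambda>i j. K (x i) (x j)) c" unfolding Q using H by simp
      fix D assume D: "primitive_chain m D"
      have siD: "square_integrable leb01 (D 0)" "square_integrable leb01 (D m)"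
        using primitive_chain_square_integrable[OF D] by auto
      have "(\<Sum>i\<in>J. c i * D 0 (x i)) = (\<Sum>i\<in>J. c i * (\<integral>s. a (x i) s * D 0 s \<partial>leb01)) + (\<Sum>i\<in>J. c i * (\<integral>s. b (x i) s * D m s \<partial>leb01))"
        unfolding sum.distrib[symmetric] distrib_left[symmetric]
        by (intro sum.cong refl arg_cong2[where f="(*)"] ab5[OF _ D]) (use J in auto)
      also have "\<dots> = (\<integral>s. A s * D 0 s \<partial>leb01) + (\<integral>s. Bb s * D m s \<partial>leb01)"
        unfolding A_def Bb_def using J ab siD by (intro arg_cong2[where f="(+)"] integral_sum_mult) auto
      finally have S: "(\<Sum>i\<in>J. c i * D 0 (x i)) = (\<integral>s. A s * D 0 s \<partial>leb01) + (\<integral>s. Bb s * D m s \<partial>leb01)" .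
      let ?p = "sqrt (L2_sq leb01 A)" and ?q = "sqrt (L2_sq leb01 Bb / H)"
      let ?u = "sqrt (L2_sq leb01 (D 0))" and ?v = "sqrt (H * L2_sq leb01 (D m))"
      \<comment> \<open>The weight \<open>H\<close> cancels between the two factors.\<close>
      have qv: "?q * ?v = sqrt (L2_sq leb01 Bb) * sqrt (L2_sq leb01 (D m))"
        using H by (simp add: real_sqrt_mult[symmetric])
      have "\<bar>\<Sum>i\<in>J. c i * D 0 (x i)\<bar> \<le> ?p * ?u + ?q * ?v"
        unfolding S qv using L2_Cauchy_Schwarz[OF siA siD(1)] L2_Cauchy_Schwarz[OF siB siD(2)] by linarith
      \<comment> \<open>Cauchy-Schwarz in the plane merges the two pairings into one.\<close>
      also have "\<dots> \<le> sqrt ((?p\<^sup>2 + ?q\<^sup>2) * (?u\<^sup>2 + ?v\<^sup>2))"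
      proof (rule real_le_rsqrt)
        have "0 \<le> (?p * ?v - ?q * ?u)\<^sup>2" by simp
        then show "(?p * ?u + ?q * ?v)\<^sup>2 \<le> (?p\<^sup>2 + ?q\<^sup>2) * (?u\<^sup>2 + ?v\<^sup>2)"
          by (simp only: power2_eq_square) (simp only: algebra_simps)
      qed
      also have "\<dots> = sqrt ((L2_sq leb01 A + L2_sq leb01 Bb / H) * (L2_sq leb01 (D 0) + H * L2_sq leb01 (D m)))"
        using H by simp
      also have "\<dots> = sqrt (L2_sq leb01 A + L2_sq leb01 Bb / H) * sqrt (L2_sq leb01 (D 0) + H * L2_sq leb01 (D m))"
        by (rule real_sqrt_mult)
      finally show "\<bar>\<Sum>i\<in>J. c i * D 0 (x i)\<bar> \<le> sqrt (quadratic_form J (\<lambda>i j. K (x i) (x j)) c) *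
            sqrt (L2_sq leb01 (D 0) + h ^ (2 * m) * L2_sq leb01 (D m))"
        unfolding Q H_def .
    qed
  qed (use B in auto)
qed

text \<open>Tonelli: a fixed \<open>s\<close> lies in the window of \<open>t\<close> only for
  \<open>t\<close> in an interval of length \<open>2 * h\<close>. Integrating a local bound
  therefore gains a factor of order \<open>h\<close> over integrating a uniform one.\<close>

lemma integral_window_product_le:
  fixes F :: "real \<Rightarrow> real"
  assumes F: "integrable leb01 F" "\<And>s. F s \<ge> 0" and h: "0 < h"
    and G: "G \<in> borel_measurable leb01" "\<And>t. G t \<ge> 0"
    and bnd: "\<And>t. t \<in> {0..1} \<Longrightarrow> G t \<le> (\<integral>s. indicator {t-h..t+h} s * F s \<partial>leb01)"
  shows "integrable leb01 G" "(\<integral>t. G t \<partial>leb01) \<le> 2 * h * (\<integral>s. F s \<partial>leb01)"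
proof -
  interpret P: pair_sigma_finite leb01 leb01 ..
  have Fm[measurable]: "F \<in> borel_measurable leb01" using F by auto
  have idm[measurable]: "(\<lambda>x. x) \<in> borel_measurable leb01"
    by (rule continuous_imp_measurable_on_sets_lebesgue) auto
  \<comment> \<open>Written through \<open>\<bar>s - t\<bar>\<close> so that joint measurability in
    both variables is evident.\<close>
  define k where "k = (\<lambda>t s. indicator {x::real. x \<le> h} \<bar>s - t\<bar> * F s)"
  have km[measurable]: "case_prod (\<lambda>t s. ennreal (k t s)) \<in> borel_measurable (leb01 \<Otimes>\<^sub>M leb01)"
    unfolding k_def by measurable
  have k_eq: "k t s = indicator {t-h..t+h} s * F s" for t s
    by (auto simp: k_def indicator_def abs_le_iff)
  have kint: "integrable leb01 (k t)" for t
  proof (rule Bochner_Integration.integrable_bound[OF F(1)])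
    show "k t \<in> borel_measurable leb01" unfolding k_def by measurable
  qed (use F in \<open>auto simp: k_def indicator_def\<close>)
  have "(\<integral>\<^sup>+t. ennreal (G t) \<partial>leb01) \<le> (\<integral>\<^sup>+t. (\<integral>\<^sup>+s. ennreal (k t s) \<partial>leb01) \<partial>leb01)"
  proof (rule nn_integral_mono)
    fix t assume "t \<in> space leb01"
    then have "ennreal (G t) \<le> ennreal (\<integral>s. k t s \<partial>leb01)"
      using bnd by (auto simp: k_eq intro!: ennreal_leI)
    also have "\<dots> = (\<integral>\<^sup>+s. ennreal (k t s) \<partial>leb01)"
      by (rule nn_integral_eq_integral[symmetric, OF kint]) (use F in \<open>auto simp: k_def\<close>)
    finally show "ennreal (G t) \<le> (\<integral>\<^sup>+s. ennreal (k t s) \<partial>leb01)" .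
  qed
  also have "\<dots> = (\<integral>\<^sup>+s. (\<integral>\<^sup>+t. ennreal (k t s) \<partial>leb01) \<partial>leb01)"
    by (rule P.Fubini'[OF km, symmetric])
  also have "\<dots> \<le> (\<integral>\<^sup>+s. ennreal (2 * h) * ennreal (F s) \<partial>leb01)"
  proof (rule nn_integral_mono)
    fix s
    have "(\<integral>\<^sup>+t. ennreal (k t s) \<partial>leb01) = (\<integral>\<^sup>+t. ennreal (F s) * indicator ({s-h..s+h} \<inter> {0..1}) t \<partial>leb01)"
      by (rule nn_integral_cong) (auto simp: k_eq indicator_def split: if_splits)
    also have "\<dots> = ennreal (F s) * emeasure leb01 ({s-h..s+h} \<inter> {0..1})"
      by (rule nn_integral_cmult_indicator) (subst sets_restrict_space_iff; auto)
    also have "emeasure leb01 ({s-h..s+h} \<inter> {0..1}) = emeasure lebesgue ({s-h..s+h} \<inter> {0..1})"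
      by (rule emeasure_restrict_space) auto
    also have "\<dots> \<le> emeasure lebesgue {s-h..s+h}" by (rule emeasure_mono) auto
    also have "\<dots> = ennreal (2 * h)" using h by simp
    finally have "(\<integral>\<^sup>+t. ennreal (k t s) \<partial>leb01) \<le> ennreal (F s) * ennreal (2 * h)"
      by (simp add: mult_left_mono)
    then show "(\<integral>\<^sup>+t. ennreal (k t s) \<partial>leb01) \<le> ennreal (2 * h) * ennreal (F s)"
      by (simp only: mult.commute)
  qed
  also have "\<dots> = ennreal (2 * h) * ennreal (\<integral>s. F s \<partial>leb01)"
    using F by (simp add: nn_integral_cmult nn_integral_eq_integral)
  also have "\<dots> = ennreal (2 * h * (\<integral>s. F s \<partial>leb01))"
    using h by (simp add: ennreal_mult')
  finally have le: "(\<integral>\<^sup>+t. ennreal (G t) \<partial>leb01) \<le> ennreal (2 * h * (\<integral>s. F s \<partial>leb01))" .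
  show iG: "integrable leb01 G"
    by (rule integrableI_nonneg) (use G le in \<open>auto simp: le_less_trans[OF le]\<close>)
  have "0 \<le> 2 * h * (\<integral>s. F s \<partial>leb01)" using h F by simp
  then show "(\<integral>t. G t \<partial>leb01) \<le> 2 * h * (\<integral>s. F s \<partial>leb01)"
    using le nn_integral_eq_integral[OF iG] G by simp
qed

lemma sum_sq_le: "(x + y)\<^sup>2 \<le> 2 * x\<^sup>2 + 2 * (y :: real)\<^sup>2"
  using sum_squares_bound[of x y] by (simp add: power2_sum)

text \<open>Pointwise, the squared first derivative is bounded by the energy times
  \<open>1 / h ^ 3\<close>; since the kernel sees only the window around \<open>t\<close>,
  integration over \<open>t\<close> returns one factor \<open>h\<close>. This controls the variation
  of squares when (A5) is applied.\<close>

lemma first_derivative_interpolation: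
  assumes m: "m \<ge> 1"
  shows "\<exists>C>0. \<forall>h D. 0 < h \<and> h \<le> 1/2 \<and> primitive_chain m D \<longrightarrow>
     h\<^sup>2 * L2_sq leb01 (D 1) \<le> C * (L2_sq leb01 (D 0) + h ^ (2 * m) * L2_sq leb01 (D m))"
proof (cases "m = 1")
  case True
  \<comment> \<open>For \<open>m = 1\<close> the first derivative is itself the penalized
    one.\<close>
  then show ?thesis by (intro exI[of _ 1]) auto
next
  case False
  then have m1: "1 < m" using m by simp
  obtain B where B: "B > 0" and ker': "\<forall>h t. 0 < h \<and> h \<le> 1/2 \<and> t \<in> {0..1} \<longrightarrow>
    (\<exists>a b. a \<in> borel_measurable leb01 \<and> b \<in> borel_measurable leb01 \<and>
      (\<forall>s\<in>{0..1}. \<bar>a s\<bar> * h ^ Suc 1 \<le> B * indicator {t-h..t+h} s \<and> \<bar>b s\<bar> * h ^ Suc 1 \<le> B * h ^ m * indicator {t-h..t+h} s) \<and>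
      (\<forall>D. primitive_chain m D \<longrightarrow>
         D 1 t = (\<integral>s. a s * D 0 s \<partial>leb01) + (\<integral>s. b s * D m s \<partial>leb01)))"
    using local_reproducing_kernel[OF m1] by (elim exE conjE) (rule that)
  note ker = ker'[rule_format]
  show ?thesis
  proof (intro exI[of _ "8 * B\<^sup>2"] conjI allI impI)
    fix h :: real and D assume hD: "0 < h \<and> h \<le> 1/2 \<and> primitive_chain m D"
    then have h: "0 < h" "h \<le> 1/2" and D: "primitive_chain m D" by auto
    have si: "square_integrable leb01 (D 0)" "square_integrable leb01 (D m)" "square_integrable leb01 (D 1)"
      using primitive_chain_square_integrable[OF D] m1 by auto
    define F where "F = (\<lambda>s. (D 0 s)\<^sup>2 + h ^ (2 * m) * (D m s)\<^sup>2)"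
    have Fi: "integrable leb01 F" using si by (auto simp: F_def square_integrable_def)
    have F0: "F s \<ge> 0" for s using h by (simp add: F_def)
    have wm: "(indicator {t-h..t+h} :: real \<Rightarrow> real) \<in> borel_measurable leb01" for t
      by (intro measurable_restrict_space1 borel_measurable_indicator) simp
    have ptw: "(D 1 t)\<^sup>2 * h ^ 4 / (4 * B\<^sup>2 * h) \<le> (\<integral>s. indicator {t-h..t+h} s * F s \<partial>leb01)"
      if t: "t \<in> {0..1}" for t
    proof -
      obtain a b where a: "a \<in> borel_measurable leb01" and b: "b \<in> borel_measurable leb01"
        and bnd: "\<And>s. s\<in>{0..1} \<Longrightarrow> \<bar>a s\<bar> * h ^ 2 \<le> B * indicator {t-h..t+h} s"
          "\<And>s. s\<in>{0..1} \<Longrightarrow> \<bar>b s\<bar> * h ^ 2 \<le> B * h ^ m * indicator {t-h..t+h} s"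
        and rep: "D 1 t = (\<integral>s. a s * D 0 s \<partial>leb01) + (\<integral>s. b s * D m s \<partial>leb01)"
        using ker[of h t] h t D by (auto simp: numeral_2_eq_2)
      let ?I = "\<lambda>s. indicator {t-h..t+h} s :: real"
      \<comment> \<open>Cauchy-Schwarz on the window: the indicator implicit in the kernel is copied
        onto \<open>g\<close>, so only the local energy of \<open>g\<close> appears.\<close>
      have gen: "(h\<^sup>2 * (\<integral>s. a s * g s \<partial>leb01))\<^sup>2 \<le> c\<^sup>2 * (2 * h) * (\<integral>s. ?I s * (g s)\<^sup>2 \<partial>leb01)"
        if a: "a \<in> borel_measurable leb01" and g: "square_integrable leb01 g" and c: "0 \<le> c"
          and bnd: "\<And>s. s\<in>{0..1} \<Longrightarrow> \<bar>a s\<bar> * h ^ 2 \<le> c * ?I s" for a g c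
      proof -
        have A: "(\<lambda>s. h\<^sup>2 * a s) \<in> borel_measurable leb01" using a by simp
        have bA: "\<bar>h\<^sup>2 * a s\<bar> \<le> c * ?I s" if "s \<in> {0..1}" for s
          using bnd[OF that] h by (simp add: abs_mult mult.commute)
        note L = L2_sq_window_le[OF A c h(1) bA]
        have gm[measurable]: "g \<in> borel_measurable leb01" using g by (simp add: square_integrable_def)
        have G: "square_integrable leb01 (\<lambda>s. ?I s * g s)"
          unfolding square_integrable_def
        proof
          show Gm: "(\<lambda>s. ?I s * g s) \<in> borel_measurable leb01" using wm by (intro borel_measurable_times gm)
          show "integrable leb01 (\<lambda>s. (?I s * g s)\<^sup>2)"
          proof (rule Bochner_Integration.integrable_bound[of _ "\<lambda>s. (g s)\<^sup>2"])
            show "(\<lambda>s. (?I s * g s)\<^sup>2) \<in> borel_measurable leb01"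
              by (intro borel_measurable_power Gm)
          qed (use g in \<open>auto simp: square_integrable_def indicator_def\<close>)
        qed
        have "h\<^sup>2 * (\<integral>s. a s * g s \<partial>leb01) = (\<integral>s. (h\<^sup>2 * a s) * (?I s * g s) \<partial>leb01)"
          unfolding Bochner_Integration.integral_mult_right_zero[symmetric]
        proof (rule Bochner_Integration.integral_cong[OF refl])
          fix s assume "s \<in> space leb01"
          then show "h\<^sup>2 * (a s * g s) = h\<^sup>2 * a s * (?I s * g s)"
            using bA[of s] by (cases "s \<in> {t-h..t+h}") auto
        qed
        then have "(h\<^sup>2 * (\<integral>s. a s * g s \<partial>leb01))\<^sup>2 \<le> (sqrt (L2_sq leb01 (\<lambda>s. h\<^sup>2 * a s)) * sqrt (L2_sq leb01 (\<lambda>s. ?I s * g s)))\<^sup>2"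
          using L2_Cauchy_Schwarz[OF L(1) G] by (intro power2_le_iff_abs_le[THEN iffD2]) auto
        also have "\<dots> = L2_sq leb01 (\<lambda>s. h\<^sup>2 * a s) * L2_sq leb01 (\<lambda>s. ?I s * g s)"
          by (simp add: power_mult_distrib)
        also have "\<dots> \<le> c\<^sup>2 * (2 * h) * L2_sq leb01 (\<lambda>s. ?I s * g s)"
          by (intro mult_right_mono L(2)) auto
        also have "L2_sq leb01 (\<lambda>s. ?I s * g s) = (\<integral>s. ?I s * (g s)\<^sup>2 \<partial>leb01)"
          unfolding L2_sq_def by (rule Bochner_Integration.integral_cong) (auto simp: indicator_def)
        finally show ?thesis .
      qed
      have Ii: "integrable leb01 (\<lambda>s. ?I s * (g s)\<^sup>2)" if "square_integrable leb01 g" for g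
      proof (rule Bochner_Integration.integrable_bound[of _ "\<lambda>s. (g s)\<^sup>2"])
        show "(\<lambda>s. ?I s * (g s)\<^sup>2) \<in> borel_measurable leb01"
          using that by (intro borel_measurable_times borel_measurable_power wm) (simp add: square_integrable_def)
      qed (use that in \<open>auto simp: square_integrable_def indicator_def\<close>)
      have "(D 1 t)\<^sup>2 * h ^ 4 = (h\<^sup>2 * (\<integral>s. a s * D 0 s \<partial>leb01) + h\<^sup>2 * (\<integral>s. b s * D m s \<partial>leb01))\<^sup>2"
        unfolding rep by (simp add: power2_eq_square numeral_eq_Suc algebra_simps)
      also have "\<dots> \<le> 2 * (h\<^sup>2 * (\<integral>s. a s * D 0 s \<partial>leb01))\<^sup>2 + 2 * (h\<^sup>2 * (\<integral>s. b s * D m s \<partial>leb01))\<^sup>2"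
        by (rule sum_sq_le)
      also have "\<dots> \<le> 2 * (B\<^sup>2 * (2 * h) * (\<integral>s. ?I s * (D 0 s)\<^sup>2 \<partial>leb01)) + 2 * ((B * h ^ m)\<^sup>2 * (2 * h) * (\<integral>s. ?I s * (D m s)\<^sup>2 \<partial>leb01))"
        using B h by (intro add_mono mult_left_mono gen[OF a si(1)] gen[OF b si(2)] bnd) auto
      also have "\<dots> = 4 * B\<^sup>2 * h * ((\<integral>s. ?I s * (D 0 s)\<^sup>2 \<partial>leb01) + h ^ (2 * m) * (\<integral>s. ?I s * (D m s)\<^sup>2 \<partial>leb01))"
        by (simp add: power_mult_distrib power_mult[symmetric] mult.commute algebra_simps)
      also have "(\<integral>s. ?I s * (D 0 s)\<^sup>2 \<partial>leb01) + h ^ (2 * m) * (\<integral>s. ?I s * (D m s)\<^sup>2 \<partial>leb01) = (\<integral>s. ?I s * (D 0 s)\<^sup>2 + h ^ (2 * m) * (?I s * (D m s)\<^sup>2) \<partial>leb01)"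
        using Ii[OF si(1)] Ii[OF si(2)] by (simp add: Bochner_Integration.integral_add)
      also have "\<dots> = (\<integral>s. ?I s * F s \<partial>leb01)"
        by (rule Bochner_Integration.integral_cong) (auto simp: F_def algebra_simps)
      finally show ?thesis using B h by (simp add: divide_le_eq mult.commute)
    qed
    have Gm: "(\<lambda>t. (D 1 t)\<^sup>2 * h ^ 4 / (4 * B\<^sup>2 * h)) \<in> borel_measurable leb01"
      using si(3) by (intro borel_measurable_divide borel_measurable_times borel_measurable_power) (auto simp: square_integrable_def)
    have "(\<integral>t. (D 1 t)\<^sup>2 * h ^ 4 / (4 * B\<^sup>2 * h) \<partial>leb01) \<le> 2 * h * (\<integral>s. F s \<partial>leb01)"
      by (rule integral_window_product_le(2)[OF Fi F0 h(1) Gm _ ptw]) (use h in auto)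
    also have "(\<integral>s. F s \<partial>leb01) = L2_sq leb01 (D 0) + h ^ (2 * m) * L2_sq leb01 (D m)"
      using si by (simp add: F_def L2_sq_def square_integrable_def)
    finally have "L2_sq leb01 (D 1) * (h ^ 4 / (4 * B\<^sup>2 * h)) \<le> 2 * h * (L2_sq leb01 (D 0) + h ^ (2 * m) * L2_sq leb01 (D m))"
      by (simp add: L2_sq_def)
    then have "L2_sq leb01 (D 1) * (h ^ 4 / (4 * B\<^sup>2 * h)) * (4 * B\<^sup>2 / h) \<le> 2 * h * (L2_sq leb01 (D 0) + h ^ (2 * m) * L2_sq leb01 (D m)) * (4 * B\<^sup>2 / h)"
      using B h by (intro mult_right_mono) auto
    moreover have "L2_sq leb01 (D 1) * (h ^ 4 / (4 * B\<^sup>2 * h)) * (4 * B\<^sup>2 / h) = h\<^sup>2 * L2_sq leb01 (D 1)"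
      using B h by (simp add: field_simps power2_eq_square numeral_eq_Suc)
    moreover have "2 * h * (L2_sq leb01 (D 0) + h ^ (2 * m) * L2_sq leb01 (D m)) * (4 * B\<^sup>2 / h)
      = 8 * B\<^sup>2 * (L2_sq leb01 (D 0) + h ^ (2 * m) * L2_sq leb01 (D m))"
      using h by simp
    ultimately show "h\<^sup>2 * L2_sq leb01 (D 1) \<le> 8 * B\<^sup>2 * (L2_sq leb01 (D 0) + h ^ (2 * m) * L2_sq leb01 (D m))"
      by simp
  qed (use B in auto)
qed

section \<open>Completeness of the Sobolev space\<close>

text \<open>A Cauchy sequence in square norm is Cauchy in the mean, so a subsequence converges
  almost everywhere; Fatou's lemma along it bounds the distance of every late term from the
  limit.\<close>

lemma L2_complete:
  fixes s :: "nat \<Rightarrow> real \<Rightarrow> real"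
  assumes s: "\<And>n. square_integrable leb01 (s n)"
    and cau: "\<And>e. e > 0 \<Longrightarrow> \<exists>N. \<forall>i\<ge>N. \<forall>j\<ge>N. L2_sq leb01 (\<lambda>x. s i x - s j x) < e"
  shows "\<exists>g. square_integrable leb01 g \<and> (\<lambda>n. L2_sq leb01 (\<lambda>x. s n x - g x)) \<longlonglongrightarrow> 0"
proof -
  have sd: "square_integrable leb01 (\<lambda>x. s i x - s j x)" for i j
    using square_integrable_lin[OF s[of i] s[of j], of 1 "-1"] by simp
  have sm[measurable]: "s n \<in> borel_measurable leb01" for n using s by (simp add: square_integrable_def)
  have L1: "\<exists>N. \<forall>i\<ge>N. \<forall>j\<ge>N. (\<integral>x. norm (s i x - s j x) \<partial>leb01) < e" if e: "e > 0" for e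
  proof -
    obtain N where N: "\<And>i j. i \<ge> N \<Longrightarrow> j \<ge> N \<Longrightarrow> L2_sq leb01 (\<lambda>x. s i x - s j x) < e\<^sup>2"
      using cau[of "e\<^sup>2"] e by auto
    have "(\<integral>x. norm (s i x - s j x) \<partial>leb01) < e" if "i \<ge> N" "j \<ge> N" for i j
    proof -
      have "sqrt (L2_sq leb01 (\<lambda>x. s i x - s j x)) < e"
        using N[OF that] e by (intro real_less_lsqrt) auto
      then show ?thesis using integral_sq_le_L2_sq[OF sd[of i j]] by simp
    qed
    then show ?thesis by blast
  qed
  obtain r where r: "strict_mono r" "AE x in leb01. Cauchy (\<lambda>i. s (r i) x)"
    using cauchy_L1_AE_cauchy_subseq[OF square_integrable_integrable[OF s] L1] by blast
  define g where "g = (\<lambda>x. lim (\<lambda>i. s (r i) x))"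
  have gm[measurable]: "g \<in> borel_measurable leb01"
    unfolding g_def by (rule borel_measurable_lim_metric) simp
  have lim: "AE x in leb01. (\<lambda>i. s (r i) x) \<longlonglongrightarrow> g x"
    using r(2) by (rule eventually_mono) (simp add: g_def Cauchy_convergent_iff convergent_LIMSEQ_iff)
  have bound: "(\<integral>\<^sup>+x. ennreal ((s n x - g x)\<^sup>2) \<partial>leb01) \<le> ennreal e"
    if e: "e > 0" and N: "\<And>i j. i \<ge> N \<Longrightarrow> j \<ge> N \<Longrightarrow> L2_sq leb01 (\<lambda>x. s i x - s j x) < e" and n: "n \<ge> N" for e N n
  proof -
    define u where "u = (\<lambda>i x. ennreal ((s n x - s (r i) x)\<^sup>2))"
    have um: "u i \<in> borel_measurable leb01" for i unfolding u_def by measurable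
    have "AE x in leb01. ennreal ((s n x - g x)\<^sup>2) = liminf (\<lambda>i. u i x)"
      using lim
    proof (rule eventually_mono)
      fix x assume "(\<lambda>i. s (r i) x) \<longlonglongrightarrow> g x"
      then have "(\<lambda>i. u i x) \<longlonglongrightarrow> ennreal ((s n x - g x)\<^sup>2)"
        unfolding u_def by (intro tendsto_ennrealI tendsto_intros)
      then show "ennreal ((s n x - g x)\<^sup>2) = liminf (\<lambda>i. u i x)"
        by (intro lim_imp_Liminf[symmetric]) auto
    qed
    then have "(\<integral>\<^sup>+x. ennreal ((s n x - g x)\<^sup>2) \<partial>leb01) = (\<integral>\<^sup>+x. liminf (\<lambda>i. u i x) \<partial>leb01)"
      by (rule nn_integral_cong_AE)
    also have "\<dots> \<le> liminf (\<lambda>i. \<integral>\<^sup>+x. u i x \<partial>leb01)"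
      by (rule nn_integral_liminf[OF um])
    also have "\<dots> \<le> limsup (\<lambda>i. \<integral>\<^sup>+x. u i x \<partial>leb01)"
      by (rule Liminf_le_Limsup) simp
    also have "\<dots> \<le> ennreal e"
    proof (rule Limsup_bounded)
      show "\<forall>\<^sub>F i in sequentially. (\<integral>\<^sup>+x. u i x \<partial>leb01) \<le> ennreal e"
        using eventually_ge_at_top[of N]
      proof eventually_elim
        case (elim i)
        then have ri: "r i \<ge> N" using seq_suble[OF r(1), of i] by simp
        have "(\<integral>\<^sup>+x. u i x \<partial>leb01) = ennreal (L2_sq leb01 (\<lambda>x. s n x - s (r i) x))"
          unfolding u_def L2_sq_def using sd[of n "r i"]
          by (intro nn_integral_eq_integral) (auto simp: square_integrable_def)
        then show ?case using N[OF n ri] by (simp add: ennreal_leI)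
      qed
    qed
    finally show ?thesis .
  qed
  have sq: "integrable leb01 (\<lambda>x. (s n x - g x)\<^sup>2) \<and> L2_sq leb01 (\<lambda>x. s n x - g x) \<le> e"
    if e: "e > 0" and N: "\<And>i j. i \<ge> N \<Longrightarrow> j \<ge> N \<Longrightarrow> L2_sq leb01 (\<lambda>x. s i x - s j x) < e" and n: "n \<ge> N" for e N n
  proof -
    note b = bound[OF that]
    have i: "integrable leb01 (\<lambda>x. (s n x - g x)\<^sup>2)"
      by (rule integrableI_nonneg) (use b in \<open>auto simp: le_less_trans[OF b]\<close>)
    then show ?thesis
      using b nn_integral_eq_integral[OF i] e by (simp add: L2_sq_def)
  qed
  \<comment> \<open>The limit is square integrable as one late term minus a square integrable
    difference.\<close>
  obtain N1 where N1: "\<And>i j. i \<ge> N1 \<Longrightarrow> j \<ge> N1 \<Longrightarrow> L2_sq leb01 (\<lambda>x. s i x - s j x) < 1"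
    using cau[of 1] by auto
  have "square_integrable leb01 (\<lambda>x. s N1 x - g x)"
    using sq[of 1 N1 N1, OF _ N1] by (simp add: square_integrable_def)
  from square_integrable_lin[OF s[of N1] this, of 1 "-1"]
  have "square_integrable leb01 g" by simp
  moreover have "(\<lambda>n. L2_sq leb01 (\<lambda>x. s n x - g x)) \<longlonglongrightarrow> 0"
  proof (rule LIMSEQ_I)
    fix e :: real assume e: "e > 0"
    obtain N where N: "\<And>i j. i \<ge> N \<Longrightarrow> j \<ge> N \<Longrightarrow> L2_sq leb01 (\<lambda>x. s i x - s j x) < e/2"
      using cau[of "e/2"] e by auto
    show "\<exists>no. \<forall>n\<ge>no. norm (L2_sq leb01 (\<lambda>x. s n x - g x) - 0) < e"
      using sq[of "e/2" N, OF _ N] e by (intro exI[of _ N]) force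
  qed
  ultimately show ?thesis by blast
qed

text \<open>Descending induction from the top entry: integration over part of the unit interval does
  not enlarge a bound, so each level adds only its own initial value. For a chain with zero initial
  values, such as a Taylor remainder, the top norm alone controls the bottom.\<close>

lemma chain_bound_by_initial_values:
  assumes D: "primitive_chain m D" and j: "j < m" and x: "x \<in> {0..1}"
  shows "\<bar>D j x\<bar> \<le> (\<Sum>i<m. \<bar>D i 0\<bar>) + sqrt (L2_sq leb01 (D m))"
proof -
  note D' = primitive_chainD[OF D]
  have "\<forall>x\<in>{0..1}. \<bar>D (m - Suc i) x\<bar> \<le> (\<Sum>l\<in>{m - Suc i..<m}. \<bar>D l 0\<bar>) + sqrt (L2_sq leb01 (D m))" if "i < m" for i
    using that
  proof (induction i)
    case 0
    show ?case
    proof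
      fix x :: real assume x: "x \<in> {0..1}"
      have m: "m - Suc 0 < m" "Suc (m - Suc 0) = m" using 0 by auto
      have ai: "D m absolutely_integrable_on {0..1}" using D'(1)[OF m(1)] unfolding m(2) .
      have "\<bar>integral {0..x} (D m)\<bar> \<le> integral {0..x} (\<lambda>y. \<bar>D m y\<bar>)"
        using integral_norm_bound_integral[OF integrable_on_initial[OF ai x] integrable_on_initial[OF set_integrable_abs[OF ai] x]]
        by simp
      also have "\<dots> \<le> integral {0..1} (\<lambda>y. \<bar>D m y\<bar>)"
        using x by (intro integral_subset_le integrable_on_initial[OF set_integrable_abs[OF ai]]) auto
      also have "\<dots> = (\<integral>y. \<bar>D m y\<bar> \<partial>leb01)"
        using set_lebesgue_integral_eq_integral(2)[OF set_integrable_abs[OF ai]] by (simp add: set_integral_leb01)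
      also have "\<dots> \<le> sqrt (L2_sq leb01 (D m))"
        by (rule integral_sq_le_L2_sq[OF D'(3)])
      finally have "\<bar>integral {0..x} (D m)\<bar> \<le> sqrt (L2_sq leb01 (D m))" .
      moreover have "D (m - Suc 0) x = D (m - Suc 0) 0 + integral {0..x} (D m)"
        using D'(2)[OF m(1) x] unfolding m(2) .
      moreover have "{m - Suc 0..<m} = {m - Suc 0}" using m by auto
      ultimately show "\<bar>D (m - Suc 0) x\<bar> \<le> (\<Sum>l\<in>{m - Suc 0..<m}. \<bar>D l 0\<bar>) + sqrt (L2_sq leb01 (D m))"
        by simp
    qed
  next
    case (Suc i)
    show ?case
    proof
      fix x :: real assume x: "x \<in> {0..1}"
      define k where "k = m - Suc (Suc i)"
      have k: "k < m" "Suc k = m - Suc i" using Suc.prems by (auto simp: k_def)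
      let ?b = "(\<Sum>l\<in>{m - Suc i..<m}. \<bar>D l 0\<bar>) + sqrt (L2_sq leb01 (D m))"
      have ai: "D (Suc k) absolutely_integrable_on {0..1}" by (rule D'(1)[OF k(1)])
      have "\<bar>integral {0..x} (D (Suc k))\<bar> \<le> integral {0..x} (\<lambda>y. ?b)"
      proof -
        have "norm (integral {0..x} (D (Suc k))) \<le> integral {0..x} (\<lambda>y. ?b)"
          using Suc x k by (intro integral_norm_bound_integral integrable_on_initial[OF ai x]) auto
        then show ?thesis by simp
      qed
      also have "\<dots> = x * ?b" using x by simp
      also have "\<dots> \<le> 1 * ?b" using x by (intro mult_right_mono) (auto intro!: add_nonneg_nonneg sum_nonneg)
      finally have "\<bar>integral {0..x} (D (Suc k))\<bar> \<le> ?b" by simp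
      moreover have "D k x = D k 0 + integral {0..x} (D (Suc k))" by (rule D'(2)[OF k(1) x])
      moreover have "{k..<m} = insert k {m - Suc i..<m}" using k by auto
      then have "(\<Sum>l\<in>{k..<m}. \<bar>D l 0\<bar>) = \<bar>D k 0\<bar> + (\<Sum>l\<in>{m - Suc i..<m}. \<bar>D l 0\<bar>)"
        using k by simp
      ultimately show "\<bar>D (m - Suc (Suc i)) x\<bar> \<le> (\<Sum>l\<in>{m - Suc (Suc i)..<m}. \<bar>D l 0\<bar>) + sqrt (L2_sq leb01 (D m))"
        unfolding k_def[symmetric] by linarith
    qed
  qed
  from this[of "m - Suc j"] j x
  have "\<bar>D j x\<bar> \<le> (\<Sum>l\<in>{j..<m}. \<bar>D l 0\<bar>) + sqrt (L2_sq leb01 (D m))" by (auto simp: Suc_diff_Suc)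
  also have "(\<Sum>l\<in>{j..<m}. \<bar>D l 0\<bar>) \<le> (\<Sum>i<m. \<bar>D i 0\<bar>)" by (intro sum_mono2) auto
  finally show ?thesis by simp
qed

lemma L2_sq_le_sup:
  assumes "square_integrable leb01 f" "\<And>x. x \<in> {0..1} \<Longrightarrow> \<bar>f x\<bar> \<le> c"
  shows "L2_sq leb01 f \<le> c\<^sup>2"
proof -
  have "(f x)\<^sup>2 \<le> c\<^sup>2" if "x \<in> {0..1}" for x
    using power_mono[OF assms(2)[OF that], of 2] by simp
  then have "L2_sq leb01 f \<le> (\<integral>x. c\<^sup>2 \<partial>leb01)"
    unfolding L2_sq_def
    using assms(1) by (intro integral_mono) (auto simp: square_integrable_def)
  then show ?thesis using leb01.prob_space by simp
qed

text \<open>The limit is rebuilt from its top entry: \<open>D n m\<close> converges in square norm,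
  the initial values converge because point evaluation is bounded, and \<open>m\<close> integrations
  produce the chain. The bottom entries then converge even uniformly.\<close>

lemma primitive_chain_complete:
  assumes m: "m \<ge> 1" and D: "\<And>n. primitive_chain m (D n)"
    and cau: "\<And>e. e > 0 \<Longrightarrow> \<exists>N. \<forall>i\<ge>N. \<forall>j\<ge>N.
      L2_sq leb01 (\<lambda>x. D i 0 x - D j 0 x) < e \<and> L2_sq leb01 (\<lambda>x. D i m x - D j m x) < e"
  shows "\<exists>E. primitive_chain m E \<and> (\<lambda>n. L2_sq leb01 (\<lambda>x. D n 0 x - E 0 x)) \<longlonglongrightarrow> 0 \<and>
    (\<lambda>n. L2_sq leb01 (\<lambda>x. D n m x - E m x)) \<longlonglongrightarrow> 0"
proof -
  have diff: "primitive_chain m (\<lambda>k x. D i k x - D j k x)" for i j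
    using primitive_chain_lin[OF D[of i] D[of j], of 1 "-1"] by simp
  obtain g where g: "square_integrable leb01 g" "(\<lambda>n. L2_sq leb01 (\<lambda>x. D n m x - g x)) \<longlonglongrightarrow> 0"
    using L2_complete[of "\<lambda>n. D n m"] primitive_chainD(3)[OF D] cau by meson
  have "\<exists>c. (\<lambda>n. D n k 0) \<longlonglongrightarrow> c" if k: "k < m" for k
  proof -
    obtain C where C: "C > 0" "\<And>E t. primitive_chain m E \<Longrightarrow> t \<in> {0..1} \<Longrightarrow>
        \<bar>E k t\<bar> \<le> C * (sqrt (L2_sq leb01 (E 0)) + sqrt (L2_sq leb01 (E m)))"
      using chain_pointwise_bound[OF k] by blast
    have "Cauchy (\<lambda>n. D n k 0)"
    proof (rule CauchyI)
      fix e :: real assume e: "e > 0"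
      define e' where "e' = (e / (2 * C))\<^sup>2"
      have "e' > 0" using e C by (simp add: e'_def)
      from cau[OF this] obtain N where N: "\<And>i j. i \<ge> N \<Longrightarrow> j \<ge> N \<Longrightarrow>
        L2_sq leb01 (\<lambda>x. D i 0 x - D j 0 x) < e' \<and> L2_sq leb01 (\<lambda>x. D i m x - D j m x) < e'" by blast
      have "norm (D i k 0 - D j k 0) < e" if ij: "i \<ge> N" "j \<ge> N" for i j
      proof -
        have s: "sqrt y < e / (2 * C)" if "y < e'" for y
          using real_sqrt_less_mono[OF that] e C by (simp add: e'_def)
        have "\<bar>D i k 0 - D j k 0\<bar> \<le> C * (sqrt (L2_sq leb01 (\<lambda>x. D i 0 x - D j 0 x)) + sqrt (L2_sq leb01 (\<lambda>x. D i m x - D j m x)))"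
          using C(2)[OF diff[of i j], of 0] by simp
        also have "\<dots> < C * (e / (2 * C) + e / (2 * C))"
          using N[OF ij] C(1) by (intro mult_strict_left_mono add_strict_mono s) auto
        also have "\<dots> = e" using C(1) by simp
        finally show ?thesis by simp
      qed
      then show "\<exists>M. \<forall>m\<ge>M. \<forall>n\<ge>M. norm (D m k 0 - D n k 0) < e" by blast
    qed
    then show ?thesis by (simp add: Cauchy_convergent_iff convergent_def)
  qed
  then obtain c where c: "\<And>k. k < m \<Longrightarrow> (\<lambda>n. D n k 0) \<longlonglongrightarrow> c k" by metis
  \<comment> \<open>Built from the top, so \<open>E' i\<close> is the entry of order
    \<open>m - i\<close>; the constant added in step \<open>i\<close> belongs to order
    \<open>m - 1 - i\<close>.\<close>
  define E' where "E' = rec_nat g (\<lambda>i h x. c (m - 1 - i) + integral {0..x} h)"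
  have E'0: "E' 0 = g" and E'S: "E' (Suc i) = (\<lambda>x. c (m - 1 - i) + integral {0..x} (E' i))" for i
    by (auto simp: E'_def)
  have E'int: "E' i absolutely_integrable_on {0..1}" for i
  proof (induction i)
    case 0
    then show ?case using square_integrable_integrable[OF g(1)] by (simp add: E'0 absolutely_integrable_leb01)
  next
    case (Suc i)
    have "continuous_on {0..1} (E' (Suc i))"
      by (rule primitive_continuous[OF Suc]) (simp add: E'S)
    then show ?case by (rule absolutely_integrable_continuous_real)
  qed
  define E where "E = (\<lambda>k. E' (m - k))"
  have E_Suc: "E k = (\<lambda>x. c k + integral {0..x} (E (Suc k)))" if "k < m" for k
  proof -
    have "m - k = Suc (m - Suc k)" "m - 1 - (m - Suc k) = k" using that by auto
    then show ?thesis unfolding E_def using E'S[of "m - Suc k"] by metis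
  qed
  have E0: "E k 0 = c k" if "k < m" for k using E_Suc[OF that] by (simp add: fun_eq_iff)
  have chE: "primitive_chain m E"
    unfolding primitive_chain_def
  proof (intro conjI allI impI ballI)
    fix k assume k: "k < m"
    show "E (Suc k) absolutely_integrable_on {0..1}" unfolding E_def by (rule E'int)
    fix x :: real
    show "E k x = E k 0 + integral {0..x} (E (Suc k))"
      unfolding E0[OF k] using E_Suc[OF k] by (rule fun_cong)
  qed (simp add: E_def E'0 g)
  have chd: "primitive_chain m (\<lambda>k x. D n k x - E k x)" for n
    using primitive_chain_lin[OF D[of n] chE, of 1 "-1"] by simp
  have Em: "E m = g" by (simp add: E_def E'0)
  define \<delta> where "\<delta> = (\<lambda>n. (\<Sum>i<m. \<bar>D n i 0 - c i\<bar>) + sqrt (L2_sq leb01 (\<lambda>x. D n m x - g x)))"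
  have "\<delta> \<longlonglongrightarrow> (\<Sum>i<m. \<bar>c i - c i\<bar>) + sqrt 0"
    unfolding \<delta>_def using c g(2) by (intro tendsto_intros) auto
  then have \<delta>0: "\<delta> \<longlonglongrightarrow> 0" by simp
  have le: "L2_sq leb01 (\<lambda>x. D n 0 x - E 0 x) \<le> (\<delta> n)\<^sup>2" for n
  proof (rule L2_sq_le_sup)
    show "square_integrable leb01 (\<lambda>x. D n 0 x - E 0 x)"
      using primitive_chain_square_integrable[OF chd[of n], of 0] by simp
    fix x :: real assume x: "x \<in> {0..1}"
    have "\<bar>D n 0 x - E 0 x\<bar> \<le> (\<Sum>i<m. \<bar>D n i 0 - E i 0\<bar>) + sqrt (L2_sq leb01 (\<lambda>x. D n m x - E m x))"
      using chain_bound_by_initial_values[OF chd[of n] _ x, of 0] m by simp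
    also have "\<dots> = \<delta> n" by (simp add: \<delta>_def E0 Em)
    finally show "\<bar>D n 0 x - E 0 x\<bar> \<le> \<delta> n" .
  qed
  have \<delta>2: "(\<lambda>n. (\<delta> n)\<^sup>2) \<longlonglongrightarrow> 0" using tendsto_power[OF \<delta>0, of 2] by simp
  have "(\<lambda>n. L2_sq leb01 (\<lambda>x. D n 0 x - E 0 x)) \<longlonglongrightarrow> 0"
    by (rule tendsto_sandwich[OF _ _ tendsto_const \<delta>2]) (use le in auto)
  then show ?thesis using chE g(2) Em by auto
qed

section \<open>The squared Sobolev norm: convexity, completeness and continuity of
  evaluation\<close>

definition sobolev_sq :: "nat \<Rightarrow> real \<Rightarrow> (real \<Rightarrow> real) \<Rightarrow> real" where
  "sobolev_sq m lam f = L2_sq leb01 f + lam * L2_sq leb01 (deriv01 m f)"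

lemma sob_norm_sq:
  assumes "lam \<ge> 0" shows "(sob_norm m lam f)\<^sup>2 = sobolev_sq m lam f"
  using assms
  by (simp add: sob_norm_def sob_inner_def L2_inner01_def set_integral_leb01 sobolev_sq_def L2_sq_def power2_eq_square)

context
  fixes m :: nat
  assumes m: "m \<ge> 1"
begin

lemma sobolev01_square_integrable:
  assumes "f \<in> sobolev01 m 2"
  shows "square_integrable leb01 f" "square_integrable leb01 (deriv01 m f)"
  using primitive_chain_square_integrable[OF sobolev01_chain[OF assms m], of 0]
    primitive_chain_square_integrable[OF sobolev01_chain[OF assms m], of m] by auto

text \<open>The derivative of order \<open>m\<close> is linear only almost everywhere, because
  \<open>deriv01\<close> is unspecified where the derivative of a function does not exist. Later
  identities therefore compare square norms and not functions.\<close>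

lemma sobolev01_lin:
  assumes f: "f \<in> sobolev01 m 2" and g: "g \<in> sobolev01 m 2"
  shows "(\<lambda>x. a * f x + b * g x) \<in> sobolev01 m 2"
    "AE x in leb01. deriv01 m (\<lambda>x. a * f x + b * g x) x = a * deriv01 m f x + b * deriv01 m g x"
  using chain_sobolev01(1,3)[OF primitive_chain_lin[OF sobolev01_chain[OF f m] sobolev01_chain[OF g m], of a b] m]
  by auto

lemma L2_sq_deriv_lin:
  assumes f: "f \<in> sobolev01 m 2" and g: "g \<in> sobolev01 m 2"
  shows "L2_sq leb01 (deriv01 m (\<lambda>x. a * f x + b * g x)) = L2_sq leb01 (\<lambda>x. a * deriv01 m f x + b * deriv01 m g x)"
proof (rule L2_sq_AE_cong(2))
  show "square_integrable leb01 (\<lambda>x. a * deriv01 m f x + b * deriv01 m g x)"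
    by (intro square_integrable_lin sobolev01_square_integrable f g)
  show "deriv01 m (\<lambda>x. a * f x + b * g x) \<in> borel_measurable leb01"
    using sobolev01_square_integrable(2)[OF sobolev01_lin(1)[OF f g]] by (simp add: square_integrable_def)
qed (rule sobolev01_lin(2)[OF f g])

lemma sobolev01_diff:
  assumes f: "f \<in> sobolev01 m 2" and g: "g \<in> sobolev01 m 2"
  shows "(\<lambda>x. f x - g x) \<in> sobolev01 m 2"
    "L2_sq leb01 (deriv01 m (\<lambda>x. f x - g x)) = L2_sq leb01 (\<lambda>x. deriv01 m f x - deriv01 m g x)"
  using sobolev01_lin(1)[OF f g, of 1 "-1"] L2_sq_deriv_lin[OF f g, of 1 "-1"] by simp_all

lemma L2_parallelogram:
  assumes "square_integrable M f" "square_integrable M g" "square_integrable M h"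
  shows "L2_sq M (\<lambda>x. f x - g x) = 2 * L2_sq M (\<lambda>x. f x - h x) + 2 * L2_sq M (\<lambda>x. g x - h x)
    - 4 * L2_sq M (\<lambda>x. (f x + g x) / 2 - h x)"
proof -
  have p: "square_integrable M (\<lambda>x. f x - h x)" and q: "square_integrable M (\<lambda>x. g x - h x)"
    using square_integrable_lin[OF assms(1,3), of 1 "-1"] square_integrable_lin[OF assms(2,3), of 1 "-1"] by simp_all
  have 1: "L2_sq M (\<lambda>x. f x - g x) = L2_sq M (\<lambda>x. 1 * (f x - h x) + (-1) * (g x - h x))"
    by simp
  have "(\<lambda>x. (f x + g x) / 2 - h x) = (\<lambda>x. (1/2) * (f x - h x) + (1/2) * (g x - h x))"
    by (auto simp: fun_eq_iff field_simps)
  then have 2: "L2_sq M (\<lambda>x. (f x + g x) / 2 - h x) = L2_sq M (\<lambda>x. (1/2) * (f x - h x) + (1/2) * (g x - h x))"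
    by (rule arg_cong)
  show ?thesis unfolding 1 2 L2_sq_lin[OF p q] by (simp add: power2_eq_square)
qed

text \<open>The sum of the parallelogram identities of both square norms. Together with the
  convexity of the penalty it makes almost closest elements a Cauchy sequence.\<close>

lemma sobolev_sq_parallelogram:
  assumes u: "u \<in> sobolev01 m 2" and v: "v \<in> sobolev01 m 2" and w: "w \<in> sobolev01 m 2"
  shows "(\<lambda>x. (u x + v x) / 2) \<in> sobolev01 m 2"
    "sobolev_sq m lam (\<lambda>x. u x - v x) = 2 * sobolev_sq m lam (\<lambda>x. u x - w x) + 2 * sobolev_sq m lam (\<lambda>x. v x - w x)
      - 4 * sobolev_sq m lam (\<lambda>x. (u x + v x) / 2 - w x)"
    "L2_sq leb01 (deriv01 m (\<lambda>x. (u x + v x) / 2)) \<le> (L2_sq leb01 (deriv01 m u) + L2_sq leb01 (deriv01 m v)) / 2"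
proof -
  have mid: "(\<lambda>x. (u x + v x) / 2) = (\<lambda>x. 1/2 * u x + 1/2 * v x)" by (auto simp: fun_eq_iff)
  show midS: "(\<lambda>x. (u x + v x) / 2) \<in> sobolev01 m 2" unfolding mid by (rule sobolev01_lin(1)[OF u v])
  note si = sobolev01_square_integrable
  have "AE x in leb01. deriv01 m (\<lambda>x. (u x + v x) / 2) x = (deriv01 m u x + deriv01 m v x) / 2"
    using sobolev01_lin(2)[OF u v, of "1/2" "1/2"] unfolding mid by (rule eventually_mono) simp
  moreover have "AE x in leb01. deriv01 m (\<lambda>x. (u x + v x) / 2 - w x) x = deriv01 m (\<lambda>x. (u x + v x) / 2) x - deriv01 m w x"
    using sobolev01_lin(2)[OF midS w, of 1 "-1"] by simp
  ultimately have ae: "AE x in leb01. deriv01 m (\<lambda>x. (u x + v x) / 2 - w x) x = (deriv01 m u x + deriv01 m v x) / 2 - deriv01 m w x"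
    by eventually_elim simp
  have "L2_sq leb01 (deriv01 m (\<lambda>x. (u x + v x) / 2 - w x)) = L2_sq leb01 (\<lambda>x. (deriv01 m u x + deriv01 m v x) / 2 - deriv01 m w x)"
  proof (rule L2_sq_AE_cong(2)[OF _ _ ae])
    have "square_integrable leb01 (\<lambda>x. 1/2 * deriv01 m u x + 1/2 * deriv01 m v x)"
      by (intro square_integrable_lin si u v)
    from square_integrable_lin[OF this si(2)[OF w], of 1 "-1"]
    show "square_integrable leb01 (\<lambda>x. (deriv01 m u x + deriv01 m v x) / 2 - deriv01 m w x)"
      by (simp add: add_divide_distrib)
    show "deriv01 m (\<lambda>x. (u x + v x) / 2 - w x) \<in> borel_measurable leb01"
      using si(2)[OF sobolev01_diff(1)[OF midS w]] by (simp add: square_integrable_def)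
  qed
  then show "sobolev_sq m lam (\<lambda>x. u x - v x) = 2 * sobolev_sq m lam (\<lambda>x. u x - w x) + 2 * sobolev_sq m lam (\<lambda>x. v x - w x)
      - 4 * sobolev_sq m lam (\<lambda>x. (u x + v x) / 2 - w x)"
    unfolding sobolev_sq_def sobolev01_diff(2)[OF u v] sobolev01_diff(2)[OF u w] sobolev01_diff(2)[OF v w]
      L2_parallelogram[OF si(1)[OF u] si(1)[OF v] si(1)[OF w]]
      L2_parallelogram[OF si(2)[OF u] si(2)[OF v] si(2)[OF w]]
    by (simp add: algebra_simps)
  have "L2_sq leb01 (deriv01 m (\<lambda>x. (u x + v x) / 2)) = L2_sq leb01 (\<lambda>x. 1/2 * deriv01 m u x + 1/2 * deriv01 m v x)"
    unfolding mid by (rule L2_sq_deriv_lin[OF u v])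
  moreover have "0 \<le> L2_sq leb01 (\<lambda>x. 1/2 * deriv01 m u x + (-1/2) * deriv01 m v x)" by simp
  ultimately show "L2_sq leb01 (deriv01 m (\<lambda>x. (u x + v x) / 2)) \<le> (L2_sq leb01 (deriv01 m u) + L2_sq leb01 (deriv01 m v)) / 2"
    unfolding L2_sq_lin[OF si(2)[OF u] si(2)[OF v]] by (simp add: power2_eq_square)
qed

lemma sobolev_sq_complete:
  assumes lam: "lam > 0" and F: "\<And>k. F k \<in> sobolev01 m 2"
    and cau: "\<And>e. e > 0 \<Longrightarrow> \<exists>N. \<forall>i\<ge>N. \<forall>j\<ge>N. sobolev_sq m lam (\<lambda>x. F i x - F j x) < e"
  shows "\<exists>f\<in>sobolev01 m 2. (\<lambda>k. sobolev_sq m lam (\<lambda>x. F k x - f x)) \<longlonglongrightarrow> 0"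
proof -
  define D where "D = (\<lambda>n k. deriv01 k (F n))"
  have ch: "primitive_chain m (D n)" for n unfolding D_def by (rule sobolev01_chain[OF F m])
  have "\<exists>N. \<forall>i\<ge>N. \<forall>j\<ge>N. L2_sq leb01 (\<lambda>x. D i 0 x - D j 0 x) < e \<and> L2_sq leb01 (\<lambda>x. D i m x - D j m x) < e"
    if e: "e > 0" for e
  proof -
    \<comment> \<open>Both square norms have to fall below \<open>e\<close>, and the second one
      carries the weight \<open>lam\<close>.\<close>
    define e' where "e' = min e (lam * e)"
    have "e' > 0" using e lam by (simp add: e'_def)
    from cau[OF this] obtain N where N: "\<And>i j. i \<ge> N \<Longrightarrow> j \<ge> N \<Longrightarrow> sobolev_sq m lam (\<lambda>x. F i x - F j x) < e'" by blast
    have "L2_sq leb01 (\<lambda>x. D i 0 x - D j 0 x) < e \<and> L2_sq leb01 (\<lambda>x. D i m x - D j m x) < e" if ij: "i \<ge> N" "j \<ge> N" for i j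
    proof -
      have s: "L2_sq leb01 (\<lambda>x. D i 0 x - D j 0 x) + lam * L2_sq leb01 (\<lambda>x. D i m x - D j m x) < e'"
        using N[OF ij] unfolding sobolev_sq_def sobolev01_diff(2)[OF F F] by (simp add: D_def)
      have "0 \<le> lam * L2_sq leb01 (\<lambda>x. D i m x - D j m x)" "0 \<le> L2_sq leb01 (\<lambda>x. D i 0 x - D j 0 x)" using lam by simp_all
      then have "L2_sq leb01 (\<lambda>x. D i 0 x - D j 0 x) < e" "lam * L2_sq leb01 (\<lambda>x. D i m x - D j m x) < lam * e"
        using s unfolding e'_def by linarith+
      then show ?thesis using lam by simp
    qed
    then show ?thesis by blast
  qed
  from primitive_chain_complete[OF m ch this] obtain E where E: "primitive_chain m E"
    "(\<lambda>n. L2_sq leb01 (\<lambda>x. D n 0 x - E 0 x)) \<longlonglongrightarrow> 0" "(\<lambda>n. L2_sq leb01 (\<lambda>x. D n m x - E m x)) \<longlonglongrightarrow> 0" by blast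
  have ES: "E 0 \<in> sobolev01 m 2" and aeE: "AE x in leb01. deriv01 m (E 0) x = E m x"
    using chain_sobolev01(1,3)[OF E(1) m, of "E 0"] by auto
  have eqm: "L2_sq leb01 (\<lambda>x. deriv01 m (F n) x - deriv01 m (E 0) x) = L2_sq leb01 (\<lambda>x. D n m x - E m x)" for n
  proof (rule L2_sq_AE_cong(2))
    show "square_integrable leb01 (\<lambda>x. D n m x - E m x)"
      using square_integrable_lin[OF primitive_chainD(3)[OF ch[of n]] primitive_chainD(3)[OF E(1)], of 1 "-1"] by simp
    show "(\<lambda>x. deriv01 m (F n) x - deriv01 m (E 0) x) \<in> borel_measurable leb01"
      using sobolev01_square_integrable(2)[OF F[of n]] sobolev01_square_integrable(2)[OF ES]
      by (auto simp: square_integrable_def)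
    show "AE x in leb01. deriv01 m (F n) x - deriv01 m (E 0) x = D n m x - E m x"
      using aeE by eventually_elim (simp add: D_def)
  qed
  have "(\<lambda>k. sobolev_sq m lam (\<lambda>x. F k x - E 0 x)) \<longlonglongrightarrow> 0 + lam * 0"
    unfolding sobolev_sq_def sobolev01_diff(2)[OF F ES] eqm
    using E(2,3) by (intro tendsto_intros) (simp_all add: D_def)
  then show ?thesis using ES by (intro bexI[of _ "E 0"]) auto
qed

text \<open>The constant depends on \<open>lam\<close>, which suffices for existence; the rate rests
  on \<open>evaluation_kernel\<close> instead.\<close>

lemma sobolev01_eval_bound:
  assumes lam: "lam > 0"
  shows "\<exists>C>0. \<forall>f\<in>sobolev01 m 2. \<forall>t\<in>{0..1}. \<bar>f t\<bar> \<le> C * sqrt (sobolev_sq m lam f)"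
proof -
  obtain C where C: "C > 0" "\<And>E t. primitive_chain m E \<Longrightarrow> t \<in> {0..1} \<Longrightarrow>
        \<bar>E 0 t\<bar> \<le> C * (sqrt (L2_sq leb01 (E 0)) + sqrt (L2_sq leb01 (E m)))"
    using chain_pointwise_bound[of 0 m] m by auto
  show ?thesis
  proof (intro exI[of _ "C * (1 + 1 / sqrt lam)"] conjI ballI)
    show "C * (1 + 1 / sqrt lam) > 0" using C lam by (intro mult_pos_pos add_pos_pos) auto
    fix f and t :: real assume f: "f \<in> sobolev01 m 2" and t: "t \<in> {0..1}"
    have "L2_sq leb01 f \<le> sobolev_sq m lam f" using lam by (simp add: sobolev_sq_def)
    then have 1: "sqrt (L2_sq leb01 f) \<le> sqrt (sobolev_sq m lam f)" by simp
    have "L2_sq leb01 (deriv01 m f) \<le> sobolev_sq m lam f / lam" using lam by (simp add: sobolev_sq_def field_simps)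
    then have 2: "sqrt (L2_sq leb01 (deriv01 m f)) \<le> sqrt (sobolev_sq m lam f) / sqrt lam"
      unfolding real_sqrt_divide[symmetric] by simp
    have "\<bar>f t\<bar> \<le> C * (sqrt (L2_sq leb01 f) + sqrt (L2_sq leb01 (deriv01 m f)))"
      using C(2)[OF sobolev01_chain[OF f m] t] by simp
    also have "\<dots> \<le> C * (sqrt (sobolev_sq m lam f) + sqrt (sobolev_sq m lam f) / sqrt lam)"
      using C(1) 1 2 by (intro mult_left_mono add_mono) auto
    finally show "\<bar>f t\<bar> \<le> C * (1 + 1 / sqrt lam) * sqrt (sobolev_sq m lam f)" by (simp add: algebra_simps)
  qed
qed

lemma L2_sq_tendsto:
  assumes "\<And>k. square_integrable M (F k)" "square_integrable M f" "(\<lambda>k. L2_sq M (\<lambda>x. F k x - f x)) \<longlonglongrightarrow> 0"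
  shows "(\<lambda>k. L2_sq M (F k)) \<longlonglongrightarrow> L2_sq M f"
proof -
  have d: "square_integrable M (\<lambda>x. F k x - f x)" "square_integrable M (\<lambda>x. f x - F k x)" for k
    using square_integrable_lin[OF assms(1)[of k] assms(2), of 1 "-1"] square_integrable_lin[OF assms(2,1), of 1 "-1" k] by simp_all
  have sym: "L2_sq M (\<lambda>x. f x - F k x) = L2_sq M (\<lambda>x. F k x - f x)" for k
    by (simp add: L2_sq_def power2_commute)
  have le: "\<bar>sqrt (L2_sq M (F k)) - sqrt (L2_sq M f)\<bar> \<le> sqrt (L2_sq M (\<lambda>x. F k x - f x))" for k
    using L2_Minkowski[OF assms(2) d(1)[of k]] L2_Minkowski[OF assms(1)[of k] d(2)[of k]] sym[of k] by simp
  have l0: "(\<lambda>k. sqrt (L2_sq M (\<lambda>x. F k x - f x))) \<longlonglongrightarrow> 0"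
    using tendsto_real_sqrt[OF assms(3)] by simp
  have "(\<lambda>k. sqrt (L2_sq M (F k)) - sqrt (L2_sq M f)) \<longlonglongrightarrow> 0"
    by (rule Lim_null_comparison[OF always_eventually l0]) (simp add: le)
  then have "(\<lambda>k. sqrt (L2_sq M (F k))) \<longlonglongrightarrow> sqrt (L2_sq M f)" by (simp add: LIM_zero_iff)
  from tendsto_power[OF this, of 2] show ?thesis by simp
qed

text \<open>Norm convergence carries over to everything that the objective and the distance depend
  on.\<close>

lemma sobolev_sq_tendsto:
  assumes lam: "lam > 0" and F: "\<And>k. F k \<in> sobolev01 m 2" and f: "f \<in> sobolev01 m 2"
    and lim: "(\<lambda>k. sobolev_sq m lam (\<lambda>x. F k x - f x)) \<longlonglongrightarrow> 0"
  shows "\<And>t. t \<in> {0..1} \<Longrightarrow> (\<lambda>k. F k t) \<longlonglongrightarrow> f t"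
    "(\<lambda>k. L2_sq leb01 (deriv01 m (F k))) \<longlonglongrightarrow> L2_sq leb01 (deriv01 m f)"
    "\<And>g. g \<in> sobolev01 m 2 \<Longrightarrow> (\<lambda>k. sobolev_sq m lam (\<lambda>x. F k x - g x)) \<longlonglongrightarrow> sobolev_sq m lam (\<lambda>x. f x - g x)"
proof -
  note si = sobolev01_square_integrable
  have l0: "(\<lambda>k. L2_sq leb01 (\<lambda>x. F k x - f x)) \<longlonglongrightarrow> 0"
    by (rule tendsto_sandwich[OF _ _ tendsto_const lim]) (use lam in \<open>auto simp: sobolev_sq_def\<close>)
  have "(\<lambda>k. sobolev_sq m lam (\<lambda>x. F k x - f x) / lam) \<longlonglongrightarrow> 0 / lam" by (intro tendsto_intros lim) (use lam in auto)
  then have lim': "(\<lambda>k. sobolev_sq m lam (\<lambda>x. F k x - f x) / lam) \<longlonglongrightarrow> 0" by simp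
  have "L2_sq leb01 (\<lambda>x. deriv01 m (F k) x - deriv01 m f x) \<le> sobolev_sq m lam (\<lambda>x. F k x - f x) / lam" for k
    unfolding sobolev_sq_def sobolev01_diff(2)[OF F f] using lam by (simp add: field_simps)
  then have lm: "(\<lambda>k. L2_sq leb01 (\<lambda>x. deriv01 m (F k) x - deriv01 m f x)) \<longlonglongrightarrow> 0"
    by (intro tendsto_sandwich[OF _ _ tendsto_const lim'] always_eventually allI) simp_all
  show "(\<lambda>k. L2_sq leb01 (deriv01 m (F k))) \<longlonglongrightarrow> L2_sq leb01 (deriv01 m f)"
    by (rule L2_sq_tendsto[OF si(2)[OF F] si(2)[OF f] lm])
  show "(\<lambda>k. sobolev_sq m lam (\<lambda>x. F k x - g x)) \<longlonglongrightarrow> sobolev_sq m lam (\<lambda>x. f x - g x)"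
    if g: "g \<in> sobolev01 m 2" for g
  proof -
    have dsi: "square_integrable leb01 (\<lambda>x. u x - v x)" if "square_integrable leb01 u" "square_integrable leb01 v" for u v
      using square_integrable_lin[OF that, of 1 "-1"] by simp
    have "(\<lambda>k. L2_sq leb01 (\<lambda>x. F k x - g x)) \<longlonglongrightarrow> L2_sq leb01 (\<lambda>x. f x - g x)"
      by (rule L2_sq_tendsto[OF dsi[OF si(1)[OF F] si(1)[OF g]] dsi[OF si(1)[OF f] si(1)[OF g]]]) (use l0 in simp)
    moreover have "(\<lambda>k. L2_sq leb01 (\<lambda>x. deriv01 m (F k) x - deriv01 m g x)) \<longlonglongrightarrow> L2_sq leb01 (\<lambda>x. deriv01 m f x - deriv01 m g x)"
      by (rule L2_sq_tendsto[OF dsi[OF si(2)[OF F] si(2)[OF g]] dsi[OF si(2)[OF f] si(2)[OF g]]]) (use lm in simp)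
    ultimately show ?thesis
      unfolding sobolev_sq_def sobolev01_diff(2)[OF F g] sobolev01_diff(2)[OF f g] by (intro tendsto_intros)
  qed
  fix t :: real assume t: "t \<in> {0..1}"
  obtain C where C: "C > 0" "\<forall>f\<in>sobolev01 m 2. \<forall>t\<in>{0..1}. \<bar>f t\<bar> \<le> C * sqrt (sobolev_sq m lam f)"
    using sobolev01_eval_bound[OF lam] by blast
  have "(\<lambda>k. C * sqrt (sobolev_sq m lam (\<lambda>x. F k x - f x))) \<longlonglongrightarrow> C * sqrt 0"
    by (intro tendsto_intros lim)
  then have l1: "(\<lambda>k. C * sqrt (sobolev_sq m lam (\<lambda>x. F k x - f x))) \<longlonglongrightarrow> 0" by simp
  have le: "\<bar>F k t - f t\<bar> \<le> C * sqrt (sobolev_sq m lam (\<lambda>x. F k x - f x))" for k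
    by (rule C(2)[rule_format, OF sobolev01_diff(1)[OF F[of k] f] t])
  have "(\<lambda>k. F k t - f t) \<longlonglongrightarrow> 0"
    by (rule Lim_null_comparison[OF always_eventually l1]) (simp add: le)
  then show "(\<lambda>k. F k t) \<longlonglongrightarrow> f t" by (simp add: LIM_zero_iff)
qed

text \<open>(A5) concerns functions with one integrable derivative. It is going to be applied to
  squares, whose variation Cauchy-Schwarz bounds by the norms of \<open>f\<close> and
  \<open>deriv01 1 f\<close>.\<close>

lemma sobolev01_square_W11:
  assumes f: "f \<in> sobolev01 m 2"
  shows "(\<lambda>x. f x * f x) \<in> sobolev01 1 1"
    "(\<integral>x. \<bar>deriv01 1 (\<lambda>x. f x * f x) x\<bar> \<partial>leb01) \<le> 2 * sqrt (L2_sq leb01 f) * sqrt (L2_sq leb01 (deriv01 1 f))"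
proof -
  note ch = sobolev01_chain[OF f m]
  have m0: "0 < m" using m by simp
  have ai: "deriv01 1 f absolutely_integrable_on {0..1}"
    using primitive_chainD(1)[OF ch m0] by simp
  have eq: "f x = f 0 + integral {0..x} (deriv01 1 f)" if "x \<in> {0..1}" for x
    using primitive_chainD(2)[OF ch m0 that] by simp
  note pm = primitive_mult[OF ai eq ai eq]
  have si: "square_integrable leb01 f" "square_integrable leb01 (deriv01 1 f)"
    using primitive_chain_square_integrable[OF ch, of 0] primitive_chain_square_integrable[OF ch, of 1] m by auto
  have d1: "deriv01 1 (\<lambda>x. f x * f x) = (\<lambda>x. vector_derivative (\<lambda>x. f x * f x) (at x within {0..1}))"
    by simp
  have dai: "deriv01 1 (\<lambda>x. f x * f x) absolutely_integrable_on {0..1}"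
    unfolding d1 by (rule abs_continuous_FTC(1)[OF pm(3)])
  show "(\<lambda>x. f x * f x) \<in> sobolev01 1 1"
    using pm(3) set_integrable_abs[OF dai] by (simp add: sobolev01_def)
  have "(\<integral>x. \<bar>deriv01 1 (\<lambda>x. f x * f x) x\<bar> \<partial>leb01) = (\<integral>x. 2 * (\<bar>f x\<bar> * \<bar>deriv01 1 f x\<bar>) \<partial>leb01)"
  proof (rule integral_cong_AE)
    show "(\<lambda>x. \<bar>deriv01 1 (\<lambda>x. f x * f x) x\<bar>) \<in> borel_measurable leb01"
      using dai by (auto simp: absolutely_integrable_leb01 simp del: deriv01.simps)
    show "(\<lambda>x. 2 * (\<bar>f x\<bar> * \<bar>deriv01 1 f x\<bar>)) \<in> borel_measurable leb01"
      using si by (auto simp: square_integrable_def simp del: deriv01.simps)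
    show "AE x in leb01. \<bar>deriv01 1 (\<lambda>x. f x * f x) x\<bar> = 2 * (\<bar>f x\<bar> * \<bar>deriv01 1 f x\<bar>)"
      using pm(4) unfolding d1
    proof (rule eventually_mono)
      fix x assume "vector_derivative (\<lambda>x. f x * f x) (at x within {0..1}) = deriv01 1 f x * f x + f x * deriv01 1 f x"
      then have "vector_derivative (\<lambda>x. f x * f x) (at x within {0..1}) = 2 * (f x * deriv01 1 f x)" by (metis mult.commute mult_2)
      then show "\<bar>vector_derivative (\<lambda>x. f x * f x) (at x within {0..1})\<bar> = 2 * (\<bar>f x\<bar> * \<bar>deriv01 1 f x\<bar>)"
        by (simp only: abs_mult abs_numeral)
    qed
  qed
  also have "\<dots> = 2 * (\<integral>x. \<bar>f x\<bar> * \<bar>deriv01 1 f x\<bar> \<partial>leb01)" by simp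
  also have "(\<integral>x. \<bar>f x\<bar> * \<bar>deriv01 1 f x\<bar> \<partial>leb01) \<le> sqrt (L2_sq leb01 (\<lambda>x. \<bar>f x\<bar>)) * sqrt (L2_sq leb01 (\<lambda>x. \<bar>deriv01 1 f x\<bar>))"
    using L2_Cauchy_Schwarz[of leb01 "\<lambda>x. \<bar>f x\<bar>" "\<lambda>x. \<bar>deriv01 1 f x\<bar>"] si by (auto simp: square_integrable_def simp del: deriv01.simps)
  finally show "(\<integral>x. \<bar>deriv01 1 (\<lambda>x. f x * f x) x\<bar> \<partial>leb01) \<le> 2 * sqrt (L2_sq leb01 f) * sqrt (L2_sq leb01 (deriv01 1 f))"
    by (simp add: L2_sq_def del: deriv01.simps)
qed

end

section \<open>Closest minimizers and their measurability\<close>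

text \<open>Polynomials enter through their formal derivatives, which spares evaluating
  \<open>deriv01\<close> on them.\<close>

lemma poly_primitive_chain: "primitive_chain m (\<lambda>k. poly ((pderiv ^^ k) q))"
  unfolding primitive_chain_def
proof (intro conjI allI impI ballI)
  have d: "(poly ((pderiv ^^ k) q) has_real_derivative poly ((pderiv ^^ Suc k) q) x) (at x)" for k x
    by (simp add: poly_DERIV)
  have c: "continuous_on A (poly ((pderiv ^^ k) q))" for A k by (intro continuous_intros)
  fix k
  show "poly ((pderiv ^^ Suc k) q) absolutely_integrable_on {0..1}"
    by (rule primitive_of_C1(2)[OF d c, of 0]) auto
  fix x :: real assume "x \<in> {0..1}"
  then show "poly ((pderiv ^^ k) q) x = poly ((pderiv ^^ k) q) 0 + integral {0..x} (poly ((pderiv ^^ Suc k) q))"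
    by (rule primitive_of_C1(1)[OF d c])
next
  show "square_integrable leb01 (poly ((pderiv ^^ m) q))"
    by (intro continuous_square_integrable continuous_intros)
qed

lemma higher_pderiv_eq_0:
  assumes "\<And>i. i \<ge> m \<Longrightarrow> coeff q i = 0" shows "(pderiv ^^ m) q = 0"
  by (rule poly_eqI) (simp add: coeff_higher_pderiv assms)

text \<open>Lagrange interpolation at \<open>min (card T) m\<close> of the points. With at least
  \<open>m\<close> points it reproduces \<open>p\<close>; with fewer it may be a different
  polynomial with the same values on \<open>T\<close>, and this replacement is what makes a bound by
  those values possible. Inside the unit interval every factor \<open>x - u\<close> has modulus at
  most 1, so the basis polynomials are bounded by \<open>1 / \<bar>w s\<bar>\<close>.\<close>

lemma interpolation_bound:
  fixes T :: "real set"
  assumes "finite T" "T \<subseteq> {0..1}" "m \<ge> 1"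
  shows "\<exists>L. \<forall>(p :: real poly) B. degree p < m \<and> (\<forall>t\<in>T. \<bar>poly p t\<bar> \<le> B) \<longrightarrow>
    (\<exists>q. (\<forall>i\<ge>m. coeff q i = 0) \<and> (\<forall>t\<in>T. poly q t = poly p t) \<and> (\<forall>x\<in>{0..1}. \<bar>poly q x\<bar> \<le> L * B))"
proof -
  obtain T' where T': "T' \<subseteq> T" "card T' = min (card T) m" "finite T'"
    using obtain_subset_with_card_n[of "min (card T) m" T] by auto
  define w where "w = (\<lambda>s. \<Prod>u\<in>T' - {s}. s - u)"
  have w0: "w s \<noteq> 0" for s using T'(3) by (simp add: w_def)
  define L where "L = (\<Sum>s\<in>T'. 1 / \<bar>w s\<bar>)"
  have "\<exists>q. (\<forall>i\<ge>m. coeff q i = 0) \<and> (\<forall>t\<in>T. poly q t = poly p t) \<and> (\<forall>x\<in>{0..1}. \<bar>poly q x\<bar> \<le> L * B)"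
    if p: "degree p < m" and B: "\<And>t. t \<in> T \<Longrightarrow> \<bar>poly p t\<bar> \<le> B" for p :: "real poly" and B
  proof -
    define l where "l = (\<lambda>s. \<Prod>u\<in>T' - {s}. [:- u, 1:])"
    define q where "q = (\<Sum>s\<in>T'. smult (poly p s / w s) (l s))"
    have pl: "poly (l s) x = (\<Prod>u\<in>T' - {s}. x - u)" for s x by (simp add: l_def poly_prod)
    have pq: "poly q x = (\<Sum>s\<in>T'. poly p s / w s * poly (l s) x)" for x by (simp add: q_def poly_sum)
    have q_eq: "poly q t = poly p t" if t: "t \<in> T'" for t
    proof -
      have "poly q t = (\<Sum>s\<in>T'. if s = t then poly p t else 0)"
        unfolding pq
      proof (rule sum.cong[OF refl])
        fix s assume s: "s \<in> T'"
        show "poly p s / w s * poly (l s) t = (if s = t then poly p t else 0)"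
        proof (cases "s = t")
          case True
          then show ?thesis using w0[of t] by (simp add: pl w_def)
        next
          case False
          then have "(\<Prod>u\<in>T' - {s}. t - u) = 0" using t T'(3) by (intro prod_zero) auto
          then show ?thesis using False by (simp add: pl)
        qed
      qed
      then show ?thesis using t T'(3) by simp
    qed
    have deg: "degree q < m"
    proof -
      have "degree (smult (poly p s / w s) (l s)) \<le> m - 1" if "s \<in> T'" for s
      proof -
        have "degree (l s) \<le> (\<Sum>u\<in>T' - {s}. 1)"
          unfolding l_def by (rule order_trans[OF degree_prod_sum_le]) (use T'(3) in auto)
        also have "\<dots> = card T' - 1" using that T'(3) by simp
        also have "\<dots> \<le> m - 1" using T'(2) by simp
        finally show ?thesis using degree_smult_le order_trans by blast
      qed
      then have "degree q \<le> m - 1" unfolding q_def by (intro degree_sum_le T'(3)) auto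
      then show ?thesis using assms(3) by simp
    qed
    \<comment> \<open>Away from the nodes: with \<open>m\<close> nodes, \<open>q - p\<close> has
      degree below \<open>m\<close> but \<open>m\<close> roots.\<close>
    have "poly q t = poly p t" if t: "t \<in> T" for t
    proof (cases "card T \<le> m")
      case True
      then have "T' = T" using T' assms(1) by (intro card_subset_eq) auto
      then show ?thesis using q_eq t by simp
    next
      case False
      then have cT: "card T' = m" using T' by simp
      have "q - p = 0"
      proof (rule ccontr)
        assume n0: "q - p \<noteq> 0"
        have "T' \<subseteq> {x. poly (q - p) x = 0}" using q_eq by auto
        then have "card T' \<le> card {x. poly (q - p) x = 0}" using n0 by (intro card_mono poly_roots_finite)
        also have "\<dots> \<le> degree (q - p)" using n0 by (rule card_poly_roots_bound)
        also have "\<dots> < m" using deg p by (rule degree_diff_less)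
        finally show False using cT by simp
      qed
      then show ?thesis by simp
    qed
    moreover have "\<bar>poly q x\<bar> \<le> L * B" if x: "x \<in> {0..1}" for x
    proof -
      have "\<bar>poly q x\<bar> \<le> (\<Sum>s\<in>T'. \<bar>poly p s / w s * poly (l s) x\<bar>)" unfolding pq by (rule sum_abs)
      also have "\<dots> \<le> (\<Sum>s\<in>T'. 1 / \<bar>w s\<bar> * B)"
      proof (rule sum_mono)
        fix s assume s: "s \<in> T'"
        have B0: "0 \<le> B" using B[of s] s T' by force
        have "\<bar>poly (l s) x\<bar> = (\<Prod>u\<in>T' - {s}. \<bar>x - u\<bar>)" unfolding pl by (rule abs_prod)
        also have "\<dots> \<le> (\<Prod>u\<in>T' - {s}. 1)"
        proof (rule prod_mono)
          fix u assume "u \<in> T' - {s}"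
          then have "u \<in> {0..1}" using T'(1) assms(2) by auto
          then show "0 \<le> \<bar>x - u\<bar> \<and> \<bar>x - u\<bar> \<le> 1" using x by auto
        qed
        finally have "\<bar>poly (l s) x\<bar> \<le> 1" by simp
        then have "\<bar>poly p s\<bar> * \<bar>poly (l s) x\<bar> \<le> B * 1" using B[of s] s T' B0 by (intro mult_mono) auto
        then show "\<bar>poly p s / w s * poly (l s) x\<bar> \<le> 1 / \<bar>w s\<bar> * B"
          by (simp add: abs_mult divide_right_mono)
      qed
      finally show ?thesis by (simp add: L_def sum_distrib_right)
    qed
    moreover have "\<forall>i\<ge>m. coeff q i = 0" using deg by (auto intro: coeff_eq_0)
    ultimately show ?thesis by blast
  qed
  then show ?thesis by blast
qed

text \<open>With fewer than \<open>m\<close> distinct design points the objective ignores some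
  nonzero polynomials, and a minimizing sequence may run off along them. In the splitting of
  \<open>f\<close> into its Taylor polynomial at 0 and the remainder, the remainder is bounded by
  \<open>sqrt E\<close>, and the polynomial is exchanged for a bounded one with the same values on
  \<open>T\<close>; data values and penalty stay unchanged.\<close>

lemma bounded_representative:
  fixes T :: "real set"
  assumes m: "m \<ge> 1" and T: "finite T" "T \<subseteq> {0..1}" and E: "E \<ge> 0"
  shows "\<exists>B2. \<forall>f\<in>sobolev01 m 2. (\<forall>t\<in>T. \<bar>f t\<bar> \<le> B) \<and> L2_sq leb01 (deriv01 m f) \<le> E \<longrightarrow>
    (\<exists>f'\<in>sobolev01 m 2. (\<forall>t\<in>T. f' t = f t) \<and> L2_sq leb01 (deriv01 m f') = L2_sq leb01 (deriv01 m f) \<and>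
       (\<forall>x\<in>{0..1}. \<bar>f' x\<bar> \<le> B2))"
proof -
  obtain L where L: "\<And>(p :: real poly) B. degree p < m \<Longrightarrow> (\<And>t. t\<in>T \<Longrightarrow> \<bar>poly p t\<bar> \<le> B) \<Longrightarrow>
    \<exists>q. (\<forall>i\<ge>m. coeff q i = 0) \<and> (\<forall>t\<in>T. poly q t = poly p t) \<and> (\<forall>x\<in>{0..1}. \<bar>poly q x\<bar> \<le> L * B)"
    using interpolation_bound[OF T m] by blast
  show ?thesis
  proof (intro exI[of _ "L * (B + sqrt E) + sqrt E"] ballI impI)
    fix f assume f: "f \<in> sobolev01 m 2" and fB: "(\<forall>t\<in>T. \<bar>f t\<bar> \<le> B) \<and> L2_sq leb01 (deriv01 m f) \<le> E"
    note ch = sobolev01_chain[OF f m]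
    define p where "p = (\<Sum>k<m. monom (deriv01 k f 0 / fact k) k)"
    have cp: "coeff p i = (if i < m then deriv01 i f 0 / fact i else 0)" for i
      by (simp add: p_def coeff_sum)
    have dp: "degree p < m"
    proof -
      have "degree p \<le> m - 1" by (rule degree_le) (use cp m in auto)
      then show ?thesis using m by simp
    qed
    have pm: "(pderiv ^^ m) p = 0" by (rule higher_pderiv_eq_0) (simp add: cp)
    define R where "R = (\<lambda>k x. deriv01 k f x - poly ((pderiv ^^ k) p) x)"
    have chR: "primitive_chain m R"
      using primitive_chain_lin[OF ch poly_primitive_chain, of 1 "-1" p] by (simp add: R_def)
    have Rm: "R m = deriv01 m f" by (simp add: R_def pm)
    have R0: "R k 0 = 0" if "k < m" for k
      using that by (simp add: R_def poly_0_coeff_0 coeff_higher_pderiv cp pochhammer_fact[symmetric])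
    have Rb: "\<bar>R 0 x\<bar> \<le> sqrt E" if x: "x \<in> {0..1}" for x
    proof -
      have "\<bar>R 0 x\<bar> \<le> (\<Sum>i<m. \<bar>R i 0\<bar>) + sqrt (L2_sq leb01 (R m))"
        using m by (intro chain_bound_by_initial_values[OF chR _ x]) simp
      also have "\<dots> \<le> sqrt E" using fB R0 by (simp add: Rm)
      finally show ?thesis .
    qed
    have fx: "f x = poly p x + R 0 x" for x by (simp add: R_def)
    have "\<bar>poly p t\<bar> \<le> B + sqrt E" if t: "t \<in> T" for t
    proof -
      have "\<bar>R 0 t\<bar> \<le> sqrt E" "\<bar>f t\<bar> \<le> B" using Rb[of t] t T(2) fB by auto
      then show ?thesis using fx[of t] by linarith
    qed
    from L[OF dp this] obtain q where q: "\<And>i. i \<ge> m \<Longrightarrow> coeff q i = 0" "\<And>t. t \<in> T \<Longrightarrow> poly q t = poly p t"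
      "\<And>x. x\<in>{0..1} \<Longrightarrow> \<bar>poly q x\<bar> \<le> L * (B + sqrt E)" by blast
    define f' where "f' = (\<lambda>x. poly q x + R 0 x)"
    have ch': "primitive_chain m (\<lambda>k x. poly ((pderiv ^^ k) q) x + R k x)"
      using primitive_chain_lin[OF poly_primitive_chain[of m q] chR, of 1 1] by simp
    have f'0: "f' x = poly ((pderiv ^^ 0) q) x + R 0 x" for x by (simp add: f'_def)
    note cs = chain_sobolev01[OF ch' m f'0]
    have ae: "AE x in leb01. deriv01 m f' x = deriv01 m f x"
      using cs(3) by (rule eventually_mono) (simp add: higher_pderiv_eq_0[OF q(1)] Rm)
    have "L2_sq leb01 (deriv01 m f') = L2_sq leb01 (deriv01 m f)"
      by (rule L2_sq_AE_cong(2)[OF sobolev01_square_integrable(2)[OF m f] _ ae])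
         (use sobolev01_square_integrable(2)[OF m cs(1)] in \<open>simp add: square_integrable_def\<close>)
    moreover have "f' t = f t" if "t \<in> T" for t using q(2)[OF that] by (simp add: f'_def fx)
    moreover have "\<bar>f' x\<bar> \<le> L * (B + sqrt E) + sqrt E" if "x \<in> {0..1}" for x
      using q(3)[OF that] Rb[OF that] unfolding f'_def by linarith
    ultimately show "\<exists>f'\<in>sobolev01 m 2. (\<forall>t\<in>T. f' t = f t) \<and> L2_sq leb01 (deriv01 m f') = L2_sq leb01 (deriv01 m f) \<and>
       (\<forall>x\<in>{0..1}. \<bar>f' x\<bar> \<le> L * (B + sqrt E) + sqrt E)"
      using cs(1) by blast
  qed
qed

text \<open>Elements of almost minimal \<open>X\<close> in the shrinking sublevel sets of \<open>J\<close> form a Cauchy sequence by the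
  parallelogram identity; the limit is a minimizer of \<open>J\<close> that is also closest with respect to \<open>X\<close>.\<close>

lemma ex_closest_minimizer:
  fixes J X :: "'a \<Rightarrow> real" and d :: "'a \<Rightarrow> 'a \<Rightarrow> real"
  assumes S: "S \<noteq> {}" and J0: "\<And>f. f \<in> S \<Longrightarrow> 0 \<le> J f" and X0: "\<And>f. f \<in> S \<Longrightarrow> 0 \<le> X f"
    and mid: "\<And>f g. f \<in> S \<Longrightarrow> g \<in> S \<Longrightarrow> mid f g \<in> S"
      "\<And>f g. f \<in> S \<Longrightarrow> g \<in> S \<Longrightarrow> J (mid f g) \<le> max (J f) (J g)"
      "\<And>f g. f \<in> S \<Longrightarrow> g \<in> S \<Longrightarrow> d f g = 2 * X f + 2 * X g - 4 * X (mid f g)"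
    and complete: "\<And>F. (\<And>k::nat. F k \<in> S) \<Longrightarrow> (\<And>e. e > 0 \<Longrightarrow> \<exists>N. \<forall>i\<ge>N. \<forall>j\<ge>N. d (F i) (F j) < e) \<Longrightarrow>
      \<exists>f\<in>S. (\<lambda>k. X (F k)) \<longlonglongrightarrow> X f \<and> (\<lambda>k. J (F k)) \<longlonglongrightarrow> J f"
    and bounded: "\<And>e. e > 0 \<Longrightarrow> \<exists>f\<in>S. (\<forall>g\<in>S. J f \<le> J g + e) \<and> X f \<le> B"
  shows "\<exists>f\<in>S. (\<forall>g\<in>S. J f \<le> J g) \<and>
    (\<forall>b. (\<forall>e>0. \<exists>g\<in>S. J g \<le> J f + e \<and> X g \<le> b) \<longrightarrow> X f \<le> b)"
proof -
  define I where "I = Inf (J ` S)"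
  have bddJ: "bdd_below (J ` S)" using J0 by (intro bdd_belowI2[of _ 0]) auto
  have I_le: "I \<le> J g" if "g \<in> S" for g unfolding I_def using bddJ that by (intro cINF_lower)
  have J_le_I: "u \<le> I" if "\<And>g. g \<in> S \<Longrightarrow> u \<le> J g" for u unfolding I_def using S that by (intro cINF_greatest)
  define r where "r = (\<lambda>k::nat. 1 / (real k + 1))"
  have r0: "r k > 0" for k by (simp add: r_def)
  have r_mono: "r j \<le> r i" if "i \<le> j" for i j using that by (simp add: r_def field_simps)
  have r_lim: "r \<longlonglongrightarrow> 0" unfolding r_def using LIMSEQ_inverse_real_of_nat by (simp add: inverse_eq_divide add.commute)
  define A where "A = (\<lambda>k. {g\<in>S. J g \<le> I + r k})"
  have AB: "\<exists>f\<in>A k. X f \<le> B" for k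
  proof -
    obtain f where f: "f \<in> S" "\<And>g. g \<in> S \<Longrightarrow> J f \<le> J g + r k" "X f \<le> B" using bounded[OF r0[of k]] by blast
    have "J f - r k \<le> I" by (rule J_le_I) (use f(2) in force)
    then show ?thesis using f by (intro bexI[of _ f]) (auto simp: A_def)
  qed
  have Ane: "A k \<noteq> {}" for k using AB[of k] by auto
  \<comment> \<open>Smaller sublevel sets have larger infima of \<open>X\<close>, and the assumption
    \<open>bounded\<close> keeps these below \<open>B\<close>, so they converge.\<close>
  define \<nu> where "\<nu> = (\<lambda>k. Inf (X ` A k))"
  have bddX: "bdd_below (X ` A k)" for k using X0 by (intro bdd_belowI2[of _ 0]) (auto simp: A_def)
  have \<nu>_le: "\<nu> k \<le> X g" if "g \<in> A k" for g k unfolding \<nu>_def using bddX that by (intro cINF_lower)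
  have \<nu>B: "\<nu> k \<le> B" for k using AB[of k] \<nu>_le[of _ k] by force
  have \<nu>inc: "incseq \<nu>"
  proof (rule incseq_SucI)
    fix k
    have "A (Suc k) \<subseteq> A k" using r_mono[of k "Suc k"] by (auto simp: A_def)
    then show "\<nu> k \<le> \<nu> (Suc k)" unfolding \<nu>_def using Ane bddX by (intro cINF_superset_mono) auto
  qed
  obtain \<nu>' where \<nu>': "\<nu> \<longlonglongrightarrow> \<nu>'" "\<And>k. \<nu> k \<le> \<nu>'"
    using incseq_convergent[OF \<nu>inc, of B] \<nu>B by blast
  have "\<exists>f\<in>A k. X f < \<nu> k + r k" for k
  proof -
    have "Inf (X ` A k) < \<nu> k + r k" using r0[of k] by (simp add: \<nu>_def)
    then show ?thesis using cINF_less_iff[OF Ane bddX] by blast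
  qed
  then obtain F where F: "\<And>k. F k \<in> A k" "\<And>k. X (F k) < \<nu> k + r k" by metis
  have FS: "F k \<in> S" for k using F(1)[of k] by (simp add: A_def)
  have cau: "\<exists>N. \<forall>i\<ge>N. \<forall>j\<ge>N. d (F i) (F j) < e" if e: "e > 0" for e
  proof -
    have "(\<lambda>k. 4 * (\<nu>' - \<nu> k) + 4 * r k) \<longlonglongrightarrow> 4 * (\<nu>' - \<nu>') + 4 * 0"
      by (intro tendsto_intros \<nu>'(1) r_lim)
    then have "\<forall>\<^sub>F k in sequentially. 4 * (\<nu>' - \<nu> k) + 4 * r k < e"
      using e by (intro order_tendstoD(2)) auto
    then obtain N where N: "4 * (\<nu>' - \<nu> N) + 4 * r N < e" by (auto simp: eventually_sequentially)
    have "d (F i) (F j) < e" if ij: "i \<ge> N" "j \<ge> N" for i j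
    proof -
      have "J (mid (F i) (F j)) \<le> max (J (F i)) (J (F j))" by (rule mid(2)[OF FS FS])
      also have "\<dots> \<le> I + r N" using F(1)[of i] F(1)[of j] r_mono[OF ij(1)] r_mono[OF ij(2)] by (auto simp: A_def)
      finally have "\<nu> N \<le> X (mid (F i) (F j))" using mid(1)[OF FS FS] by (intro \<nu>_le) (simp add: A_def)
      moreover have "X (F i) \<le> \<nu>' + r N" "X (F j) \<le> \<nu>' + r N"
        using F(2)[of i] F(2)[of j] \<nu>'(2)[of i] \<nu>'(2)[of j] r_mono[OF ij(1)] r_mono[OF ij(2)] by linarith+
      ultimately show ?thesis
        using mid(3)[OF FS[of i] FS[of j]] N by argo
    qed
    then show ?thesis by blast
  qed
  from complete[OF FS this] obtain f where f: "f \<in> S" "(\<lambda>k. X (F k)) \<longlonglongrightarrow> X f" "(\<lambda>k. J (F k)) \<longlonglongrightarrow> J f" by blast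
  have "J f \<le> I + 0"
  proof (rule LIMSEQ_le[OF f(3)])
    show "(\<lambda>k. I + r k) \<longlonglongrightarrow> I + 0" by (intro tendsto_intros r_lim)
    show "\<exists>N. \<forall>n\<ge>N. J (F n) \<le> I + r n" using F(1) by (auto simp: A_def)
  qed
  then have Jf: "J f = I" using I_le[OF f(1)] by simp
  show ?thesis
  proof (intro bexI[of _ f] conjI ballI allI impI)
    show "J f \<le> J g" if "g \<in> S" for g using I_le[OF that] Jf by simp
    fix b assume b: "\<forall>e>0. \<exists>g\<in>S. J g \<le> J f + e \<and> X g \<le> b"
    have "\<nu> k \<le> b" for k
    proof -
      obtain g where g: "g \<in> S" "J g \<le> J f + r k" "X g \<le> b" using b r0[of k] by blast
      then have "g \<in> A k" by (simp add: A_def Jf)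
      then show ?thesis using \<nu>_le[of g k] g(3) by simp
    qed
    then have "X (F k) \<le> b + r k" for k using F(2)[of k] by (smt (verit))
    moreover have "(\<lambda>k. b + r k) \<longlonglongrightarrow> b + 0" by (intro tendsto_intros r_lim)
    ultimately show "X f \<le> b" using LIMSEQ_le[OF f(2), of "\<lambda>k. b + r k" b] by auto
  qed (rule f(1))
qed

text \<open>The choice of a minimizer need not be measurable, but its distance is:
  \<open>X (fh \<omega>) \<le> b\<close> holds exactly if elements with \<open>X g \<le> b\<close>
  come within every \<open>r k\<close> of the minimal value. A rational \<open>q\<close> between the
  two random sides makes this a countable combination of events.\<close>

lemma closest_minimizer_measurable:
  fixes J :: "'w \<Rightarrow> 'b \<Rightarrow> real" and X :: "'b \<Rightarrow> real"
  assumes meas: "\<And>C q. C \<subseteq> S \<Longrightarrow> {\<omega>\<in>space M. \<exists>g\<in>C. J \<omega> g < q} \<in> sets M"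
    and S: "\<And>\<omega>. \<omega> \<in> space M \<Longrightarrow> fh \<omega> \<in> S"
    and min: "\<And>\<omega> g. \<omega> \<in> space M \<Longrightarrow> g \<in> S \<Longrightarrow> J \<omega> (fh \<omega>) \<le> J \<omega> g"
    and closest: "\<And>\<omega> b. \<omega> \<in> space M \<Longrightarrow> (\<And>e. e > 0 \<Longrightarrow> \<exists>g\<in>S. J \<omega> g \<le> J \<omega> (fh \<omega>) + e \<and> X g \<le> b) \<Longrightarrow> X (fh \<omega>) \<le> b"
  shows "(\<lambda>\<omega>. X (fh \<omega>)) \<in> borel_measurable M"
proof -
  define V where "V = (\<lambda>\<omega>. J \<omega> (fh \<omega>))"
  have V[measurable]: "V \<in> borel_measurable M"
    unfolding borel_measurable_iff_less
  proof
    fix a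
    have "{\<omega>\<in>space M. V \<omega> < a} = {\<omega>\<in>space M. \<exists>g\<in>S. J \<omega> g < a}"
      using S min by (fastforce simp: V_def intro: le_less_trans)
    then show "{\<omega>\<in>space M. V \<omega> < a} \<in> sets M" using meas[of S a] by simp
  qed
  define r where "r = (\<lambda>k::nat. 1 / (real k + 1))"
  have r0: "r k > 0" for k by (simp add: r_def)
  show ?thesis
    unfolding borel_measurable_iff_le
  proof
    fix b
    let ?C = "{g\<in>S. X g \<le> b}"
    have "{\<omega>\<in>space M. X (fh \<omega>) \<le> b} =
      (\<Inter>k. \<Union>q\<in>\<rat>. {\<omega>\<in>space M. \<exists>g\<in>?C. J \<omega> g < q} \<inter> {\<omega>\<in>space M. q < V \<omega> + r k})" (is "?L = ?R")
    proof (intro set_eqI iffI)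
      fix \<omega> assume "\<omega> \<in> ?L"
      then have \<omega>: "\<omega> \<in> space M" "X (fh \<omega>) \<le> b" by auto
      have "\<exists>q\<in>\<rat>. J \<omega> (fh \<omega>) < q \<and> q < V \<omega> + r k" for k
        using Rats_dense_in_real[of "V \<omega>" "V \<omega> + r k"] r0[of k] by (auto simp: V_def)
      then show "\<omega> \<in> ?R" using \<omega> S[OF \<omega>(1)] by blast
    next
      fix \<omega> assume \<omega>R: "\<omega> \<in> ?R"
      then have \<omega>: "\<omega> \<in> space M" by auto
      have "X (fh \<omega>) \<le> b"
      proof (rule closest[OF \<omega>])
        fix e :: real assume "e > 0"
        then obtain k where k: "r k < e" using nat_approx_posE[of e] by (auto simp: r_def add.commute)
        obtain q g where "g \<in> ?C" "J \<omega> g < q" "q < V \<omega> + r k" using \<omega>R by blast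
        then show "\<exists>g\<in>S. J \<omega> g \<le> J \<omega> (fh \<omega>) + e \<and> X g \<le> b"
          using k by (intro bexI[of _ g]) (auto simp: V_def)
      qed
      then show "\<omega> \<in> ?L" using \<omega> by simp
    qed
    also have "\<dots> \<in> sets M"
    proof -
      have "{\<omega>\<in>space M. \<exists>g\<in>?C. J \<omega> g < q} \<inter> {\<omega> \<in> space M. q < V \<omega> + r k} \<in> sets M" for q k
        by (intro sets.Int meas) (auto simp del: mem_Collect_eq)
      then show ?thesis by (intro sets.countable_INT image_subsetI sets.countable_UN' countable_rat) auto
    qed
    finally show "{\<omega>\<in>space M. X (fh \<omega>) \<le> b} \<in> sets M" .
  qed
qed

section \<open>Existence and measurability of the closest spline\<close>

lemma M_spline_objective_eq:
  "M_spline_objective \<rho> m lam n t y f =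
     1 / real n * (\<Sum>i=1..n. \<rho> (y i - f (t i))) + lam * L2_sq leb01 (deriv01 m f)"
  by (simp add: M_spline_objective_def set_integral_leb01 L2_sq_def)

lemma sobolev_sq_diff_le:
  assumes m: "m \<ge> 1" and f: "f \<in> sobolev01 m 2" and g: "g \<in> sobolev01 m 2" and lam: "lam \<ge> 0"
  shows "sobolev_sq m lam (\<lambda>x. f x - g x) \<le> 2 * sobolev_sq m lam f + 2 * sobolev_sq m lam g"
proof -
  have L2: "L2_sq leb01 (\<lambda>x. u x - v x) \<le> 2 * L2_sq leb01 u + 2 * L2_sq leb01 v"
    if "square_integrable leb01 u" "square_integrable leb01 v" for u v
    using L2_sq_lin[OF that, of 1 "-1"] L2_sq_lin[OF that, of 1 1] L2_sq_nonneg[of leb01 "\<lambda>x. 1 * u x + 1 * v x"]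
    by simp
  note si = sobolev01_square_integrable[OF m]
  have "L2_sq leb01 (\<lambda>x. f x - g x) \<le> 2 * L2_sq leb01 f + 2 * L2_sq leb01 g" by (rule L2[OF si(1)[OF f] si(1)[OF g]])
  moreover have "lam * L2_sq leb01 (deriv01 m (\<lambda>x. f x - g x)) \<le> lam * (2 * L2_sq leb01 (deriv01 m f) + 2 * L2_sq leb01 (deriv01 m g))"
    unfolding sobolev01_diff(2)[OF m f g] using lam by (intro mult_left_mono L2[OF si(2)[OF f] si(2)[OF g]])
  ultimately show ?thesis by (simp add: sobolev_sq_def algebra_simps)
qed

text \<open>An instance of \<open>ex_closest_minimizer\<close> with pointwise midpoints. Its
  boundedness condition is the delicate one: coercivity of \<open>\<rho>\<close> bounds
  near-minimizers at the design points, the penalty bounds their top derivative, and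
  \<open>bounded_representative\<close> then yields equally good functions of bounded norm.\<close>

theorem ex_closest_M_spline:
  fixes t :: "nat \<Rightarrow> real" and y :: "nat \<Rightarrow> real"
  assumes m: "m \<ge> 1" and lam: "lam > 0" and n: "n \<ge> 1"
    and t: "\<And>i. i \<in> {1..n} \<Longrightarrow> t i \<in> {0..1}"
    and rho0: "\<And>x. \<rho> x \<ge> 0" and conv: "convex_on UNIV \<rho>" and cont: "continuous_on UNIV \<rho>"
    and coer: "\<alpha> > 0" "\<And>x. \<alpha> * \<bar>x\<bar> - \<beta> \<le> \<rho> x" and f0: "f0 \<in> sobolev01 m 2"
  defines "J \<equiv> M_spline_objective \<rho> m lam n t y"
    and "X \<equiv> \<lambda>f. sobolev_sq m lam (\<lambda>x. f x - f0 x)"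
  shows "\<exists>f\<in>sobolev01 m 2. (\<forall>g\<in>sobolev01 m 2. J f \<le> J g) \<and>
    (\<forall>b. (\<forall>e>0. \<exists>g\<in>sobolev01 m 2. J g \<le> J f + e \<and> X g \<le> b) \<longrightarrow> X f \<le> b)"
proof -
  let ?S = "sobolev01 m 2"
  have J: "J f = 1 / real n * (\<Sum>i=1..n. \<rho> (y i - f (t i))) + lam * L2_sq leb01 (deriv01 m f)" for f
    by (simp add: J_def M_spline_objective_eq)
  have sum0: "0 \<le> (\<Sum>i=1..n. \<rho> (y i - f (t i)))" for f using rho0 by (intro sum_nonneg)
  have J0: "0 \<le> J f" for f unfolding J using sum0[of f] lam by (intro add_nonneg_nonneg mult_nonneg_nonneg) auto
  \<comment> \<open>Everything within 1 of the infimum has objective at most \<open>A\<close>, since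
    \<open>f0\<close> competes.\<close>
  define A where "A = J f0 + 1"
  have A0: "A \<ge> 0" using J0[of f0] by (simp add: A_def)
  define Bf where "Bf = (real n * A + \<beta>) / \<alpha> + (\<Sum>i=1..n. \<bar>y i\<bar>)"
  have E: "A / lam \<ge> 0" using A0 lam by simp
  have T: "finite (t ` {1..n})" "t ` {1..n} \<subseteq> {0..1}" using t by auto
  obtain B2 where B2: "\<And>f. f\<in>?S \<Longrightarrow> (\<forall>t\<in>t ` {1..n}. \<bar>f t\<bar> \<le> Bf) \<and> L2_sq leb01 (deriv01 m f) \<le> A / lam \<Longrightarrow>
    (\<exists>f'\<in>?S. (\<forall>t\<in>t ` {1..n}. f' t = f t) \<and> L2_sq leb01 (deriv01 m f') = L2_sq leb01 (deriv01 m f) \<and>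
       (\<forall>x\<in>{0..1}. \<bar>f' x\<bar> \<le> B2))"
    using bounded_representative[OF m T E, of Bf] by blast
  show ?thesis
  proof (rule ex_closest_minimizer[where mid="\<lambda>f g x. (f x + g x) / 2" and d="\<lambda>f g. sobolev_sq m lam (\<lambda>x. f x - g x)"
        and B="2 * (B2\<^sup>2 + A) + 2 * sobolev_sq m lam f0"])
    show "?S \<noteq> {}" using f0 by auto
    show "0 \<le> J f" for f by (rule J0)
    show "0 \<le> X f" for f using lam by (simp add: X_def sobolev_sq_def)
    fix f g assume f: "f \<in> ?S" and g: "g \<in> ?S"
    note par = sobolev_sq_parallelogram[OF m f g]
    show "(\<lambda>x. (f x + g x) / 2) \<in> ?S" by (rule par(1)[OF f0])
    show "sobolev_sq m lam (\<lambda>x. f x - g x) = 2 * X f + 2 * X g - 4 * X (\<lambda>x. (f x + g x) / 2)"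
      unfolding X_def by (rule par(2)[OF f0])
    have "(\<Sum>i=1..n. \<rho> (y i - (f (t i) + g (t i)) / 2)) \<le> (\<Sum>i=1..n. (\<rho> (y i - f (t i)) + \<rho> (y i - g (t i))) / 2)"
    proof (rule sum_mono)
      fix i
      have cv: "\<rho> ((1 - 1/2) *\<^sub>R (y i - f (t i)) + (1/2) *\<^sub>R (y i - g (t i))) \<le> (1 - 1/2) * \<rho> (y i - f (t i)) + 1/2 * \<rho> (y i - g (t i))"
        by (rule convex_onD[OF conv]) auto
      have "(1 - 1/2) *\<^sub>R (y i - f (t i)) + (1/2) *\<^sub>R (y i - g (t i)) = y i - (f (t i) + g (t i)) / 2"
        by (simp add: field_simps)
      from cv[unfolded this] show "\<rho> (y i - (f (t i) + g (t i)) / 2) \<le> (\<rho> (y i - f (t i)) + \<rho> (y i - g (t i))) / 2"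
        by (simp add: add_divide_distrib)
    qed
    also have "\<dots> = ((\<Sum>i=1..n. \<rho> (y i - f (t i))) + (\<Sum>i=1..n. \<rho> (y i - g (t i)))) / 2"
      by (simp add: sum.distrib[symmetric] sum_divide_distrib)
    finally have "J (\<lambda>x. (f x + g x) / 2) \<le> 1 / real n * (((\<Sum>i=1..n. \<rho> (y i - f (t i))) + (\<Sum>i=1..n. \<rho> (y i - g (t i)))) / 2)
       + lam * ((L2_sq leb01 (deriv01 m f) + L2_sq leb01 (deriv01 m g)) / 2)"
      unfolding J using lam by (intro add_mono mult_left_mono par(3)[OF f0]) auto
    also have "\<dots> = (J f + J g) / 2"
    proof -
      have "k * ((a + b) / 2) + l * ((c + d) / 2) = ((k * a + l * c) + (k * b + l * d)) / 2" for k a b l c d :: real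
        by (simp add: algebra_simps add_divide_distrib)
      then show ?thesis unfolding J by blast
    qed
    also have "\<dots> \<le> max (J f) (J g)" by (auto simp: max_def)
    finally show "J (\<lambda>x. (f x + g x) / 2) \<le> max (J f) (J g)" .
  next
    fix F assume F: "\<And>k::nat. F k \<in> ?S"
      and cau: "\<And>e. e > 0 \<Longrightarrow> \<exists>N. \<forall>i\<ge>N. \<forall>j\<ge>N. sobolev_sq m lam (\<lambda>x. F i x - F j x) < e"
    obtain f where f: "f \<in> ?S" "(\<lambda>k. sobolev_sq m lam (\<lambda>x. F k x - f x)) \<longlonglongrightarrow> 0"
      using sobolev_sq_complete[OF m lam F cau] by blast
    note lims = sobolev_sq_tendsto[OF m lam F f]
    have rl: "(\<lambda>k. \<rho> (y i - F k (t i))) \<longlonglongrightarrow> \<rho> (y i - f (t i))" if "i \<in> {1..n}" for i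
      using cont t[OF that]
      by (intro continuous_on_tendsto_compose[OF cont] tendsto_intros lims(1)) auto
    have "(\<lambda>k. J (F k)) \<longlonglongrightarrow> J f"
      unfolding J by (intro tendsto_intros rl lims(2)) auto
    moreover have "(\<lambda>k. X (F k)) \<longlonglongrightarrow> X f" unfolding X_def by (rule lims(3)[OF f0])
    ultimately show "\<exists>f\<in>?S. (\<lambda>k. X (F k)) \<longlonglongrightarrow> X f \<and> (\<lambda>k. J (F k)) \<longlonglongrightarrow> J f" using f(1) by blast
  next
    fix e :: real assume e: "e > 0"
    have bddJ: "bdd_below (J ` ?S)" using J0 by (intro bdd_belowI2[of _ 0]) auto
    \<comment> \<open>A slack of at most 1, so that the bounds built from \<open>A\<close> do not
      depend on \<open>e\<close>.\<close>
    have "\<exists>f\<in>?S. J f < Inf (J ` ?S) + min e 1"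
    proof -
      have "Inf (J ` ?S) < Inf (J ` ?S) + min e 1" using e by simp
      then show ?thesis using f0 cINF_less_iff[OF _ bddJ, of "Inf (J ` ?S) + min e 1"] by auto
    qed
    then obtain f where f: "f \<in> ?S" "J f < Inf (J ` ?S) + min e 1" by blast
    have fJ: "J f \<le> J g + min e 1" if "g \<in> ?S" for g
      using f(2) cINF_lower[OF bddJ that] by simp
    have fA: "J f \<le> A" using fJ[OF f0] by (simp add: A_def)
    have "1 / real n * (\<Sum>i=1..n. \<rho> (y i - f (t i))) \<le> A"
    proof -
      have "0 \<le> lam * L2_sq leb01 (deriv01 m f)" using lam by simp
      then show ?thesis using fA unfolding J by linarith
    qed
    then have sA: "(\<Sum>i=1..n. \<rho> (y i - f (t i))) \<le> real n * A" using n by (simp add: field_simps)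
    have "\<bar>f (t i)\<bar> \<le> Bf" if i: "i \<in> {1..n}" for i
    proof -
      have "\<alpha> * \<bar>y i - f (t i)\<bar> - \<beta> \<le> \<rho> (y i - f (t i))" by (rule coer)
      also have "\<dots> \<le> (\<Sum>i=1..n. \<rho> (y i - f (t i)))"
        using i rho0 by (intro member_le_sum) auto
      finally have "\<bar>y i - f (t i)\<bar> \<le> (real n * A + \<beta>) / \<alpha>" using sA coer(1) by (simp add: field_simps)
      moreover have "\<bar>y i\<bar> \<le> (\<Sum>i=1..n. \<bar>y i\<bar>)" using i by (intro member_le_sum) auto
      ultimately show ?thesis unfolding Bf_def by linarith
    qed
    moreover have LA: "lam * L2_sq leb01 (deriv01 m f) \<le> A"
    proof -
      have "0 \<le> 1 / real n * (\<Sum>i=1..n. \<rho> (y i - f (t i)))" using sum0[of f] by (intro mult_nonneg_nonneg) auto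
      then show ?thesis using fA unfolding J by linarith
    qed
    then have "L2_sq leb01 (deriv01 m f) \<le> A / lam" using lam by (simp add: field_simps)
    ultimately obtain f' where f': "f' \<in> ?S" "\<And>i. i \<in> {1..n} \<Longrightarrow> f' (t i) = f (t i)"
      "L2_sq leb01 (deriv01 m f') = L2_sq leb01 (deriv01 m f)" "\<And>x. x \<in> {0..1} \<Longrightarrow> \<bar>f' x\<bar> \<le> B2"
      using B2[OF f(1)] by auto
    have Jf': "J f' = J f" unfolding J f'(3) using f'(2) by simp
    have "sobolev_sq m lam f' \<le> B2\<^sup>2 + A"
      using L2_sq_le_sup[OF sobolev01_square_integrable(1)[OF m f'(1)] f'(4)] LA
      by (simp add: sobolev_sq_def f'(3))
    moreover have "X f' \<le> 2 * sobolev_sq m lam f' + 2 * sobolev_sq m lam f0"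
      unfolding X_def using lam by (intro sobolev_sq_diff_le[OF m f'(1) f0]) simp
    ultimately have "X f' \<le> 2 * (B2\<^sup>2 + A) + 2 * sobolev_sq m lam f0" by argo
    then show "\<exists>f\<in>?S. (\<forall>g\<in>?S. J f \<le> J g + e) \<and> X f \<le> 2 * (B2\<^sup>2 + A) + 2 * sobolev_sq m lam f0"
      using f'(1) fJ Jf' by (intro bexI[of _ f']) (force simp: Jf')+
  qed
qed

text \<open>\<open>C\<close> may be uncountable, but for each \<open>g\<close> the objective is
  continuous in the data vector, so the union over \<open>C\<close> is an open set of data and its
  preimage is an event.\<close>

lemma objective_level_sets_measurable:
  fixes y :: "'w \<Rightarrow> nat \<Rightarrow> real"
  assumes y: "\<And>i. i \<in> {1..n} \<Longrightarrow> (\<lambda>\<omega>. y \<omega> i) \<in> borel_measurable M" and cont: "continuous_on UNIV \<rho>"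
  shows "{\<omega>\<in>space M. \<exists>g\<in>C. M_spline_objective \<rho> m lam n t (y \<omega>) g < q} \<in> sets M"
proof -
  \<comment> \<open>Coordinates outside \<open>1..n\<close> are set to 0: measurability is given
    only for the observed ones, and the objective reads no others.\<close>
  define y' where "y' = (\<lambda>\<omega> i. if i \<in> {1..n} then y \<omega> i else 0)"
  have y'm: "y' \<in> M \<rightarrow>\<^sub>M borel"
  proof (rule measurable_coordinatewise_then_product)
    show "(\<lambda>\<omega>. y' \<omega> i) \<in> borel_measurable M" for i
    proof (cases "i \<in> {1..n}")
      case True
      then show ?thesis using y[OF True] by (simp add: y'_def)
    next
      case False
      then have "(\<lambda>\<omega>. y' \<omega> i) = (\<lambda>_. 0)" by (auto simp: y'_def)
      then show ?thesis by simp
    qed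
  qed
  have eq: "M_spline_objective \<rho> m lam n t (y \<omega>) g = M_spline_objective \<rho> m lam n t (y' \<omega>) g" for \<omega> g
    by (simp add: M_spline_objective_def y'_def)
  define U where "U = (\<Union>g\<in>C. {z. M_spline_objective \<rho> m lam n t z g < q})"
  have "continuous_on UNIV (\<lambda>z. M_spline_objective \<rho> m lam n t z g)" for g
    unfolding M_spline_objective_def
    by (intro continuous_intros continuous_on_compose2[OF cont] continuous_on_product_coordinates) auto
  then have "open U" unfolding U_def by (intro open_UN ballI open_Collect_less continuous_on_const)
  then have "y' -` U \<inter> space M \<in> sets M" using y'm by (intro measurable_sets[OF y'm]) auto
  moreover have "{\<omega>\<in>space M. \<exists>g\<in>C. M_spline_objective \<rho> m lam n t (y \<omega>) g < q} = y' -` U \<inter> space M"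
    by (auto simp: U_def eq)
  ultimately show ?thesis by simp
qed

section \<open>Symmetrization and contraction\<close>

lemma abs_Max_image_le:
  fixes f :: "'g \<Rightarrow> real"
  assumes "finite F" "F \<noteq> {}" "\<And>x. x \<in> F \<Longrightarrow> \<bar>f x\<bar> \<le> B"
  shows "\<bar>Max (f ` F)\<bar> \<le> B"
proof -
  have "Max (f ` F) \<in> f ` F" using assms by (intro Max_in) auto
  then show ?thesis using assms(3) by auto
qed

text \<open>Symmetrization and contraction of a single coordinate: with an independent copy \<open>y'\<close> of \<open>y\<close>
  the increment \<open>\<phi> y' - \<phi> y\<close> is symmetric and \<open>2 L\<close>-Lipschitz in \<open>z\<close>, so the two maxima over its signs
  are dominated by those with \<open>2 L z\<close> in its place.\<close>

lemma contraction_step: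
  fixes \<phi> :: "real \<Rightarrow> real \<Rightarrow> real" and A z :: "'g \<Rightarrow> real"
  assumes \<mu>: "prob_space \<mu>" "sets \<mu> = sets borel"
    and F: "finite F" "F \<noteq> {}"
    and \<phi>m: "\<And>x. (\<lambda>e. \<phi> e x) \<in> borel_measurable borel"
    and \<phi>0: "\<And>e. \<phi> e 0 = 0" and L: "L \<ge> 0"
    and lip: "\<And>e x y. \<bar>x\<bar> \<le> b \<Longrightarrow> \<bar>y\<bar> \<le> b \<Longrightarrow> \<bar>\<phi> e x - \<phi> e y\<bar> \<le> L * \<bar>x - y\<bar>"
    and z: "\<And>g. g \<in> F \<Longrightarrow> \<bar>z g\<bar> \<le> b"
  defines "H \<equiv> \<lambda>x. \<integral>e. \<phi> e x \<partial>\<mu>"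
  shows "(\<integral>y. Max ((\<lambda>g. A g + (H (z g) - \<phi> y (z g))) ` F) \<partial>\<mu>) \<le>
    (Max ((\<lambda>g. A g + 2 * L * z g) ` F) + Max ((\<lambda>g. A g - 2 * L * z g) ` F)) / 2"
proof -
  interpret \<mu>: prob_space \<mu> by (rule \<mu>(1))
  interpret P: pair_prob_space \<mu> \<mu> ..
  have b0: "0 \<le> b" using F z by force
  have \<phi>m'[measurable]: "(\<lambda>e. \<phi> e x) \<in> borel_measurable \<mu>" for x
    using \<phi>m by (subst measurable_cong_sets[OF \<mu>(2) refl])
  have \<phi>b: "\<bar>\<phi> e (z g)\<bar> \<le> L * b" if "g \<in> F" for e g
  proof -
    have "\<bar>\<phi> e (z g) - \<phi> e 0\<bar> \<le> L * \<bar>z g - 0\<bar>" using z[OF that] b0 by (intro lip) auto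
    also have "\<dots> \<le> L * b" using z[OF that] L by (intro mult_left_mono) auto
    finally show ?thesis by (simp add: \<phi>0)
  qed
  have \<phi>i: "integrable \<mu> (\<lambda>e. \<phi> e (z g))" if "g \<in> F" for g
    by (rule \<mu>.integrable_const_bound[where B="L * b"]) (use \<phi>b[OF that] in auto)
  have Hb: "\<bar>H (z g)\<bar> \<le> L * b" if g: "g \<in> F" for g
  proof -
    have "\<bar>H (z g)\<bar> \<le> (\<integral>e. \<bar>\<phi> e (z g)\<bar> \<partial>\<mu>)" unfolding H_def by (rule integral_abs_bound)
    also have "\<dots> \<le> (\<integral>e. L * b \<partial>\<mu>)" using \<phi>i[OF g] \<phi>b[OF g] by (intro integral_mono) auto
    finally show ?thesis by (simp add: \<mu>.prob_space)
  qed
  define B where "B = Max ((\<lambda>g. \<bar>A g\<bar>) ` F)"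
  have AB: "\<bar>A g\<bar> \<le> B" if "g \<in> F" for g unfolding B_def using that F by (intro Max_ge) auto
  define u where "u = (\<lambda>y. Max ((\<lambda>g. A g + (H (z g) - \<phi> y (z g))) ` F))"
  define w where "w = (\<lambda>y y'. Max ((\<lambda>g. A g + (\<phi> y' (z g) - \<phi> y (z g))) ` F))"
  have um[measurable]: "u \<in> borel_measurable \<mu>"
    unfolding u_def by (rule borel_measurable_Max) (use F in auto)
  have wm[measurable]: "case_prod w \<in> borel_measurable (\<mu> \<Otimes>\<^sub>M \<mu>)"
    unfolding w_def case_prod_beta by (rule borel_measurable_Max) (use F in auto)
  have wm1[measurable]: "w y \<in> borel_measurable \<mu>" "(\<lambda>y. w y y') \<in> borel_measurable \<mu>" for y y'
    unfolding w_def by (rule borel_measurable_Max; use F in auto)+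
  have wb: "\<bar>w y y'\<bar> \<le> B + 2 * (L * b)" for y y'
    unfolding w_def
  proof (rule abs_Max_image_le[OF F])
    fix g assume g: "g \<in> F"
    show "\<bar>A g + (\<phi> y' (z g) - \<phi> y (z g))\<bar> \<le> B + 2 * (L * b)"
      using AB[OF g] \<phi>b[OF g, of y] \<phi>b[OF g, of y'] by linarith
  qed
  have ub: "\<bar>u y\<bar> \<le> B + 2 * (L * b)" for y
    unfolding u_def
  proof (rule abs_Max_image_le[OF F])
    fix g assume g: "g \<in> F"
    show "\<bar>A g + (H (z g) - \<phi> y (z g))\<bar> \<le> B + 2 * (L * b)"
      using AB[OF g] \<phi>b[OF g, of y] Hb[OF g] by linarith
  qed
  have wi: "integrable (\<mu> \<Otimes>\<^sub>M \<mu>) (case_prod w)"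
    by (rule P.integrable_const_bound[where B="B + 2 * (L * b)"]) (use wb in auto)
  have wi1: "integrable \<mu> (w y)" for y
    by (rule \<mu>.integrable_const_bound[where B="B + 2 * (L * b)"]) (use wb in auto)
  have wi2: "integrable \<mu> (\<lambda>y. w y y')" for y'
    by (rule \<mu>.integrable_const_bound[where B="B + 2 * (L * b)"]) (use wb in auto)
  have ui: "integrable \<mu> u"
    by (rule \<mu>.integrable_const_bound[where B="B + 2 * (L * b)"]) (use ub in auto)
  \<comment> \<open>Averaging over the copy \<open>y'\<close> turns its term into \<open>H\<close>,
    and a maximum of averages is at most the average of the maxima.\<close>
  have uw: "u y \<le> (\<integral>y'. w y y' \<partial>\<mu>)" for y
    unfolding u_def
  proof (rule Max.boundedI)
    fix v assume "v \<in> (\<lambda>g. A g + (H (z g) - \<phi> y (z g))) ` F"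
    then obtain g where g: "g \<in> F" "v = A g + (H (z g) - \<phi> y (z g))" by auto
    have "v = (\<integral>y'. A g + (\<phi> y' (z g) - \<phi> y (z g)) \<partial>\<mu>)"
      using \<phi>i[OF g(1)] unfolding g(2) H_def by (simp add: \<mu>.prob_space)
    also have "\<dots> \<le> (\<integral>y'. w y y' \<partial>\<mu>)"
    proof (rule integral_mono[OF _ wi1])
      show "integrable \<mu> (\<lambda>y'. A g + (\<phi> y' (z g) - \<phi> y (z g)))" using \<phi>i[OF g(1)] by simp
      fix y' show "A g + (\<phi> y' (z g) - \<phi> y (z g)) \<le> w y y'"
        unfolding w_def using F g(1) by (intro Max_ge) auto
    qed
    finally show "v \<le> (\<integral>y'. w y y' \<partial>\<mu>)" .
  qed (use F in auto)
  define c0 where "c0 = Max ((\<lambda>g. A g + 2 * L * z g) ` F) + Max ((\<lambda>g. A g - 2 * L * z g) ` F)"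
  have c0: "(A g + 2 * L * z g) + (A g' - 2 * L * z g') \<le> c0" if "g \<in> F" "g' \<in> F" for g g'
    unfolding c0_def using that F by (intro add_mono Max_ge) auto
  \<comment> \<open>Adding the two orders of \<open>y\<close> and \<open>y'\<close> stands for
    averaging over a random sign. For the maximizers \<open>g\<close> and \<open>g'\<close> the
    terms \<open>A\<close> remain, and the increments contribute at most \<open>2 * L\<close> times
    the distance of \<open>z g\<close> and \<open>z g'\<close>; whichever of these is larger takes
    the plus sign.\<close>
  have sym: "w y y' + w y' y \<le> c0" for y y'
  proof -
    have "w y y' \<in> (\<lambda>g. A g + (\<phi> y' (z g) - \<phi> y (z g))) ` F" unfolding w_def using F by (intro Max_in) auto
    then obtain g where g: "g \<in> F" "w y y' = A g + (\<phi> y' (z g) - \<phi> y (z g))" by auto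
    have "w y' y \<in> (\<lambda>g. A g + (\<phi> y (z g) - \<phi> y' (z g))) ` F" unfolding w_def using F by (intro Max_in) auto
    then obtain g' where g': "g' \<in> F" "w y' y = A g' + (\<phi> y (z g') - \<phi> y' (z g'))" by auto
    have "\<phi> y' (z g) - \<phi> y' (z g') \<le> L * \<bar>z g - z g'\<bar>" "\<phi> y (z g') - \<phi> y (z g) \<le> L * \<bar>z g - z g'\<bar>"
      using lip[OF z[OF g(1)] z[OF g'(1)], of y'] lip[OF z[OF g'(1)] z[OF g(1)], of y] by (auto simp: abs_minus_commute)
    then have "w y y' + w y' y \<le> A g + A g' + 2 * (L * \<bar>z g - z g'\<bar>)" unfolding g(2) g'(2) by linarith
    also have "\<dots> \<le> c0"
    proof (cases "z g \<ge> z g'")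
      case True
      then have "2 * (L * \<bar>z g - z g'\<bar>) = 2 * L * z g - 2 * L * z g'" by (simp add: algebra_simps)
      then show ?thesis using c0[OF g(1) g'(1)] by linarith
    next
      case False
      then have "2 * (L * \<bar>z g - z g'\<bar>) = 2 * L * z g' - 2 * L * z g" by (simp add: algebra_simps)
      then show ?thesis using c0[OF g'(1) g(1)] by linarith
    qed
    finally show ?thesis .
  qed
  have i1: "integrable \<mu> (\<lambda>y. \<integral>y'. w y y' \<partial>\<mu>)"
    using P.integrable_fst'[OF wi] by simp
  have i2: "integrable \<mu> (\<lambda>y. \<integral>y'. w y' y \<partial>\<mu>)"
    using P.integrable_snd[OF wi] by simp
  have "(\<integral>y. u y \<partial>\<mu>) \<le> (\<integral>y. (\<integral>y'. w y y' \<partial>\<mu>) \<partial>\<mu>)"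
    by (rule integral_mono[OF ui i1 uw])
  moreover have "(\<integral>y. u y \<partial>\<mu>) \<le> (\<integral>y. (\<integral>y'. w y' y \<partial>\<mu>) \<partial>\<mu>)"
    using calculation P.Fubini_integral[OF wi] by simp
  moreover have "(\<integral>y. (\<integral>y'. w y y' \<partial>\<mu>) \<partial>\<mu>) + (\<integral>y. (\<integral>y'. w y' y \<partial>\<mu>) \<partial>\<mu>) \<le> c0"
  proof -
    have "(\<integral>y. (\<integral>y'. w y y' \<partial>\<mu>) \<partial>\<mu>) + (\<integral>y. (\<integral>y'. w y' y \<partial>\<mu>) \<partial>\<mu>)
        = (\<integral>y. (\<integral>y'. w y y' \<partial>\<mu>) + (\<integral>y'. w y' y \<partial>\<mu>) \<partial>\<mu>)"
      by (rule Bochner_Integration.integral_add[symmetric, OF i1 i2])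
    also have "\<dots> = (\<integral>y. (\<integral>y'. w y y' + w y' y \<partial>\<mu>) \<partial>\<mu>)"
      by (intro Bochner_Integration.integral_cong refl Bochner_Integration.integral_add[symmetric] wi1 wi2)
    also have "\<dots> \<le> (\<integral>y. c0 \<partial>\<mu>)"
    proof (rule integral_mono)
      show "integrable \<mu> (\<lambda>y. \<integral>y'. w y y' + w y' y \<partial>\<mu>)"
      proof -
        have "(\<lambda>y. \<integral>y'. w y y' + w y' y \<partial>\<mu>) = (\<lambda>y. (\<integral>y'. w y y' \<partial>\<mu>) + (\<integral>y'. w y' y \<partial>\<mu>))"
          by (intro ext Bochner_Integration.integral_add wi1 wi2)
        then show ?thesis using i1 i2 by simp
      qed
      fix y
      have "(\<integral>y'. w y y' + w y' y \<partial>\<mu>) \<le> (\<integral>y'. c0 \<partial>\<mu>)"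
        using wi1 wi2 sym by (intro integral_mono) auto
      then show "(\<integral>y'. w y y' + w y' y \<partial>\<mu>) \<le> c0" by (simp add: \<mu>.prob_space)
    qed auto
    finally show ?thesis by (simp add: \<mu>.prob_space)
  qed
  ultimately show ?thesis unfolding u_def c0_def by simp
qed

text \<open>The cross terms with the shifted coordinate cancel between the two signs, leaving its
  diagonal entry.\<close>

lemma quadratic_form_parallelogram:
  assumes J: "finite J" "i \<in> J" and K: "\<And>j k. K j k = K k j"
  shows "quadratic_form J K (c(i := c i + w)) + quadratic_form J K (c(i := c i - w)) = 2 * quadratic_form J K c + 2 * w\<^sup>2 * K i i"
proof -
  define \<delta> where "\<delta> = (\<lambda>j. if j = i then 1 else 0 :: real)"
  have c: "c(i := c i + w) = (\<lambda>j. c j + w * \<delta> j)" "c(i := c i - w) = (\<lambda>j. c j - w * \<delta> j)"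
    by (auto simp: fun_eq_iff \<delta>_def)
  have "quadratic_form J K (c(i := c i + w)) + quadratic_form J K (c(i := c i - w))
      = (\<Sum>j\<in>J. \<Sum>k\<in>J. 2 * (c j * c k * K j k) + 2 * w\<^sup>2 * (\<delta> j * \<delta> k * K j k))"
    unfolding quadratic_form_def c sum.distrib[symmetric]
    by (intro sum.cong refl) (simp add: algebra_simps power2_eq_square)
  also have "\<dots> = 2 * quadratic_form J K c + 2 * w\<^sup>2 * (\<Sum>j\<in>J. \<Sum>k\<in>J. \<delta> j * \<delta> k * K j k)"
    by (simp add: quadratic_form_def sum.distrib sum_distrib_left)
  also have "(\<Sum>j\<in>J. \<Sum>k\<in>J. \<delta> j * \<delta> k * K j k) = (\<Sum>j\<in>J. if j = i then K i i else 0)"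
  proof (rule sum.cong[OF refl])
    fix j assume "j \<in> J"
    have "(\<Sum>k\<in>J. \<delta> j * \<delta> k * K j k) = (\<Sum>k\<in>J. if k = i then \<delta> j * K j i else 0)"
      by (intro sum.cong refl) (auto simp: \<delta>_def)
    then show "(\<Sum>k\<in>J. \<delta> j * \<delta> k * K j k) = (if j = i then K i i else 0)"
      using J by (simp add: \<delta>_def)
  qed
  also have "\<dots> = K i i" using J by simp
  finally show ?thesis .
qed

lemma sqrt_mean_le: 
  assumes "0 \<le> a" "0 \<le> b" shows "(sqrt a + sqrt b) / 2 \<le> sqrt ((a + b) / 2)"
proof (rule real_le_rsqrt)
  have "0 \<le> (sqrt a - sqrt b)\<^sup>2" by simp
  then have "2 * (sqrt a * sqrt b) \<le> a + b" using assms by (simp add: power2_diff)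
  moreover have "((sqrt a + sqrt b) / 2)\<^sup>2 = (a + b + 2 * (sqrt a * sqrt b)) / 4"
    using assms by (simp add: power2_sum power_divide)
  ultimately show "((sqrt a + sqrt b) / 2)\<^sup>2 \<le> (a + b) / 2" by simp
qed

text \<open>Iterating the one-coordinate step. The sign averages never have to be expanded, because the
  parallelogram identity for the quadratic form absorbs them one at a time.\<close>

lemma expectation_Max_le:
  fixes \<phi> :: "real \<Rightarrow> real \<Rightarrow> real" and x :: "'i \<Rightarrow> 'g \<Rightarrow> real"
  assumes \<mu>: "prob_space \<mu>" "sets \<mu> = sets borel"
    and F: "finite F" "F \<noteq> {}"
    and \<phi>m: "\<And>x. (\<lambda>e. \<phi> e x) \<in> borel_measurable borel"
    and \<phi>0: "\<And>e. \<phi> e 0 = 0" and L: "L \<ge> 0"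
    and lip: "\<And>e x y. \<bar>x\<bar> \<le> b \<Longrightarrow> \<bar>y\<bar> \<le> b \<Longrightarrow> \<bar>\<phi> e x - \<phi> e y\<bar> \<le> L * \<bar>x - y\<bar>"
    and x: "\<And>i g. i \<in> J \<Longrightarrow> g \<in> F \<Longrightarrow> \<bar>x i g\<bar> \<le> b"
    and J: "finite J" and K: "\<And>j k. K j k = K k j" and r: "r \<ge> 0"
    and Q0: "\<And>c. 0 \<le> quadratic_form J K c"
    and dual: "\<And>g c. g \<in> F \<Longrightarrow> (\<Sum>j\<in>J. c j * x j g) \<le> r * sqrt (quadratic_form J K c)"
    and I: "I \<subseteq> J"
  defines "H \<equiv> \<lambda>x. \<integral>e. \<phi> e x \<partial>\<mu>"
  shows "(\<integral>\<omega>. Max ((\<lambda>g. (\<Sum>j\<in>J. c j * x j g) + (\<Sum>i\<in>I. H (x i g) - \<phi> (\<omega> i) (x i g))) ` F) \<partial>(\<Pi>\<^sub>M i\<in>I. \<mu>))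
    \<le> r * sqrt (quadratic_form J K c + 4 * L\<^sup>2 * (\<Sum>i\<in>I. K i i))"
proof -
  interpret \<mu>: prob_space \<mu> by (rule \<mu>(1))
  interpret PS: product_prob_space "\<lambda>_. \<mu>" UNIV ..
  have finI: "finite I" using I J finite_subset by blast
  have \<phi>m'[measurable]: "(\<lambda>e. \<phi> e x) \<in> borel_measurable \<mu>" for x
    using \<phi>m by (subst measurable_cong_sets[OF \<mu>(2) refl])
  obtain g0 where g0: "g0 \<in> F" using F by auto
  have K0: "0 \<le> K i i" if i: "i \<in> J" for i
  proof -
    have "quadratic_form J K (\<lambda>j. if j = i then 1 else 0) = (\<Sum>j\<in>J. if j = i then K i i else 0)"
      unfolding quadratic_form_def using i J by (intro sum.cong refl) (auto simp: if_distrib[of "\<lambda>x. x * _"] sum.delta cong: if_cong)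
    then show ?thesis using Q0[of "\<lambda>j. if j = i then 1 else 0"] i J by simp
  qed
  have \<phi>b: "\<bar>\<phi> e (x i g)\<bar> \<le> L * b" if "i \<in> J" "g \<in> F" for e i g
  proof -
    have "\<bar>\<phi> e (x i g) - \<phi> e 0\<bar> \<le> L * \<bar>x i g - 0\<bar>" using x[OF that] by (intro lip) auto
    also have "\<dots> \<le> L * b" using x[OF that] L by (intro mult_left_mono) auto
    finally show ?thesis by (simp add: \<phi>0)
  qed
  have \<phi>i: "integrable \<mu> (\<lambda>e. \<phi> e (x i g))" if "i \<in> J" "g \<in> F" for i g
    by (rule \<mu>.integrable_const_bound[where B="L * b"]) (use \<phi>b[OF that] in auto)
  have Hb: "\<bar>H (x i g)\<bar> \<le> L * b" if g: "i \<in> J" "g \<in> F" for i g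
  proof -
    have "\<bar>H (x i g)\<bar> \<le> (\<integral>e. \<bar>\<phi> e (x i g)\<bar> \<partial>\<mu>)" unfolding H_def by (rule integral_abs_bound)
    also have "\<dots> \<le> (\<integral>e. L * b \<partial>\<mu>)" using \<phi>i[OF g] \<phi>b[OF g] by (intro integral_mono) auto
    finally show ?thesis by (simp add: \<mu>.prob_space)
  qed
  \<comment> \<open>The coefficient vector \<open>c\<close> is carried along so that the induction
    can absorb each removed coordinate as a shift of \<open>c\<close>.\<close>
  define \<Psi> where "\<Psi> = (\<lambda>I c \<omega> g. (\<Sum>j\<in>J. c j * x j g) + (\<Sum>i\<in>I. H (x i g) - \<phi> (\<omega> i) (x i g)))"
  define Bd where "Bd = (\<lambda>(I :: 'i set) c. Max ((\<lambda>g. \<bar>\<Sum>j\<in>J. c j * x j g\<bar>) ` F) + (\<Sum>i\<in>I. 2 * (L * b)))"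
  have \<Psi>b: "\<bar>Max (\<Psi> I c \<omega> ` F)\<bar> \<le> Bd I c" if I: "I \<subseteq> J" for I c \<omega>
  proof (rule abs_Max_image_le[OF F])
    fix g assume g: "g \<in> F"
    have "\<bar>\<Sum>i\<in>I. H (x i g) - \<phi> (\<omega> i) (x i g)\<bar> \<le> (\<Sum>i\<in>I. \<bar>H (x i g) - \<phi> (\<omega> i) (x i g)\<bar>)" by (rule sum_abs)
    also have "\<dots> \<le> (\<Sum>i\<in>I. 2 * (L * b))"
    proof (rule sum_mono)
      fix i assume "i \<in> I"
      then have "i \<in> J" using I by auto
      then show "\<bar>H (x i g) - \<phi> (\<omega> i) (x i g)\<bar> \<le> 2 * (L * b)"
        using Hb[of i g] \<phi>b[of i g "\<omega> i"] g by linarith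
    qed
    moreover have "\<bar>\<Sum>j\<in>J. c j * x j g\<bar> \<le> Max ((\<lambda>g. \<bar>\<Sum>j\<in>J. c j * x j g\<bar>) ` F)" using F g by (intro Max_ge) auto
    ultimately show "\<bar>\<Psi> I c \<omega> g\<bar> \<le> Bd I c" unfolding \<Psi>_def Bd_def by linarith
  qed
  have \<Psi>m: "(\<lambda>\<omega>. \<Psi> I c \<omega> g) \<in> borel_measurable (\<Pi>\<^sub>M i\<in>I. \<mu>)" for I c g
  proof -
    have "(\<lambda>\<omega>. \<phi> (\<omega> i) (x i g)) \<in> borel_measurable (\<Pi>\<^sub>M i\<in>I. \<mu>)" if "i \<in> I" for i
      using measurable_compose[OF measurable_component_singleton[OF that] \<phi>m'] .
    then show ?thesis
      unfolding \<Psi>_def by (intro borel_measurable_add borel_measurable_sum borel_measurable_diff) auto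
  qed
  have int: "integrable (\<Pi>\<^sub>M i\<in>I. \<mu>) (\<lambda>\<omega>. Max (\<Psi> I c \<omega> ` F))" if I: "I \<subseteq> J" for I c
  proof -
    interpret PI: prob_space "\<Pi>\<^sub>M i\<in>I. \<mu>" by (rule prob_space_PiM) (rule \<mu>(1))
    have "(\<lambda>\<omega>. Max ((\<lambda>g. \<Psi> I c \<omega> g) ` F)) \<in> borel_measurable (\<Pi>\<^sub>M i\<in>I. \<mu>)"
      by (rule borel_measurable_Max[OF F(1) \<Psi>m])
    then show ?thesis
      using \<Psi>b[OF I] by (intro PI.integrable_const_bound[where B="Bd I c"]) auto
  qed
  have "(\<integral>\<omega>. Max (\<Psi> I c \<omega> ` F) \<partial>(\<Pi>\<^sub>M i\<in>I. \<mu>)) \<le> r * sqrt (quadratic_form J K c + 4 * L\<^sup>2 * (\<Sum>i\<in>I. K i i))"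
    using finI I
  proof (induction I arbitrary: c rule: finite_induct)
    case empty
    interpret PI: prob_space "\<Pi>\<^sub>M i\<in>({} :: 'i set). \<mu>" by (rule prob_space_PiM) (rule \<mu>(1))
    have "Max (\<Psi> {} c \<omega> ` F) \<le> r * sqrt (quadratic_form J K c)" for \<omega>
      using F dual by (intro Max.boundedI) (auto simp: \<Psi>_def)
    then have "(\<integral>\<omega>. Max (\<Psi> {} c \<omega> ` F) \<partial>(\<Pi>\<^sub>M i\<in>{}. \<mu>)) \<le> (\<integral>\<omega>. r * sqrt (quadratic_form J K c) \<partial>(\<Pi>\<^sub>M i\<in>({} :: 'i set). \<mu>))"
      using int[of "{}" c] by (intro integral_mono) auto
    then show ?case by (simp add: PI.prob_space)
  next
    case (insert i I)
    then have iJ: "i \<in> J" and IJ: "I \<subseteq> J" by auto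
    \<comment> \<open>The slope delivered by \<open>contraction_step\<close>.\<close>
    define w where "w = 2 * L"
    define s where "s = 4 * L\<^sup>2 * (\<Sum>i\<in>I. K i i)"
    have s0: "0 \<le> s" unfolding s_def using K0 IJ by (intro mult_nonneg_nonneg sum_nonneg) auto
    have split: "\<Psi> (insert i I) c (fun_upd \<omega> i y) g = \<Psi> I c \<omega> g + (H (x i g) - \<phi> y (x i g))" for \<omega> y g
    proof -
      have "(\<Sum>k\<in>I. H (x k g) - \<phi> ((fun_upd \<omega> i y) k) (x k g)) = (\<Sum>k\<in>I. H (x k g) - \<phi> (\<omega> k) (x k g))"
        using insert by (intro sum.cong) auto
      then show ?thesis unfolding \<Psi>_def using insert by simp
    qed
    have shift: "\<Psi> I (c(i := c i + v)) \<omega> g = \<Psi> I c \<omega> g + v * x i g" for v \<omega> g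
    proof -
      have "(\<Sum>j\<in>J. (c(i := c i + v)) j * x j g) = (\<Sum>j\<in>J. c j * x j g + (if j = i then v * x i g else 0))"
        by (intro sum.cong) (auto simp: algebra_simps)
      then show ?thesis unfolding \<Psi>_def using J iJ by (simp add: sum.distrib)
    qed
    \<comment> \<open>The new coordinate is integrated first, with the others held fixed.\<close>
    have "(\<integral>\<omega>. Max (\<Psi> (insert i I) c \<omega> ` F) \<partial>(\<Pi>\<^sub>M i\<in>insert i I. \<mu>))
        = (\<integral>\<omega>. (\<integral>y. Max (\<Psi> (insert i I) c (fun_upd \<omega> i y) ` F) \<partial>\<mu>) \<partial>(\<Pi>\<^sub>M i\<in>I. \<mu>))"
      by (rule PS.product_integral_insert[OF insert(1,2) int]) (use insert in auto)
    also have "\<dots> \<le> (\<integral>\<omega>. (Max (\<Psi> I (c(i := c i + w)) \<omega> ` F) + Max (\<Psi> I (c(i := c i + - w)) \<omega> ` F)) / 2 \<partial>(\<Pi>\<^sub>M i\<in>I. \<mu>))"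
    proof (rule integral_mono)
      interpret PI: prob_space "\<Pi>\<^sub>M i\<in>I. \<mu>" by (rule prob_space_PiM) (rule \<mu>(1))
      show "integrable (\<Pi>\<^sub>M i\<in>I. \<mu>) (\<lambda>\<omega>. (Max (\<Psi> I (c(i := c i + w)) \<omega> ` F) + Max (\<Psi> I (c(i := c i + - w)) \<omega> ` F)) / 2)"
        using int[OF IJ] by auto
      have ie: "integrable \<mu> (\<lambda>y. Max (\<Psi> (insert i I) c (fun_upd \<omega> i y) ` F))" for \<omega>
      proof (rule \<mu>.integrable_const_bound[where B="Bd (insert i I) c"])
        show "(\<lambda>y. Max (\<Psi> (insert i I) c (fun_upd \<omega> i y) ` F)) \<in> borel_measurable \<mu>"
          unfolding split by (rule borel_measurable_Max[OF F(1)]) simp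
      qed (use \<Psi>b[OF insert.prems] in auto)
      show "integrable (\<Pi>\<^sub>M i\<in>I. \<mu>) (\<lambda>\<omega>. \<integral>y. Max (\<Psi> (insert i I) c (fun_upd \<omega> i y) ` F) \<partial>\<mu>)"
      proof (rule PI.integrable_const_bound[where B="Bd (insert i I) c"])
        have "case_prod (\<lambda>\<omega> y. Max ((\<lambda>g. \<Psi> I c \<omega> g + (H (x i g) - \<phi> y (x i g))) ` F)) \<in> borel_measurable ((\<Pi>\<^sub>M i\<in>I. \<mu>) \<Otimes>\<^sub>M \<mu>)"
          unfolding case_prod_beta
        proof (rule borel_measurable_Max[OF F(1)])
          fix g
          show "(\<lambda>p. \<Psi> I c (fst p) g + (H (x i g) - \<phi> (snd p) (x i g))) \<in> borel_measurable ((\<Pi>\<^sub>M i\<in>I. \<mu>) \<Otimes>\<^sub>M \<mu>)"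
            using measurable_compose[OF measurable_fst \<Psi>m] measurable_compose[OF measurable_snd \<phi>m']
            by (intro borel_measurable_add borel_measurable_diff) auto
        qed
        then show "(\<lambda>\<omega>. \<integral>y. Max (\<Psi> (insert i I) c (fun_upd \<omega> i y) ` F) \<partial>\<mu>) \<in> borel_measurable (\<Pi>\<^sub>M i\<in>I. \<mu>)"
          unfolding split by (rule \<mu>.borel_measurable_lebesgue_integral)
        have "\<bar>\<integral>y. Max (\<Psi> (insert i I) c (fun_upd \<omega> i y) ` F) \<partial>\<mu>\<bar> \<le> Bd (insert i I) c" for \<omega>
        proof -
          have "\<bar>\<integral>y. Max (\<Psi> (insert i I) c (fun_upd \<omega> i y) ` F) \<partial>\<mu>\<bar> \<le> (\<integral>y. \<bar>Max (\<Psi> (insert i I) c (fun_upd \<omega> i y) ` F)\<bar> \<partial>\<mu>)"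
            by (rule integral_abs_bound)
          also have "\<dots> \<le> (\<integral>y. Bd (insert i I) c \<partial>\<mu>)"
            using ie \<Psi>b[OF insert.prems] by (intro integral_mono) auto
          finally show ?thesis by (simp add: \<mu>.prob_space)
        qed
        then show "AE \<omega> in (\<Pi>\<^sub>M i\<in>I. \<mu>). norm (\<integral>y. Max (\<Psi> (insert i I) c (fun_upd \<omega> i y) ` F) \<partial>\<mu>) \<le> Bd (insert i I) c"
          by simp
      qed
      fix \<omega>
      show "(\<integral>y. Max (\<Psi> (insert i I) c (fun_upd \<omega> i y) ` F) \<partial>\<mu>) \<le> (Max (\<Psi> I (c(i := c i + w)) \<omega> ` F) + Max (\<Psi> I (c(i := c i + - w)) \<omega> ` F)) / 2"
        using contraction_step[OF \<mu> F \<phi>m \<phi>0 L lip, of b "x i" "\<Psi> I c \<omega>"] x[OF iJ]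
        unfolding split shift w_def by (simp add: H_def)
    qed
    also have "\<dots> = ((\<integral>\<omega>. Max (\<Psi> I (c(i := c i + w)) \<omega> ` F) \<partial>(\<Pi>\<^sub>M i\<in>I. \<mu>)) + (\<integral>\<omega>. Max (\<Psi> I (c(i := c i + - w)) \<omega> ` F) \<partial>(\<Pi>\<^sub>M i\<in>I. \<mu>))) / 2"
      using int[OF IJ] by simp
    also have "\<dots> \<le> (r * sqrt (quadratic_form J K (c(i := c i + w)) + s) + r * sqrt (quadratic_form J K (c(i := c i + - w)) + s)) / 2"
      unfolding s_def by (intro divide_right_mono add_mono insert.IH IJ) auto
    also have "\<dots> = r * ((sqrt (quadratic_form J K (c(i := c i + w)) + s) + sqrt (quadratic_form J K (c(i := c i + - w)) + s)) / 2)"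
      by (simp add: algebra_simps)
    \<comment> \<open>Concavity of the square root; the parallelogram identity then turns the mean
      of the two forms into the original form plus \<open>w^2 * K i i\<close>.\<close>
    also have "\<dots> \<le> r * sqrt (((quadratic_form J K (c(i := c i + w)) + s) + (quadratic_form J K (c(i := c i + - w)) + s)) / 2)"
      using r Q0 s0 by (intro mult_left_mono sqrt_mean_le) auto
    also have "((quadratic_form J K (c(i := c i + w)) + s) + (quadratic_form J K (c(i := c i + - w)) + s)) / 2
        = quadratic_form J K c + 4 * L\<^sup>2 * (\<Sum>i\<in>insert i I. K i i)"
      using quadratic_form_parallelogram[OF J iJ K, where c=c and w=w] insert
      by (simp add: s_def w_def power2_eq_square algebra_simps)
    finally show ?case .
  qed
  then show ?thesis unfolding \<Psi>_def .
qed

text \<open>What the stochastic part needs, free of function spaces: the values \<open>x i g\<close>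
  at the design points, a kernel in duality with them, and functions \<open>\<phi> e\<close> that
  vanish at 0 and are Lipschitz on the range of these values. The element \<open>g0\<close> with
  zero values makes the supremum of the deviation nonnegative, as Markov's inequality
  requires.\<close>

locale contracted_process = prob_space M for M :: "'a measure" +
  fixes \<epsilon> :: "nat \<Rightarrow> 'a \<Rightarrow> real" and n :: nat and \<phi> :: "real \<Rightarrow> real \<Rightarrow> real" and L b r :: real
    and x :: "nat \<Rightarrow> 'g \<Rightarrow> real" and K :: "nat \<Rightarrow> nat \<Rightarrow> real" and G :: "'g set" and g0 :: 'g
  assumes indep: "indep_vars (\<lambda>_. borel) \<epsilon> {1..}"
    and ident: "\<And>i. i \<ge> 1 \<Longrightarrow> distr M borel (\<epsilon> i) = distr M borel (\<epsilon> 1)"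
    and n: "n \<ge> 1"
    and \<phi>_measurable: "\<And>x. (\<lambda>e. \<phi> e x) \<in> borel_measurable borel"
    and \<phi>_0: "\<And>e. \<phi> e 0 = 0" and L: "L \<ge> 0"
    and lipschitz: "\<And>e x y. \<bar>x\<bar> \<le> b \<Longrightarrow> \<bar>y\<bar> \<le> b \<Longrightarrow> \<bar>\<phi> e x - \<phi> e y\<bar> \<le> L * \<bar>x - y\<bar>"
    and x_bound: "\<And>i g. i \<in> {1..n} \<Longrightarrow> g \<in> G \<Longrightarrow> \<bar>x i g\<bar> \<le> b"
    and K_sym: "\<And>j k. K j k = K k j" and r: "r \<ge> 0"
    and Q_nonneg: "\<And>c. 0 \<le> quadratic_form {1..n} K c"
    and dual_bound: "\<And>g c. g \<in> G \<Longrightarrow> (\<Sum>j\<in>{1..n}. c j * x j g) \<le> r * sqrt (quadratic_form {1..n} K c)"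
    and g0: "g0 \<in> G" "\<And>i. i \<in> {1..n} \<Longrightarrow> x i g0 = 0"
begin

definition "\<mu> = distr M borel (\<epsilon> 1)"

definition "H z = (\<integral>e. \<phi> e z \<partial>\<mu>)"

definition "deviation \<omega> g = (\<Sum>i\<in>{1..n}. H (x i g) - \<phi> (\<epsilon> i \<omega>) (x i g))"

lemma \<epsilon>_measurable: "i \<ge> 1 \<Longrightarrow> \<epsilon> i \<in> borel_measurable M"
  using indep by (auto simp: indep_vars_def)

lemma \<mu>: "prob_space \<mu>" "sets \<mu> = sets borel"
  unfolding \<mu>_def by (auto intro!: prob_space_distr \<epsilon>_measurable)

lemma K_diag_nonneg: "i \<in> {1..n} \<Longrightarrow> 0 \<le> K i i"
proof -
  assume i: "i \<in> {1..n}"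
  have "quadratic_form {1..n} K (\<lambda>j. if j = i then 1 else 0) = (\<Sum>j\<in>{1..n}. if j = i then K i i else 0)"
    unfolding quadratic_form_def using i
    by (intro sum.cong refl) (auto simp: if_distrib[of "\<lambda>x. x * _"] sum.delta cong: if_cong)
  then show ?thesis using Q_nonneg[of "\<lambda>j. if j = i then 1 else 0"] i by simp
qed

lemma deviation_measurable: "(\<lambda>\<omega>. deviation \<omega> g) \<in> borel_measurable M"
  unfolding deviation_def
  by (intro borel_measurable_sum borel_measurable_diff borel_measurable_const
      measurable_compose[OF \<epsilon>_measurable \<phi>_measurable]) auto

text \<open>Independence and equal laws turn the joint law of the errors into a product measure,
  where \<open>expectation_Max_le\<close> applies with \<open>c = 0\<close>; Markov's inequality
  does the rest.\<close>

lemma deviation_tail_finite: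
  assumes F: "finite F" "F \<subseteq> G" "g0 \<in> F" and a: "a > 0"
  shows "prob {\<omega>\<in>space M. \<exists>g\<in>F. deviation \<omega> g > a} \<le> r * sqrt (4 * L\<^sup>2 * (\<Sum>i\<in>{1..n}. K i i)) / a"
proof -
  define \<Phi> where "\<Phi> = (\<lambda>\<omega>. Max ((\<lambda>g. \<Sum>i\<in>{1..n}. H (x i g) - \<phi> (\<omega> i) (x i g)) ` F))"
  define \<Omega> where "\<Omega> = (\<lambda>\<omega>. \<lambda>i\<in>{1..n}. \<epsilon> i \<omega>)"
  have Fne: "F \<noteq> {}" using F by auto
  have \<Phi>\<Omega>: "\<Phi> (\<Omega> \<omega>) = Max (deviation \<omega> ` F)" for \<omega>
    unfolding \<Phi>_def deviation_def \<Omega>_def by (intro arg_cong[where f=Max] image_cong refl sum.cong) auto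
  have \<Omega>m: "\<Omega> \<in> measurable M (\<Pi>\<^sub>M i\<in>{1..n}. borel)"
    unfolding \<Omega>_def by (intro measurable_restrict \<epsilon>_measurable) auto
  have \<Phi>m: "\<Phi> \<in> borel_measurable (\<Pi>\<^sub>M i\<in>{1..n}. borel)"
    unfolding \<Phi>_def
  proof (rule borel_measurable_Max[OF F(1)])
    fix g
    have "(\<lambda>\<omega>. \<phi> (\<omega> i) (x i g)) \<in> borel_measurable (\<Pi>\<^sub>M i\<in>{1..n}. borel)" if "i \<in> {1..n}" for i
      by (rule measurable_compose[OF measurable_component_singleton[OF that] \<phi>_measurable])
    then show "(\<lambda>\<omega>. \<Sum>i\<in>{1..n}. H (x i g) - \<phi> (\<omega> i) (x i g)) \<in> borel_measurable (\<Pi>\<^sub>M i\<in>{1..n}. borel)"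
      by (intro borel_measurable_sum borel_measurable_diff borel_measurable_const)
  qed
  have ind: "indep_vars (\<lambda>_. borel) \<epsilon> {1..n}" using indep by (rule indep_vars_subset) auto
  have "distr M (\<Pi>\<^sub>M i\<in>{1..n}. borel) \<Omega> = (\<Pi>\<^sub>M i\<in>{1..n}. distr M borel (\<epsilon> i))"
    unfolding \<Omega>_def using n \<epsilon>_measurable ind
    by (intro indep_vars_iff_distr_eq_PiM'[THEN iffD1]) auto
  also have "\<dots> = (\<Pi>\<^sub>M i\<in>{1..n}. \<mu>)"
    unfolding \<mu>_def by (intro PiM_cong refl ident) auto
  finally have D: "distr M (\<Pi>\<^sub>M i\<in>{1..n}. borel) \<Omega> = (\<Pi>\<^sub>M i\<in>{1..n}. \<mu>)" .
  have "(\<integral>\<omega>. Max (deviation \<omega> ` F) \<partial>M) = (\<integral>\<omega>. \<Phi> \<omega> \<partial>(\<Pi>\<^sub>M i\<in>{1..n}. \<mu>))"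
    unfolding D[symmetric] \<Phi>\<Omega>[symmetric] by (rule integral_distr[OF \<Omega>m \<Phi>m, symmetric])
  also have "\<dots> \<le> r * sqrt (quadratic_form {1..n} K (\<lambda>_. 0) + 4 * L\<^sup>2 * (\<Sum>i\<in>{1..n}. K i i))"
  proof -
    have "(\<integral>\<omega>. Max ((\<lambda>g. (\<Sum>j\<in>{1..n}. 0 * x j g) + (\<Sum>i\<in>{1..n}. H (x i g) - \<phi> (\<omega> i) (x i g))) ` F) \<partial>(\<Pi>\<^sub>M i\<in>{1..n}. \<mu>))
      \<le> r * sqrt (quadratic_form {1..n} K (\<lambda>_. 0) + 4 * L\<^sup>2 * (\<Sum>i\<in>{1..n}. K i i))"
      unfolding H_def
      by (rule expectation_Max_le[OF \<mu> F(1) Fne \<phi>_measurable \<phi>_0 L lipschitz, where J="{1..n}" and c="\<lambda>_. 0"])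
         (use F x_bound K_sym r Q_nonneg dual_bound in auto)
    then show ?thesis unfolding \<Phi>_def by simp
  qed
  also have "quadratic_form {1..n} K (\<lambda>_. 0) = 0" by (simp add: quadratic_form_def)
  finally have E: "(\<integral>\<omega>. Max (deviation \<omega> ` F) \<partial>M) \<le> r * sqrt (4 * L\<^sup>2 * (\<Sum>i\<in>{1..n}. K i i))" by simp
  have \<phi>b: "\<bar>\<phi> e (x i g)\<bar> \<le> L * b" if "i \<in> {1..n}" "g \<in> G" for e i g
  proof -
    have "\<bar>\<phi> e (x i g) - \<phi> e 0\<bar> \<le> L * \<bar>x i g - 0\<bar>" using x_bound[OF that] by (intro lipschitz) auto
    also have "\<dots> \<le> L * b" using x_bound[OF that] L by (intro mult_left_mono) auto
    finally show ?thesis by (simp add: \<phi>_0)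
  qed
  have nn: "0 \<le> Max (deviation \<omega> ` F)" for \<omega>
  proof -
    have "deviation \<omega> g0 = 0" by (simp add: deviation_def g0(2) \<phi>_0 H_def)
    then show ?thesis using F Max_ge[of "deviation \<omega> ` F" "deviation \<omega> g0"] by simp
  qed
  have int: "integrable M (\<lambda>\<omega>. Max (deviation \<omega> ` F))"
  proof (rule integrable_const_bound[where B="(\<Sum>i\<in>{1..n}. Max ((\<lambda>g. \<bar>H (x i g)\<bar>) ` F) + L * b)"])
    show "AE \<omega> in M. norm (Max (deviation \<omega> ` F)) \<le> (\<Sum>i\<in>{1..n}. Max ((\<lambda>g. \<bar>H (x i g)\<bar>) ` F) + L * b)"
    proof (rule AE_I2)
      fix \<omega>
      have "\<bar>Max ((\<lambda>g. deviation \<omega> g) ` F)\<bar> \<le> (\<Sum>i\<in>{1..n}. Max ((\<lambda>g. \<bar>H (x i g)\<bar>) ` F) + L * b)"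
      proof (rule abs_Max_image_le[OF F(1) Fne])
        fix g assume g: "g \<in> F"
        have "\<bar>deviation \<omega> g\<bar> \<le> (\<Sum>i\<in>{1..n}. \<bar>H (x i g) - \<phi> (\<epsilon> i \<omega>) (x i g)\<bar>)"
          unfolding deviation_def by (rule sum_abs)
        also have "\<dots> \<le> (\<Sum>i\<in>{1..n}. Max ((\<lambda>g. \<bar>H (x i g)\<bar>) ` F) + L * b)"
        proof (rule sum_mono)
          fix i assume i: "i \<in> {1..n}"
          have "\<bar>H (x i g)\<bar> \<le> Max ((\<lambda>g. \<bar>H (x i g)\<bar>) ` F)" using F g by (intro Max_ge) auto
          then show "\<bar>H (x i g) - \<phi> (\<epsilon> i \<omega>) (x i g)\<bar> \<le> Max ((\<lambda>g. \<bar>H (x i g)\<bar>) ` F) + L * b"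
            using \<phi>b[OF i, of g "\<epsilon> i \<omega>"] g F(2) by (auto simp: subset_iff)
        qed
        finally show "\<bar>deviation \<omega> g\<bar> \<le> (\<Sum>i\<in>{1..n}. Max ((\<lambda>g. \<bar>H (x i g)\<bar>) ` F) + L * b)" .
      qed
      then show "norm (Max (deviation \<omega> ` F)) \<le> (\<Sum>i\<in>{1..n}. Max ((\<lambda>g. \<bar>H (x i g)\<bar>) ` F) + L * b)" by simp
    qed
    show "(\<lambda>\<omega>. Max (deviation \<omega> ` F)) \<in> borel_measurable M"
      using borel_measurable_Max[OF F(1) deviation_measurable] .
  qed
  have "prob {\<omega>\<in>space M. \<exists>g\<in>F. deviation \<omega> g > a} \<le> prob {\<omega>\<in>space M. Max (deviation \<omega> ` F) \<ge> a}"
  proof (rule finite_measure_mono)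
    show "{\<omega>\<in>space M. \<exists>g\<in>F. deviation \<omega> g > a} \<subseteq> {\<omega>\<in>space M. Max (deviation \<omega> ` F) \<ge> a}"
      using F(1) by (force intro: less_imp_le less_le_trans Max_ge)
    show "{\<omega>\<in>space M. Max (deviation \<omega> ` F) \<ge> a} \<in> events" using int by measurable
  qed
  also have "\<dots> \<le> (\<integral>\<omega>. Max (deviation \<omega> ` F) \<partial>M) / a"
    by (rule integral_Markov_inequality_measure[where A="{}"]) (use int nn a in auto)
  also have "\<dots> \<le> r * sqrt (4 * L\<^sup>2 * (\<Sum>i\<in>{1..n}. K i i)) / a"
    using E a by (intro divide_right_mono) auto
  finally show ?thesis .
qed

text \<open>Allows passing from a dense subset to all of \<open>G\<close>; the factor 2 counts the
  term and its mean.\<close>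

lemma deviation_lipschitz:
  assumes g: "g \<in> G" "g' \<in> G" and d: "\<And>i. i \<in> {1..n} \<Longrightarrow> \<bar>x i g - x i g'\<bar> \<le> d"
  shows "deviation \<omega> g \<le> deviation \<omega> g' + real n * (2 * L * d)"
proof -
  interpret \<mu>: prob_space \<mu> by (rule \<mu>)
  have "\<bar>H (x i g) - H (x i g')\<bar> \<le> L * d \<and> \<bar>\<phi> e (x i g) - \<phi> e (x i g')\<bar> \<le> L * d" if i: "i \<in> {1..n}" for i e
  proof -
    have \<phi>d: "\<bar>\<phi> e (x i g) - \<phi> e (x i g')\<bar> \<le> L * d" for e
    proof -
      have "\<bar>\<phi> e (x i g) - \<phi> e (x i g')\<bar> \<le> L * \<bar>x i g - x i g'\<bar>" using x_bound i g by (intro lipschitz) auto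
      also have "\<dots> \<le> L * d" using d[OF i] L by (intro mult_left_mono)
      finally show ?thesis .
    qed
    have int: "integrable \<mu> (\<lambda>e. \<phi> e (x i h))" if h: "h \<in> G" for h
    proof (rule \<mu>.integrable_const_bound[where B="L * b"])
      have "\<bar>\<phi> e (x i h)\<bar> \<le> L * b" for e
      proof -
        have "\<bar>\<phi> e (x i h) - \<phi> e 0\<bar> \<le> L * \<bar>x i h - 0\<bar>" using x_bound[OF i h] by (intro lipschitz) auto
        also have "\<dots> \<le> L * b" using x_bound[OF i h] L by (intro mult_left_mono) auto
        finally show ?thesis by (simp add: \<phi>_0)
      qed
      then show "AE e in \<mu>. norm (\<phi> e (x i h)) \<le> L * b" by simp
      show "(\<lambda>e. \<phi> e (x i h)) \<in> borel_measurable \<mu>"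
        using \<phi>_measurable by (subst measurable_cong_sets[OF \<mu>(2) refl])
    qed
    have "\<bar>H (x i g) - H (x i g')\<bar> = \<bar>\<integral>e. \<phi> e (x i g) - \<phi> e (x i g') \<partial>\<mu>\<bar>"
      unfolding H_def using int g by simp
    also have "\<dots> \<le> (\<integral>e. \<bar>\<phi> e (x i g) - \<phi> e (x i g')\<bar> \<partial>\<mu>)" by (rule integral_abs_bound)
    also have "\<dots> \<le> (\<integral>e. L * d \<partial>\<mu>)" using int g \<phi>d by (intro integral_mono) auto
    finally show ?thesis using \<phi>d by (simp add: \<mu>.prob_space)
  qed
  note close = this
  have "deviation \<omega> g \<le> (\<Sum>i\<in>{1..n}. (H (x i g') - \<phi> (\<epsilon> i \<omega>) (x i g')) + 2 * L * d)"
    unfolding deviation_def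
  proof (rule sum_mono)
    fix i assume "i \<in> {1..n}"
    from close[OF this, of "\<epsilon> i \<omega>"]
    show "H (x i g) - \<phi> (\<epsilon> i \<omega>) (x i g) \<le> (H (x i g') - \<phi> (\<epsilon> i \<omega>) (x i g')) + 2 * L * d"
      unfolding mult.assoc by linarith
  qed
  also have "\<dots> = deviation \<omega> g' + real n * (2 * L * d)"
    by (simp add: deviation_def sum.distrib)
  finally show ?thesis .
qed

text \<open>Only the values at the \<open>n\<close> design points matter, so a countable subset of \<open>G\<close> suffices.\<close>

lemma countable_dense_subset:
  obtains G0 where "countable G0" "G0 \<subseteq> G" "g0 \<in> G0"
    "\<And>g d. g \<in> G \<Longrightarrow> d > 0 \<Longrightarrow> \<exists>g'\<in>G0. \<forall>i\<in>{1..n}. \<bar>x i g - x i g'\<bar> \<le> d"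
proof -
  \<comment> \<open>A grid of rational target values at the \<open>n\<close> points; each target
    with nearby elements of \<open>G\<close> is represented by one of them, every other by
    \<open>g0\<close>.\<close>
  define P where "P = (\<lambda>(k::nat, q) g. g \<in> G \<and> (\<forall>i\<in>{1..n}. \<bar>x i g - q i\<bar> < 1 / (real k + 1)))"
  define pick where "pick = (\<lambda>kq. if \<exists>g. P kq g then (SOME g. P kq g) else g0)"
  define C where "C = (UNIV :: nat set) \<times> (Pi\<^sub>E {1..n} (\<lambda>_. \<rat> :: real set))"
  have pick: "pick kq \<in> G" for kq
    using g0 someI_ex[of "P kq"] by (auto simp: pick_def P_def split: prod.splits)
  show ?thesis
  proof (rule that[of "insert g0 (pick ` C)"])
    have "countable C" unfolding C_def by (intro countable_SIGMA countable_PiE countable_rat) auto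
    then show "countable (insert g0 (pick ` C))" by simp
    show "insert g0 (pick ` C) \<subseteq> G" using pick g0 by auto
    fix g d assume g: "g \<in> G" and d: "(d::real) > 0"
    obtain k :: nat where k: "1 / (real k + 1) < d / 2"
      using nat_approx_posE[of "d/2"] d by (auto simp: add.commute)
    have "\<exists>q\<in>\<rat>. \<bar>x i g - q\<bar> < 1 / (real k + 1)" for i
    proof -
      obtain q where "q \<in> \<rat>" "x i g < q" "q < x i g + 1 / (real k + 1)"
        using Rats_dense_in_real[of "x i g" "x i g + 1 / (real k + 1)"] by auto
      then show ?thesis by (intro bexI[of _ q]) auto
    qed
    then obtain q' where q': "\<And>i. q' i \<in> \<rat>" "\<And>i. \<bar>x i g - q' i\<bar> < 1 / (real k + 1)" by metis
    define q where "q = restrict q' {1..n}"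
    have kqC: "(k, q) \<in> C" using q' by (auto simp: C_def q_def)
    have "P (k, q) g" using g q' by (auto simp: P_def q_def)
    then have "P (k, q) (pick (k, q))" unfolding pick_def using someI_ex[of "P (k, q)"] by auto
    then have "\<bar>x i (pick (k, q)) - q i\<bar> < 1 / (real k + 1)" if "i \<in> {1..n}" for i
      using that by (auto simp: P_def)
    moreover have "\<bar>x i g - q i\<bar> < 1 / (real k + 1)" if "i \<in> {1..n}" for i
      using q'(2)[of i] that by (simp add: q_def)
    ultimately have "\<forall>i\<in>{1..n}. \<bar>x i g - x i (pick (k, q))\<bar> \<le> d"
      using k by (smt (verit) field_sum_of_halves)
    then show "\<exists>g'\<in>insert g0 (pick ` C). \<forall>i\<in>{1..n}. \<bar>x i g - x i g'\<bar> \<le> d"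
      using kqC by blast
  qed simp
qed

text \<open>The supremum over \<open>G\<close> need not be measurable, so an exceptional event is
  provided instead. It is the increasing union of the events for finite subsets of a countable dense
  set; their common bound survives the limit.\<close>

lemma deviation_tail:
  assumes a: "a > 0"
  obtains N where "N \<in> events" "prob N \<le> r * sqrt (4 * L\<^sup>2 * (\<Sum>i\<in>{1..n}. K i i)) / a"
    "\<And>\<omega> g. \<omega> \<in> space M - N \<Longrightarrow> g \<in> G \<Longrightarrow> deviation \<omega> g \<le> a"
proof -
  obtain G0 where G0: "countable G0" "G0 \<subseteq> G" "g0 \<in> G0"
    "\<And>g d. g \<in> G \<Longrightarrow> d > 0 \<Longrightarrow> \<exists>g'\<in>G0. \<forall>i\<in>{1..n}. \<bar>x i g - x i g'\<bar> \<le> d"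
    using countable_dense_subset by blast
  define F where "F = (\<lambda>k. insert g0 (from_nat_into G0 ` {..<k::nat}))"
  define E where "E = (\<lambda>k. {\<omega>\<in>space M. \<exists>g\<in>F k. deviation \<omega> g > a})"
  have FG0: "F k \<subseteq> G0" for k using G0(3) from_nat_into[of G0] by (auto simp: F_def)
  have UF: "(\<Union>k. F k) = G0"
  proof (rule antisym)
    show "G0 \<subseteq> (\<Union>k. F k)"
    proof
      fix g assume "g \<in> G0"
      then obtain k where "from_nat_into G0 k = g" using from_nat_into_surj[OF G0(1)] by blast
      then have "g \<in> F (Suc k)" by (auto simp: F_def)
      then show "g \<in> (\<Union>k. F k)" by blast
    qed
  qed (use FG0 in blast)
  have Em: "E k \<in> events" for k
  proof -
    have "E k = (\<Union>g\<in>F k. {\<omega>\<in>space M. deviation \<omega> g > a})" by (auto simp: E_def)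
    moreover have "{\<omega>\<in>space M. deviation \<omega> g > a} \<in> events" for g
      using deviation_measurable[of g] by measurable
    ultimately show ?thesis by (auto simp: F_def)
  qed
  have Eb: "prob (E k) \<le> r * sqrt (4 * L\<^sup>2 * (\<Sum>i\<in>{1..n}. K i i)) / a" for k
    unfolding E_def by (rule deviation_tail_finite[OF _ _ _ a]) (use FG0[of k] G0(2) in \<open>auto simp: F_def\<close>)
  have Einc: "incseq E" unfolding incseq_def E_def F_def by auto
  define N where "N = (\<Union>k. E k)"
  show ?thesis
  proof (rule that[of N])
    show "N \<in> events" unfolding N_def using Em by auto
    have "(\<lambda>k. prob (E k)) \<longlonglongrightarrow> prob N"
      unfolding N_def by (rule finite_Lim_measure_incseq) (use Em Einc in auto)
    then show "prob N \<le> r * sqrt (4 * L\<^sup>2 * (\<Sum>i\<in>{1..n}. K i i)) / a"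
      by (rule LIMSEQ_le_const2) (use Eb in auto)
    fix \<omega> g assume \<omega>: "\<omega> \<in> space M - N" and g: "g \<in> G"
    have dG0: "deviation \<omega> g' \<le> a" if gG0: "g' \<in> G0" for g'
    proof -
      obtain k where "g' \<in> F k" using gG0 UF by blast
      then show ?thesis using \<omega> by (force simp: N_def E_def)
    qed
    show "deviation \<omega> g \<le> a"
    proof (rule field_le_epsilon)
      fix e :: real assume e: "e > 0"
      \<comment> \<open>Converts the tolerance \<open>e\<close> into a distance of values; the
        \<open>+ 1\<close> covers \<open>L = 0\<close>.\<close>
      define d where "d = e / (real n * (2 * L) + 1)"
      have pos: "real n * (2 * L) + 1 > 0" using L by (intro add_nonneg_pos mult_nonneg_nonneg) auto
      then have d: "d > 0" using e by (simp add: d_def)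
      obtain g' where g': "g' \<in> G0" "\<forall>i\<in>{1..n}. \<bar>x i g - x i g'\<bar> \<le> d" using G0(4)[OF g d] by blast
      have "deviation \<omega> g \<le> deviation \<omega> g' + real n * (2 * L * d)"
        using g' G0(2) by (intro deviation_lipschitz g) auto
      also have "real n * (2 * L * d) \<le> (real n * (2 * L) + 1) * d" using d by (simp add: algebra_simps)
      also have "\<dots> = e" using pos by (simp add: d_def)
      finally show "deviation \<omega> g \<le> a + e" using dG0[OF g'(1)] by simp
    qed
  qed
qed

text \<open>By independence and centring the products off the diagonal have mean 0, so only the
  trace of the kernel enters the mean of the quadratic form.\<close>

lemma score_tail:
  assumes \<psi>: "\<psi> \<in> borel_measurable borel" and int2: "integrable M (\<lambda>\<omega>. (\<psi> (\<epsilon> 1 \<omega>))\<^sup>2)"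
    and mean: "expectation (\<lambda>\<omega>. \<psi> (\<epsilon> 1 \<omega>)) = 0" and a: "a > 0"
  shows "{\<omega>\<in>space M. quadratic_form {1..n} K (\<lambda>i. \<psi> (\<epsilon> i \<omega>)) \<ge> a} \<in> events"
    "prob {\<omega>\<in>space M. quadratic_form {1..n} K (\<lambda>i. \<psi> (\<epsilon> i \<omega>)) \<ge> a} \<le>
      expectation (\<lambda>\<omega>. (\<psi> (\<epsilon> 1 \<omega>))\<^sup>2) * (\<Sum>i\<in>{1..n}. K i i) / a"
proof -
  have m: "(\<lambda>\<omega>. \<psi> (\<epsilon> i \<omega>)) \<in> borel_measurable M" if "i \<ge> 1" for i
    by (rule measurable_compose[OF \<epsilon>_measurable[OF that] \<psi>])
  have tr: "integrable M (\<lambda>\<omega>. f (\<epsilon> i \<omega>)) = integrable M (\<lambda>\<omega>. f (\<epsilon> 1 \<omega>)) \<and>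
      expectation (\<lambda>\<omega>. f (\<epsilon> i \<omega>)) = expectation (\<lambda>\<omega>. f (\<epsilon> 1 \<omega>))"
    if f: "f \<in> borel_measurable borel" and i: "i \<ge> 1" for f :: "real \<Rightarrow> real" and i
    using integrable_distr_eq[OF \<epsilon>_measurable[OF i] f] integrable_distr_eq[OF \<epsilon>_measurable[of 1] f]
      integral_distr[OF \<epsilon>_measurable[OF i] f] integral_distr[OF \<epsilon>_measurable[of 1] f] ident[OF i] by simp
  have \<psi>2: "(\<lambda>x. (\<psi> x)\<^sup>2) \<in> borel_measurable borel" using \<psi> by simp
  have i2: "integrable M (\<lambda>\<omega>. (\<psi> (\<epsilon> i \<omega>))\<^sup>2)" "expectation (\<lambda>\<omega>. (\<psi> (\<epsilon> i \<omega>))\<^sup>2) = expectation (\<lambda>\<omega>. (\<psi> (\<epsilon> 1 \<omega>))\<^sup>2)" if "i \<ge> 1" for i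
    using tr[OF \<psi>2 that] int2 by auto
  have i1: "integrable M (\<lambda>\<omega>. \<psi> (\<epsilon> i \<omega>))" "expectation (\<lambda>\<omega>. \<psi> (\<epsilon> i \<omega>)) = 0" if "i \<ge> 1" for i
    using square_integrable_imp_integrable[OF m[OF that] i2(1)[OF that]] tr[OF \<psi> that] mean by auto
  have iv: "indep_vars (\<lambda>_. borel) (\<lambda>i \<omega>. \<psi> (\<epsilon> i \<omega>)) {1..}"
    by (rule indep_vars_compose2[OF indep]) (use \<psi> in auto)
  have pr: "integrable M (\<lambda>\<omega>. \<psi> (\<epsilon> i \<omega>) * \<psi> (\<epsilon> j \<omega>)) \<and>
      expectation (\<lambda>\<omega>. \<psi> (\<epsilon> i \<omega>) * \<psi> (\<epsilon> j \<omega>)) = (if i = j then expectation (\<lambda>\<omega>. (\<psi> (\<epsilon> 1 \<omega>))\<^sup>2) else 0)"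
    if ij: "i \<ge> 1" "j \<ge> 1" for i j
  proof (cases "i = j")
    case True
    then show ?thesis using i2[OF ij(1)] by (simp add: power2_eq_square)
  next
    case False
    have iv2: "indep_vars (\<lambda>_. borel) (\<lambda>i \<omega>. \<psi> (\<epsilon> i \<omega>)) {i, j}" using iv by (rule indep_vars_subset) (use ij in auto)
    have ii: "\<And>k. k \<in> {i, j} \<Longrightarrow> integrable M (\<lambda>\<omega>. \<psi> (\<epsilon> k \<omega>))" using i1 ij by auto
    show ?thesis
      using indep_vars_lebesgue_integral[OF _ iv2 ii] indep_vars_integrable[OF _ iv2 ii] False i1(2)[OF ij(1)] by simp
  qed
  have intQ: "integrable M (\<lambda>\<omega>. quadratic_form {1..n} K (\<lambda>i. \<psi> (\<epsilon> i \<omega>)))"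
    unfolding quadratic_form_def using pr
    by (intro Bochner_Integration.integrable_sum Bochner_Integration.integrable_mult_left) auto
  then show "{\<omega>\<in>space M. quadratic_form {1..n} K (\<lambda>i. \<psi> (\<epsilon> i \<omega>)) \<ge> a} \<in> events" by measurable
  have "expectation (\<lambda>\<omega>. quadratic_form {1..n} K (\<lambda>i. \<psi> (\<epsilon> i \<omega>)))
      = (\<Sum>i\<in>{1..n}. \<Sum>j\<in>{1..n}. expectation (\<lambda>\<omega>. \<psi> (\<epsilon> i \<omega>) * \<psi> (\<epsilon> j \<omega>) * K i j))"
    unfolding quadratic_form_def using pr
    by (subst Bochner_Integration.integral_sum;
        (intro Bochner_Integration.integrable_sum Bochner_Integration.integrable_mult_left)?;
        simp add: Bochner_Integration.integral_sum)
  also have "\<dots> = (\<Sum>i\<in>{1..n}. \<Sum>j\<in>{1..n}. if j = i then expectation (\<lambda>\<omega>. (\<psi> (\<epsilon> 1 \<omega>))\<^sup>2) * K i i else 0)"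
    by (intro sum.cong refl) (use pr in auto)
  also have "\<dots> = expectation (\<lambda>\<omega>. (\<psi> (\<epsilon> 1 \<omega>))\<^sup>2) * (\<Sum>i\<in>{1..n}. K i i)"
    by (simp add: sum_distrib_left)
  finally have EQ: "expectation (\<lambda>\<omega>. quadratic_form {1..n} K (\<lambda>i. \<psi> (\<epsilon> i \<omega>))) = expectation (\<lambda>\<omega>. (\<psi> (\<epsilon> 1 \<omega>))\<^sup>2) * (\<Sum>i\<in>{1..n}. K i i)" .
  have "prob {\<omega>\<in>space M. quadratic_form {1..n} K (\<lambda>i. \<psi> (\<epsilon> i \<omega>)) \<ge> a} \<le> expectation (\<lambda>\<omega>. quadratic_form {1..n} K (\<lambda>i. \<psi> (\<epsilon> i \<omega>))) / a"
    by (rule integral_Markov_inequality_measure[where A="{}"]) (use intQ Q_nonneg a in auto)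
  then show "prob {\<omega>\<in>space M. quadratic_form {1..n} K (\<lambda>i. \<psi> (\<epsilon> i \<omega>)) \<ge> a} \<le>
      expectation (\<lambda>\<omega>. (\<psi> (\<epsilon> 1 \<omega>))\<^sup>2) * (\<Sum>i\<in>{1..n}. K i i) / a" unfolding EQ .
qed

end

section \<open>Subgradients and the remainder of the loss\<close>

lemma subgradient_increment_bounds:
  assumes "is_subgradient \<rho> \<psi>"
  shows "\<psi> u * (v - u) \<le> \<rho> v - \<rho> u" "\<rho> v - \<rho> u \<le> \<psi> v * (v - u)"
proof -
  have "\<rho> v \<ge> \<rho> u + \<psi> u * (v - u)" using assms by (simp add: is_subgradient_def)
  then show "\<psi> u * (v - u) \<le> \<rho> v - \<rho> u" by linarith
  have "\<rho> u \<ge> \<rho> v + \<psi> v * (u - v)" using assms by (simp add: is_subgradient_def)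
  then show "\<rho> v - \<rho> u \<le> \<psi> v * (v - u)" by (simp add: algebra_simps)
qed

lemma subgradient_mono:
  assumes "is_subgradient \<rho> \<psi>" shows "mono \<psi>"
proof (rule monoI)
  fix u v :: real assume "u \<le> v"
  have "\<psi> u * (v - u) \<le> \<psi> v * (v - u)" using subgradient_increment_bounds[OF assms, where u=u and v=v] by linarith
  then show "\<psi> u \<le> \<psi> v" using \<open>u \<le> v\<close> by (cases "u = v") auto
qed

text \<open>The increment of the loss when the residual \<open>e\<close> drops by \<open>x\<close>,
  freed of its linear part \<open>- x * \<psi> e\<close>. The score is split off because
  \<open>\<psi>\<close> may be unbounded, while by (A2) the remainder is Lipschitz for small
  \<open>x\<close>, uniformly in \<open>e\<close>.\<close>

definition remainder_loss :: "(real \<Rightarrow> real) \<Rightarrow> (real \<Rightarrow> real) \<Rightarrow> real \<Rightarrow> real \<Rightarrow> real" where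
  "remainder_loss \<rho> \<psi> e x = \<rho> (e - x) - \<rho> e + x * \<psi> e"

lemma remainder_loss_lipschitz:
  assumes sg: "is_subgradient \<rho> \<psi>" and osc: "\<And>x y. \<bar>y\<bar> < \<kappa> \<Longrightarrow> \<bar>\<psi> (x + y) - \<psi> x\<bar> \<le> M1"
    and xy: "\<bar>x\<bar> < \<kappa>" "\<bar>y\<bar> < \<kappa>"
  shows "\<bar>remainder_loss \<rho> \<psi> e x - remainder_loss \<rho> \<psi> e y\<bar> \<le> M1 * \<bar>x - y\<bar>"
proof -
  have *: "remainder_loss \<rho> \<psi> e x - remainder_loss \<rho> \<psi> e y \<le> M1 * \<bar>x - y\<bar>" if xy: "\<bar>x\<bar> < \<kappa>" "\<bar>y\<bar> < \<kappa>" for x y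
  proof -
    have "remainder_loss \<rho> \<psi> e x - remainder_loss \<rho> \<psi> e y = (\<rho> (e - x) - \<rho> (e - y)) + (x - y) * \<psi> e"
      by (simp add: remainder_loss_def algebra_simps)
    also have "\<dots> \<le> \<psi> (e - x) * ((e - x) - (e - y)) + (x - y) * \<psi> e"
      using subgradient_increment_bounds(2)[OF sg, where v="e - x" and u="e - y"] by linarith
    also have "\<dots> = (x - y) * (\<psi> e - \<psi> (e + - x))" by (simp add: algebra_simps)
    also have "\<dots> \<le> \<bar>x - y\<bar> * \<bar>\<psi> e - \<psi> (e + - x)\<bar>" by (metis abs_ge_self abs_mult)
    also have "\<dots> \<le> \<bar>x - y\<bar> * M1"
      using osc[of "- x" e] xy by (intro mult_left_mono) (auto simp: abs_minus_commute)
    finally show ?thesis by (simp add: mult.commute)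
  qed
  show ?thesis using *[OF xy] *[OF xy(2,1)] by (simp add: abs_minus_commute abs_le_iff)
qed

text \<open>The tangent inequality at \<open>e\<close> alone would only give 0. Passing through the
  midpoint \<open>e - x / 2\<close> and using the subgradient there on the far half retains the
  increase of \<open>\<psi>\<close>, and with it the curvature.\<close>

lemma remainder_loss_ge:
  assumes sg: "is_subgradient \<rho> \<psi>"
  shows "x / 2 * (\<psi> e - \<psi> (e + - (x / 2))) \<le> remainder_loss \<rho> \<psi> e x"
proof -
  have "\<psi> (e + - (x/2)) * ((e - x) - (e + - (x/2))) \<le> \<rho> (e - x) - \<rho> (e + - (x/2))"
    by (rule subgradient_increment_bounds(1)[OF sg])
  moreover have "\<psi> e * ((e + - (x/2)) - e) \<le> \<rho> (e + - (x/2)) - \<rho> e"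
    by (rule subgradient_increment_bounds(1)[OF sg])
  ultimately show ?thesis by (simp add: remainder_loss_def field_simps)
qed

section \<open>The tail of the estimation error\<close>

text \<open>A function farther out is pulled back along the segment to \<open>f0\<close> until it
  meets the sphere; by convexity the objective there is at most its value at \<open>f0\<close>,
  against \<open>gap\<close>. The expression in \<open>gap\<close> is the increase of the objective:
  the terms with \<open>\<psi>\<close> cancel in it and only separate the score from the
  remainder.\<close>

lemma minimizers_near_center:
  fixes t y e :: "nat \<Rightarrow> real"
  assumes m: "m \<ge> 1" and lam: "lam > 0" and n: "n \<ge> 1" and conv: "convex_on UNIV \<rho>" and r: "r > 0"
    and f0: "f0 \<in> sobolev01 m 2" and y: "\<And>i. i \<in> {1..n} \<Longrightarrow> y i = f0 (t i) + e i"
    and gap: "\<And>g. g \<in> sobolev01 m 2 \<Longrightarrow> sobolev_sq m lam g = r\<^sup>2 \<Longrightarrow>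
      0 < 1 / real n * (\<Sum>i=1..n. remainder_loss \<rho> \<psi> (e i) (g (t i)) - g (t i) * \<psi> (e i))
        + lam * (2 * (\<integral>x. deriv01 m f0 x * deriv01 m g x \<partial>leb01) + L2_sq leb01 (deriv01 m g))"
    and f: "f \<in> sobolev01 m 2" and le: "M_spline_objective \<rho> m lam n t y f \<le> M_spline_objective \<rho> m lam n t y f0"
  shows "sobolev_sq m lam (\<lambda>x. f x - f0 x) \<le> r\<^sup>2"
proof (rule ccontr)
  let ?J = "M_spline_objective \<rho> m lam n t y" and ?D = "deriv01 m"
  note si = sobolev01_square_integrable[OF m]
  define N where "N = sobolev_sq m lam (\<lambda>x. f x - f0 x)"
  assume "\<not> sobolev_sq m lam (\<lambda>x. f x - f0 x) \<le> r\<^sup>2"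
  then have N: "r\<^sup>2 < N" by (simp add: N_def)
  then have N0: "0 < N" using r by (meson order_less_trans zero_less_power)
  \<comment> \<open>The share of the way from \<open>f0\<close> to \<open>f\<close> at which the
    distance equals \<open>r\<close>.\<close>
  define s where "s = r / sqrt N"
  have "r < sqrt N" using N r by (intro real_less_rsqrt)
  then have s: "0 < s" "s < 1" using r N0 by (auto simp: s_def)
  have sN: "s\<^sup>2 * N = r\<^sup>2" using N0 by (simp add: s_def power_divide)
  define g where "g = (\<lambda>x. s * f x + (- s) * f0 x)"
  have gS: "g \<in> sobolev01 m 2" unfolding g_def by (rule sobolev01_lin(1)[OF m f f0])
  have sc: "L2_sq M (\<lambda>x. s * u x + (- s) * v x) = s\<^sup>2 * L2_sq M (\<lambda>x. u x - v x)" for M and u v :: "real \<Rightarrow> real"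
  proof -
    have "(\<lambda>x. (s * u x + (- s) * v x)\<^sup>2) = (\<lambda>x. s\<^sup>2 * (u x - v x)\<^sup>2)"
      by (auto simp: fun_eq_iff power2_eq_square algebra_simps)
    then show ?thesis by (simp add: L2_sq_def)
  qed
  have "sobolev_sq m lam g = s\<^sup>2 * N"
    unfolding sobolev_sq_def N_def sobolev01_diff(2)[OF m f f0]
    unfolding g_def L2_sq_deriv_lin[OF m f f0] sc by (simp add: algebra_simps)
  then have gr: "sobolev_sq m lam g = r\<^sup>2" using sN by simp
  define p where "p = (\<lambda>x. 1 * f0 x + 1 * g x)"
  have p_eq: "p = (\<lambda>x. (1 - s) * f0 x + s * f x)" by (auto simp: p_def g_def fun_eq_iff algebra_simps)
  have Lp: "L2_sq leb01 (?D p) = L2_sq leb01 (?D f0) + 2 * (\<integral>x. ?D f0 x * ?D g x \<partial>leb01) + L2_sq leb01 (?D g)"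
    unfolding p_def L2_sq_deriv_lin[OF m f0 gS] L2_sq_lin[OF si(2)[OF f0] si(2)[OF gS]] by simp
  have Sp: "(\<Sum>i=1..n. \<rho> (y i - p (t i))) = (\<Sum>i=1..n. remainder_loss \<rho> \<psi> (e i) (g (t i)) - g (t i) * \<psi> (e i)) + (\<Sum>i=1..n. \<rho> (y i - f0 (t i)))"
    unfolding sum.distrib[symmetric]
  proof (rule sum.cong[OF refl])
    fix i assume "i \<in> {1..n}"
    then have "y i - p (t i) = e i - g (t i)" "y i - f0 (t i) = e i" using y by (auto simp: p_def)
    then show "\<rho> (y i - p (t i)) = remainder_loss \<rho> \<psi> (e i) (g (t i)) - g (t i) * \<psi> (e i) + \<rho> (y i - f0 (t i))"
      by (simp add: remainder_loss_def)
  qed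
  have "?J p - ?J f0 = 1 / real n * (\<Sum>i=1..n. remainder_loss \<rho> \<psi> (e i) (g (t i)) - g (t i) * \<psi> (e i))
        + lam * (2 * (\<integral>x. ?D f0 x * ?D g x \<partial>leb01) + L2_sq leb01 (?D g))"
    unfolding M_spline_objective_eq Sp Lp by (simp add: algebra_simps add_divide_distrib diff_divide_distrib)
  then have gt: "?J f0 < ?J p" using gap[OF gS gr] by linarith
  have "(\<Sum>i=1..n. \<rho> (y i - p (t i))) \<le> (\<Sum>i=1..n. (1 - s) * \<rho> (y i - f0 (t i)) + s * \<rho> (y i - f (t i)))"
  proof (rule sum_mono)
    fix i
    have cv: "\<rho> ((1 - s) *\<^sub>R (y i - f0 (t i)) + s *\<^sub>R (y i - f (t i))) \<le> (1 - s) * \<rho> (y i - f0 (t i)) + s * \<rho> (y i - f (t i))"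
      using s by (intro convex_onD[OF conv]) auto
    have "(1 - s) *\<^sub>R (y i - f0 (t i)) + s *\<^sub>R (y i - f (t i)) = y i - p (t i)"
      by (simp add: p_eq algebra_simps)
    from cv[unfolded this] show "\<rho> (y i - p (t i)) \<le> (1 - s) * \<rho> (y i - f0 (t i)) + s * \<rho> (y i - f (t i))" .
  qed
  then have S: "(\<Sum>i=1..n. \<rho> (y i - p (t i))) \<le> (1 - s) * (\<Sum>i=1..n. \<rho> (y i - f0 (t i))) + s * (\<Sum>i=1..n. \<rho> (y i - f (t i)))"
    by (simp add: sum.distrib sum_distrib_left)
  \<comment> \<open>Convexity of the squared norm; the discarded defect is
    \<open>(1 - s) * s\<close> times a squared distance.\<close>
  have Lc: "L2_sq leb01 (?D p) \<le> (1 - s) * L2_sq leb01 (?D f0) + s * L2_sq leb01 (?D f)"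
  proof -
    let ?a = "L2_sq leb01 (?D f0)" and ?b = "\<integral>x. ?D f0 x * ?D f x \<partial>leb01" and ?c = "L2_sq leb01 (?D f)"
    have "L2_sq leb01 (?D p) = (1 - s)\<^sup>2 * ?a + 2 * (1 - s) * s * ?b + s\<^sup>2 * ?c"
      unfolding p_eq L2_sq_deriv_lin[OF m f0 f] L2_sq_lin[OF si(2)[OF f0] si(2)[OF f]] ..
    also have "\<dots> = (1 - s) * ?a + s * ?c - (1 - s) * s * (?a - 2 * ?b + ?c)"
      by (simp add: power2_eq_square algebra_simps)
    also have "?a - 2 * ?b + ?c = L2_sq leb01 (\<lambda>x. 1 * ?D f0 x + (-1) * ?D f x)"
      unfolding L2_sq_lin[OF si(2)[OF f0] si(2)[OF f]] by simp
    finally show ?thesis using s L2_sq_nonneg[of leb01 "\<lambda>x. 1 * ?D f0 x + (-1) * ?D f x"]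
      by (smt (verit) mult_nonneg_nonneg)
  qed
  have "?J p \<le> 1 / real n * ((1 - s) * (\<Sum>i=1..n. \<rho> (y i - f0 (t i))) + s * (\<Sum>i=1..n. \<rho> (y i - f (t i))))
      + lam * ((1 - s) * L2_sq leb01 (?D f0) + s * L2_sq leb01 (?D f))"
    unfolding M_spline_objective_eq using lam by (intro add_mono mult_left_mono S Lc) auto
  also have "\<dots> = (1 - s) * ?J f0 + s * ?J f"
    unfolding M_spline_objective_eq by (simp add: algebra_simps add_divide_distrib diff_divide_distrib)
  also have "\<dots> \<le> (1 - s) * ?J f0 + s * ?J f0" using le s by (intro add_mono mult_left_mono) auto
  also have "\<dots> = ?J f0" by (simp add: algebra_simps)
  finally show False using gt by simp
qed

text \<open>Since \<open>\<psi>\<close> is centred and its mean increases through \<open>0\<close>, the convex \<open>\<rho>\<close> cannot be constant on a half-line.\<close>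

lemma loss_coercive:
  assumes sg: "is_subgradient \<rho> \<psi>" and pos: "\<psi> x1 > 0" and neg: "\<psi> x2 < 0" and rho0: "\<And>x. \<rho> x \<ge> 0"
  shows "\<exists>\<alpha>>0. \<exists>\<beta>. \<forall>x. \<alpha> * \<bar>x\<bar> - \<beta> \<le> \<rho> x"
proof -
  define \<alpha> where "\<alpha> = min (\<psi> x1) (- \<psi> x2)"
  define \<beta> where "\<beta> = \<bar>\<psi> x1 * x1\<bar> + \<bar>\<psi> x2 * x2\<bar>"
  have "\<alpha> * \<bar>x\<bar> - \<beta> \<le> \<rho> x" for x
  proof (cases "x \<ge> 0")
    case True
    have "\<alpha> * \<bar>x\<bar> \<le> \<psi> x1 * x" using True by (auto simp: \<alpha>_def intro!: mult_right_mono)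
    moreover have "\<rho> x1 + \<psi> x1 * (x - x1) \<le> \<rho> x" using sg by (simp add: is_subgradient_def)
    then have "\<rho> x1 + \<psi> x1 * x - \<psi> x1 * x1 \<le> \<rho> x" by (simp add: right_diff_distrib)
    ultimately show ?thesis using rho0[of x1] unfolding \<beta>_def by linarith
  next
    case False
    have "\<alpha> * \<bar>x\<bar> \<le> (- \<psi> x2) * (- x)" using False unfolding \<alpha>_def by (intro mult_mono) (auto simp: min_def pos neg less_imp_le)
    then have "\<alpha> * \<bar>x\<bar> \<le> \<psi> x2 * x" by simp
    moreover have "\<rho> x2 + \<psi> x2 * (x - x2) \<le> \<rho> x" using sg by (simp add: is_subgradient_def)
    then have "\<rho> x2 + \<psi> x2 * x - \<psi> x2 * x2 \<le> \<rho> x" by (simp add: right_diff_distrib)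
    ultimately show ?thesis using rho0[of x2] unfolding \<beta>_def by linarith
  qed
  moreover have "\<alpha> > 0" using pos neg by (simp add: \<alpha>_def)
  ultimately show ?thesis by blast
qed

text \<open>(A5) for the square of \<open>g\<close>: its variation is at most twice the product of
  the norms of \<open>g\<close> and of its derivative, which the interpolation inequality bounds by
  the squared Sobolev norm divided by \<open>h\<close>. The relative error is thus of order
  \<open>1 / (n * h)\<close>.\<close>

lemma quadrature_lower_bound:
  assumes m: "m \<ge> 1" and n: "n \<ge> 2" and h: "0 < h" "h \<le> 1/2"
    and A5: "\<And>f. f \<in> sobolev01 1 1 \<Longrightarrow>
      \<bar>1 / real n * (\<Sum>i=1..n. f (t i)) - (LINT x:{0..1}|lebesgue. f x)\<bar>
        \<le> M3 / real n * (LINT x:{0..1}|lebesgue. \<bar>deriv01 1 f x\<bar>)"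
    and C: "C > 0" "\<And>D. primitive_chain m D \<Longrightarrow>
      h\<^sup>2 * L2_sq leb01 (D 1) \<le> C * (L2_sq leb01 (D 0) + h ^ (2 * m) * L2_sq leb01 (D m))"
    and g: "g \<in> sobolev01 m 2"
  shows "L2_sq leb01 g - 2 * \<bar>M3\<bar> * sqrt C / (real n * h) * sobolev_sq m (h ^ (2 * m)) g
    \<le> 1 / real n * (\<Sum>i=1..n. (g (t i))\<^sup>2)"
proof -
  let ?Q = "sobolev_sq m (h ^ (2 * m)) g"
  note W = sobolev01_square_W11[OF m g]
  have hm: "0 \<le> h ^ (2 * m)" using h by simp
  have Q0: "0 \<le> ?Q" using hm by (simp add: sobolev_sq_def)
  have "h\<^sup>2 * L2_sq leb01 (deriv01 1 g) \<le> C * ?Q"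
    using C(2)[OF sobolev01_chain[OF g m]] by (simp add: sobolev_sq_def)
  then have "L2_sq leb01 (deriv01 1 g) \<le> C * ?Q / h\<^sup>2" using h by (simp add: field_simps)
  then have "sqrt (L2_sq leb01 (deriv01 1 g)) \<le> sqrt (C * ?Q / h\<^sup>2)" by simp
  also have "\<dots> = sqrt C * sqrt ?Q / h" using h by (simp add: real_sqrt_mult real_sqrt_divide)
  finally have d: "sqrt (L2_sq leb01 (deriv01 1 g)) \<le> sqrt C * sqrt ?Q / h" .
  have g2: "sqrt (L2_sq leb01 g) \<le> sqrt ?Q" using hm by (simp add: sobolev_sq_def)
  have "\<bar>1 / real n * (\<Sum>i=1..n. g (t i) * g (t i)) - L2_sq leb01 g\<bar>
      \<le> M3 / real n * (\<integral>x. \<bar>deriv01 1 (\<lambda>x. g x * g x) x\<bar> \<partial>leb01)"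
    using A5[OF W(1)] unfolding set_integral_leb01 by (simp add: L2_sq_def power2_eq_square del: deriv01.simps)
  also have "\<dots> \<le> \<bar>M3\<bar> / real n * (\<integral>x. \<bar>deriv01 1 (\<lambda>x. g x * g x) x\<bar> \<partial>leb01)"
    by (intro mult_right_mono divide_right_mono Bochner_Integration.integral_nonneg) auto
  also have "\<dots> \<le> \<bar>M3\<bar> / real n * (2 * sqrt ?Q * (sqrt C * sqrt ?Q / h))"
  proof (intro mult_left_mono)
    have "2 * sqrt (L2_sq leb01 g) * sqrt (L2_sq leb01 (deriv01 1 g)) \<le> 2 * sqrt ?Q * (sqrt C * sqrt ?Q / h)"
      using g2 d h C(1) Q0 by (intro mult_mono) auto
    then show "(\<integral>x. \<bar>deriv01 1 (\<lambda>x. g x * g x) x\<bar> \<partial>leb01) \<le> 2 * sqrt ?Q * (sqrt C * sqrt ?Q / h)"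
      using W(2) by (rule order_trans[rotated])
  qed auto
  also have "\<dots> = 2 * \<bar>M3\<bar> * sqrt C / (real n * h) * (sqrt ?Q * sqrt ?Q)" by simp
  also have "sqrt ?Q * sqrt ?Q = ?Q" using Q0 by simp
  finally show ?thesis by (simp add: power2_eq_square)
qed

section \<open>Curvature of the expected loss and the tail bound\<close>

context prob_space
begin

text \<open>The mean of \<open>remainder_loss_ge\<close>, with (A4) expanded at
  \<open>s = - (z / 2)\<close>, where the error is at most half of the main term. What is left is
  \<open>\<xi> / 2 * s^2\<close>, that is \<open>\<xi> / 8 * z^2\<close>.\<close>

lemma remainder_loss_mean_lower_bound:
  assumes sg: "is_subgradient \<rho> \<psi>" and \<rho>m: "\<rho> \<in> borel_measurable borel" and e: "e \<in> borel_measurable M"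
    and osc: "\<And>x y. \<bar>y\<bar> < \<kappa> \<Longrightarrow> \<bar>\<psi> (x + y) - \<psi> x\<bar> \<le> M1"
    and int: "integrable M (\<lambda>\<omega>. \<psi> (e \<omega>))" and mean: "expectation (\<lambda>\<omega>. \<psi> (e \<omega>)) = 0"
    and lin: "\<And>s. \<bar>s\<bar> < \<delta> \<Longrightarrow> \<bar>expectation (\<lambda>\<omega>. \<psi> (e \<omega> + s)) - \<xi> * s\<bar> \<le> \<xi> / 2 * \<bar>s\<bar>"
    and z: "\<bar>z\<bar> < \<kappa>" "\<bar>z\<bar> < \<delta>"
  shows "\<xi> / 8 * z\<^sup>2 \<le> expectation (\<lambda>\<omega>. remainder_loss \<rho> \<psi> (e \<omega>) z)"
proof -
  have \<psi>m: "\<psi> \<in> borel_measurable borel" by (rule borel_measurable_mono[OF subgradient_mono[OF sg]])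
  define s where "s = - (z / 2)"
  have s: "\<bar>s\<bar> < \<kappa>" "\<bar>s\<bar> < \<delta>" using z by (auto simp: s_def)
  have ism: "(\<lambda>\<omega>. \<psi> (e \<omega> + s)) \<in> borel_measurable M"
    by (rule measurable_compose[OF _ \<psi>m]) (use e in simp)
  \<comment> \<open>The shifted score is integrable because by (A2) it differs from the unshifted
    one by at most \<open>M1\<close>.\<close>
  have idiff: "integrable M (\<lambda>\<omega>. \<psi> (e \<omega> + s) - \<psi> (e \<omega>))"
    by (rule integrable_const_bound[where B=M1]) (use osc[OF s(1)] ism int in auto)
  have is': "integrable M (\<lambda>\<omega>. \<psi> (e \<omega> + s))"
    using Bochner_Integration.integrable_add[OF idiff int] by simp
  have ir: "integrable M (\<lambda>\<omega>. remainder_loss \<rho> \<psi> (e \<omega>) z)"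
  proof (rule integrable_const_bound[where B="M1 * \<bar>z\<bar>"])
    have "\<bar>remainder_loss \<rho> \<psi> u z\<bar> \<le> M1 * \<bar>z\<bar>" for u
      using remainder_loss_lipschitz[OF sg osc z(1), of 0 u] z by (simp add: remainder_loss_def)
    then show "AE \<omega> in M. norm (remainder_loss \<rho> \<psi> (e \<omega>) z) \<le> M1 * \<bar>z\<bar>" by simp
    have "(\<lambda>u. remainder_loss \<rho> \<psi> u z) \<in> borel_measurable borel"
      unfolding remainder_loss_def using \<rho>m \<psi>m by measurable
    then show "(\<lambda>\<omega>. remainder_loss \<rho> \<psi> (e \<omega>) z) \<in> borel_measurable M" by (rule measurable_compose[OF e])
  qed
  have "\<xi> / 8 * z\<^sup>2 = \<xi> / 2 * s\<^sup>2" by (simp add: s_def power2_eq_square)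
  also have "\<dots> \<le> s * expectation (\<lambda>\<omega>. \<psi> (e \<omega> + s))"
  proof -
    let ?E = "expectation (\<lambda>\<omega>. \<psi> (e \<omega> + s))"
    have "\<bar>s * (?E - \<xi> * s)\<bar> \<le> \<bar>s\<bar> * (\<xi> / 2 * \<bar>s\<bar>)"
      unfolding abs_mult by (intro mult_left_mono lin s) auto
    also have "\<dots> = \<xi> / 2 * s\<^sup>2" by (simp add: power2_eq_square)
    finally have "s * (?E - \<xi> * s) \<ge> - (\<xi> / 2 * s\<^sup>2)" by linarith
    then show ?thesis by (simp add: power2_eq_square algebra_simps)
  qed
  also have "\<dots> = expectation (\<lambda>\<omega>. z / 2 * (\<psi> (e \<omega>) - \<psi> (e \<omega> + s)))"
    using int is' mean by (simp add: s_def)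
  also have "\<dots> \<le> expectation (\<lambda>\<omega>. remainder_loss \<rho> \<psi> (e \<omega>) z)"
    by (rule integral_mono) (use int is' ir remainder_loss_ge[OF sg] in \<open>auto simp: s_def\<close>)
  finally show ?thesis .
qed

text \<open>On the sphere of radius \<open>r = D sqrt Cn\<close> the curvature term is of order \<open>D\<^sup>2 Cn\<close>, whereas the score, the
  deviation of the remainder and the penalty are of order \<open>D Cn\<close> outside small events.\<close>

lemma M_spline_tail:
  fixes t :: "nat \<Rightarrow> real" and \<epsilon> :: "nat \<Rightarrow> 'a \<Rightarrow> real"
  assumes m: "m \<ge> 1" and n: "n \<ge> 2" and h: "0 < h" "h \<le> 1/2"
    and f0: "f0 \<in> sobolev01 m 2" and t: "\<And>i. i \<in> {1..n} \<Longrightarrow> t i \<in> {0..1}"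
    and indep: "indep_vars (\<lambda>_. borel) \<epsilon> {1..}" and ident: "\<And>i. i \<ge> 1 \<Longrightarrow> distr M borel (\<epsilon> i) = distr M borel (\<epsilon> 1)"
    and conv: "convex_on UNIV \<rho>" and \<rho>m: "\<rho> \<in> borel_measurable borel" and sg: "is_subgradient \<rho> \<psi>"
    and osc: "\<And>x y. \<bar>y\<bar> < \<kappa> \<Longrightarrow> \<bar>\<psi> (x + y) - \<psi> x\<bar> \<le> M1" and M1: "M1 \<ge> 0"
    and int2: "integrable M (\<lambda>\<omega>. (\<psi> (\<epsilon> 1 \<omega>))\<^sup>2)" and mean: "expectation (\<lambda>\<omega>. \<psi> (\<epsilon> 1 \<omega>)) = 0"
    and curv: "\<And>z. \<bar>z\<bar> \<le> b \<Longrightarrow> \<xi> / 8 * z\<^sup>2 \<le> expectation (\<lambda>\<omega>. remainder_loss \<rho> \<psi> (\<epsilon> 1 \<omega>) z)"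
    and b: "b < \<kappa>" and \<xi>: "\<xi> > 0"
    and A5: "\<And>f. f \<in> sobolev01 1 1 \<Longrightarrow>
      \<bar>1 / real n * (\<Sum>i=1..n. f (t i)) - (LINT x:{0..1}|lebesgue. f x)\<bar>
        \<le> M3 / real n * (LINT x:{0..1}|lebesgue. \<bar>deriv01 1 f x\<bar>)"
    and Ci: "Ci > 0" "\<And>D. primitive_chain m D \<Longrightarrow>
      h\<^sup>2 * L2_sq leb01 (D 1) \<le> Ci * (L2_sq leb01 (D 0) + h ^ (2 * m) * L2_sq leb01 (D m))"
    and K_sym: "\<And>s t. K s t = K t s" and K_diag: "\<And>t. t \<in> {0..1} \<Longrightarrow> K t t \<le> Ck / h" and Ck: "Ck > 0"
    and K_dual: "\<And>(J :: nat set) x c. finite J \<and> (\<forall>i\<in>J. x i \<in> {0..1}) \<Longrightarrow>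
       0 \<le> quadratic_form J (\<lambda>i j. K (x i) (x j)) c \<and>
       (\<forall>D. primitive_chain m D \<longrightarrow> \<bar>\<Sum>i\<in>J. c i * D 0 (x i)\<bar> \<le>
          sqrt (quadratic_form J (\<lambda>i j. K (x i) (x j)) c) *
          sqrt (L2_sq leb01 (D 0) + h ^ (2 * m) * L2_sq leb01 (D m)))"
  defines "lam \<equiv> h ^ (2 * m)" and "Cn \<equiv> h ^ (2 * m) + 1 / (real n * h)"
  assumes \<delta>: "\<delta> > 0" and A1: "A1 > 0" "expectation (\<lambda>\<omega>. (\<psi> (\<epsilon> 1 \<omega>))\<^sup>2) * Ck / A1\<^sup>2 \<le> \<delta> / 2"
    and A2: "A2 > 0" "2 * M1 * sqrt Ck / A2 \<le> \<delta> / 2"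
    and \<eta>: "\<xi> / 8 * (2 * \<bar>M3\<bar> * sqrt Ci / (real n * h)) \<le> min (\<xi> / 8) 1 / 2"
    and D: "D > 0" "A1 + A2 + 2 * sqrt (L2_sq leb01 (deriv01 m f0)) < min (\<xi> / 8) 1 / 2 * D"
    and small: "sqrt (Ck / h) * (D * sqrt Cn) \<le> b"
    and fh: "\<And>\<omega>. \<omega> \<in> space M \<Longrightarrow> fh \<omega> \<in> sobolev01 m 2"
      "\<And>\<omega>. \<omega> \<in> space M \<Longrightarrow> M_spline_objective \<rho> m lam n t (y \<omega>) (fh \<omega>) \<le> M_spline_objective \<rho> m lam n t (y \<omega>) f0"
    and y: "\<And>\<omega> i. \<omega> \<in> space M \<Longrightarrow> i \<in> {1..n} \<Longrightarrow> y \<omega> i = f0 (t i) + \<epsilon> i \<omega>"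
  shows "prob {\<omega>\<in>space M. sobolev_sq m lam (\<lambda>x. fh \<omega> x - f0 x) > D\<^sup>2 * Cn} \<le> \<delta>"
proof -
  let ?S = "sobolev01 m 2"
  define r where "r = D * sqrt Cn"
  \<comment> \<open>\<open>\<xi> / 8\<close> is the curvature of the data term and 1 the weight of
    the penalty; the minimum serves both parts of the squared norm at once.\<close>
  define c0 where "c0 = min (\<xi> / 8) 1"
  define B0 where "B0 = sqrt (L2_sq leb01 (deriv01 m f0))"
  have n0: "real n > 0" using n by simp
  have lam: "lam > 0" using h by (simp add: lam_def)
  have nh: "real n * h > 0" using n0 h by simp
  have Cn: "Cn > 0" "lam \<le> Cn" "1 \<le> real n * h * Cn"
  proof -
    show "Cn > 0" unfolding Cn_def using lam nh by (intro add_pos_pos) (auto simp: lam_def)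
    show "lam \<le> Cn" using nh by (simp add: Cn_def lam_def)
    have "real n * h * Cn = real n * h * lam + 1" using nh n0 h by (simp add: Cn_def lam_def distrib_left)
    then show "1 \<le> real n * h * Cn" using nh lam by simp
  qed
  have r: "r > 0" using D Cn by (simp add: r_def)
  have r2: "r\<^sup>2 = D\<^sup>2 * Cn" using Cn by (simp add: r_def power_mult_distrib)
  \<comment> \<open>The whole ball and not just the sphere, because the process needs the element
    0.\<close>
  define G where "G = {g\<in>?S. sobolev_sq m lam g \<le> r\<^sup>2}"
  have zS: "(\<lambda>_. 0) \<in> ?S" using sobolev01_lin(1)[OF m f0 f0, of 0 0] by simp
  have "L2_sq leb01 (deriv01 m (\<lambda>_. 0)) = 0"
    using L2_sq_deriv_lin[OF m f0 f0, of 0 0] by (simp add: L2_sq_def)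
  then have zG: "(\<lambda>_. 0) \<in> G" using zS by (simp add: G_def sobolev_sq_def L2_sq_def)
  let ?K = "\<lambda>i j. K (t i) (t j)"
  have sQ: "sqrt (sobolev_sq m lam g) \<le> r" if "g \<in> G" for g
    using that r by (intro real_le_lsqrt) (auto simp: G_def)
  have dual: "\<bar>\<Sum>j\<in>{1..n}. c j * g (t j)\<bar> \<le> r * sqrt (quadratic_form {1..n} ?K c)" if g: "g \<in> G" for g c
  proof -
    have gS: "g \<in> ?S" using g by (simp add: G_def)
    have "\<bar>\<Sum>j\<in>{1..n}. c j * deriv01 0 g (t j)\<bar> \<le> sqrt (quadratic_form {1..n} ?K c) *
          sqrt (L2_sq leb01 (deriv01 0 g) + h ^ (2 * m) * L2_sq leb01 (deriv01 m g))"
      using K_dual[of "{1..n}" t c] t sobolev01_chain[OF gS m] by blast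
    also have "\<dots> \<le> sqrt (quadratic_form {1..n} ?K c) * r"
      using sQ[OF g] K_dual[of "{1..n}" t c] t by (intro mult_left_mono) (auto simp: sobolev_sq_def lam_def)
    finally show ?thesis by (simp add: mult.commute)
  qed
  \<comment> \<open>Evaluation at one point is the duality bound for a singleton;
    \<open>small\<close> keeps the value in the range of (A2) and of the curvature bound.\<close>
  have xb: "\<bar>g (t i)\<bar> \<le> b" if i: "i \<in> {1..n}" and g: "g \<in> G" for i g
  proof -
    have gS: "g \<in> ?S" using g by (simp add: G_def)
    have "\<bar>\<Sum>j\<in>{i}. 1 * deriv01 0 g (t j)\<bar> \<le> sqrt (quadratic_form {i} ?K (\<lambda>_. 1)) *
          sqrt (L2_sq leb01 (deriv01 0 g) + h ^ (2 * m) * L2_sq leb01 (deriv01 m g))"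
      using K_dual[of "{i}" t "\<lambda>_. 1"] t[OF i] sobolev01_chain[OF gS m] by blast
    then have "\<bar>g (t i)\<bar> \<le> sqrt (K (t i) (t i)) * sqrt (sobolev_sq m lam g)"
      by (simp add: quadratic_form_def sobolev_sq_def lam_def)
    also have "\<dots> \<le> sqrt (Ck / h) * r"
      using K_diag[OF t[OF i]] sQ[OF g] r Ck h lam by (intro mult_mono) (auto simp: sobolev_sq_def)
    also have "\<dots> \<le> b" using small by (simp add: r_def)
    finally show ?thesis .
  qed
  interpret cp: contracted_process M \<epsilon> n "remainder_loss \<rho> \<psi>" M1 b r "\<lambda>i g. g (t i)" ?K G "\<lambda>_. 0"
  proof unfold_locales
    have "\<psi> \<in> borel_measurable borel" by (rule borel_measurable_mono[OF subgradient_mono[OF sg]])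
    then show "(\<lambda>e. remainder_loss \<rho> \<psi> e x) \<in> borel_measurable borel" for x
      unfolding remainder_loss_def using \<rho>m by measurable
    show "\<bar>remainder_loss \<rho> \<psi> e x - remainder_loss \<rho> \<psi> e y\<bar> \<le> M1 * \<bar>x - y\<bar>" if "\<bar>x\<bar> \<le> b" "\<bar>y\<bar> \<le> b" for e x y
      using that b by (intro remainder_loss_lipschitz[OF sg osc]) auto
    show "(\<Sum>j\<in>{1..n}. c j * g (t j)) \<le> r * sqrt (quadratic_form {1..n} ?K c)" if "g \<in> G" for g c
      using dual[OF that, of c] by linarith
    show "0 \<le> quadratic_form {1..n} ?K c" for c using K_dual[of "{1..n}" t c] t by auto
    show "indep_vars (\<lambda>_. borel) \<epsilon> {1..}" by (rule indep)
    show "distr M borel (\<epsilon> i) = distr M borel (\<epsilon> 1)" if "i \<ge> 1" for i by (rule ident[OF that])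
    show "n \<ge> 1" using n by simp
    show "0 \<le> M1" by (rule M1)
    show "0 \<le> r" using r by simp
    show "\<bar>g (t i)\<bar> \<le> b" if "i \<in> {1..n}" "g \<in> G" for i g by (rule xb[OF that])
    show "K (t j) (t k) = K (t k) (t j)" for j k by (rule K_sym)
    show "(\<lambda>_. 0) \<in> G" by (rule zG)
  qed (simp_all add: remainder_loss_def)
  have KS: "(\<Sum>i\<in>{1..n}. K (t i) (t i)) \<le> real n * Ck / h"
    using sum_mono[of "{1..n}" "\<lambda>i. K (t i) (t i)" "\<lambda>_. Ck / h"] K_diag t by simp
  have KS0: "0 \<le> (\<Sum>i\<in>{1..n}. K (t i) (t i))" by (intro sum_nonneg cp.K_diag_nonneg)
  \<comment> \<open>The share of the deviation in the final balance, before division by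
    \<open>n\<close>.\<close>
  define a where "a = A2 * D * real n * Cn"
  have a: "a > 0" using A2 D n0 Cn by (simp add: a_def)
  obtain N1 where N1: "N1 \<in> events" "prob N1 \<le> r * sqrt (4 * M1\<^sup>2 * (\<Sum>i\<in>{1..n}. K (t i) (t i))) / a"
    "\<And>\<omega> g. \<omega> \<in> space M - N1 \<Longrightarrow> g \<in> G \<Longrightarrow> cp.deviation \<omega> g \<le> a"
    using cp.deviation_tail[OF a] by blast
  have N1p: "prob N1 \<le> \<delta> / 2"
  proof -
    have "sqrt (4 * M1\<^sup>2 * (\<Sum>i\<in>{1..n}. K (t i) (t i))) \<le> sqrt (4 * M1\<^sup>2 * (real n * Ck / h))"
      using KS by (intro real_sqrt_le_mono mult_left_mono) auto
    also have "\<dots> = 2 * M1 * sqrt Ck * sqrt (real n / h)"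
      using M1 by (simp add: real_sqrt_mult real_sqrt_divide)
    \<comment> \<open>This is \<open>1 \<le> n * h * Cn\<close> in another form, which holds thanks
      to the summand \<open>1 / (n * h)\<close> of \<open>Cn\<close>.\<close>
    also have "sqrt (real n / h) \<le> real n * sqrt Cn"
    proof (rule real_le_lsqrt)
      have "real n / h * 1 \<le> real n / h * (real n * h * Cn)" using Cn(3) n0 h by (intro mult_left_mono) auto
      also have "\<dots> = (real n * sqrt Cn)\<^sup>2" using h Cn(1) by (simp add: power2_eq_square power_mult_distrib)
      finally show "real n / h \<le> (real n * sqrt Cn)\<^sup>2" by simp
    qed (use n0 h Cn in auto)
    finally have "sqrt (4 * M1\<^sup>2 * (\<Sum>i\<in>{1..n}. K (t i) (t i))) \<le> 2 * M1 * sqrt Ck * (real n * sqrt Cn)"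
      using M1 Ck by (simp add: mult_left_mono)
    then have "r * sqrt (4 * M1\<^sup>2 * (\<Sum>i\<in>{1..n}. K (t i) (t i))) / a \<le> r * (2 * M1 * sqrt Ck * (real n * sqrt Cn)) / a"
      using r a by (intro divide_right_mono mult_left_mono) auto
    also have "\<dots> = 2 * M1 * sqrt Ck / A2"
    proof -
      have ss: "sqrt Cn * sqrt Cn = Cn" using Cn(1) by simp
      have num: "r * (2 * M1 * sqrt Ck * (real n * sqrt Cn)) = 2 * M1 * sqrt Ck * (D * real n * Cn)"
      proof -
        have "r * (2 * M1 * sqrt Ck * (real n * sqrt Cn)) = 2 * M1 * sqrt Ck * (D * real n * (sqrt Cn * sqrt Cn))"
          unfolding r_def by (simp only: mult_ac)
        then show ?thesis unfolding ss .
      qed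
      have den: "a = A2 * (D * real n * Cn)" by (simp add: a_def)
      have "D * real n * Cn \<noteq> 0" using D n0 Cn by simp
      then show ?thesis unfolding num den by (rule mult_divide_mult_cancel_right)
    qed
    finally show ?thesis using N1(2) A2(2) by linarith
  qed
  \<comment> \<open>With \<open>r = D * sqrt Cn\<close> this level makes the score at most
    \<open>A1 * D * n * Cn\<close> on the whole ball, the same order as the deviation.\<close>
  define N2 where "N2 = {\<omega>\<in>space M. quadratic_form {1..n} ?K (\<lambda>i. \<psi> (\<epsilon> i \<omega>)) \<ge> A1\<^sup>2 * (real n)\<^sup>2 * Cn}"
  have pos2: "A1\<^sup>2 * (real n)\<^sup>2 * Cn > 0" using A1 n0 Cn by simp
  note st = cp.score_tail[OF borel_measurable_mono[OF subgradient_mono[OF sg]] int2 mean pos2]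
  let ?\<sigma> = "expectation (\<lambda>\<omega>. (\<psi> (\<epsilon> 1 \<omega>))\<^sup>2)"
  have \<sigma>: "0 \<le> ?\<sigma>" by simp
  have N2p: "prob N2 \<le> \<delta> / 2"
  proof -
    have "prob N2 \<le> ?\<sigma> * (\<Sum>i\<in>{1..n}. K (t i) (t i)) / (A1\<^sup>2 * (real n)\<^sup>2 * Cn)"
      unfolding N2_def by (rule st(2))
    also have "\<dots> \<le> ?\<sigma> * (real n * Ck / h) / (A1\<^sup>2 * (real n)\<^sup>2 * Cn)"
      using KS \<sigma> pos2 by (intro divide_right_mono mult_left_mono) auto
    also have "\<dots> = (?\<sigma> * Ck / A1\<^sup>2) * (1 / (real n * h * Cn))"
      using n0 h by (simp add: field_simps power2_eq_square)
    also have "\<dots> \<le> (?\<sigma> * Ck / A1\<^sup>2) * 1"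
      using Cn(3) \<sigma> Ck by (intro mult_left_mono) auto
    finally show ?thesis unfolding mult_1_right using A1(2) by (rule order_trans)
  qed
  have good: "sobolev_sq m lam (\<lambda>x. fh \<omega> x - f0 x) \<le> r\<^sup>2" if \<omega>: "\<omega> \<in> space M" "\<omega> \<notin> N1" "\<omega> \<notin> N2" for \<omega>
  proof (rule minimizers_near_center[OF m lam _ conv r f0 y[OF \<omega>(1)] _ fh(1)[OF \<omega>(1)] fh(2)[OF \<omega>(1)]])
    show "n \<ge> 1" using n by simp
    fix g assume g: "g \<in> ?S" and gr: "sobolev_sq m lam g = r\<^sup>2"
    have gG: "g \<in> G" using g gr by (simp add: G_def)
    let ?R = "\<Sum>i=1..n. remainder_loss \<rho> \<psi> (\<epsilon> i \<omega>) (g (t i))"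
    let ?I = "\<integral>x. deriv01 m f0 x * deriv01 m g x \<partial>leb01"
    let ?Lg = "L2_sq leb01 (deriv01 m g)"
    have "cp.deviation \<omega> g \<le> a" using N1(3)[of \<omega> g] \<omega> gG by auto
    then have 1: "(\<Sum>i=1..n. cp.H (g (t i))) - a \<le> ?R"
      by (simp add: cp.deviation_def sum_subtractf)
    have "\<xi> / 8 * (g (t i))\<^sup>2 \<le> cp.H (g (t i))" if i: "i \<in> {1..n}" for i
      using curv[OF xb[OF i gG]] unfolding cp.H_def cp.\<mu>_def
      by (subst integral_distr[OF cp.\<epsilon>_measurable cp.\<phi>_measurable]) auto
    then have 2: "\<xi> / 8 * (\<Sum>i=1..n. (g (t i))\<^sup>2) \<le> (\<Sum>i=1..n. cp.H (g (t i)))"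
      unfolding sum_distrib_left by (intro sum_mono) auto
    have 3: "(\<Sum>i=1..n. g (t i) * \<psi> (\<epsilon> i \<omega>)) \<le> A1 * D * real n * Cn"
    proof -
      have "(\<Sum>i=1..n. g (t i) * \<psi> (\<epsilon> i \<omega>)) \<le> r * sqrt (quadratic_form {1..n} ?K (\<lambda>i. \<psi> (\<epsilon> i \<omega>)))"
        using dual[OF gG, of "\<lambda>i. \<psi> (\<epsilon> i \<omega>)"] by (simp add: mult.commute)
      also have "\<dots> \<le> r * (A1 * real n * sqrt Cn)"
      proof (intro mult_left_mono real_le_lsqrt)
        show "quadratic_form {1..n} ?K (\<lambda>i. \<psi> (\<epsilon> i \<omega>)) \<le> (A1 * real n * sqrt Cn)\<^sup>2"
          using \<omega> Cn(1) by (simp add: N2_def power_mult_distrib)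
      qed (use A1 n0 Cn r in auto)
      also have "\<dots> = A1 * D * real n * (sqrt Cn * sqrt Cn)" by (simp add: r_def)
      finally show ?thesis using Cn(1) by simp
    qed
    have gam: "?Lg * lam \<le> r\<^sup>2"
    proof -
      have "L2_sq leb01 g + lam * ?Lg = r\<^sup>2" using gr unfolding sobolev_sq_def .
      moreover have "0 \<le> L2_sq leb01 g" by (rule L2_sq_nonneg)
      moreover have "?Lg * lam = lam * ?Lg" by (rule mult.commute)
      ultimately show ?thesis by argo
    qed
    \<comment> \<open>Cauchy-Schwarz for the cross term: one factor \<open>sqrt lam\<close> is at
      most \<open>sqrt Cn\<close>, the other belongs to the norm of \<open>g\<close>, so the term is
      linear in \<open>D\<close>.\<close>
    have 4: "- (2 * B0 * D * Cn) \<le> lam * (2 * ?I)"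
    proof -
      have "\<bar>?I\<bar> \<le> B0 * sqrt ?Lg"
        unfolding B0_def using L2_Cauchy_Schwarz[OF sobolev01_square_integrable(2)[OF m f0] sobolev01_square_integrable(2)[OF m g]] .
      then have "lam * \<bar>?I\<bar> \<le> lam * (B0 * sqrt ?Lg)" using lam by (intro mult_left_mono) auto
      also have "\<dots> = B0 * (sqrt lam * sqrt (?Lg * lam))"
        using lam by (simp add: real_sqrt_mult)
      also have "\<dots> \<le> B0 * (sqrt Cn * r)"
        using Cn gam r lam unfolding B0_def by (intro mult_left_mono mult_mono real_le_lsqrt) auto
      also have "\<dots> = B0 * D * (sqrt Cn * sqrt Cn)" by (simp add: r_def)
      finally have "lam * \<bar>?I\<bar> \<le> B0 * D * Cn" using Cn(1) by simp
      moreover have "- (lam * \<bar>?I\<bar>) \<le> lam * ?I" using lam by (simp add: abs_if)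
      ultimately show ?thesis by argo
    qed
    \<comment> \<open>The quadrature error may consume half of the curvature, which is what the
      assumption named \<open>\<eta>\<close> permits.\<close>
    have 5: "c0 / 2 * r\<^sup>2 \<le> 1 / real n * (\<xi> / 8 * (\<Sum>i=1..n. (g (t i))\<^sup>2)) + lam * ?Lg"
    proof -
      let ?e = "2 * \<bar>M3\<bar> * sqrt Ci / (real n * h)"
      have "L2_sq leb01 g - ?e * r\<^sup>2 \<le> 1 / real n * (\<Sum>i=1..n. (g (t i))\<^sup>2)"
        using quadrature_lower_bound[OF m n h A5 Ci g] gr by (simp add: lam_def)
      then have "\<xi> / 8 * (L2_sq leb01 g - ?e * r\<^sup>2) \<le> \<xi> / 8 * (1 / real n * (\<Sum>i=1..n. (g (t i))\<^sup>2))"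
        using \<xi> by (intro mult_left_mono) auto
      moreover have "\<xi> / 8 * ?e * r\<^sup>2 \<le> c0 / 2 * r\<^sup>2" using \<eta> by (intro mult_right_mono) (auto simp: c0_def)
      moreover have "c0 * L2_sq leb01 g \<le> \<xi> / 8 * L2_sq leb01 g"
        by (rule mult_right_mono) (simp_all add: c0_def)
      moreover have "c0 * (lam * ?Lg) \<le> 1 * (lam * ?Lg)"
      proof (rule mult_right_mono)
        show "0 \<le> lam * ?Lg" using lam by (intro mult_nonneg_nonneg) auto
      qed (simp add: c0_def)
      moreover have "c0 * L2_sq leb01 g + c0 * (lam * ?Lg) = c0 * r\<^sup>2"
        using gr by (simp add: sobolev_sq_def distrib_left[symmetric])
      moreover have "\<xi> / 8 * (L2_sq leb01 g - ?e * r\<^sup>2) = \<xi> / 8 * L2_sq leb01 g - \<xi> / 8 * ?e * r\<^sup>2"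
        by (simp add: algebra_simps)
      moreover have "c0 * r\<^sup>2 = c0 / 2 * r\<^sup>2 + c0 / 2 * r\<^sup>2" by simp
      moreover have "\<xi> / 8 * (1 / real n * (\<Sum>i=1..n. (g (t i))\<^sup>2)) = 1 / real n * (\<xi> / 8 * (\<Sum>i=1..n. (g (t i))\<^sup>2))" by simp
      ultimately show ?thesis by linarith
    qed
    have 6: "1 / real n * (\<xi> / 8 * (\<Sum>i=1..n. (g (t i))\<^sup>2)) - A2 * D * Cn - A1 * D * Cn
        \<le> 1 / real n * (\<Sum>i=1..n. remainder_loss \<rho> \<psi> (\<epsilon> i \<omega>) (g (t i)) - g (t i) * \<psi> (\<epsilon> i \<omega>))"
    proof -
      have "1 / real n * (\<xi> / 8 * (\<Sum>i=1..n. (g (t i))\<^sup>2)) - A2 * D * Cn - A1 * D * Cn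
          = 1 / real n * (\<xi> / 8 * (\<Sum>i=1..n. (g (t i))\<^sup>2) - a - A1 * D * real n * Cn)"
        using n0 by (simp add: a_def field_simps)
      also have "\<dots> \<le> 1 / real n * (?R - (\<Sum>i=1..n. g (t i) * \<psi> (\<epsilon> i \<omega>)))"
        using 1 2 3 n0 by (intro mult_left_mono) auto
      finally show ?thesis by (simp add: sum_subtractf)
    qed
    have "0 < D * Cn * (c0 / 2 * D - (A1 + A2 + 2 * B0))"
      using D Cn(1) by (intro mult_pos_pos) (auto simp: c0_def B0_def)
    also have "\<dots> = c0 / 2 * r\<^sup>2 - A2 * D * Cn - A1 * D * Cn - 2 * B0 * D * Cn"
      unfolding r2 by (simp add: power2_eq_square algebra_simps)
    finally have 7: "0 < c0 / 2 * r\<^sup>2 - A2 * D * Cn - A1 * D * Cn - 2 * B0 * D * Cn" .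
    have "lam * (2 * ?I + ?Lg) = lam * (2 * ?I) + lam * ?Lg" by (rule distrib_left)
    then show "0 < 1 / real n * (\<Sum>i=1..n. remainder_loss \<rho> \<psi> (\<epsilon> i \<omega>) (g (t i)) - g (t i) * \<psi> (\<epsilon> i \<omega>))
        + lam * (2 * ?I + ?Lg)"
      using 4 5 6 7 by linarith
  qed
  have "prob {\<omega>\<in>space M. sobolev_sq m lam (\<lambda>x. fh \<omega> x - f0 x) > D\<^sup>2 * Cn} \<le> prob (N1 \<union> N2)"
  proof (rule finite_measure_mono)
    show "{\<omega>\<in>space M. sobolev_sq m lam (\<lambda>x. fh \<omega> x - f0 x) > D\<^sup>2 * Cn} \<subseteq> N1 \<union> N2"
      using good unfolding r2 by (auto simp: not_le[symmetric])
    show "N1 \<union> N2 \<in> events" using N1(1) st(1) by (auto simp: N2_def)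
  qed
  also have "\<dots> \<le> prob N1 + prob N2" using N1(1) st(1) by (intro measure_Un_le) (auto simp: N2_def)
  also have "\<dots> \<le> \<delta>" using N1p N2p by simp
  finally show ?thesis .
qed

end

text \<open>As \<open>1 / (4 * m^2) \<le> 1 / (2 * m)\<close>, the exponent in the rate is at least
  \<open>1 / m\<close>, and \<open>h^2 = lam powr (1 / m)\<close>; so once
  \<open>lam \<le> 1\<close> the condition gives \<open>n * h^2 \<rightarrow> \<infinity>\<close>.
  The third limit follows, since \<open>Cn / h\<close> is \<open>lam / h\<close> plus
  \<open>1 / (n * h^2)\<close> and eventually \<open>lam / h \<le> h\<close>.\<close>

lemma smoothing_rates:
  fixes lam :: "nat \<Rightarrow> real"
  assumes m: "m \<ge> 1" and lam_pos: "\<And>n. n \<ge> 1 \<Longrightarrow> lam n > 0" and lam_0: "lam \<longlonglongrightarrow> 0"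
    and rate: "filterlim (\<lambda>n. real n * lam n powr (3 / (2 * real m) - 1 / (4 * (real m)\<^sup>2))) at_top sequentially"
  shows "(\<lambda>n. lam n powr (1 / (2 * real m))) \<longlonglongrightarrow> 0"
    "filterlim (\<lambda>n. real n * lam n powr (1 / (2 * real m))) at_top sequentially"
    "(\<lambda>n. (lam n + 1 / (real n * lam n powr (1 / (2 * real m)))) / lam n powr (1 / (2 * real m))) \<longlonglongrightarrow> 0"
proof -
  let ?h = "\<lambda>n. lam n powr (1 / (2 * real m))"
  have m0: "real m > 0" using m by simp
  have pos: "\<forall>\<^sub>F n in sequentially. lam n > 0" using eventually_ge_at_top[of 1] by (rule eventually_mono) (rule lam_pos)
  show h0: "?h \<longlonglongrightarrow> 0"
    using pos m0 by (intro tendsto_zero_powrI[OF lam_0 tendsto_const]) (auto elim: eventually_mono)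
  have le1: "\<forall>\<^sub>F n in sequentially. ?h n \<le> 1"
    using order_tendstoD(2)[OF h0, of 1] by (auto elim: eventually_mono)
  have laml1: "\<forall>\<^sub>F n in sequentially. lam n \<le> 1"
    using order_tendstoD(2)[OF lam_0, of 1] by (auto elim: eventually_mono)
  have expo: "1 / real m \<le> 3 / (2 * real m) - 1 / (4 * (real m)\<^sup>2)"
  proof -
    have "1 / (4 * (real m)\<^sup>2) \<le> 1 / (2 * real m)"
      using m by (intro divide_left_mono) (auto simp: power2_eq_square)
    moreover have "3 / (2 * real m) = 1 / real m + 1 / (2 * real m)" using m0 by (simp add: field_simps)
    ultimately show ?thesis by linarith
  qed
  have hh: "?h n * ?h n = lam n powr (1 / real m)" for n
    by (simp add: powr_add[symmetric])
  have nh2: "filterlim (\<lambda>n. real n * (?h n * ?h n)) at_top sequentially"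
    using rate
  proof (rule filterlim_at_top_mono)
    show "\<forall>\<^sub>F n in sequentially. real n * lam n powr (3 / (2 * real m) - 1 / (4 * (real m)\<^sup>2)) \<le> real n * (?h n * ?h n)"
      using pos laml1 unfolding hh
      by eventually_elim (intro mult_left_mono powr_mono' expo; simp)
  qed
  show nh: "filterlim (\<lambda>n. real n * ?h n) at_top sequentially"
    using nh2
  proof (rule filterlim_at_top_mono)
    show "\<forall>\<^sub>F n in sequentially. real n * (?h n * ?h n) \<le> real n * ?h n"
      using le1 by eventually_elim (intro mult_left_mono mult_left_le; simp)
  qed
  have lim1: "(\<lambda>n. lam n / ?h n) \<longlonglongrightarrow> 0"
  proof (rule tendsto_sandwich[OF _ _ tendsto_const h0])
    show "\<forall>\<^sub>F n in sequentially. 0 \<le> lam n / ?h n" using pos by eventually_elim simp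
    show "\<forall>\<^sub>F n in sequentially. lam n / ?h n \<le> ?h n"
      using pos laml1
    proof eventually_elim
      case (elim n)
      have "lam n = lam n powr 1" using elim by simp
      also have "\<dots> \<le> lam n powr (1 / real m)" using elim m by (intro powr_mono') auto
      finally show ?case using elim by (simp add: hh[symmetric] divide_le_eq)
    qed
  qed
  have "(\<lambda>n. lam n / ?h n + inverse (real n * (?h n * ?h n))) \<longlonglongrightarrow> 0 + 0"
    by (intro tendsto_add lim1 tendsto_inverse_0_at_top nh2)
  moreover have "lam n / ?h n + inverse (real n * (?h n * ?h n)) = (lam n + 1 / (real n * ?h n)) / ?h n" for n
    by (simp only: add_divide_distrib divide_divide_eq_left inverse_eq_divide mult.assoc)
  ultimately show "(\<lambda>n. (lam n + 1 / (real n * ?h n)) / ?h n) \<longlonglongrightarrow> 0" by simp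
qed

theorem theorem2:
  fixes m :: nat
    and M :: "'a measure"
    and \<epsilon> :: "nat \<Rightarrow> 'a \<Rightarrow> real"
    and f0 :: "real \<Rightarrow> real"
    and t :: "nat \<Rightarrow> nat \<Rightarrow> real"
    and Y :: "nat \<Rightarrow> nat \<Rightarrow> 'a \<Rightarrow> real"
    and \<rho> \<psi> :: "real \<Rightarrow> real"
    and \<kappa> \<tau> \<xi> M1 M2 M3 :: real
    and lam :: "nat \<Rightarrow> real"
  assumes m: "m \<ge> 1"
    and M: "prob_space M"
    and f0: "f0 \<in> sobolev01 m 2"
    and design: "\<And>n i. 1 \<le> i \<Longrightarrow> i \<le> n \<Longrightarrow> t n i \<in> {0..1}"
    and indep: "prob_space.indep_vars M (\<lambda>_. borel) \<epsilon> {1..}"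
    and ident: "\<And>i. i \<ge> 1 \<Longrightarrow> distr M borel (\<epsilon> i) = distr M borel (\<epsilon> 1)"
    and Y: "\<And>n i \<omega>. 1 \<le> i \<Longrightarrow> i \<le> n \<Longrightarrow> \<omega> \<in> space M \<Longrightarrow> Y n i \<omega> = f0 (t n i) + \<epsilon> i \<omega>"
    and rho_nonneg: "\<And>x. \<rho> x \<ge> 0"
    and rho_0: "\<rho> 0 = 0"
    and A1_ac: "\<And>a b. abs_continuous_on_interval a b \<rho>"
    and A1_convex: "convex_on UNIV \<rho>"
    and A1_subgradient: "is_subgradient \<rho> \<psi>"
    and A2_kappa: "\<kappa> > 0"
    and A2: "\<And>x y. \<bar>y\<bar> < \<kappa> \<Longrightarrow> \<bar>\<psi> (x + y) - \<psi> x\<bar> \<le> M1"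
    and A3: "\<forall>\<^sub>F h in at_right 0.
      (SUP s\<in>{-h..h}. \<integral>\<^sup>+\<omega>. ennreal (\<bar>\<psi> (\<epsilon> 1 \<omega> + s) - \<psi> (\<epsilon> 1 \<omega>)\<bar>\<^sup>2) \<partial>M)
        \<le> ennreal (M2 * \<bar>h\<bar>)"
    and A4_second: "(\<integral>\<^sup>+\<omega>. ennreal (\<bar>\<psi> (\<epsilon> 1 \<omega>)\<bar>\<^sup>2) \<partial>M) \<le> ennreal (\<tau>\<^sup>2)"
    and A4_mean: "prob_space.expectation M (\<lambda>\<omega>. \<psi> (\<epsilon> 1 \<omega>)) = 0"
    and A4_xi: "\<xi> > 0"
    and A4_expansion:
      "(\<lambda>s. prob_space.expectation M (\<lambda>\<omega>. \<psi> (\<epsilon> 1 \<omega> + s)) - \<xi> * s) \<in> o[at 0](\<lambda>s. s)"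
    and A5: "\<And>n f. n \<ge> 2 \<Longrightarrow> f \<in> sobolev01 1 1 \<Longrightarrow>
      \<bar>1 / real n * (\<Sum>i=1..n. f (t n i)) - (LINT x:{0..1}|lebesgue. f x)\<bar>
        \<le> M3 / real n * (LINT x:{0..1}|lebesgue. \<bar>deriv01 1 f x\<bar>)"
    and lam_pos: "\<And>n. n \<ge> 1 \<Longrightarrow> lam n > 0"
    and lam_0: "lam \<longlonglongrightarrow> 0"
    and lam_rate: "filterlim
      (\<lambda>n. real n * lam n powr (3 / (2 * real m) - 1 / (4 * (real m)\<^sup>2))) at_top sequentially"
  shows "\<exists>fhat :: nat \<Rightarrow> 'a \<Rightarrow> real \<Rightarrow> real.
    (\<forall>n\<ge>1. \<forall>\<omega>\<in>space M.
       M_smoothing_spline \<rho> m (lam n) n (t n) (\<lambda>i. Y n i \<omega>) (fhat n \<omega>)) \<and>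
    bigO_P M (\<lambda>n \<omega>. (sob_norm m (lam n) (\<lambda>x. fhat n \<omega> x - f0 x))\<^sup>2)
      (\<lambda>n. lam n + 1 / (real n * lam n powr (1 / (2 * real m))))"
proof -
  interpret prob_space M by (rule M)
  let ?S = "sobolev01 m 2"
  note sg = A1_subgradient
  have cont: "continuous_on UNIV \<rho>" by (rule convex_on_continuous[OF open_UNIV A1_convex])
  have \<rho>m: "\<rho> \<in> borel_measurable borel" by (rule borel_measurable_continuous_onI[OF cont])
  have \<psi>m: "\<psi> \<in> borel_measurable borel" by (rule borel_measurable_mono[OF subgradient_mono[OF sg]])
  have M1: "0 \<le> M1" using A2[of 0 0] A2_kappa by simp
  have \<epsilon>m: "\<epsilon> i \<in> borel_measurable M" if "i \<ge> 1" for i using indep that by (auto simp: indep_vars_def)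
  have \<psi>\<epsilon>m: "(\<lambda>\<omega>. \<psi> (\<epsilon> 1 \<omega> + s)) \<in> borel_measurable M" for s
    by (rule measurable_compose[OF _ \<psi>m]) (use \<epsilon>m[of 1] in simp)
  have int2: "integrable M (\<lambda>\<omega>. (\<psi> (\<epsilon> 1 \<omega>))\<^sup>2)"
  proof (rule integrableI_nonneg)
    show "(\<integral>\<^sup>+\<omega>. ennreal ((\<psi> (\<epsilon> 1 \<omega>))\<^sup>2) \<partial>M) < \<infinity>"
      using A4_second by (simp add: le_less_trans)
  qed (use \<psi>\<epsilon>m[of 0] in auto)
  have int1: "integrable M (\<lambda>\<omega>. \<psi> (\<epsilon> 1 \<omega>))"
    by (rule square_integrable_imp_integrable[OF _ int2]) (use \<psi>\<epsilon>m[of 0] in simp)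
  define E where "E = (\<lambda>s. expectation (\<lambda>\<omega>. \<psi> (\<epsilon> 1 \<omega> + s)))"
  have "\<forall>\<^sub>F s in at 0. norm (E s - \<xi> * s) \<le> \<xi> / 2 * norm s"
    using landau_o.smallD[OF A4_expansion, of "\<xi> / 2"] A4_xi by (simp add: E_def)
  then obtain \<delta>1 where \<delta>1: "\<delta>1 > 0" "\<And>s. s \<noteq> 0 \<Longrightarrow> \<bar>s\<bar> < \<delta>1 \<Longrightarrow> \<bar>E s - \<xi> * s\<bar> \<le> \<xi> / 2 * \<bar>s\<bar>"
    unfolding eventually_at by (auto simp: dist_real_def)
  \<comment> \<open>The expansion speaks of \<open>s \<noteq> 0\<close>; at 0 the claim is the
    centring of \<open>\<psi>\<close>.\<close>
  have lin: "\<bar>E s - \<xi> * s\<bar> \<le> \<xi> / 2 * \<bar>s\<bar>" if "\<bar>s\<bar> < \<delta>1" for s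
    using \<delta>1(2)[OF _ that] A4_mean by (cases "s = 0") (auto simp: E_def)
  \<comment> \<open>A positive mean forces \<open>\<psi>\<close> to be positive somewhere, one of
    the two facts behind coercivity.\<close>
  have E_pos: "E (\<delta>1 / 2) > 0"
  proof -
    have "\<bar>E (\<delta>1 / 2) - \<xi> * (\<delta>1 / 2)\<bar> \<le> \<xi> / 2 * (\<delta>1 / 2)"
      using lin[of "\<delta>1 / 2"] \<delta>1(1) by simp
    moreover have "0 < \<xi> * \<delta>1" by (rule mult_pos_pos[OF A4_xi \<delta>1(1)])
    moreover have "\<xi> * (\<delta>1 / 2) = (\<xi> * \<delta>1 / 2)" "\<xi> / 2 * (\<delta>1 / 2) = \<xi> * \<delta>1 / 4" by simp_all
    ultimately show ?thesis by linarith
  qed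
  have "\<exists>x1. \<psi> x1 > 0"
  proof (rule ccontr)
    assume "\<nexists>x1. \<psi> x1 > 0"
    then have "0 \<le> expectation (\<lambda>\<omega>. - \<psi> (\<epsilon> 1 \<omega> + \<delta>1 / 2))"
      by (intro Bochner_Integration.integral_nonneg) (simp add: not_less)
    with E_pos show False by (simp add: E_def)
  qed
  then obtain x1 where x1: "\<psi> x1 > 0" by blast
  have E_neg: "E (- (\<delta>1 / 2)) < 0"
  proof -
    have "\<bar>E (- (\<delta>1 / 2)) - \<xi> * (- (\<delta>1 / 2))\<bar> \<le> \<xi> / 2 * (\<delta>1 / 2)"
      using lin[of "- (\<delta>1 / 2)"] \<delta>1(1) by simp
    moreover have "0 < \<xi> * \<delta>1" by (rule mult_pos_pos[OF A4_xi \<delta>1(1)])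
    moreover have "\<xi> * (- (\<delta>1 / 2)) = - (\<xi> * \<delta>1 / 2)" "\<xi> / 2 * (\<delta>1 / 2) = \<xi> * \<delta>1 / 4" by simp_all
    ultimately show ?thesis by linarith
  qed
  have "\<exists>x2. \<psi> x2 < 0"
  proof (rule ccontr)
    assume "\<nexists>x2. \<psi> x2 < 0"
    then have "0 \<le> expectation (\<lambda>\<omega>. \<psi> (\<epsilon> 1 \<omega> + - (\<delta>1 / 2)))"
      by (intro Bochner_Integration.integral_nonneg) (simp add: not_less)
    with E_neg show False by (simp add: E_def)
  qed
  then obtain x2 where x2: "\<psi> x2 < 0" by blast
  obtain \<alpha> \<beta> where coer: "\<alpha> > 0" "\<And>x. \<alpha> * \<bar>x\<bar> - \<beta> \<le> \<rho> x"
    using loss_coercive[OF sg x1 x2 rho_nonneg] by blast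
  define J where "J = (\<lambda>n \<omega>. M_spline_objective \<rho> m (lam n) n (t n) (\<lambda>i. Y n i \<omega>))"
  define X where "X = (\<lambda>n f. sobolev_sq m (lam n) (\<lambda>x. f x - f0 x))"
  \<comment> \<open>The second clause says that admitting approximate minimizers cannot lower
    \<open>X\<close> any further.\<close>
  define P where "P = (\<lambda>n \<omega> f. f \<in> ?S \<and> (\<forall>g\<in>?S. J n \<omega> f \<le> J n \<omega> g) \<and>
    (\<forall>b. (\<forall>e>0. \<exists>g\<in>?S. J n \<omega> g \<le> J n \<omega> f + e \<and> X n g \<le> b) \<longrightarrow> X n f \<le> b))"
  have exP: "\<exists>f. P n \<omega> f" if n: "n \<ge> 1" for n \<omega>
    using ex_closest_M_spline[OF m lam_pos[OF n] n _ rho_nonneg A1_convex cont coer f0, of "t n" "\<lambda>i. Y n i \<omega>"] design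
    unfolding P_def J_def X_def by auto
  \<comment> \<open>\<open>n = 0\<close> lies outside the existence result; the default
    \<open>f0\<close> keeps the error measurable for every \<open>n\<close>.\<close>
  define fh where "fh = (\<lambda>n \<omega>. if n \<ge> 1 then SOME f. P n \<omega> f else f0)"
  have Pfh: "P n \<omega> (fh n \<omega>)" if "n \<ge> 1" for n \<omega>
    using someI_ex[OF exP[OF that, of \<omega>]] that by (simp add: fh_def)
  have fhS: "fh n \<omega> \<in> ?S" if "n \<ge> 1" for n \<omega> using Pfh[OF that] by (simp add: P_def)
  have fh_min: "J n \<omega> (fh n \<omega>) \<le> J n \<omega> g" if "n \<ge> 1" "g \<in> ?S" for n \<omega> g
    using Pfh[OF that(1), of \<omega>] that(2) by (simp add: P_def)
  have spline: "M_smoothing_spline \<rho> m (lam n) n (t n) (\<lambda>i. Y n i \<omega>) (fh n \<omega>)" if "n \<ge> 1" for n \<omega>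
    unfolding M_smoothing_spline_def is_arg_min_def
    using fhS[OF that] fh_min[OF that] by (auto simp: J_def not_less)
  have Ym: "(\<lambda>\<omega>. Y n i \<omega>) \<in> borel_measurable M" if "i \<in> {1..n}" for n i
  proof -
    have "(\<lambda>\<omega>. f0 (t n i) + \<epsilon> i \<omega>) \<in> borel_measurable M" using \<epsilon>m[of i] that by simp
    then show ?thesis by (rule measurable_cong[THEN iffD2, rotated]) (use Y that in auto)
  qed
  have Xm: "(\<lambda>\<omega>. X n (fh n \<omega>)) \<in> borel_measurable M" if n: "n \<ge> 1" for n
  proof (rule closest_minimizer_measurable[where S="?S" and J="J n" and X="X n" and fh="fh n"])
    show "{\<omega> \<in> space M. \<exists>g\<in>C. J n \<omega> g < q} \<in> events" for C q
      unfolding J_def by (rule objective_level_sets_measurable[OF Ym cont])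
    fix \<omega>
    show "fh n \<omega> \<in> ?S" by (rule fhS[OF n])
    show "J n \<omega> (fh n \<omega>) \<le> J n \<omega> g" if "g \<in> ?S" for g by (rule fh_min[OF n that])
    show "X n (fh n \<omega>) \<le> b" if "\<And>e. e > 0 \<Longrightarrow> \<exists>g\<in>?S. J n \<omega> g \<le> J n \<omega> (fh n \<omega>) + e \<and> X n g \<le> b" for b
      using Pfh[OF n, of \<omega>] that by (simp add: P_def)
  qed
  have norm_eq: "(sob_norm m (lam n) (\<lambda>x. fh n \<omega> x - f0 x))\<^sup>2 = X n (fh n \<omega>)" if "n \<ge> 1" for n \<omega>
    unfolding X_def using lam_pos[OF that] by (intro sob_norm_sq) simp
  define h where "h = (\<lambda>n. lam n powr (1 / (2 * real m)))"
  have h_eq: "lam n powr (1 / (2 * real m)) = h n" for n by (simp add: h_def)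
  note rates = smoothing_rates[OF m lam_pos lam_0 lam_rate, unfolded h_eq]
  define Cn where "Cn = (\<lambda>n. lam n + 1 / (real n * h n))"
  obtain Ck where Ck: "Ck > 0" "\<And>h. 0 < h \<and> h \<le> 1/2 \<Longrightarrow> (\<exists>K :: real \<Rightarrow> real \<Rightarrow> real.
    (\<forall>s t. K s t = K t s) \<and> (\<forall>t\<in>{0..1}. K t t \<le> Ck / h) \<and>
    (\<forall>(J :: nat set) x c. finite J \<and> (\<forall>i\<in>J. x i \<in> {0..1}) \<longrightarrow>
       0 \<le> quadratic_form J (\<lambda>i j. K (x i) (x j)) c \<and>
       (\<forall>D. primitive_chain m D \<longrightarrow> \<bar>\<Sum>i\<in>J. c i * D 0 (x i)\<bar> \<le>
          sqrt (quadratic_form J (\<lambda>i j. K (x i) (x j)) c) *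
          sqrt (L2_sq leb01 (D 0) + h ^ (2 * m) * L2_sq leb01 (D m)))))"
    using evaluation_kernel[OF m] by (elim exE conjE) (rule that, assumption, blast)
  obtain Ci where Ci: "Ci > 0" "\<And>h D. 0 < h \<and> h \<le> 1/2 \<and> primitive_chain m D \<Longrightarrow>
     h\<^sup>2 * L2_sq leb01 (D 1) \<le> Ci * (L2_sq leb01 (D 0) + h ^ (2 * m) * L2_sq leb01 (D m))"
    using first_derivative_interpolation[OF m] by blast
  \<comment> \<open>Half of the minimum lies strictly inside both ranges.\<close>
  define b where "b = min \<kappa> \<delta>1 / 2"
  have b: "b > 0" "b < \<kappa>" "b < \<delta>1" using A2_kappa \<delta>1(1) by (auto simp: b_def min_def)
  have curv: "\<xi> / 8 * z\<^sup>2 \<le> expectation (\<lambda>\<omega>. remainder_loss \<rho> \<psi> (\<epsilon> 1 \<omega>) z)" if "\<bar>z\<bar> \<le> b" for z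
    by (rule remainder_loss_mean_lower_bound[OF sg \<rho>m \<epsilon>m A2 int1 A4_mean lin[unfolded E_def]]) (use that b in auto)
  have tail: "\<exists>C>0. \<forall>\<^sub>F n in sequentially. prob {\<omega>\<in>space M. X n (fh n \<omega>) > C * Cn n} \<le> \<delta>" if \<delta>: "\<delta> > 0" for \<delta>
  proof -
    define \<sigma> where "\<sigma> = expectation (\<lambda>\<omega>. (\<psi> (\<epsilon> 1 \<omega>))\<^sup>2)"
    have \<sigma>: "0 \<le> \<sigma>" by (simp add: \<sigma>_def)
    \<comment> \<open>Makes Markov's bound for the score at most \<open>\<delta> / 2\<close>, with
      \<open>+ 1\<close> for positivity when the second moment is 0; \<open>A2\<close> does the same
      for the deviation.\<close>
    define A1 where "A1 = sqrt (2 * \<sigma> * Ck / \<delta>) + 1"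
    define A2 where "A2 = 4 * M1 * sqrt Ck / \<delta> + 1"
    have A1: "A1 > 0" "\<sigma> * Ck / A1\<^sup>2 \<le> \<delta> / 2"
    proof -
      have q: "0 \<le> 2 * \<sigma> * Ck / \<delta>" using \<sigma> Ck(1) \<delta> by simp
      then show A1: "A1 > 0" unfolding A1_def by (intro add_nonneg_pos) auto
      have "2 * \<sigma> * Ck / \<delta> = (sqrt (2 * \<sigma> * Ck / \<delta>))\<^sup>2" using q by (simp only: real_sqrt_pow2)
      also have "\<dots> \<le> A1\<^sup>2" unfolding A1_def using q by (intro power_mono) auto
      finally show "\<sigma> * Ck / A1\<^sup>2 \<le> \<delta> / 2" using A1 \<delta> by (simp add: field_simps)
    qed
    have A2': "A2 > 0" "2 * M1 * sqrt Ck / A2 \<le> \<delta> / 2"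
    proof -
      have q: "0 \<le> 4 * M1 * sqrt Ck / \<delta>" using M1 Ck(1) \<delta> by simp
      then show A2: "A2 > 0" unfolding A2_def by (intro add_nonneg_pos) auto
      have "4 * M1 * sqrt Ck / \<delta> \<le> A2" by (simp add: A2_def)
      then show "2 * M1 * sqrt Ck / A2 \<le> \<delta> / 2" using A2 \<delta> by (simp add: field_simps)
    qed
    define c0 where "c0 = min (\<xi> / 8) 1"
    have c0: "c0 > 0" using A4_xi by (simp add: c0_def)
    define B0 where "B0 = sqrt (L2_sq leb01 (deriv01 m f0))"
    \<comment> \<open>Solves the linear inequality \<open>Dc\<close> with room
      \<open>c0 / 2\<close>.\<close>
    define D where "D = (A1 + A2 + 2 * B0) / (c0 / 2) + 1"
    have "0 \<le> (A1 + A2 + 2 * B0) / (c0 / 2)" using A1 A2' c0 by (simp add: B0_def)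
    then have D: "D > 0" by (simp add: D_def)
    have "c0 / 2 * D = A1 + A2 + 2 * B0 + c0 / 2" using c0 by (simp add: D_def field_simps)
    then have Dc: "A1 + A2 + 2 * B0 < c0 / 2 * D" using c0 by simp
    have ev1: "\<forall>\<^sub>F n in sequentially. h n \<le> 1/2"
      using order_tendstoD(2)[OF rates(1), of "1/2"] by (auto elim: eventually_mono)
    have ev2: "\<forall>\<^sub>F n in sequentially. \<xi> / 8 * (2 * \<bar>M3\<bar> * sqrt Ci / (real n * h n)) \<le> c0 / 2"
    proof -
      have "(\<lambda>n. \<xi> / 8 * (2 * \<bar>M3\<bar> * sqrt Ci * inverse (real n * h n))) \<longlonglongrightarrow> \<xi> / 8 * (2 * \<bar>M3\<bar> * sqrt Ci * 0)"
        by (intro tendsto_intros tendsto_inverse_0_at_top rates(2))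
      then have "\<forall>\<^sub>F n in sequentially. \<xi> / 8 * (2 * \<bar>M3\<bar> * sqrt Ci * inverse (real n * h n)) < c0 / 2"
        by (rule order_tendstoD(2)) (use c0 in simp)
      then show ?thesis unfolding divide_inverse[of "2 * \<bar>M3\<bar> * sqrt Ci"] by (rule eventually_mono) (rule less_imp_le)
    qed
    \<comment> \<open>From some \<open>n\<close> on the values of the whole ball at the design
      points lie where (A2) and (A4) are effective; here the rate condition enters.\<close>
    have ev3: "\<forall>\<^sub>F n in sequentially. sqrt (Ck / h n) * (D * sqrt (Cn n)) \<le> b"
    proof -
      have "(\<lambda>n. D * sqrt (Ck * (Cn n / h n))) \<longlonglongrightarrow> D * sqrt (Ck * 0)"
        unfolding Cn_def by (intro tendsto_intros rates(3))
      then have "\<forall>\<^sub>F n in sequentially. D * sqrt (Ck * (Cn n / h n)) < b"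
        by (rule order_tendstoD(2)) (use b(1) in simp)
      then show ?thesis
      proof (rule eventually_mono)
        fix n assume "D * sqrt (Ck * (Cn n / h n)) < b"
        moreover have "sqrt (Ck / h n) * (D * sqrt (Cn n)) = D * sqrt (Ck * (Cn n / h n))"
          by (simp add: real_sqrt_mult real_sqrt_divide)
        ultimately show "sqrt (Ck / h n) * (D * sqrt (Cn n)) \<le> b" by linarith
      qed
    qed
    have "\<forall>\<^sub>F n in sequentially. prob {\<omega>\<in>space M. X n (fh n \<omega>) > D\<^sup>2 * Cn n} \<le> \<delta>"
      using ev1 ev2 ev3 eventually_ge_at_top[of 2]
    proof eventually_elim
      case (elim n)
      then have n: "n \<ge> 2" "n \<ge> 1" by auto
      have hn: "0 < h n" "h n \<le> 1/2" using elim lam_pos[OF n(2)] by (auto simp: h_def)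
      \<comment> \<open>The scale is the \<open>2 m\<close>-th root of \<open>lam\<close>, so the
        norm in the kernel bound is the Sobolev norm of the problem.\<close>
      have lam_h: "h n ^ (2 * m) = lam n"
        unfolding h_def using lam_pos[OF n(2)] m by (simp add: powr_power)
      obtain K :: "real \<Rightarrow> real \<Rightarrow> real" where K: "\<And>s t. K s t = K t s" "\<And>t. t \<in> {0..1} \<Longrightarrow> K t t \<le> Ck / h n"
        "\<And>(J :: nat set) x c. finite J \<and> (\<forall>i\<in>J. x i \<in> {0..1}) \<Longrightarrow>
          0 \<le> quadratic_form J (\<lambda>i j. K (x i) (x j)) c \<and>
          (\<forall>D. primitive_chain m D \<longrightarrow> \<bar>\<Sum>i\<in>J. c i * D 0 (x i)\<bar> \<le>
             sqrt (quadratic_form J (\<lambda>i j. K (x i) (x j)) c) *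
             sqrt (L2_sq leb01 (D 0) + h n ^ (2 * m) * L2_sq leb01 (D m)))"
        using Ck(2)[OF conjI[OF hn]] 
        by (elim exE conjE) (rule that, erule allE, erule allE, assumption, erule bspec, assumption, erule allE, erule allE, erule allE, erule mp, assumption)
      have "prob {\<omega>\<in>space M. sobolev_sq m (h n ^ (2 * m)) (\<lambda>x. fh n \<omega> x - f0 x) > D\<^sup>2 * (h n ^ (2 * m) + 1 / (real n * h n))} \<le> \<delta>"
      proof (rule M_spline_tail[OF m n(1) hn f0 _ indep ident A1_convex \<rho>m sg A2 M1 int2 A4_mean curv b(2) A4_xi A5[OF n(1)] Ci(1) _ K(1,2) Ck(1) K(3) \<delta> A1(1) A1(2)[unfolded \<sigma>_def] A2' _ D Dc[unfolded c0_def B0_def]])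
        show "t n i \<in> {0..1}" if "i \<in> {1..n}" for i using design that by simp
        show "(h n)\<^sup>2 * L2_sq leb01 (D 1) \<le> Ci * (L2_sq leb01 (D 0) + h n ^ (2 * m) * L2_sq leb01 (D m))"
          if "primitive_chain m D" for D using Ci(2)[of "h n" D] hn that by simp
        show "\<xi> / 8 * (2 * \<bar>M3\<bar> * sqrt Ci / (real n * h n)) \<le> min (\<xi> / 8) 1 / 2" using elim by (simp add: c0_def)
        show "sqrt (Ck / h n) * (D * sqrt (h n ^ (2 * m) + 1 / (real n * h n))) \<le> b"
          using elim unfolding lam_h Cn_def by simp
        fix \<omega> assume \<omega>: "\<omega> \<in> space M"
        show "fh n \<omega> \<in> ?S" by (rule fhS[OF n(2)])
        show "M_spline_objective \<rho> m (h n ^ (2 * m)) n (t n) (\<lambda>i. Y n i \<omega>) (fh n \<omega>)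
            \<le> M_spline_objective \<rho> m (h n ^ (2 * m)) n (t n) (\<lambda>i. Y n i \<omega>) f0"
          using fh_min[OF n(2) f0, of \<omega>] unfolding J_def lam_h .
        show "Y n i \<omega> = f0 (t n i) + \<epsilon> i \<omega>" if "i \<in> {1..n}" for i using Y \<omega> that by simp
      qed
      then show ?case unfolding lam_h X_def Cn_def .
    qed
    then show ?thesis using D by (intro exI[of _ "D\<^sup>2"]) auto
  qed
  show ?thesis
  proof (intro exI[of _ fh] conjI allI impI ballI)
    show "M_smoothing_spline \<rho> m (lam n) n (t n) (\<lambda>i. Y n i \<omega>) (fh n \<omega>)" if "n \<ge> 1" for n \<omega>
      by (rule spline[OF that])
    show "bigO_P M (\<lambda>n \<omega>. (sob_norm m (lam n) (\<lambda>x. fh n \<omega> x - f0 x))\<^sup>2)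
      (\<lambda>n. lam n + 1 / (real n * lam n powr (1 / (2 * real m))))"
      unfolding bigO_P_def
    proof (intro conjI allI impI)
      fix n
      show "(\<lambda>\<omega>. (sob_norm m (lam n) (\<lambda>x. fh n \<omega> x - f0 x))\<^sup>2) \<in> borel_measurable M"
      proof (cases "n \<ge> 1")
        case True
        then show ?thesis using Xm[OF True] by (simp only: norm_eq)
      next
        case False
        then show ?thesis by (simp add: fh_def)
      qed
    next
      fix \<delta> :: real assume "\<delta> > 0"
      then obtain C where C: "C > 0" "\<forall>\<^sub>F n in sequentially. prob {\<omega>\<in>space M. X n (fh n \<omega>) > C * Cn n} \<le> \<delta>"
        using tail by blast
      have "\<forall>\<^sub>F n in sequentially. prob {\<omega> \<in> space M. \<bar>(sob_norm m (lam n) (\<lambda>x. fh n \<omega> x - f0 x))\<^sup>2\<bar>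
          > C * (lam n + 1 / (real n * lam n powr (1 / (2 * real m))))} \<le> \<delta>"
        using C(2) eventually_ge_at_top[of 1]
      proof eventually_elim
        case (elim n)
        have "\<bar>(sob_norm m (lam n) (\<lambda>x. fh n \<omega> x - f0 x))\<^sup>2\<bar> = X n (fh n \<omega>)" for \<omega>
          unfolding abs_power2 by (rule norm_eq[OF elim(2)])
        then show ?case using elim(1) unfolding Cn_def h_def by (simp only:)
      qed
      then show "\<exists>C>0. \<forall>\<^sub>F n in sequentially. prob {\<omega> \<in> space M. \<bar>(sob_norm m (lam n) (\<lambda>x. fh n \<omega> x - f0 x))\<^sup>2\<bar>
          > C * (lam n + 1 / (real n * lam n powr (1 / (2 * real m))))} \<le> \<delta>"
        using C(1) by blast
    qed
  qed
qed

end
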